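(* Let $\{X_i\}$ be i.i.d. real-valued random variables with law $\mu$ (no further assumptions). Then: 1. The sequence $\{M_n\}$ satisfies the large deviation principle in $(\mathcal X_M,\tau_{AW})$ with a convex good rate function $I_M$ which has the following properties: (a) for every probability measure $\nu$ whose MGF $f_\nu$ is finite on a non-empty open interval, $I_M(f_\nu)=H(\nu|\mu)$; (b) for the function $f$ with $f(0)=1$ and $f(\theta)=\infty$ for $\theta\neq0$, $I_M(f)=\inf_{\{\nu: f_\nu=f\}}H(\nu|\mu)$; (c) for every $f\in\mathcal D_{[\alpha,\beta]}$ that is not an MGF but mimics the MGF $f_\nu$, $I_M(f)=I_M(f_\nu)$ if $I_M(g)<\infty$ for some MGF $g\in\mathcal D_{[\alpha,\beta]}$, and $I_M(f)=+\infty$ otherwise. 2. $\{\Lambda_n\}$ satisfies the LDP in $(\mathcal X_\Lambda,\tau_{AW})$ with rate function $I_\Lambda(f)=I_M(g)$ where $g(\theta)=\exp(f(\theta))$ for all $\theta$. 3. $\{J_n\}$ satisfies the LDP in $(\mathcal X_J,\tau_{AW})$ with rate function $I_J(f)=I_M(g)$ where $g(\theta)=\exp(\theta f(\theta))$ for $\theta\neq0$ and $g(0)=1$. 4. $\{I_n\}$ satisfies the LDP in $(\mathcal X_I,\tau_{AW})$ with rate function $I_I(f)=I_M(g)$ where $g(\theta)=\exp\big(\sup_{x\in\mathbb R}(x\theta-f(x))\big)$ for all $\theta$.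
   Context: Let $\{X_i\}_{i\ge1}$ be i.i.d. real-valued random variables with common law $\mu$. For a probability measure $\nu$ on $\mathbb R$ let $f_\nu(\theta)=\int_{\mathbb R}e^{\theta x}\nu(dx)\in(0,\infty]$; a function is an MGF if it equals $f_\nu$ for some probability measure $\nu$. Estimators: $M_n(\theta)=\frac1n\sum_{i=1}^n e^{\theta X_i}$, $\Lambda_n(\theta)=\log M_n(\theta)$, $J_n(\theta)=\Lambda_n(\theta)/\theta$ for $\theta\ne0$ with $J_n(0)=\liminf_{\theta\to0}J_n(\theta)$, and $I_n(x)=\sup_{\theta\in\mathbb R}(\theta x-\Lambda_n(\theta))$. Conventions: $\log\infty=\infty$. For $f:\mathbb R\to[-\infty,\infty]$, $\mathrm{epi}(f)=\{(\theta,b)\in\mathbb R^2:b\ge f(\theta)\}$, $\mathcal D_f=\{\theta:f(\theta)<\infty\}$. On $\mathbb R^2$ use the box metric $d(x,y)=\max(|x_1-y_1|,|x_2-y_2|)$, $d(x,A)=\inf_{y\in A}d(x,y)$, $\overline B_k=\{x:d(0,x)\le k\}$. The Attouch–Wets topology $\tau_{AW}$ on a set of lower semicontinuous functions is the topology with local base at $f$ given by $V_k(f)=\{g:\sup_{x\in\overline B_k}|d(x,\mathrm{epi}(g))-d(x,\mathrm{epi}(f))|<1/k\}$, $k\in\mathbb N$ (so $f_n\to f$ iff $\sup_{x\in B}|d(x,\mathrm{epi} f_n)-d(x,\mathrm{epi} f)|\to0$ for every bounded $B\subset\mathbb R^2$). Spaces: $\mathcal X_M'$ = lower semicontinuous convex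 $f:\mathbb R\to[0,\infty]$ with $f(0)<\infty$; $\mathcal X_M$ = those $f\in\mathcal X_M'$ with values in $(0,\infty]$ for which there is a probability measure $\nu$ with $f(\theta)=f_\nu(\theta)$ whenever $f(\theta)<\infty$; $\mathcal X_\Lambda=\{\log g:g\in\mathcal X_M\}$; $\mathcal X_I=\{x\mapsto\sup_\theta(\theta x-g(\theta)):g\in\mathcal X_\Lambda\}$; $\mathcal X_J$ = functions $f$ with $f(\theta)=g(\theta)/\theta$ for $\theta\neq0$ and $f(0)=\liminf_{\theta\to0}f(\theta)$ for some $g\in\mathcal X_\Lambda$, where each $f\in\mathcal X_J$ is identified with the closure of its epigraph (equivalently its lower semicontinuous regularisation) when forming $\tau_{AW}$. All spaces carry $\tau_{AW}$ and Borel σ-algebras. An $f\in\mathcal X_M$ which is not an MGF but satisfies $f=f_\nu$ on $\mathcal D_f$ for some probability $\nu$ is said to mimic $f_\nu$. For $-\infty\le\alpha\le0\le\beta\le\infty$, $\mathcal D_{[\alpha,\beta]}=\{f\in\mathcal X_M':\overline{\mathcal D_f}=[\alpha,\beta]\}$ (with $[-\infty$ read as $(-\infty$ and $\infty]$ as $\infty)$). Relative entropy: $H(\nu|\mu)=\int\frac{d\nu}{d\mu}\log\frac{d\nu}{d\mu}d\mu$ if $\nu\ll\mu$, $+\infty$ otherwise. LDP with good rate function $I$: $I$ lower semicontinuous with compact level sets, $-\inf_G I\le\liminf\frac1n\log P(Y_n\in G)$ for open $G$ and $\limsup\frac1n\log P(Y_n\in F)\le-\inf_F I$ for closed $F$.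 *)

theory Defs
  imports "HOL-Probability.Probability"
begin

definition elog :: "ereal \<Rightarrow> ereal" where
  "elog x = (if x = \<infinity> then \<infinity> else if x > 0 then ereal (ln (real_of_ereal x)) else -\<infinity>)"

definition eexp :: "ereal \<Rightarrow> ereal" where
  "eexp x = (if x = \<infinity> then \<infinity> else if x = -\<infinity> then 0 else ereal (exp (real_of_ereal x)))"

definition prob_measure_real :: "real measure \<Rightarrow> bool" where
  "prob_measure_real \<nu> \<longleftrightarrow> prob_space \<nu> \<and> sets \<nu> = sets borel"

definition mgf :: "real measure \<Rightarrow> real \<Rightarrow> ereal" where
  "mgf \<nu> \<theta> = enn2ereal (\<integral>\<^sup>+ x. ennreal (exp (\<theta> * x)) \<partial>\<nu>)"

definition is_MGF :: "(real \<Rightarrow> ereal) \<Rightarrow> bool" where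
  "is_MGF f \<longleftrightarrow> (\<exists>\<nu>. prob_measure_real \<nu> \<and> f = mgf \<nu>)"

text \<open>Relative entropy H(nu|mu) = int h log h d mu with h = d nu / d mu if nu << mu, else inf.
  The integrand is bounded below by -1/e, so the integral is split into positive and negative parts.\<close>
definition rel_entropy :: "real measure \<Rightarrow> real measure \<Rightarrow> ereal" where
  "rel_entropy \<nu> \<mu> =
     (if absolutely_continuous \<mu> \<nu> \<and> sets \<nu> = sets \<mu> then
        (let h = (\<lambda>x. enn2real (RN_deriv \<mu> \<nu> x)) in
          enn2ereal (\<integral>\<^sup>+ x. ennreal (h x * ln (h x)) \<partial>\<mu>)
          - enn2ereal (\<integral>\<^sup>+ x. ennreal (- (h x * ln (h x))) \<partial>\<mu>))
      else \<infinity>)"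

definition dom_fun :: "(real \<Rightarrow> ereal) \<Rightarrow> real set" where
  "dom_fun f = {\<theta>. f \<theta> < \<infinity>}"

definition lsc_fun :: "(real \<Rightarrow> ereal) \<Rightarrow> bool" where
  "lsc_fun f \<longleftrightarrow> (\<forall>c::ereal. closed {\<theta>. f \<theta> \<le> c})"

definition convex_efun :: "(real \<Rightarrow> ereal) \<Rightarrow> bool" where
  "convex_efun f \<longleftrightarrow> (\<forall>x y t. 0 < t \<and> t < 1 \<longrightarrow>
      f (t * x + (1 - t) * y) \<le> ereal t * f x + ereal (1 - t) * f y)"

definition XMp :: "(real \<Rightarrow> ereal) set" where
  "XMp = {f. lsc_fun f \<and> convex_efun f \<and> (\<forall>\<theta>. 0 \<le> f \<theta>) \<and> f 0 < \<infinity>}"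

definition XM :: "(real \<Rightarrow> ereal) set" where
  "XM = {f \<in> XMp. (\<forall>\<theta>. 0 < f \<theta>) \<and>
          (\<exists>\<nu>. prob_measure_real \<nu> \<and> (\<forall>\<theta>. f \<theta> < \<infinity> \<longrightarrow> f \<theta> = mgf \<nu> \<theta>))}"

definition XLam :: "(real \<Rightarrow> ereal) set" where
  "XLam = (\<lambda>g. elog \<circ> g) ` XM"

definition legendre :: "(real \<Rightarrow> ereal) \<Rightarrow> real \<Rightarrow> ereal" where
  "legendre g x = (SUP \<theta>. ereal (\<theta> * x) - g \<theta>)"

definition XI :: "(real \<Rightarrow> ereal) set" where
  "XI = legendre ` XLam"

definition jfun :: "(real \<Rightarrow> ereal) \<Rightarrow> real \<Rightarrow> ereal" where
  "jfun g \<theta> = (if \<theta> = 0 then Liminf (at 0) (\<lambda>t. g t / ereal t) else g \<theta> / ereal \<theta>)"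

definition XJ :: "(real \<Rightarrow> ereal) set" where
  "XJ = jfun ` XLam"

definition mimics :: "(real \<Rightarrow> ereal) \<Rightarrow> real measure \<Rightarrow> bool" where
  "mimics f \<nu> \<longleftrightarrow> f \<in> XM \<and> \<not> is_MGF f \<and> prob_measure_real \<nu> \<and>
     (\<forall>\<theta> \<in> dom_fun f. f \<theta> = mgf \<nu> \<theta>)"

text \<open>D_[alpha,beta]; using extended reals makes infinite endpoints open automatically.\<close>
definition Dint :: "ereal \<Rightarrow> ereal \<Rightarrow> (real \<Rightarrow> ereal) set" where
  "Dint \<alpha> \<beta> = {f \<in> XMp. closure (dom_fun f) = {\<theta>. \<alpha> \<le> ereal \<theta> \<and> ereal \<theta> \<le> \<beta>}}"

definition epi :: "(real \<Rightarrow> ereal) \<Rightarrow> (real \<times> real) set" where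
  "epi f = {(\<theta>, b). f \<theta> \<le> ereal b}"

definition box_dist :: "real \<times> real \<Rightarrow> real \<times> real \<Rightarrow> real" where
  "box_dist x y = max \<bar>fst x - fst y\<bar> \<bar>snd x - snd y\<bar>"

text \<open>d(x,A); the infimum over the empty set is +inf.\<close>
definition box_setdist :: "real \<times> real \<Rightarrow> (real \<times> real) set \<Rightarrow> ereal" where
  "box_setdist x A = (INF y\<in>A. ereal (box_dist x y))"

definition box_ball :: "real \<Rightarrow> (real \<times> real) set" where
  "box_ball k = {x. box_dist (0, 0) x \<le> k}"

text \<open>|d(x,epi g) - d(x,epi f)|, with the convention |inf - inf| = 0.\<close>
definition aw_gap :: "(real \<Rightarrow> ereal) \<Rightarrow> (real \<Rightarrow> ereal) \<Rightarrow> real \<times> real \<Rightarrow> ereal" where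
  "aw_gap g f x = (if box_setdist x (epi g) = box_setdist x (epi f) then 0
                   else \<bar>box_setdist x (epi g) - box_setdist x (epi f)\<bar>)"

definition aw_nbhd :: "(real \<Rightarrow> ereal) set \<Rightarrow> nat \<Rightarrow> (real \<Rightarrow> ereal) \<Rightarrow> (real \<Rightarrow> ereal) set" where
  "aw_nbhd S k f = {g \<in> S. (SUP x \<in> box_ball (real k). aw_gap g f x) < ereal (1 / real k)}"

definition AW_top :: "(real \<Rightarrow> ereal) set \<Rightarrow> (real \<Rightarrow> ereal) topology" where
  "AW_top S = topology (\<lambda>U. U \<subseteq> S \<and> (\<forall>f\<in>U. \<exists>k\<ge>1. aw_nbhd S k f \<subseteq> U))"

definition borel_of_top :: "'b topology \<Rightarrow> 'b measure" where
  "borel_of_top T = sigma (topspace T) (Collect (openin T))"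

definition rate_function :: "'b topology \<Rightarrow> ('b \<Rightarrow> ereal) \<Rightarrow> bool" where
  "rate_function T I \<longleftrightarrow> (\<forall>x\<in>topspace T. 0 \<le> I x) \<and>
      (\<forall>c::ereal. closedin T {x \<in> topspace T. I x \<le> c})"

definition good_rate_function :: "'b topology \<Rightarrow> ('b \<Rightarrow> ereal) \<Rightarrow> bool" where
  "good_rate_function T I \<longleftrightarrow> rate_function T I \<and>
      (\<forall>c::real. compactin T {x \<in> topspace T. I x \<le> ereal c})"

definition elog_prob :: "real \<Rightarrow> ereal" where
  "elog_prob p = (if p > 0 then ereal (ln p) else -\<infinity>)"

definition LDP :: "'a measure \<Rightarrow> 'b topology \<Rightarrow> (nat \<Rightarrow> 'a \<Rightarrow> 'b) \<Rightarrow> ('b \<Rightarrow> ereal) \<Rightarrow> bool" where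
  "LDP P T Y I \<longleftrightarrow>
     (\<forall>n\<ge>1. Y n \<in> measurable P (borel_of_top T)) \<and>
     rate_function T I \<and>
     (\<forall>G. openin T G \<longrightarrow>
        - (INF x\<in>G. I x) \<le>
        liminf (\<lambda>n. ereal (1 / real n) * elog_prob (measure P (Y n -` G \<inter> space P)))) \<and>
     (\<forall>F. closedin T F \<longrightarrow>
        limsup (\<lambda>n. ereal (1 / real n) * elog_prob (measure P (Y n -` F \<inter> space P)))
        \<le> - (INF x\<in>F. I x))"

definition Mn :: "(nat \<Rightarrow> 'a \<Rightarrow> real) \<Rightarrow> nat \<Rightarrow> 'a \<Rightarrow> real \<Rightarrow> ereal" where
  "Mn X n \<omega> = (\<lambda>\<theta>. ereal ((1 / real n) * (\<Sum>i\<in>{1..n}. exp (\<theta> * X i \<omega>))))"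

definition Lamn :: "(nat \<Rightarrow> 'a \<Rightarrow> real) \<Rightarrow> nat \<Rightarrow> 'a \<Rightarrow> real \<Rightarrow> ereal" where
  "Lamn X n \<omega> = elog \<circ> Mn X n \<omega>"

definition Jn :: "(nat \<Rightarrow> 'a \<Rightarrow> real) \<Rightarrow> nat \<Rightarrow> 'a \<Rightarrow> real \<Rightarrow> ereal" where
  "Jn X n \<omega> = jfun (Lamn X n \<omega>)"

definition In :: "(nat \<Rightarrow> 'a \<Rightarrow> real) \<Rightarrow> nat \<Rightarrow> 'a \<Rightarrow> real \<Rightarrow> ereal" where
  "In X n \<omega> = legendre (Lamn X n \<omega>)"

end

theory Submission
  imports Defs "HOL-Complex_Analysis.Complex_Analysis"
begin

text \<open>
  For functions with a nonempty epigraph, Attouch--Wets convergence is epi-convergence. It is metrised by the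
  distances to the epigraph at rational points, so compactness and continuity can be checked on sequences, and
  \<open>\<Lambda>\<^sub>n\<close>, \<open>J\<^sub>n\<close>, \<open>I\<^sub>n\<close> are continuous images of \<open>M\<^sub>n\<close>.

  The rate of \<open>f\<close> is the least relative entropy of a law whose moment generating function agrees with \<open>f\<close> where
  \<open>f\<close> is finite, provided that the domain of \<open>f\<close> is admissible. Testing the Donsker--Varadhan inequality with
  \<open>exp (b * x)\<close> shows that finite entropy forces a finite moment generating function wherever
  \<open>exp (exp (b * x))\<close> is \<open>\<mu>\<close>-integrable. Where it is not, \<open>\<mu>\<close> conditioned on suitable distant bands can be mixed,
  at finite entropy, into a law without exponential moments beyond a prescribed point; adding a small multiple of
  it to a given law truncates the domain at arbitrarily small cost, which is where mimicking functions come from.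

  The lower bound is the entropy inequality for product measures together with a weak law of large numbers for
  the empirical moment generating function. For the upper bound, a single bounded continuous test function (or
  \<open>exp (b * x)\<close>, if the domain is not admissible) and Chernoff's inequality bound the probability of a
  neighbourhood among tight empirical measures, whose limits are determined by their moment generating functions;
  exponential tightness and compactness then give the bound for closed sets.
\<close>

section \<open>The Attouch--Wets topology\<close>

text \<open>The map from laws to moment generating functions is not weakly continuous: a vanishing
  amount of mass far out leaves the limit law unchanged and can still make the function infinite.
  Law and domain are therefore carried separately through every limit, and the rate splits in the
  same way, into an entropy and a yes/no condition on the domain. Entropy is handled through its
  dual inequality against bounded functions, because in that form weak limits, mixtures and products
  are accessible without estimating a density. The same inequality explains the double exponential:
  entropy pairs a test function with the exponential of it, and the test function that controls the
  domain is already exponential. Whether a domain contains its end points is left open by these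
  arguments, hence the recurring factors \<open>s > 1\<close> and \<open>t < 1\<close>. The function
  that is finite at 0 alone fits every law, so that no law can be recovered from it; there \<mu>
  itself is a match and the rate can only be 0 or infinite.\<close>

lemma box_dist_triangle: "box_dist x z \<le> box_dist x y + box_dist y z"
  by (auto simp: box_dist_def)

lemma box_dist_commute: "box_dist x y = box_dist y x"
  by (auto simp: box_dist_def abs_minus_commute)

lemma box_dist_nonneg [simp]: "0 \<le> box_dist x y"
  by (auto simp: box_dist_def)

lemma box_dist_self [simp]: "box_dist x x = 0"
  by (auto simp: box_dist_def)

lemma box_dist_ball_eq: "{z. box_dist y z < e} = {fst y - e<..<fst y + e} \<times> {snd y - e<..<snd y + e}"
  by (auto simp: box_dist_def)

lemma box_dist_cball_eq: "{z. box_dist y z \<le> e} = {fst y - e..fst y + e} \<times> {snd y - e..snd y + e}"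
  by (auto simp: box_dist_def)

lemma open_box_dist_ball: "open {z. box_dist y z < e}"
  unfolding box_dist_ball_eq by (intro open_Times) auto

lemma compact_box_dist_cball: "compact {z. box_dist y z \<le> e}"
  unfolding box_dist_cball_eq by (intro compact_Times) auto

lemma box_dist_le_dist: "box_dist x y \<le> dist x y"
proof -
  have "\<bar>fst x - fst y\<bar> \<le> dist x y" "\<bar>snd x - snd y\<bar> \<le> dist x y"
    using dist_fst_le[of x y] dist_snd_le[of x y] by (auto simp: dist_real_def)
  then show ?thesis by (auto simp: box_dist_def)
qed

lemma dist_le_box_dist: "dist x y \<le> 2 * box_dist x y"
  using sqrt_sum_squares_le_sum_abs[of "fst x - fst y" "snd x - snd y"]
  unfolding box_dist_def dist_prod_def dist_real_def by (simp add: max_def)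

lemma closure_box_dist: "y \<in> closure A \<longleftrightarrow> (\<forall>e>0. \<exists>z\<in>A. box_dist y z < e)"
proof
  assume "y \<in> closure A"
  then show "\<forall>e>0. \<exists>z\<in>A. box_dist y z < e"
    unfolding closure_approachable using box_dist_le_dist
    by (metis dist_commute le_less_trans)
next
  assume *: "\<forall>e>0. \<exists>z\<in>A. box_dist y z < e"
  show "y \<in> closure A"
    unfolding closure_approachable
  proof (intro allI impI)
    fix e :: real assume "e > 0"
    then obtain z where "z \<in> A" "box_dist y z < e/2" using * by (meson half_gt_zero)
    then show "\<exists>z\<in>A. dist z y < e"
      using dist_le_box_dist[of y z] by (intro bexI[of _ z]) (auto simp: dist_commute)
  qed
qed

text \<open>Real-valued, so that Lipschitz estimates need no extended arithmetic; it agrees with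
  \<open>box_setdist\<close> once the epigraph is nonempty, and that is assumed wherever the value
  matters.\<close>

definition epi_dist :: "(real \<Rightarrow> ereal) \<Rightarrow> real \<times> real \<Rightarrow> real" where
  "epi_dist f x = (INF y\<in>epi f. box_dist x y)"

lemma epi_dist_bdd: "bdd_below (box_dist x ` A)"
  by (rule bdd_belowI[of _ 0]) auto

lemma epi_dist_less_iff:
  assumes "epi f \<noteq> {}"
  shows "epi_dist f x < r \<longleftrightarrow> (\<exists>y\<in>epi f. box_dist x y < r)"
  unfolding epi_dist_def using assms by (subst cINF_less_iff) (auto intro: epi_dist_bdd)

lemma epi_dist_le: "y \<in> epi f \<Longrightarrow> epi_dist f x \<le> box_dist x y"
  unfolding epi_dist_def by (rule cINF_lower[OF epi_dist_bdd])

lemma epi_dist_nonneg: "epi f \<noteq> {} \<Longrightarrow> 0 \<le> epi_dist f x"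
  unfolding epi_dist_def by (rule cINF_greatest) auto

lemma box_setdist_epi: "epi f \<noteq> {} \<Longrightarrow> box_setdist x (epi f) = ereal (epi_dist f x)"
  unfolding box_setdist_def epi_dist_def
  using ereal_Inf'[OF epi_dist_bdd[of x "epi f"]] by (simp add: image_image)

lemma epi_dist_lipschitz:
  assumes "epi f \<noteq> {}"
  shows "\<bar>epi_dist f x - epi_dist f y\<bar> \<le> box_dist x y"
proof -
  have *: "epi_dist f u \<le> box_dist u v + epi_dist f v" for u v
  proof (rule field_le_epsilon)
    fix e :: real assume "e > 0"
    then obtain z where z: "z \<in> epi f" "box_dist v z < epi_dist f v + e"
      using epi_dist_less_iff[OF assms, of v "epi_dist f v + e"] by auto
    then show "epi_dist f u \<le> box_dist u v + epi_dist f v + e"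
      using epi_dist_le[OF z(1), of u] box_dist_triangle[of u z v] by linarith
  qed
  show ?thesis using *[of x y] *[of y x] box_dist_commute[of x y] by linarith
qed

lemma closure_epi_iff:
  assumes "epi f \<noteq> {}"
  shows "y \<in> closure (epi f) \<longleftrightarrow> epi_dist f y = 0"
  unfolding closure_box_dist epi_dist_less_iff[OF assms, symmetric]
  using epi_dist_nonneg[OF assms, of y] by (metis dual_order.strict_iff_order less_irrefl linorder_not_less)

lemma aw_gap_eq:
  assumes "epi f \<noteq> {}" "epi g \<noteq> {}"
  shows "aw_gap g f x = ereal \<bar>epi_dist g x - epi_dist f x\<bar>"
  using assms by (auto simp: aw_gap_def box_setdist_epi)

text \<open>The countable index type makes \<open>dist\<close> on this function space metrise
  pointwise convergence, so that \<open>aw_dist\<close> arises by pull-back.\<close>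

definition epi_coord :: "(real \<Rightarrow> ereal) \<Rightarrow> rat \<times> rat \<Rightarrow> real" where
  "epi_coord f q = epi_dist f (of_rat (fst q), of_rat (snd q))"

definition aw_dist :: "(real \<Rightarrow> ereal) \<Rightarrow> (real \<Rightarrow> ereal) \<Rightarrow> real" where
  "aw_dist f g = dist (epi_coord f) (epi_coord g)"

lemma rat_box_dist_approx: "e > 0 \<Longrightarrow> \<exists>q::rat\<times>rat. box_dist x (of_rat (fst q), of_rat (snd q)) < e"
proof -
  assume "e > 0"
  then obtain a b where "fst x - e < of_rat a" "of_rat a < fst x + e" "snd x - e < of_rat b" "of_rat b < snd x + e"
    using of_rat_dense[of "fst x - e" "fst x + e"] of_rat_dense[of "snd x - e" "snd x + e"] by auto
  then show ?thesis by (intro exI[of _ "(a,b)"]) (auto simp: box_dist_def)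
qed

lemma tendsto_fun_iff:
  fixes f :: "'c \<Rightarrow> 'a::countable \<Rightarrow> 'b::metric_space"
  shows "(f \<longlongrightarrow> l) F \<longleftrightarrow> (\<forall>i. ((\<lambda>n. f n i) \<longlongrightarrow> l i) F)"
proof -
  have "(f \<longlongrightarrow> l) F \<longleftrightarrow> limitin (product_topology (\<lambda>i. euclidean) UNIV) f l F"
    by (metis euclidean_product_topology limitin_canonical_iff)
  also have "\<dots> \<longleftrightarrow> (\<forall>i. ((\<lambda>n. f n i) \<longlongrightarrow> l i) F)"
    unfolding limitin_componentwise limitin_canonical_iff by simp
  finally show ?thesis .
qed

text \<open>All distance functions are 1-Lipschitz, so convergence on a dense set upgrades to
  uniform convergence on compact sets: one third of \<open>e\<close> for the values at a nearby
  rational point and one third for each of the two Lipschitz errors.\<close>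

lemma epi_dist_unif_conv:
  fixes g :: "nat \<Rightarrow> real \<Rightarrow> ereal"
  assumes ne: "epi f \<noteq> {}" "\<And>n. epi (g n) \<noteq> {}"
    and conv: "\<And>q. (\<lambda>n. epi_coord (g n) q) \<longlonglongrightarrow> epi_coord f q" and K: "compact K" and e: "e > 0"
  shows "eventually (\<lambda>n. \<forall>x\<in>K. \<bar>epi_dist (g n) x - epi_dist f x\<bar> < e) sequentially"
proof -
  let ?B = "\<lambda>q::rat\<times>rat. {z. box_dist (of_rat (fst q), of_rat (snd q)) z < e/3}"
  have "K \<subseteq> (\<Union>q\<in>UNIV. ?B q)"
    using rat_box_dist_approx[of "e/3"] e by (auto simp: box_dist_commute)
  with K open_box_dist_ball obtain Q where Q: "finite Q" "K \<subseteq> (\<Union>q\<in>Q. ?B q)"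
    by (rule compactE_image)
  have "eventually (\<lambda>n. \<bar>epi_coord (g n) q - epi_coord f q\<bar> < e/3) sequentially" for q
    using tendstoD[OF conv[of q], of "e/3"] e by (simp add: dist_real_def)
  then have "eventually (\<lambda>n. \<forall>q\<in>Q. \<bar>epi_coord (g n) q - epi_coord f q\<bar> < e/3) sequentially"
    by (intro eventually_ball_finite Q(1)) blast
  then show ?thesis
  proof eventually_elim
    case (elim n)
    show ?case
    proof
      fix x assume "x \<in> K"
      then obtain q where q: "q \<in> Q" "box_dist (of_rat (fst q), of_rat (snd q)) x < e/3" using Q by blast
      let ?q = "(of_rat (fst q), of_rat (snd q)) :: real \<times> real"
      have "\<bar>epi_dist (g n) ?q - epi_dist f ?q\<bar> < e/3"
        using elim q by (auto simp: epi_coord_def)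
      then show "\<bar>epi_dist (g n) x - epi_dist f x\<bar> < e"
        using epi_dist_lipschitz[OF ne(1), of ?q x] epi_dist_lipschitz[OF ne(2), of n ?q x] q by linarith
    qed
  qed
qed

lemma aw_dist_tendsto_iff:
  fixes g :: "nat \<Rightarrow> real \<Rightarrow> ereal"
  assumes ne: "epi f \<noteq> {}" "\<And>n. epi (g n) \<noteq> {}"
  shows "(\<lambda>n. aw_dist (g n) f) \<longlonglongrightarrow> 0 \<longleftrightarrow> (\<forall>x. (\<lambda>n. epi_dist (g n) x) \<longlonglongrightarrow> epi_dist f x)"
proof -
  have "(\<lambda>n. aw_dist (g n) f) \<longlonglongrightarrow> 0 \<longleftrightarrow> (\<forall>q. (\<lambda>n. epi_coord (g n) q) \<longlonglongrightarrow> epi_coord f q)"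
    unfolding aw_dist_def tendsto_dist_iff[symmetric] tendsto_fun_iff ..
  also have "\<dots> \<longleftrightarrow> (\<forall>x. (\<lambda>n. epi_dist (g n) x) \<longlonglongrightarrow> epi_dist f x)"
  proof (intro iffI allI tendstoI)
    fix x e assume *: "\<forall>q. (\<lambda>n. epi_coord (g n) q) \<longlonglongrightarrow> epi_coord f q" and e: "(e::real) > 0"
    have "eventually (\<lambda>n. \<forall>y\<in>{x}. \<bar>epi_dist (g n) y - epi_dist f y\<bar> < e) sequentially"
      by (rule epi_dist_unif_conv) (use * e ne in auto)
    then show "\<forall>\<^sub>F n in sequentially. dist (epi_dist (g n) x) (epi_dist f x) < e"
      by (simp add: dist_real_def)
  qed (auto simp: epi_coord_def dest: tendstoD)
  finally show ?thesis .
qed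

text \<open>Closures are compared because the members of \<open>XJ\<close> need not be lower
  semicontinuous and are identified with the closures of their epigraphs.\<close>

definition epi_sep :: "(real \<Rightarrow> ereal) set \<Rightarrow> bool" where
  "epi_sep S \<longleftrightarrow> (\<forall>f\<in>S. epi f \<noteq> {}) \<and> inj_on (\<lambda>f. closure (epi f)) S"

lemma epi_sep_Metric_space:
  assumes "epi_sep S" shows "Metric_space S aw_dist"
proof
  fix f g assume "f \<in> S" "g \<in> S"
  then have ne: "epi f \<noteq> {}" "epi g \<noteq> {}" using assms by (auto simp: epi_sep_def)
  show "(aw_dist f g = 0) = (f = g)"
  proof
    assume "aw_dist f g = 0"
    then have eq: "epi_coord f = epi_coord g" by (simp add: aw_dist_def)
    have "(\<lambda>n::nat. epi_dist g x) \<longlonglongrightarrow> epi_dist f x" for x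
    proof -
      have "(\<lambda>n::nat. aw_dist g f) \<longlonglongrightarrow> 0" by (simp add: aw_dist_def eq)
      then show ?thesis using aw_dist_tendsto_iff[OF ne(1), of "\<lambda>_. g"] ne(2) by blast
    qed
    then have "epi_dist g x = epi_dist f x" for x
      using LIMSEQ_unique[OF _ tendsto_const] by metis
    then have "closure (epi f) = closure (epi g)"
      by (auto simp: closure_epi_iff[OF ne(1)] closure_epi_iff[OF ne(2)])
    then show "f = g" using assms \<open>f \<in> S\<close> \<open>g \<in> S\<close> by (auto simp: epi_sep_def inj_on_def)
  qed (simp add: aw_dist_def)
qed (auto simp: aw_dist_def dist_commute dist_triangle)

section \<open>The Attouch--Wets neighbourhoods and their metrisation\<close>

lemma aw_nbhd_mono:
  assumes "k \<ge> 1" "k \<le> m" shows "aw_nbhd S m f \<subseteq> aw_nbhd S k f"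
proof
  fix g assume g: "g \<in> aw_nbhd S m f"
  have "(SUP x\<in>box_ball (real k). aw_gap g f x) \<le> (SUP x\<in>box_ball (real m). aw_gap g f x)"
    by (rule SUP_subset_mono) (use assms in \<open>auto simp: box_ball_def\<close>)
  also have "\<dots> < ereal (1 / real m)" using g by (auto simp: aw_nbhd_def)
  also have "\<dots> \<le> ereal (1 / real k)" using assms by (auto simp: frac_le)
  finally show "g \<in> aw_nbhd S k f" using g by (auto simp: aw_nbhd_def)
qed

lemma openin_AW_top:
  "openin (AW_top S) U \<longleftrightarrow> U \<subseteq> S \<and> (\<forall>f\<in>U. \<exists>k\<ge>1. aw_nbhd S k f \<subseteq> U)"
proof -
  have "istopology (\<lambda>U. U \<subseteq> S \<and> (\<forall>f\<in>U. \<exists>k\<ge>1. aw_nbhd S k f \<subseteq> U))"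
    unfolding istopology_def
  proof (intro conjI allI impI)
    fix U V assume U: "U \<subseteq> S \<and> (\<forall>f\<in>U. \<exists>k\<ge>1. aw_nbhd S k f \<subseteq> U)"
      and V: "V \<subseteq> S \<and> (\<forall>f\<in>V. \<exists>k\<ge>1. aw_nbhd S k f \<subseteq> V)"
    show "U \<inter> V \<subseteq> S" using U by auto
    show "\<forall>f\<in>U \<inter> V. \<exists>k\<ge>1. aw_nbhd S k f \<subseteq> U \<inter> V"
    proof
      fix f assume "f \<in> U \<inter> V"
      then obtain k m where km: "k \<ge> 1" "m \<ge> 1" "aw_nbhd S k f \<subseteq> U" "aw_nbhd S m f \<subseteq> V"
        using U V by blast
      then have "aw_nbhd S (max k m) f \<subseteq> U \<inter> V"
        using aw_nbhd_mono[of k "max k m" S f] aw_nbhd_mono[of m "max k m" S f] by auto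
      then show "\<exists>k\<ge>1. aw_nbhd S k f \<subseteq> U \<inter> V" using km by (meson max.coboundedI1)
    qed
  next
    fix K assume K: "\<forall>U\<in>K. U \<subseteq> S \<and> (\<forall>f\<in>U. \<exists>k\<ge>1. aw_nbhd S k f \<subseteq> U)"
    then show "\<Union>K \<subseteq> S" by auto
    show "\<forall>f\<in>\<Union>K. \<exists>k\<ge>1. aw_nbhd S k f \<subseteq> \<Union>K"
    proof
      fix f assume "f \<in> \<Union>K"
      then obtain U where U: "U \<in> K" "f \<in> U" by blast
      then obtain k where "k \<ge> 1" "aw_nbhd S k f \<subseteq> U" using K by blast
      then show "\<exists>k\<ge>1. aw_nbhd S k f \<subseteq> \<Union>K" using U(1) by blast
    qed
  qed
  then show ?thesis unfolding AW_top_def by (simp add: topology_inverse')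
qed

text \<open>Both inclusions are argued by contradiction: counterexamples chosen in shrinking
  neighbourhoods of one kind converge in all distances and hence enter the given neighbourhood of
  the other kind.\<close>

lemma AW_top_eq_mtopology:
  assumes S: "epi_sep S" shows "AW_top S = Metric_space.mtopology S aw_dist"
proof -
  interpret Metric_space S aw_dist using epi_sep_Metric_space[OF S] .
  have ne: "f \<in> S \<Longrightarrow> epi f \<noteq> {}" for f using S by (auto simp: epi_sep_def)
  have ball_sub: "\<exists>r>0. mball f r \<subseteq> aw_nbhd S k f" if f: "f \<in> S" and k: "k \<ge> 1" for f k
  proof (rule ccontr)
    assume "\<not> (\<exists>r>0. mball f r \<subseteq> aw_nbhd S k f)"
    then have "\<exists>g. g \<in> mball f (1 / Suc n) \<and> g \<notin> aw_nbhd S k f" for n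
      by (metis of_nat_0_less_iff subsetI zero_less_Suc zero_less_divide_1_iff)
    then obtain g where g: "\<And>n. g n \<in> mball f (1 / Suc n)" "\<And>n. g n \<notin> aw_nbhd S k f" by metis
    then have gS: "g n \<in> S" for n by (auto simp: mball_def)
    have "(\<lambda>n. aw_dist (g n) f) \<longlonglongrightarrow> 0"
    proof (rule real_tendsto_sandwich[OF _ _ tendsto_const LIMSEQ_inverse_real_of_nat])
      show "\<forall>\<^sub>F n in sequentially. 0 \<le> aw_dist (g n) f" by (simp add: aw_dist_def)
      show "\<forall>\<^sub>F n in sequentially. aw_dist (g n) f \<le> inverse (real (Suc n))"
        using g(1) by (auto simp: mball_def aw_dist_def dist_commute inverse_eq_divide less_imp_le)
    qed
    then have "(\<lambda>n. epi_coord (g n) q) \<longlonglongrightarrow> epi_coord f q" for q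
      using aw_dist_tendsto_iff[OF ne[OF f], of g] ne gS by (auto simp: epi_coord_def)
    then have "\<forall>\<^sub>F n in sequentially. \<forall>x\<in>{z. box_dist (0,0) z \<le> real k}. \<bar>epi_dist (g n) x - epi_dist f x\<bar> < 1 / (2 * real k)"
      using f gS ne k by (intro epi_dist_unif_conv compact_box_dist_cball) auto
    then obtain n where n: "\<forall>x\<in>box_ball (real k). \<bar>epi_dist (g n) x - epi_dist f x\<bar> < 1 / (2 * real k)"
      unfolding box_ball_def using eventually_happens'[OF sequentially_bot] by blast
    have "(SUP x\<in>box_ball (real k). aw_gap (g n) f x) \<le> ereal (1 / (2 * real k))"
      using n aw_gap_eq[OF ne[OF f] ne[OF gS[of n]]] by (intro SUP_least) (auto simp: less_imp_le)
    also have "\<dots> < ereal (1 / real k)" using k by (auto simp: field_simps)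
    finally show False using g(2)[of n] gS by (auto simp: aw_nbhd_def)
  qed
  have nbhd_sub: "\<exists>k\<ge>1. aw_nbhd S k f \<subseteq> mball f r" if f: "f \<in> S" and r: "r > 0" for f r
  proof (rule ccontr)
    assume *: "\<not> (\<exists>k\<ge>1. aw_nbhd S k f \<subseteq> mball f r)"
    have "\<exists>g. g \<in> aw_nbhd S (Suc n) f \<and> g \<notin> mball f r" for n
      using * by (metis subsetI le_add1 plus_1_eq_Suc)
    then obtain g where g: "\<And>n. g n \<in> aw_nbhd S (Suc n) f" "\<And>n. g n \<notin> mball f r" by metis
    then have gS: "g n \<in> S" for n by (auto simp: aw_nbhd_def)
    have "(\<lambda>n. epi_dist (g n) x) \<longlonglongrightarrow> epi_dist f x" for x
    proof (rule Lim_null[THEN iffD2], rule Lim_null_comparison[OF _ LIMSEQ_inverse_real_of_nat])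
      obtain N :: nat where N: "box_dist (0,0) x \<le> real N" using real_arch_simple by blast
      show "\<forall>\<^sub>F n in sequentially. norm (epi_dist (g n) x - epi_dist f x) \<le> inverse (real (Suc n))"
        using eventually_ge_at_top[of N]
      proof eventually_elim
        case (elim n)
        have "x \<in> box_ball (real (Suc n))" using N elim by (auto simp: box_ball_def)
        then have "aw_gap (g n) f x \<le> (SUP x\<in>box_ball (real (Suc n)). aw_gap (g n) f x)" by (rule SUP_upper)
        also have "\<dots> < ereal (1 / real (Suc n))" using g(1)[of n] by (auto simp: aw_nbhd_def)
        finally show ?case using aw_gap_eq[OF ne[OF f] ne[OF gS[of n]]] by (auto simp: inverse_eq_divide)
      qed
    qed
    then have "(\<lambda>n. aw_dist (g n) f) \<longlonglongrightarrow> 0" using aw_dist_tendsto_iff[OF ne[OF f], of g] ne gS by auto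
    then have "\<forall>\<^sub>F n in sequentially. aw_dist (g n) f < r" using r by (rule order_tendstoD)
    then obtain n where "aw_dist (g n) f < r" using eventually_happens'[OF sequentially_bot] by blast
    then show False using g(2)[of n] gS f by (auto simp: mball_def aw_dist_def dist_commute)
  qed
  have "(\<forall>f\<in>U. \<exists>k\<ge>1. aw_nbhd S k f \<subseteq> U) \<longleftrightarrow> (\<forall>x. x \<in> U \<longrightarrow> (\<exists>r>0. mball x r \<subseteq> U))"
    if U: "U \<subseteq> S" for U
    using ball_sub nbhd_sub U by (meson subset_trans subsetD)
  then show ?thesis
    unfolding topology_eq openin_AW_top openin_mtopology by blast
qed

text \<open>Kuratowski convergence of the epigraphs: points of the limit are approached, and points
  off its closure are eventually avoided by a fixed distance. In this form it makes sense for
  epigraphs that are not closed.\<close>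

definition epi_conv :: "(nat \<Rightarrow> real \<Rightarrow> ereal) \<Rightarrow> (real \<Rightarrow> ereal) \<Rightarrow> bool" where
  "epi_conv g f \<longleftrightarrow>
    (\<forall>y\<in>epi f. \<forall>e>0. \<forall>\<^sub>F n in sequentially. \<exists>z\<in>epi (g n). box_dist y z < e) \<and>
    (\<forall>y. y \<notin> closure (epi f) \<longrightarrow> (\<exists>e>0. \<forall>\<^sub>F n in sequentially. \<forall>z\<in>epi (g n). e \<le> box_dist y z))"

text \<open>Upper bounds on the distance come from approximating one nearly closest point. Lower
  bounds need compactness: a closed ball that misses the limit is covered by finitely many balls
  that the late epigraphs avoid.\<close>

lemma epi_conv_iff:
  fixes g :: "nat \<Rightarrow> real \<Rightarrow> ereal"
  assumes ne: "epi f \<noteq> {}" "\<And>n. epi (g n) \<noteq> {}"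
  shows "(\<lambda>n. aw_dist (g n) f) \<longlonglongrightarrow> 0 \<longleftrightarrow> epi_conv g f"
proof
  assume "(\<lambda>n. aw_dist (g n) f) \<longlonglongrightarrow> 0"
  then have conv: "(\<lambda>n. epi_dist (g n) x) \<longlonglongrightarrow> epi_dist f x" for x
    using aw_dist_tendsto_iff ne by blast
  show "epi_conv g f"
    unfolding epi_conv_def
  proof (intro conjI ballI allI impI)
    fix y e assume "y \<in> epi f" and e: "(e::real) > 0"
    then have "epi_dist f y = 0" using closure_epi_iff[OF ne(1)] closure_subset by blast
    then have "\<forall>\<^sub>F n in sequentially. epi_dist (g n) y < e"
      using order_tendstoD(2)[OF conv[of y], of e] e by simp
    then show "\<forall>\<^sub>F n in sequentially. \<exists>z\<in>epi (g n). box_dist y z < e"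
      by (simp add: epi_dist_less_iff[OF ne(2)])
  next
    fix y assume "y \<notin> closure (epi f)"
    then have pos: "epi_dist f y > 0"
      using closure_epi_iff[OF ne(1), of y] epi_dist_nonneg[OF ne(1), of y] by linarith
    then have "\<forall>\<^sub>F n in sequentially. epi_dist (g n) y > epi_dist f y / 2"
      using order_tendstoD(1)[OF conv[of y], of "epi_dist f y / 2"] by simp
    then show "\<exists>e>0. \<forall>\<^sub>F n in sequentially. \<forall>z\<in>epi (g n). e \<le> box_dist y z"
    proof (intro exI conjI)
      show "\<forall>\<^sub>F n in sequentially. \<forall>z\<in>epi (g n). epi_dist f y / 2 \<le> box_dist y z"
        using \<open>\<forall>\<^sub>F n in sequentially. epi_dist (g n) y > epi_dist f y / 2\<close>
        by eventually_elim (meson epi_dist_le less_imp_le less_le_trans)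
    qed (use pos in simp)
  qed
next
  assume kp: "epi_conv g f"
  have "(\<lambda>n. epi_dist (g n) x) \<longlonglongrightarrow> epi_dist f x" for x
  proof (rule order_tendstoI)
    fix a assume "epi_dist f x < a"
    then obtain y where y: "y \<in> epi f" "box_dist x y < a" using epi_dist_less_iff[OF ne(1)] by blast
    then have "\<forall>\<^sub>F n in sequentially. \<exists>z\<in>epi (g n). box_dist y z < a - box_dist x y"
      using kp unfolding epi_conv_def by (meson diff_gt_0_iff_gt)
    then show "\<forall>\<^sub>F n in sequentially. epi_dist (g n) x < a"
    proof eventually_elim
      case (elim n)
      then obtain z where "z \<in> epi (g n)" "box_dist y z < a - box_dist x y" by blast
      then show ?case using epi_dist_le[of z "g n" x] box_dist_triangle[of x z y] by linarith
    qed
  next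
    fix a assume a: "a < epi_dist f x"
    \<comment> \<open>Strictly in between: the closed ball of radius \<open>a'\<close> misses the
      closure of the epigraph, and avoiding it still gives a distance above
      \<open>a\<close>.\<close>
    obtain a' where a': "a < a'" "a' < epi_dist f x" using a dense by blast
    let ?K' = "{z. box_dist x z \<le> a'}"
    have "y \<notin> closure (epi f)" if "y \<in> ?K'" for y
    proof
      assume "y \<in> closure (epi f)"
      then have "epi_dist f y = 0" using closure_epi_iff[OF ne(1)] by blast
      then show False using that a' epi_dist_lipschitz[OF ne(1), of x y] by auto
    qed
    then have "\<forall>y\<in>?K'. \<exists>e>0. \<forall>\<^sub>F n in sequentially. \<forall>z\<in>epi (g n). e \<le> box_dist y z"
      using kp unfolding epi_conv_def by blast
    from bchoice[OF this] obtain E where E0: "\<forall>y\<in>?K'. E y > 0 \<and> (\<forall>\<^sub>F n in sequentially. \<forall>z\<in>epi (g n). E y \<le> box_dist y z)" ..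
    have E: "E y > 0" "\<forall>\<^sub>F n in sequentially. \<forall>z\<in>epi (g n). E y \<le> box_dist y z" if "y \<in> ?K'" for y
      using bspec[OF E0 that] by blast+
    have "?K' \<subseteq> (\<Union>y\<in>?K'. {z. box_dist y z < E y})"
    proof
      fix y assume y: "y \<in> ?K'"
      then have "y \<in> {z. box_dist y z < E y}" using E(1) by simp
      then show "y \<in> (\<Union>y\<in>?K'. {z. box_dist y z < E y})" using y by (rule UN_I[rotated])
    qed
    with compact_box_dist_cball[of x a'] open_box_dist_ball
    obtain Y where Y: "Y \<subseteq> ?K'" "finite Y" "?K' \<subseteq> (\<Union>y\<in>Y. {z. box_dist y z < E y})"
      by (rule compactE_image)
    have "\<forall>\<^sub>F n in sequentially. \<forall>y\<in>Y. \<forall>z\<in>epi (g n). E y \<le> box_dist y z"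
    proof (rule eventually_ball_finite[OF Y(2)], rule ballI)
      fix y assume "y \<in> Y"
      with Y(1) have "y \<in> ?K'" ..
      then show "\<forall>\<^sub>F n in sequentially. \<forall>z\<in>epi (g n). E y \<le> box_dist y z" by (rule E(2))
    qed
    then have "\<forall>\<^sub>F n in sequentially. a' \<le> epi_dist (g n) x"
    proof eventually_elim
      case (elim n)
      have "a' < box_dist x z" if "z \<in> epi (g n)" for z
        proof (rule ccontr)
        assume "\<not> a' < box_dist x z"
        then have "z \<in> ?K'" by simp
        then obtain y where "y \<in> Y" "box_dist y z < E y" using Y(3) by blast
        then show False using elim that by (meson not_less)
      qed
      then show ?case
        unfolding epi_dist_def using ne(2)[of n] by (intro cINF_greatest) (auto simp: less_imp_le)
    qed
    then show "\<forall>\<^sub>F n in sequentially. a < epi_dist (g n) x"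
      by eventually_elim (use a' in linarith)
  qed
  then show "(\<lambda>n. aw_dist (g n) f) \<longlonglongrightarrow> 0" using aw_dist_tendsto_iff ne by blast
qed

section \<open>Epi-convergence and the Legendre transform\<close>

lemma ereal_dense_real:
  assumes "(a::ereal) < b" obtains c where "a < ereal c" "ereal c < b"
  using ereal_dense2[OF assms] by blast

lemma ereal_less_dense_real:
  assumes "(a::ereal) < ereal b" obtains c where "a \<le> ereal c" "c < b"
  using ereal_dense2[OF assms] by (metis less_ereal.simps(1) order_less_imp_le)

section \<open>Local criteria for epi-convergence\<close>

lemma lsc_funD:
  assumes "lsc_fun f" "c < f x"
  obtains e where "e > 0" "\<And>y. \<bar>y - x\<bar> < e \<Longrightarrow> c < f y"
proof -
  have "open (- {y. f y \<le> c})" using assms(1) by (auto simp: lsc_fun_def open_Compl)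
  moreover have "x \<in> - {y. f y \<le> c}" using assms(2) by auto
  ultimately obtain e where e: "e > 0" "ball x e \<subseteq> - {y. f y \<le> c}" by (rule openE)
  have "c < f y" if "\<bar>y - x\<bar> < e" for y
  proof -
    have "y \<in> ball x e" using that by (simp add: dist_real_def abs_minus_commute)
    with e(2) have "y \<in> - {y. f y \<le> c}" ..
    then show ?thesis by (simp add: not_le)
  qed
  then show ?thesis using that e(1) by blast
qed

lemma lsc_funI:
  assumes "\<And>c x. c < f x \<Longrightarrow> \<exists>e>0. \<forall>y. \<bar>y - x\<bar> < e \<longrightarrow> c < f y"
  shows "lsc_fun f"
  unfolding lsc_fun_def
proof
  fix c
  have "open (- {y. f y \<le> c})"
    unfolding open_contains_ball
  proof
    fix x assume "x \<in> - {y. f y \<le> c}"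
    then have "c < f x" by auto
    then obtain e where "e > 0" "\<forall>y. \<bar>y - x\<bar> < e \<longrightarrow> c < f y" using assms by blast
    then show "\<exists>e>0. ball x e \<subseteq> - {y. f y \<le> c}"
      by (intro exI[of _ e]) (auto simp: dist_real_def abs_minus_commute, meson leD)
  qed
  then show "closed {y. f y \<le> c}" by (simp add: closed_def)
qed

lemma closed_epi:
  assumes "lsc_fun f" shows "closure (epi f) = epi f"
proof
  show "closure (epi f) \<subseteq> epi f"
  proof
    fix y assume y: "y \<in> closure (epi f)"
    obtain x b where yx: "y = (x, b)" by (cases y)
    show "y \<in> epi f"
    proof (rule ccontr)
      assume "y \<notin> epi f"
      then have "ereal b < f x" by (auto simp: epi_def yx)
      then obtain c where c: "ereal b < ereal c" "ereal c < f x" by (rule ereal_dense_real)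
      then obtain e where e: "e > 0" "\<And>y. \<bar>y - x\<bar> < e \<Longrightarrow> ereal c < f y" using lsc_funD[OF assms] by blast
      have "min e (c - b) > 0" using e c by simp
      then obtain z where z: "z \<in> epi f" "box_dist y z < min e (c - b)" using y closure_box_dist by blast
      obtain x' b' where zz: "z = (x', b')" by (cases z)
      have "\<bar>x' - x\<bar> < e" "b' < c" using z(2) by (auto simp: zz yx box_dist_def)
      then have "ereal b' < f x'" using e(2)[of x'] by (meson less_ereal.simps(1) less_trans)
      then show False using z(1) by (auto simp: zz epi_def)
    qed
  qed
qed (rule closure_subset)

lemma convex_efun_le:
  assumes "convex_efun f" "f x \<le> ereal a" "f y \<le> ereal b" "0 \<le> t" "t \<le> 1"
  shows "f (t * x + (1 - t) * y) \<le> ereal (t * a + (1 - t) * b)"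
proof -
  consider "t = 0" | "t = 1" | "0 < t" "t < 1" using assms by linarith
  then show ?thesis
  proof cases
    case 3
    then have "f (t * x + (1 - t) * y) \<le> ereal t * f x + ereal (1 - t) * f y"
      using assms(1) by (auto simp: convex_efun_def)
    also have "\<dots> \<le> ereal t * ereal a + ereal (1 - t) * ereal b"
      using 3 assms by (intro add_mono ereal_mult_left_mono) auto
    finally show ?thesis by simp
  qed (use assms in auto)
qed

text \<open>Argument and level are separated here. The upper condition can always be recovered from
  epi-convergence, the lower one only for a lower semicontinuous limit.\<close>

lemma epi_conv_localI:
  assumes L: "\<And>x c. ereal c < f x \<Longrightarrow> \<exists>e>0. \<forall>\<^sub>F n in sequentially. \<forall>y. \<bar>y - x\<bar> < e \<longrightarrow> ereal c < g n y"
    and U: "\<And>x c e. f x < ereal c \<Longrightarrow> e > 0 \<Longrightarrow> \<forall>\<^sub>F n in sequentially. \<exists>y. \<bar>y - x\<bar> < e \<and> g n y < ereal c"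
  shows "epi_conv g f"
  unfolding epi_conv_def
proof (intro conjI ballI allI impI)
  fix y e assume y: "y \<in> epi f" and e: "(e::real) > 0"
  obtain x b where yx: "y = (x, b)" by (cases y)
  have "f x \<le> ereal b" using y by (simp add: epi_def yx)
  also have "\<dots> < ereal (b + e/2)" using e by simp
  finally have "\<forall>\<^sub>F n in sequentially. \<exists>y. \<bar>y - x\<bar> < e \<and> g n y < ereal (b + e/2)" using U e by blast
  then show "\<forall>\<^sub>F n in sequentially. \<exists>z\<in>epi (g n). box_dist y z < e"
  proof eventually_elim
    case (elim n)
    then obtain x' where "\<bar>x' - x\<bar> < e" "g n x' < ereal (b + e/2)" by blast
    then show ?case
      using e by (intro bexI[of _ "(x', b + e/2)"]) (auto simp: epi_def box_dist_def yx)
  qed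
next
  fix y assume y: "y \<notin> closure (epi f)"
  obtain x b where yx: "y = (x, b)" by (cases y)
  have "y \<notin> epi f" using y closure_subset by blast
  then have "ereal b < f x" by (auto simp: epi_def yx)
  then obtain c where c: "ereal b < ereal c" "ereal c < f x" by (rule ereal_dense_real)
  then obtain e where e: "e > 0" "\<forall>\<^sub>F n in sequentially. \<forall>y. \<bar>y - x\<bar> < e \<longrightarrow> ereal c < g n y" using L by blast
  have "\<forall>\<^sub>F n in sequentially. \<forall>z\<in>epi (g n). min e (c - b) \<le> box_dist y z"
    using e(2)
  proof eventually_elim
    case (elim n)
    show ?case
    proof (rule ballI, rule ccontr)
      fix z assume z: "z \<in> epi (g n)" "\<not> min e (c - b) \<le> box_dist y z"
      obtain x' b' where zz: "z = (x', b')" by (cases z)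
      have "\<bar>x' - x\<bar> < e" "b' < c" using z(2) by (auto simp: zz yx box_dist_def)
      then have "ereal b' < g n x'" using elim by (meson less_ereal.simps(1) less_trans)
      then show False using z(1) by (auto simp: zz epi_def)
    qed
  qed
  then show "\<exists>e>0. \<forall>\<^sub>F n in sequentially. \<forall>z\<in>epi (g n). e \<le> box_dist y z"
    using e(1) c by (intro exI[of _ "min e (c - b)"]) auto
qed

lemma epi_conv_lowerD:
  assumes "epi_conv g f" "lsc_fun f" "ereal c < f x"
  shows "\<exists>e>0. \<forall>\<^sub>F n in sequentially. \<forall>y. \<bar>y - x\<bar> < e \<longrightarrow> ereal c < g n y"
proof -
  have "(x, c) \<notin> closure (epi f)" using assms(3) unfolding closed_epi[OF assms(2)] by (auto simp: epi_def)
  then obtain e where e: "e > 0" "\<forall>\<^sub>F n in sequentially. \<forall>z\<in>epi (g n). e \<le> box_dist (x, c) z"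
    using assms(1) unfolding epi_conv_def by blast
  have "\<forall>\<^sub>F n in sequentially. \<forall>y. \<bar>y - x\<bar> < e \<longrightarrow> ereal c < g n y"
    using e(2)
  proof eventually_elim
    case (elim n)
    show ?case
    proof (intro allI impI, rule ccontr)
      fix y assume y: "\<bar>y - x\<bar> < e" "\<not> ereal c < g n y"
      then have "(y, c) \<in> epi (g n)" by (auto simp: epi_def)
      then have "e \<le> box_dist (x, c) (y, c)" using elim by blast
      then show False using y by (auto simp: box_dist_def)
    qed
  qed
  then show ?thesis using e(1) by blast
qed

lemma epi_conv_upperD:
  assumes "epi_conv g f" "f x < ereal c" "e > 0"
  shows "\<forall>\<^sub>F n in sequentially. \<exists>y. \<bar>y - x\<bar> < e \<and> g n y < ereal c"
proof -
  obtain b where b: "f x \<le> ereal b" "b < c" using ereal_less_dense_real[OF assms(2)] .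
  have "(x, b) \<in> epi f" "min e (c - b) > 0" using b assms by (auto simp: epi_def)
  then have "\<forall>\<^sub>F n in sequentially. \<exists>z\<in>epi (g n). box_dist (x, b) z < min e (c - b)"
    using assms(1) unfolding epi_conv_def by blast
  then show ?thesis
  proof eventually_elim
    case (elim n)
    then obtain x' b' where z: "(x', b') \<in> epi (g n)" "box_dist (x, b) (x', b') < min e (c - b)" by force
    then have "\<bar>x' - x\<bar> < e" "b' < c" by (auto simp: box_dist_def)
    then show ?case using z(1) by (intro exI[of _ x']) (auto simp: epi_def intro: le_less_trans)
  qed
qed

text \<open>The lower bound near 0 does not follow from pointwise convergence: \<open>f\<close> may be finite at 0 only,
  and the \<open>g n\<close> may have steep minima next to 0.\<close>
lemma epi_conv_convexI:
  fixes z :: real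
  assumes cg: "\<And>n. convex_efun (g n)" and cf: "convex_efun f" and lsc: "lsc_fun f"
    and g0: "\<And>n. g n 0 = ereal z" and f0: "f 0 = ereal z"
    and dense: "\<And>a b. a < b \<Longrightarrow> \<exists>q\<in>Q. a < q \<and> q < b"
    and conv: "\<And>q. q \<in> Q \<Longrightarrow> (\<lambda>n. g n q) \<longlonglongrightarrow> f q"
    and near0: "\<And>c. c < z \<Longrightarrow> \<exists>e>0. \<forall>\<^sub>F n in sequentially. \<forall>y. \<bar>y\<bar> < e \<longrightarrow> ereal c < g n y"
  shows "epi_conv g f"
proof -
  \<comment> \<open>The dense set as seen from 0: convexity will be used along rays only, because 0
    is the one point where all values are known to agree.\<close>
  have dense': "\<exists>s. s * x \<in> Q \<and> a < s \<and> s < b" if "x \<noteq> 0" "a < b" for x a b :: real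
  proof (cases "x > 0")
    case True
    then have "a * x < b * x" using that by simp
    then obtain q where "q \<in> Q" "a * x < q" "q < b * x" using dense by blast
    then show ?thesis using True that by (intro exI[of _ "q / x"]) (auto simp: field_simps)
  next
    case False
    then have "b * x < a * x" using that by simp
    then obtain q where "q \<in> Q" "b * x < q" "q < a * x" using dense by blast
    then show ?thesis using False that by (intro exI[of _ "q / x"]) (auto simp: field_simps)
  qed
  show ?thesis
  proof (rule epi_conv_localI)
  fix x c e assume fx: "f x < ereal c" and e: "(e::real) > 0"
  show "\<forall>\<^sub>F n in sequentially. \<exists>y. \<bar>y - x\<bar> < e \<and> g n y < ereal c"
  proof (cases "x = 0")
    case True
    then show ?thesis using fx e g0 f0 by (intro always_eventually) (auto intro!: exI[of _ 0])
  next
    case False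
    obtain a where a: "f x \<le> ereal a" "a < c" using ereal_less_dense_real[OF fx] .
    have lim: "((\<lambda>t. t * a + (1 - t) * z) \<longlongrightarrow> 1 * a + (1 - 1) * z) (at_left 1)" "((\<lambda>t. t * x) \<longlongrightarrow> 1 * x) (at_left 1)"
      by (intro tendsto_intros)+
    have "\<forall>\<^sub>F t in at_left 1. t * a + (1 - t) * z < c \<and> \<bar>t * x - x\<bar> < e \<and> t > 0"
      using order_tendstoD(2)[OF lim(1), of c, simplified, OF a(2)] tendstoD[OF lim(2) e]
        eventually_at_left_real[OF zero_less_one]
      by eventually_elim (auto simp: dist_real_def)
    then obtain t0 where t0: "t0 < 1" "\<And>t. t0 < t \<Longrightarrow> t < 1 \<Longrightarrow> t * a + (1 - t) * z < c \<and> \<bar>t * x - x\<bar> < e \<and> t > 0"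
      unfolding eventually_at_left_field by blast
    \<comment> \<open>A point of \<open>Q\<close> just inside \<open>x\<close> on the ray; convexity
      keeps the value of \<open>f\<close> there below \<open>c\<close>, and pointwise convergence
      takes over.\<close>
    obtain s where s: "s * x \<in> Q" "t0 < s" "s < 1" using dense'[OF False t0(1)] by blast
    have "f (s * x + (1 - s) * 0) \<le> ereal (s * a + (1 - s) * z)"
      using s t0(2)[of s] a f0 by (intro convex_efun_le[OF cf]) auto
    also have "\<dots> < ereal c" using t0(2) s by simp
    finally have "f (s * x) < ereal c" by simp
    then have "\<forall>\<^sub>F n in sequentially. g n (s * x) < ereal c" using order_tendstoD(2)[OF conv[OF s(1)]] by blast
    then show ?thesis by eventually_elim (use t0(2) s in blast)
  qed
next
  fix x c assume fx: "ereal c < f x"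
  show "\<exists>e>0. \<forall>\<^sub>F n in sequentially. \<forall>y. \<bar>y - x\<bar> < e \<longrightarrow> ereal c < g n y"
  proof (cases "x = 0")
    case True
    then show ?thesis using near0[of c] fx f0 by simp
  next
    case False
    obtain c' where c': "ereal c < ereal c'" "ereal c' < f x" using fx by (rule ereal_dense_real)
    obtain r where r: "r > 0" "\<And>y. \<bar>y - x\<bar> < r \<Longrightarrow> ereal c' < f y" using lsc_funD[OF lsc c'(2)] by blast
    have lim: "((\<lambda>t. t * c + (1 - t) * z) \<longlongrightarrow> 1 * c + (1 - 1) * z) (at_left 1)" "((\<lambda>t. t * x) \<longlongrightarrow> 1 * x) (at_left 1)"
      by (intro tendsto_intros)+
    have "\<forall>\<^sub>F t in at_left 1. t * c + (1 - t) * z < c' \<and> \<bar>t * x - x\<bar> < r \<and> t > 0"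
      using order_tendstoD(2)[OF lim(1), of c', simplified, OF c'(1)[simplified]] tendstoD[OF lim(2) r(1)]
        eventually_at_left_real[OF zero_less_one]
      by eventually_elim (auto simp: dist_real_def)
    then obtain t0 where t0: "t0 < 1" "\<And>t. t0 < t \<Longrightarrow> t < 1 \<Longrightarrow> t * c + (1 - t) * z < c' \<and> \<bar>t * x - x\<bar> < r \<and> t > 0"
      unfolding eventually_at_left_field by blast
    define t1 where "t1 = max t0 (1/2)"
    have t1: "t1 < 1" "t1 > 0" "t0 \<le> t1" using t0(1) by (auto simp: t1_def)
    obtain s where s: "s * x \<in> Q" "t1 < s" "s < 1" using dense'[OF False t1(1)] by blast
    have "ereal c' < f (s * x)" using r(2) t0(2)[of s] s t1 by auto
    then have ev: "\<forall>\<^sub>F n in sequentially. ereal c' < g n (s * x)" using order_tendstoD(1)[OF conv[OF s(1)]] by blast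
    \<comment> \<open>Keeps \<open>y / x\<close> between \<open>s\<close> and \<open>s / t1\<close>,
      so that the fixed point \<open>s * x\<close> is a combination of 0 and \<open>y\<close> in
      which \<open>y\<close> has a weight between \<open>t1\<close> and 1. A low value at
      \<open>y\<close> would then force a low value at \<open>s * x\<close>.\<close>
    define d where "d = min (1 - s) (s / t1 - 1) * \<bar>x\<bar>"
    have d: "d > 0" using s t1 False by (auto simp: d_def field_simps)
    have "\<forall>\<^sub>F n in sequentially. \<forall>y. \<bar>y - x\<bar> < d \<longrightarrow> ereal c < g n y"
      using ev
    proof eventually_elim
      case (elim n)
      show ?case
      proof (intro allI impI, rule ccontr)
        fix y assume y: "\<bar>y - x\<bar> < d" "\<not> ereal c < g n y"
        define u where "u = y / x"
        have yu: "y = u * x" using False by (simp add: u_def)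
        have "\<bar>y - x\<bar> = \<bar>u - 1\<bar> * \<bar>x\<bar>" by (simp add: yu abs_mult[symmetric] algebra_simps)
        then have "\<bar>u - 1\<bar> < min (1 - s) (s / t1 - 1)" using y(1) False by (simp add: d_def)
        then have u: "s < u" "u < s / t1" by auto
        define t where "t = s / u"
        have u0: "u > 0" using u s t1 by linarith
        have t: "t1 < t" "t < 1" using u s t1 u0 by (auto simp: t_def field_simps)
        have "g n (t * y + (1 - t) * 0) \<le> ereal (t * c + (1 - t) * z)"
          using y(2) t t1 g0 by (intro convex_efun_le[OF cg]) auto
        also have "\<dots> < ereal c'" using t0(2)[of t] t t1 by simp
        also have "t * y + (1 - t) * 0 = s * x" using u0 by (simp add: t_def yu)
        finally show False using elim by simp
      qed
    qed
    then show ?thesis using d by blast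
  qed
qed
qed

text \<open>Monotonicity plays the part of convexity: a value slightly to the left is a lower bound
  for all values to the right, and the shift of the argument is absorbed by the metric, whatever
  value the limit takes at a jump.\<close>

lemma epi_conv_mono_funI:
  assumes "\<And>n. mono (g n)" "mono f"
    and dense: "\<And>a b. a < b \<Longrightarrow> \<exists>q\<in>Q. a < q \<and> q < b"
    and conv: "\<And>q. q \<in> Q \<Longrightarrow> (\<lambda>n. g n q) \<longlonglongrightarrow> (f q :: ereal)"
  shows "epi_conv g f"
  unfolding epi_conv_def
proof (intro conjI ballI allI impI)
  fix y e assume y: "y \<in> epi f" and e: "(e::real) > 0"
  obtain x b where yx: "y = (x, b)" by (cases y)
  obtain q where q: "q \<in> Q" "x - e < q" "q < x" using dense[of "x - e" x] e by auto
  have "f q \<le> f x" using assms(2) q by (auto simp: mono_def)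
  also have "\<dots> \<le> ereal b" using y by (simp add: epi_def yx)
  also have "\<dots> < ereal (b + e/2)" using e by simp
  finally have "\<forall>\<^sub>F n in sequentially. g n q < ereal (b + e/2)" using order_tendstoD(2)[OF conv[OF q(1)]] by blast
  then show "\<forall>\<^sub>F n in sequentially. \<exists>z\<in>epi (g n). box_dist y z < e"
  proof eventually_elim
    case (elim n)
    then show ?case
      using e q by (intro bexI[of _ "(q, b + e/2)"]) (auto simp: epi_def box_dist_def yx)
  qed
next
  fix y assume y: "y \<notin> closure (epi f)"
  obtain x b where yx: "y = (x, b)" by (cases y)
  obtain e where e: "e > 0" "\<And>z. z \<in> epi f \<Longrightarrow> e \<le> box_dist y z" using y closure_box_dist by (meson not_less)
  obtain q where q: "q \<in> Q" "x - e < q" "q < x" using dense[of "x - e" x] e by auto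
  have "ereal (b + e/2) < f q"
  proof (rule ccontr)
    assume "\<not> ereal (b + e/2) < f q"
    then have "e \<le> box_dist y (q, b + e/2)" by (intro e(2)) (auto simp: epi_def)
    then show False using q e(1) by (auto simp: box_dist_def yx)
  qed
  then have ev: "\<forall>\<^sub>F n in sequentially. ereal (b + e/2) < g n q" using order_tendstoD(1)[OF conv[OF q(1)]] by blast
  have "\<forall>\<^sub>F n in sequentially. \<forall>z\<in>epi (g n). min (e/2) (x - q) \<le> box_dist y z"
    using ev
  proof eventually_elim
    case (elim n)
    show ?case
    proof (rule ballI, rule ccontr)
      fix z assume z: "z \<in> epi (g n)" "\<not> min (e/2) (x - q) \<le> box_dist y z"
      obtain x' b' where zz: "z = (x', b')" by (cases z)
      have "q \<le> x'" "b' < b + e/2" using z(2) by (auto simp: zz yx box_dist_def)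
      then have "g n q \<le> g n x'" using assms(1) by (auto simp: mono_def)
      also have "\<dots> \<le> ereal b'" using z(1) by (simp add: zz epi_def)
      also have "\<dots> < ereal (b + e/2)" using \<open>b' < b + e/2\<close> by simp
      finally show False using elim by simp
    qed
  qed
  then show "\<exists>e>0. \<forall>\<^sub>F n in sequentially. \<forall>z\<in>epi (g n). e \<le> box_dist y z"
    using e(1) q by (intro exI[of _ "min (e/2) (x - q)"]) auto
qed

text \<open>Epi-convergence bounds \<open>g n\<close> only somewhere near a given point. Two such
  points, one on each side of \<open>q\<close>, and convexity of \<open>g n\<close> carry the bound
  to \<open>q\<close> itself.\<close>

lemma epi_conv_interior_upper:
  assumes ec: "epi_conv g f" and cg: "\<And>n. convex_efun (g n)" and cf: "convex_efun f"
    and ab: "a < q" "q < b" "f a < \<infinity>" "f b < \<infinity>" and fq: "f q < ereal c"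
  shows "\<forall>\<^sub>F n in sequentially. g n q < ereal c"
proof -
  have near: "\<exists>t0>0. \<forall>t. 0 < t \<and> t < t0 \<longrightarrow> f (q + t * (a - q)) < ereal c'" if fa: "f a < \<infinity>" and fq: "f q < ereal c'" for a c'
  proof -
    obtain A where A: "f a \<le> ereal A" using fa by (metis ereal_dense_real order_less_imp_le)
    obtain c0 where c0: "f q \<le> ereal c0" "c0 < c'" using ereal_less_dense_real[OF fq] .
    have lim: "((\<lambda>t. t * A + (1 - t) * c0) \<longlongrightarrow> 0 * A + (1 - 0) * c0) (at_right 0)"
      by (intro tendsto_intros)
    have "\<forall>\<^sub>F t in at_right 0. t * A + (1 - t) * c0 < c'"
      using order_tendstoD(2)[OF lim, of c'] c0 by auto
    then obtain t1 where t1: "t1 > 0" "\<And>t. 0 < t \<Longrightarrow> t < t1 \<Longrightarrow> t * A + (1 - t) * c0 < c'"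
      unfolding eventually_at_right_field by blast
    have "f (q + t * (a - q)) < ereal c'" if t: "0 < t" "t < min t1 1" for t
    proof -
      have "f (t * a + (1 - t) * q) \<le> ereal (t * A + (1 - t) * c0)"
        by (rule convex_efun_le[OF cf A c0(1)]) (use t in auto)
      also have "\<dots> < ereal c'" using t1(2)[of t] t by simp
      finally show ?thesis by (simp add: algebra_simps)
    qed
    then show ?thesis using t1(1) by (intro exI[of _ "min t1 1"]) auto
  qed
  obtain c1 where c1: "f q < ereal c1" "ereal c1 < ereal c" using fq by (rule ereal_dense_real)
  obtain t1 t2 where t: "t1 > 0" "t2 > 0" "\<And>t. 0 < t \<Longrightarrow> t < t1 \<Longrightarrow> f (q + t * (a - q)) < ereal c1"
    "\<And>t. 0 < t \<Longrightarrow> t < t2 \<Longrightarrow> f (q + t * (b - q)) < ereal c1"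
    using near[OF ab(3) c1(1)] near[OF ab(4) c1(1)] by blast
  define t where "t = min t1 t2 / 2"
  have t': "0 < t" "t < t1" "t < t2" using t(1,2) by (auto simp: t_def)
  define p1 p2 where "p1 = q + t * (a - q)" and "p2 = q + t * (b - q)"
  have p: "p1 < q" "q < p2" "f p1 < ereal c1" "f p2 < ereal c1"
    using t t' ab by (auto simp: p1_def p2_def mult_pos_neg)
  have "\<forall>\<^sub>F n in sequentially. \<exists>y. \<bar>y - p1\<bar> < q - p1 \<and> g n y < ereal c1"
    "\<forall>\<^sub>F n in sequentially. \<exists>y. \<bar>y - p2\<bar> < p2 - q \<and> g n y < ereal c1"
    using p by (auto intro!: epi_conv_upperD[OF ec])
  then show ?thesis
  proof eventually_elim
    case (elim n)
    then obtain y1 y2 where y: "\<bar>y1 - p1\<bar> < q - p1" "g n y1 < ereal c1" "\<bar>y2 - p2\<bar> < p2 - q" "g n y2 < ereal c1" by blast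
    then have yq: "y1 < q" "q < y2" by auto
    define t where "t = (y2 - q) / (y2 - y1)"
    have "0 \<le> t" "t \<le> 1" "t * y1 + (1 - t) * y2 = q"
      using yq by (auto simp: t_def divide_simps) (auto simp: algebra_simps)
    then have "g n q \<le> ereal (t * c1 + (1 - t) * c1)"
      using convex_efun_le[OF cg, of n y1 c1 y2 c1 t] y by auto
    also have "t * c1 + (1 - t) * c1 = c1" by (simp add: algebra_simps)
    finally show ?case using c1 by (metis le_less_trans)
  qed
qed

section \<open>The Legendre transform: continuity and inversion\<close>

lemma legendre_le_iff: "legendre f x \<le> ereal b \<longleftrightarrow> (\<forall>t. ereal (t * x - b) \<le> f t)"
proof -
  have "ereal (t * x) - f t \<le> ereal b \<longleftrightarrow> ereal (t * x - b) \<le> f t" for t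
    by (cases "f t") auto
  then show ?thesis by (simp add: legendre_def SUP_le_iff)
qed

lemma less_legendre_iff: "ereal b < legendre f x \<longleftrightarrow> (\<exists>t. f t < ereal (t * x - b))"
  using legendre_le_iff[of f x b] by (metis not_less)

lemma lsc_legendre: "lsc_fun (legendre f)"
proof (rule lsc_funI)
  fix c x assume c: "c < legendre f x"
  then obtain b where b: "c < ereal b" "ereal b < legendre f x" by (rule ereal_dense_real)
  then obtain t where t: "f t < ereal (t * x - b)" using less_legendre_iff by blast
  then obtain a where a: "f t < ereal a" "ereal a < ereal (t * x - b)" by (rule ereal_dense_real)
  have lim: "((\<lambda>y. t * y - b) \<longlongrightarrow> t * x - b) (at x)" by (intro tendsto_intros)
  have "\<forall>\<^sub>F y in at x. a < t * y - b" using order_tendstoD(1)[OF lim, of a] a by simp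
  then obtain e where e: "e > 0" "\<And>y. y \<noteq> x \<Longrightarrow> \<bar>y - x\<bar> < e \<Longrightarrow> a < t * y - b"
    unfolding eventually_at by (auto simp: dist_real_def)
  have "c < legendre f y" if "\<bar>y - x\<bar> < e" for y
  proof -
    have "ereal a < ereal (t * y - b)" using e(2)[of y] that a by (cases "y = x") auto
    then have "ereal b < legendre f y" using a less_legendre_iff less_trans by blast
    then show ?thesis using b less_trans by blast
  qed
  then show "\<exists>e>0. \<forall>y. \<bar>y - x\<bar> < e \<longrightarrow> c < legendre f y" using e(1) by blast
qed

text \<open>Continuity of the transform under epi-convergence (Wijsman). Lower bounds come from a
  single argument \<open>t\<close>. For upper bounds a slope near \<open>x\<close> has to be found
  whose line, lowered by \<open>B\<close> with \<open>b < B < c\<close>, stays below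
  \<open>g n\<close>.\<close>

lemma epi_conv_legendre:
  assumes ec: "epi_conv g f" and cg: "\<And>n. convex_efun (g n)" and lsc: "lsc_fun f"
    and g0: "\<And>n. g n 0 = 0" and f0: "f 0 = 0"
  shows "epi_conv (\<lambda>n. legendre (g n)) (legendre f)"
proof (rule epi_conv_localI)
  fix x c assume "ereal c < legendre f x"
  then obtain t where t: "f t < ereal (t * x - c)" using less_legendre_iff by blast
  then obtain a where a: "f t < ereal a" "ereal a < ereal (t * x - c)" by (rule ereal_dense_real)
  have lim: "((\<lambda>p. fst p * snd p - c) \<longlongrightarrow> t * x - c) (at (t, x))"
    by (auto intro!: tendsto_eq_intros)
  have "\<forall>\<^sub>F p in at (t, x). a < fst p * snd p - c" using order_tendstoD(1)[OF lim, of a] a by simp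
  then obtain e where e: "e > 0" "\<And>p. p \<noteq> (t, x) \<Longrightarrow> dist p (t, x) < e \<Longrightarrow> a < fst p * snd p - c"
    unfolding eventually_at by auto
  have near: "a < t' * x' - c" if "\<bar>t' - t\<bar> < e / 2" "\<bar>x' - x\<bar> < e / 2" for t' x'
  proof (cases "(t', x') = (t, x)")
    case False
    have "dist (t', x') (t, x) \<le> 2 * box_dist (t', x') (t, x)" by (rule dist_le_box_dist)
    also have "\<dots> < e" using that by (auto simp: box_dist_def)
    finally show ?thesis using e(2)[OF False] by simp
  qed (use a in simp)
  have "\<forall>\<^sub>F n in sequentially. \<exists>t'. \<bar>t' - t\<bar> < e / 2 \<and> g n t' < ereal a"
    by (rule epi_conv_upperD[OF ec a(1)]) (use e in simp)
  then have "\<forall>\<^sub>F n in sequentially. \<forall>y. \<bar>y - x\<bar> < e / 2 \<longrightarrow> ereal c < legendre (g n) y"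
  proof eventually_elim
    case (elim n)
    then obtain t' where t': "\<bar>t' - t\<bar> < e / 2" "g n t' < ereal a" by blast
    show ?case
    proof (intro allI impI)
      fix y assume "\<bar>y - x\<bar> < e / 2"
      then have "ereal a < ereal (t' * y - c)" using near[OF t'(1)] by simp
      then show "ereal c < legendre (g n) y" using t'(2) less_legendre_iff less_trans by blast
    qed
  qed
  then show "\<exists>e>0. \<forall>\<^sub>F n in sequentially. \<forall>y. \<bar>y - x\<bar> < e \<longrightarrow> ereal c < legendre (g n) y"
    using e(1) by (intro exI[of _ "e / 2"]) auto
next
  fix x c e assume lx: "legendre f x < ereal c" and e: "(e::real) > 0"
  obtain b where b: "legendre f x \<le> ereal b" "b < c" using lx by (rule ereal_less_dense_real)
  have fb: "ereal (t * x - b) \<le> f t" for t using b(1) legendre_le_iff by blast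
  have "b \<ge> 0" using fb[of 0] f0 by simp
  define B where "B = (b + c) / 2"
  define eta where "eta = B - b"
  have B: "B > 0" "b < B" "B < c" "eta > 0" using b(2) \<open>b \<ge> 0\<close> by (auto simp: B_def eta_def)
  \<comment> \<open>Chosen so that the slope error \<open>k = B / R\<close>, caused by the part of
    the line outside \<open>[-R, R]\<close>, is below \<open>e\<close>.\<close>
  define R where "R = 2 * B / e + 1"
  have R: "R > 0" "B / R < e" using B e by (auto simp: R_def field_simps add_pos_pos)
  define k where "k = B / R"
  have k: "k > 0" "k < e" "k * R = B" using R B by (auto simp: k_def)
  have "\<exists>d>0. \<forall>\<^sub>F n in sequentially. \<forall>y. \<bar>y - t\<bar> < d \<longrightarrow> ereal (y * x - B) < g n y" for t
  proof -
    have "ereal (t * x - b - eta / 2) < ereal (t * x - b)" using B by simp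
    also note fb[of t]
    finally obtain d where d: "d > 0"
      "\<forall>\<^sub>F n in sequentially. \<forall>y. \<bar>y - t\<bar> < d \<longrightarrow> ereal (t * x - b - eta / 2) < g n y"
      using epi_conv_lowerD[OF ec lsc] by blast
    \<comment> \<open>Within \<open>d'\<close> of \<open>t\<close> the linear term moves by at most
      \<open>eta / 2\<close>.\<close>
    define d' where "d' = min d (eta / 2 / (\<bar>x\<bar> + 1))"
    have d': "d' > 0" "d' \<le> d" using d(1) B by (auto simp: d'_def)
    have le: "y * x - B \<le> t * x - b - eta / 2" if "\<bar>y - t\<bar> < d'" for y
    proof -
      have "\<bar>y - t\<bar> < eta / 2 / (\<bar>x\<bar> + 1)" "0 < \<bar>x\<bar> + 1" using that by (auto simp: d'_def)
      then have "\<bar>y - t\<bar> * (\<bar>x\<bar> + 1) \<le> eta / 2"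
        using pos_less_divide_eq less_imp_le by blast
      moreover have "(y - t) * x \<le> \<bar>y - t\<bar> * (\<bar>x\<bar> + 1)"
      proof -
        have "(y - t) * x \<le> \<bar>y - t\<bar> * \<bar>x\<bar>" by (metis abs_ge_self abs_mult)
        also have "\<dots> \<le> \<bar>y - t\<bar> * (\<bar>x\<bar> + 1)" by (intro mult_left_mono) auto
        finally show ?thesis .
      qed
      ultimately have "(y - t) * x \<le> eta / 2" by (rule order_trans[rotated])
      then show ?thesis by (simp add: eta_def field_simps)
    qed
    have "\<forall>\<^sub>F n in sequentially. \<forall>y. \<bar>y - t\<bar> < d' \<longrightarrow> ereal (y * x - B) < g n y"
      using d(2)
    proof eventually_elim
      case (elim n)
      show ?case
      proof (intro allI impI)
        fix y assume y: "\<bar>y - t\<bar> < d'"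
        have "ereal (y * x - B) \<le> ereal (t * x - b - eta / 2)" using le[OF y] by simp
        also have "\<dots> < g n y" using elim y d' by auto
        finally show "ereal (y * x - B) < g n y" .
      qed
    qed
    then show ?thesis using d'(1) by blast
  qed
  then obtain D where D: "\<And>t. D t > 0"
    "\<And>t. \<forall>\<^sub>F n in sequentially. \<forall>y. \<bar>y - t\<bar> < D t \<longrightarrow> ereal (y * x - B) < g n y" by metis
  have op: "open {y. \<bar>y - t\<bar> < D t}" for t
  proof -
    have "{y. \<bar>y - t\<bar> < D t} = ball t (D t)" by (auto simp: dist_real_def)
    then show ?thesis by simp
  qed
  have "{-R..R} \<subseteq> (\<Union>t\<in>UNIV. {y. \<bar>y - t\<bar> < D t})"
  proof
    fix y :: real
    show "y \<in> (\<Union>t\<in>UNIV. {y. \<bar>y - t\<bar> < D t})" using D(1)[of y] by (intro UN_I[of y]) auto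
  qed
  with compact_Icc op obtain T where T: "finite T" "{-R..R} \<subseteq> (\<Union>t\<in>T. {y. \<bar>y - t\<bar> < D t})"
    by (rule compactE_image)
  have "\<forall>\<^sub>F n in sequentially. \<forall>t\<in>T. \<forall>y. \<bar>y - t\<bar> < D t \<longrightarrow> ereal (y * x - B) < g n y"
    by (rule eventually_ball_finite[OF T(1)]) (use D in blast)
  then show "\<forall>\<^sub>F n in sequentially. \<exists>y. \<bar>y - x\<bar> < e \<and> legendre (g n) y < ereal c"
  proof eventually_elim
    case (elim n)
    define G where "G = g n"
    have cG: "convex_efun G" and G0: "G 0 = 0" using cg g0 by (auto simp: G_def)
    have inner: "ereal (y * x - B) < G y" if "\<bar>y\<bar> \<le> R" for y
    proof -
      have "y \<in> {-R..R}" using that by auto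
      then obtain t where "t \<in> T" "\<bar>y - t\<bar> < D t" using T(2) by blast
      then show ?thesis using elim by (auto simp: G_def)
    qed
    \<comment> \<open>The bound at distance \<open>R\<close> is spread along the ray: since
      \<open>G\<close> is convex and vanishes at 0, the loss beyond \<open>R\<close> grows only like
      \<open>k\<close> times the distance.\<close>
    have outer: "ereal (y * x - \<bar>y\<bar> * k) \<le> G y" if y: "\<bar>y\<bar> > R" for y
    proof (rule ccontr)
      assume "\<not> ereal (y * x - \<bar>y\<bar> * k) \<le> G y"
      then have le: "G y \<le> ereal (y * x - \<bar>y\<bar> * k)" by simp
      define t where "t = R / \<bar>y\<bar>"
      have t: "0 \<le> t" "t \<le> 1" "\<bar>t * y\<bar> = R" using y R by (auto simp: t_def abs_mult)
      have "G (t * y + (1 - t) * 0) \<le> ereal (t * (y * x - \<bar>y\<bar> * k) + (1 - t) * 0)"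
        by (rule convex_efun_le[OF cG le]) (use t G0 in auto)
      also have "t * (y * x - \<bar>y\<bar> * k) + (1 - t) * 0 = (t * y) * x - B"
        using y R k(3) by (auto simp: t_def field_simps)
      finally show False using inner[of "t * y"] t(3) by auto
    qed
    have lower: "ereal (y * x - \<bar>y\<bar> * k - B) \<le> G y" for y
    proof (cases "\<bar>y\<bar> \<le> R")
      case True
      have "ereal (y * x - \<bar>y\<bar> * k - B) \<le> ereal (y * x - B)" using k by simp
      then show ?thesis using inner[OF True] by (meson less_imp_le order_trans)
    next
      case False
      have "ereal (y * x - \<bar>y\<bar> * k - B) \<le> ereal (y * x - \<bar>y\<bar> * k)" using B by simp
      then show ?thesis using outer[of y] False by (meson not_le order_trans)
    qed
    \<comment> \<open>Arguments \<open>t > 0\<close> bound the slope from above by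
      \<open>(r + B) / t\<close>, and \<open>u\<close> is the largest slope allowed by all of them.
      The extra element \<open>x + k\<close> keeps the set nonempty and \<open>u\<close> within
      \<open>k\<close> of \<open>x\<close>.\<close>
    define S where "S = insert (x + k) {(r + B) / t | r t. t > 0 \<and> G t \<le> ereal r}"
    define u where "u = Inf S"
    have S_ge: "x - k \<le> s" if sS: "s \<in> S" for s
    proof -
      consider "s = x + k" | r t where "s = (r + B) / t" "t > 0" "G t \<le> ereal r" using sS unfolding S_def by blast
      then show ?thesis
      proof cases
        case 2
        have "ereal (t * x - \<bar>t\<bar> * k - B) \<le> ereal r" using lower[of t] 2 by (meson order_trans)
        then have "(x - k) * t \<le> r + B" using 2(2) by (simp add: algebra_simps)
        then show ?thesis unfolding 2(1) using 2(2) by (simp add: pos_le_divide_eq)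
      qed (use k in auto)
    qed
    have bdd: "bdd_below S" using S_ge by (rule bdd_belowI)
    have u1: "x - k \<le> u" unfolding u_def using S_ge by (intro cInf_greatest) (auto simp: S_def)
    have u2: "u \<le> x + k" unfolding u_def by (rule cInf_lower[OF _ bdd]) (auto simp: S_def)
    have "legendre G u \<le> ereal B"
      unfolding legendre_le_iff
    proof (intro allI, rule ccontr)
      fix t assume "\<not> ereal (t * u - B) \<le> G t"
      then obtain r where r: "G t \<le> ereal r" "r < t * u - B" using ereal_less_dense_real by (metis not_le)
      consider "t = 0" | "t > 0" | "t < 0" by linarith
      then show False
      proof cases
        case 1
        then show ?thesis using r G0 B by auto
      next
        case 2
        then have "(r + B) / t \<in> S" using r by (auto simp: S_def)
        then have "u \<le> (r + B) / t" unfolding u_def by (rule cInf_lower[OF _ bdd])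
        then show ?thesis using r 2 by (auto simp: field_simps)
      next
        case 3
        have "(r + B) / t \<le> s" if sS: "s \<in> S" for s
        proof -
          consider "s = x + k" | r' t' where "s = (r' + B) / t'" "t' > 0" "G t' \<le> ereal r'" using sS unfolding S_def by blast
          then show ?thesis
          proof cases
            case 1
            have "ereal (t * x - \<bar>t\<bar> * k - B) \<le> ereal r" using lower[of t] r by (meson order_trans)
            then show ?thesis using 3 1 by (auto simp: field_simps)
          next
            case 2
            \<comment> \<open>The weight for which the segment from \<open>t\<close> to
              \<open>t'\<close> passes over 0; there convexity and \<open>G 0 = 0\<close> make the
              bounds from the two sides compatible.\<close>
            define w where "w = - t / (t' - t)"
            have w: "0 \<le> w" "w \<le> 1" "w * t' + (1 - w) * t = 0"
              using 2 3 by (auto simp: w_def divide_simps)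
            have "G 0 \<le> ereal (w * r' + (1 - w) * r)"
              using convex_efun_le[OF cG 2(3) r(1) w(1,2)] w(3) by simp
            then have "0 \<le> w * r' + (1 - w) * r" using G0 by simp
            then have "0 \<le> (w * r' + (1 - w) * r) * (t' - t)" using 2 3 by simp
            also have "\<dots> = (w * (t' - t)) * (r' - r) + r * (t' - t)" by (simp add: algebra_simps)
            also have "w * (t' - t) = - t" using 2 3 by (simp add: w_def)
            finally have "t * r' \<le> t' * r" by (simp add: algebra_simps)
            moreover have "B * t \<le> B * t'" using B 2 3 by simp
            ultimately have "(r' + B) * t \<le> (r + B) * t'" by (simp add: algebra_simps)
            then have "(r' + B) / t' * t \<le> r + B" using 2(2) by (simp add: pos_divide_le_eq)
            then show ?thesis unfolding 2(1) neg_divide_le_eq[OF 3] .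
          qed
        qed
        then have "(r + B) / t \<le> u" unfolding u_def by (intro cInf_greatest) (auto simp: S_def)
        then show ?thesis using r 3 by (auto simp: field_simps)
      qed
    qed
    also have "\<dots> < ereal c" using B by simp
    finally have "legendre (g n) u < ereal c" by (simp add: G_def)
    moreover have "\<bar>u - x\<bar> < e" using u1 u2 k by auto
    ultimately show ?case by blast
  qed
qed

lemma convex_epi: "convex_efun f \<Longrightarrow> convex (epi f)"
  unfolding convex_alt
  using convex_efun_le[of f] by (auto simp: epi_def) (metis add.commute diff_add_cancel)

text \<open>A separating line may be vertical. It is then tilted: a large multiple of it is added to
  some non-vertical minorant, which exists because \<open>f 0\<close> is finite.\<close>

lemma affine_minorant:
  assumes cf: "convex_efun f" and lsc: "lsc_fun f" and f0: "f 0 = 0" and c: "ereal c < f x"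
  obtains s B where "\<And>t. ereal (t * s - B) \<le> f t" "c < x * s - B"
proof -
  have clo: "closed (epi f)" using closed_epi[OF lsc] by (metis closed_closure)
  have sep: "\<exists>a1 a2 b. a2 \<ge> 0 \<and> a1 * x + a2 * c < b \<and> (\<forall>t r. f t \<le> ereal r \<longrightarrow> b < a1 * t + a2 * r)"
    if c: "ereal c < f x" for x c
  proof -
    have "(x, c) \<notin> epi f" using c by (auto simp: epi_def)
    from separating_hyperplane_closed_point[OF convex_epi[OF cf] clo this]
    obtain a b where ab: "inner a (x, c) < b" "\<forall>z\<in>epi f. b < inner a z" by blast
    obtain a1 a2 where a: "a = (a1, a2)" by (cases a)
    have *: "b < a1 * t + a2 * r" if "f t \<le> ereal r" for t r
      using ab(2)[rule_format, of "(t, r)"] that by (simp add: a epi_def)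
    \<comment> \<open>The epigraph contains the vertical ray over 0, along which a negative
      \<open>a2\<close> would send the functional to minus infinity.\<close>
    have "a2 \<ge> 0"
    proof (rule ccontr)
      assume "\<not> a2 \<ge> 0"
      define r where "r = max 0 (b / a2)"
      have "0 \<le> r" by (simp add: r_def)
      then have "b < a2 * r" using *[of 0 r] f0 by simp
      moreover have "a2 * r \<le> b"
        using \<open>\<not> a2 \<ge> 0\<close> by (auto simp: r_def max_def divide_simps mult.commute split: if_splits)
      ultimately show False by simp
    qed
    then show ?thesis using ab(1) * by (auto simp: a)
  qed
  have nv: "\<exists>s B. (\<forall>t. ereal (t * s - B) \<le> f t) \<and> c < x * s - B"
    if a: "a2 > 0" "a1 * x + a2 * c < b" "\<forall>t r. f t \<le> ereal r \<longrightarrow> b < a1 * t + a2 * r" for a1 a2 b x c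
  proof (intro exI conjI allI)
    show "c < x * (- a1 / a2) - (- b / a2)" using a by (simp add: field_simps)
    fix t
    show "ereal (t * (- a1 / a2) - (- b / a2)) \<le> f t"
    proof (rule ccontr)
      assume "\<not> ereal (t * (- a1 / a2) - (- b / a2)) \<le> f t"
      then obtain r where r: "f t \<le> ereal r" "r < t * (- a1 / a2) - (- b / a2)" using ereal_less_dense_real by (metis not_le)
      then have "b < a1 * t + a2 * r" using a by blast
      then show False using r a(1) by (simp add: field_simps)
    qed
  qed
  have "\<exists>s B. (\<forall>t. ereal (t * s - B) \<le> f t) \<and> c < x * s - B"
  proof -
    obtain a1 a2 b where a: "a2 \<ge> 0" "a1 * x + a2 * c < b" "\<forall>t r. f t \<le> ereal r \<longrightarrow> b < a1 * t + a2 * r"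
      using sep[OF c] by blast
    show ?thesis
    proof (cases "a2 > 0")
      case True then show ?thesis using nv a by blast
    next
      case False
      then have a2: "a2 = 0" using a by simp
      \<comment> \<open>A line that separates a point below \<open>(0, 0)\<close> cannot be
        vertical, since \<open>(0, 0)\<close> itself lies in the epigraph.\<close>
      have "ereal (-1) < f 0" using f0 by simp
      then obtain d1 d2 b' where d: "d2 \<ge> 0" "d1 * 0 + d2 * (-1) < b'" "\<forall>t r. f t \<le> ereal r \<longrightarrow> b' < d1 * t + d2 * r"
        using sep by blast
      have "b' < 0" using d(3)[rule_format, of 0 0] f0 by simp
      then have "d2 > 0" using d by (cases "d2 = 0") auto
      then obtain s0 B0 where m: "\<And>t. ereal (t * s0 - B0) \<le> f t" using nv d by blast
      \<comment> \<open>Large enough to lift the minorant above \<open>c\<close> at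
        \<open>x\<close>; on the domain of \<open>f\<close> the added term is nonpositive.\<close>
      define l where "l = max 0 ((c - (x * s0 - B0)) / (b - a1 * x) + 1)"
      have pos: "b - a1 * x > 0" using a a2 by simp
      have l: "l \<ge> 0" by (simp add: l_def)
      have "(c - (x * s0 - B0)) / (b - a1 * x) < l" by (simp add: l_def)
      then have "c - (x * s0 - B0) < l * (b - a1 * x)" using pos by (simp add: pos_divide_less_eq)
      then have 1: "c < x * (s0 - l * a1) - (B0 - l * b)" by (simp add: algebra_simps)
      have 2: "ereal (t * (s0 - l * a1) - (B0 - l * b)) \<le> f t" for t
      proof (rule ccontr)
        assume *: "\<not> ereal (t * (s0 - l * a1) - (B0 - l * b)) \<le> f t"
        then obtain r where r: "f t \<le> ereal r" using ereal_less_dense_real by (metis not_le)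
        have "b < a1 * t" using a(3) r a2 by auto
        then have "l * (b - a1 * t) \<le> 0" using l by (simp add: mult_nonneg_nonpos)
        then have "ereal (t * (s0 - l * a1) - (B0 - l * b)) \<le> ereal (t * s0 - B0)" by (simp add: algebra_simps)
        then show False using * m[of t] by (meson order_trans)
      qed
      show ?thesis using 1 2 by blast
    qed
  qed
  then obtain s B where "\<forall>t. ereal (t * s - B) \<le> f t" "c < x * s - B" by blast
  then show ?thesis using that[of s B] by blast
qed

text \<open>Fenchel--Moreau: an affine minorant that exceeds \<open>c\<close> at \<open>x\<close>
  bounds \<open>legendre f\<close> at its slope, and the second transform turns this bound into a
  value above \<open>c\<close>.\<close>

lemma legendre_legendre:
  assumes cf: "convex_efun f" and lsc: "lsc_fun f" and f0: "f 0 = 0"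
  shows "legendre (legendre f) = f"
proof (rule ext, rule antisym)
  fix x
  show "legendre (legendre f) x \<le> f x"
    unfolding legendre_def[of "legendre f"]
  proof (rule SUP_least)
    fix s
    have "ereal (x * s) - f x \<le> legendre f s" unfolding legendre_def by (rule SUP_upper) simp
    then show "ereal (s * x) - legendre f s \<le> f x"
      by (cases "f x"; cases "legendre f s") (auto simp: algebra_simps)
  qed
  show "f x \<le> legendre (legendre f) x"
  proof (rule ccontr)
    assume "\<not> f x \<le> legendre (legendre f) x"
    then have "legendre (legendre f) x < f x" by simp
    then obtain c where c: "legendre (legendre f) x < ereal c" "ereal c < f x" by (rule ereal_dense_real)
    obtain s B where s: "\<And>t. ereal (t * s - B) \<le> f t" "c < x * s - B"
      by (rule affine_minorant[OF cf lsc f0 c(2)]) blast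
    have "legendre f s \<le> ereal B" using s(1) legendre_le_iff by blast
    also have "\<dots> < ereal (s * x - c)" using s(2) by (simp add: algebra_simps)
    finally have "ereal c < legendre (legendre f) x" using less_legendre_iff by blast
    then show False using c(1) by simp
  qed
qed

section \<open>Relative entropy by duality\<close>

lemma prob_measure_real_iff: "prob_measure_real \<nu> \<longleftrightarrow> real_distribution \<nu>"
  by (auto simp: prob_measure_real_def real_distribution_def real_distribution_axioms_def)

lemma (in real_distribution) integrable_bdd:
  fixes f :: "real \<Rightarrow> real"
  assumes "f \<in> borel_measurable borel" "\<And>x. \<bar>f x\<bar> \<le> B"
  shows "integrable M f"
  by (rule integrable_const_bound[of _ B]) (use assms in auto)

text \<open>The index is discrete, so every family of laws is a measurable kernel. Infinitely many
  components are needed for laws without exponential moments.\<close>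

definition cmix :: "'i pmf \<Rightarrow> ('i \<Rightarrow> real measure) \<Rightarrow> real measure" where
  "cmix p N = measure_pmf p \<bind> N"

lemma cmix_kernel:
  assumes "\<And>i. real_distribution (N i)"
  shows "N \<in> measurable (measure_pmf p) (subprob_algebra borel)"
  using assms by (auto simp: space_subprob_algebra real_distribution_def real_distribution_axioms_def
      intro!: prob_space_imp_subprob_space)

lemma real_distribution_cmix:
  assumes "\<And>i. real_distribution (N i)"
  shows "real_distribution (cmix p N)"
proof -
  have sets: "sets (cmix p N) = sets borel"
    unfolding cmix_def by (rule sets_bind) (use assms in \<open>auto simp: real_distribution_def real_distribution_axioms_def\<close>)
  have "emeasure (cmix p N) UNIV = (\<integral>\<^sup>+i. emeasure (N i) UNIV \<partial>measure_pmf p)"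
    unfolding cmix_def by (rule emeasure_bind[OF _ cmix_kernel]) (use assms in auto)
  also have "\<dots> = (\<integral>\<^sup>+i. 1 \<partial>measure_pmf p)"
    using assms by (intro nn_integral_cong)
      (metis prob_space.emeasure_space_1 real_distribution.axioms(1) real_distribution.space_eq_univ)
  also have "\<dots> = 1" by simp
  finally show ?thesis
    using sets sets_eq_imp_space_eq[OF sets] by (auto simp: real_distribution_def real_distribution_axioms_def intro!: prob_spaceI)
qed

lemma nn_integral_cmix:
  assumes "\<And>i. real_distribution (N i)" "f \<in> borel_measurable borel"
  shows "(\<integral>\<^sup>+x. f x \<partial>cmix p N) = (\<integral>\<^sup>+i. \<integral>\<^sup>+x. f x \<partial>N i \<partial>measure_pmf p)"
  unfolding cmix_def by (rule nn_integral_bind[OF assms(2) cmix_kernel[OF assms(1)]])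

lemma integral_cmix:
  fixes f :: "real \<Rightarrow> real"
  assumes "\<And>i. real_distribution (N i)" "f \<in> borel_measurable borel" "\<And>x. \<bar>f x\<bar> \<le> B"
  shows "(\<integral>x. f x \<partial>cmix p N) = (\<integral>i. \<integral>x. f x \<partial>N i \<partial>measure_pmf p)"
  unfolding cmix_def
proof (rule integral_bind[OF assms(2) _ cmix_kernel[OF assms(1)], where B'=1])
  show "AE i in measure_pmf p. emeasure (N i) (space (N i)) \<le> ennreal 1"
    using assms(1) by (intro always_eventually) (simp add: prob_space.emeasure_space_1 real_distribution.axioms(1))
qed (use assms in \<open>auto intro: measure_pmf.finite_measure_axioms\<close>)

text \<open>An indicator is squeezed between a compact and an open set of nearly the same measure
  and replaced by a Urysohn function; induction over integrable functions does the rest. The bound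
  \<open>B\<close> makes the approximants bounded test functions.\<close>

lemma (in real_distribution) continuous_L1_dense:
  fixes f :: "real \<Rightarrow> real"
  assumes "integrable M f" "e > 0"
  shows "\<exists>g B. continuous_on UNIV g \<and> (\<forall>x. \<bar>g x\<bar> \<le> B) \<and> (\<integral>x. \<bar>f x - g x\<bar> \<partial>M) < e"
  using assms
proof (induction arbitrary: e rule: integrable_induct)
  case (base A c)
  have A: "A \<in> sets borel" using base by simp
  \<comment> \<open>Inner and outer approximation cost \<open>d\<close> each, and the total error
    \<open>2 * d\<close> is multiplied by the absolute value of \<open>c\<close>; the 1 covers
    \<open>c = 0\<close>.\<close>
  define d where "d = e / (2 * (\<bar>c\<bar> + 1))"
  have d: "d > 0" using base by (auto simp: d_def)
  have fin: "emeasure M (space M) \<noteq> \<infinity>" by (simp add: emeasure_space_1)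
  have sM: "sets M = sets borel" by simp
  have "emeasure M A < (emeasure M A) + ennreal d" using d by (simp add: emeasure_eq_measure ennreal_plus[symmetric] ennreal_less_iff del: ennreal_plus)
  then obtain U where U: "A \<subseteq> U" "open U" "emeasure M U < emeasure M A + ennreal d"
    unfolding outer_regular[OF sM fin A] INF_less_iff by auto
  obtain K where K: "K \<subseteq> A" "compact K" "emeasure M A \<le> emeasure M K + ennreal d"
  proof (cases "measure M A < d")
    case True
    then show ?thesis using that[of "{}"] by (auto simp: emeasure_eq_measure ennreal_leI)
  next
    case False
    have "ennreal (measure M A - d) < emeasure M A"
      using False d by (simp add: emeasure_eq_measure ennreal_less_iff)
    then obtain K where "K \<subseteq> A" "compact K" "ennreal (measure M A - d) < emeasure M K"
      unfolding inner_regular[OF sM fin A] less_SUP_iff by auto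
    then show ?thesis using that[of K] False d
      by (auto simp: emeasure_eq_measure ennreal_less_iff ennreal_plus[symmetric] simp del: ennreal_plus intro!: ennreal_leI)
  qed
  have "measure M U < measure M A + d"
    using U(3) d by (simp add: emeasure_eq_measure ennreal_plus[symmetric] ennreal_less_iff del: ennreal_plus)
  moreover have "measure M A \<le> measure M K + d"
    using K(3) d by (simp add: emeasure_eq_measure ennreal_plus[symmetric] del: ennreal_plus)
  ultimately have measures: "measure M U - measure M K \<le> 2 * d" by simp
  have [measurable]: "U \<in> sets borel" "K \<in> sets borel" using U K by (auto intro: borel_open borel_compact)
  have "closed K" "closed (- U)" "K \<inter> (- U) = {}" using K U by (auto intro: compact_imp_closed)
  then obtain g :: "real \<Rightarrow> real" where g: "continuous_on UNIV g" "\<And>x. g x \<in> closed_segment 1 0"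
    "\<And>x. x \<in> K \<Longrightarrow> g x = 1" "\<And>x. x \<in> - U \<Longrightarrow> g x = 0"
    by (rule Urysohn) blast
  have g01: "0 \<le> g x \<and> g x \<le> 1" for x using g(2)[of x] by (auto simp: closed_segment_eq_real_ivl split: if_splits)
  have [measurable]: "g \<in> borel_measurable borel" using g(1) by (rule borel_measurable_continuous_onI)
  have le: "\<bar>indicator A x * c - c * g x\<bar> \<le> \<bar>c\<bar> * indicator (U - K) x" for x
  proof -
    consider "x \<in> K" | "x \<notin> U" | "x \<in> U - K" by blast
    then show ?thesis
    proof cases
      case 3
      have "indicator A x * c - c * g x = c * (indicator A x - g x)" by (simp add: algebra_simps)
      then have "\<bar>indicator A x * c - c * g x\<bar> = \<bar>c\<bar> * \<bar>indicator A x - g x\<bar>" by (simp add: abs_mult)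
      also have "\<dots> \<le> \<bar>c\<bar> * 1"
        by (intro mult_left_mono) (use g01[of x] in \<open>auto simp: indicator_def\<close>)
      finally show ?thesis using 3 by simp
    qed (use g(3,4)[of x] U(1) K(1) in \<open>auto simp: indicator_def\<close>)
  qed
  have cle: "\<bar>indicator A x * c - c * g x\<bar> \<le> \<bar>c\<bar>" for x
    by (rule order_trans[OF le]) (auto simp: indicator_def)
  have "(\<integral>x. \<bar>indicator A x * c - c * g x\<bar> \<partial>M) \<le> (\<integral>x. \<bar>c\<bar> * indicator (U - K) x \<partial>M)"
  proof (rule integral_mono)
    show "integrable M (\<lambda>x. \<bar>indicator A x * c - c * g x\<bar>)"
      by (rule integrable_bdd[of _ "\<bar>c\<bar>"]) (use A cle in auto)
    show "integrable M (\<lambda>x. \<bar>c\<bar> * indicator (U - K) x)"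
      by (rule integrable_bdd[of _ "\<bar>c\<bar>"]) (auto simp: indicator_def)
  qed (rule le)
  also have "\<dots> = \<bar>c\<bar> * measure M (U - K)" by simp
  also have "measure M (U - K) = measure M U - measure M K"
    using U(1) K(1) by (intro finite_measure_Diff) auto
  also have "\<bar>c\<bar> * (measure M U - measure M K) \<le> \<bar>c\<bar> * (2 * d)"
    by (intro mult_left_mono) (use measures d in auto)
  also have "\<bar>c\<bar> * (2 * d) < e" using base(3) by (auto simp: d_def field_simps)
  finally have "(\<integral>x. \<bar>indicator A x * c - c * g x\<bar> \<partial>M) < e" .
  moreover have "\<bar>c * g x\<bar> \<le> \<bar>c\<bar>" for x using g01[of x] by (auto simp: abs_mult intro: mult_left_le)
  moreover have "continuous_on UNIV (\<lambda>x. c * g x)" using g(1) by (intro continuous_intros)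
  ultimately show ?case by (intro exI[of _ "\<lambda>x. c * g x"] exI[of _ "\<bar>c\<bar>"]) simp
next
  case (add f1 f2)
  obtain g1 B1 where g1: "continuous_on UNIV g1" "\<And>x. \<bar>g1 x\<bar> \<le> B1" "(\<integral>x. \<bar>f1 x - g1 x\<bar> \<partial>M) < e/2"
    using add.IH(1)[of "e/2"] add by auto
  obtain g2 B2 where g2: "continuous_on UNIV g2" "\<And>x. \<bar>g2 x\<bar> \<le> B2" "(\<integral>x. \<bar>f2 x - g2 x\<bar> \<partial>M) < e/2"
    using add.IH(2)[of "e/2"] add by auto
  have int: "integrable M g1" "integrable M g2"
    using g1 g2 by (auto intro!: integrable_bdd borel_measurable_continuous_onI)
  have "(\<integral>x. \<bar>f1 x + f2 x - (g1 x + g2 x)\<bar> \<partial>M) \<le> (\<integral>x. \<bar>f1 x - g1 x\<bar> + \<bar>f2 x - g2 x\<bar> \<partial>M)"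
    by (rule integral_mono) (use int add in auto)
  also have "\<dots> = (\<integral>x. \<bar>f1 x - g1 x\<bar> \<partial>M) + (\<integral>x. \<bar>f2 x - g2 x\<bar> \<partial>M)"
    by (rule Bochner_Integration.integral_add) (use int add in auto)
  also have "\<dots> < e" using g1 g2 by simp
  finally show ?case
    using g1(1,2) g2(1,2)
    by (intro exI[of _ "\<lambda>x. g1 x + g2 x"] exI[of _ "B1 + B2"])
       (auto intro!: continuous_intros add_mono intro: order_trans[OF abs_triangle_ineq])
next
  case (lim f s)
  have "(\<lambda>i. \<integral>x. \<bar>f x - s i x\<bar> \<partial>M) \<longlonglongrightarrow> (\<integral>x. 0 \<partial>M)"
  proof (rule integral_dominated_convergence[where w="\<lambda>x. 3 * \<bar>f x\<bar>"])
    show "AE x in M. (\<lambda>i. \<bar>f x - s i x\<bar>) \<longlonglongrightarrow> 0"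
    proof (rule AE_I2)
      fix x assume "x \<in> space M"
      then have "(\<lambda>i. \<bar>f x - s i x\<bar>) \<longlonglongrightarrow> \<bar>f x - f x\<bar>" by (intro tendsto_intros lim)
      then show "(\<lambda>i. \<bar>f x - s i x\<bar>) \<longlonglongrightarrow> 0" by simp
    qed
    show "AE x in M. norm \<bar>f x - s i x\<bar> \<le> 3 * \<bar>f x\<bar>" for i
    proof (rule AE_I2)
      fix x assume "x \<in> space M"
      then show "norm \<bar>f x - s i x\<bar> \<le> 3 * \<bar>f x\<bar>" using lim.hyps(3)[of x i] by auto
    qed
  qed (use lim in auto)
  then have "\<forall>\<^sub>F i in sequentially. (\<integral>x. \<bar>f x - s i x\<bar> \<partial>M) < e/2"
    using lim by (intro order_tendstoD) auto
  then obtain i where i: "(\<integral>x. \<bar>f x - s i x\<bar> \<partial>M) < e/2"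
    using eventually_happens'[OF sequentially_bot] by blast
  obtain g B where g: "continuous_on UNIV g" "\<And>x. \<bar>g x\<bar> \<le> B" "(\<integral>x. \<bar>s i x - g x\<bar> \<partial>M) < e/2"
    using lim.IH[of "e/2" i] lim by auto
  have int: "integrable M g" using g by (auto intro!: integrable_bdd borel_measurable_continuous_onI)
  have "(\<integral>x. \<bar>f x - g x\<bar> \<partial>M) \<le> (\<integral>x. \<bar>f x - s i x\<bar> + \<bar>s i x - g x\<bar> \<partial>M)"
    by (rule integral_mono) (use int lim in auto)
  also have "\<dots> = (\<integral>x. \<bar>f x - s i x\<bar> \<partial>M) + (\<integral>x. \<bar>s i x - g x\<bar> \<partial>M)"
    by (rule Bochner_Integration.integral_add) (use int lim in auto)
  also have "\<dots> < e" using i g by simp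
  finally show ?case using g by blast
qed

text \<open>The Donsker--Varadhan form of \<open>rel_entropy \<nu> \<mu> \<le> s\<close>.\<close>
definition ent_le :: "real measure \<Rightarrow> real measure \<Rightarrow> real \<Rightarrow> bool" where
  "ent_le \<nu> \<mu> s \<longleftrightarrow> (\<forall>\<phi> B. \<phi> \<in> borel_measurable borel \<longrightarrow> (\<forall>x. \<bar>\<phi> x\<bar> \<le> B) \<longrightarrow>
     (\<integral>x. \<phi> x \<partial>\<nu>) \<le> s + ln (\<integral>x. exp (\<phi> x) \<partial>\<mu>))"

lemma ent_leD:
  "ent_le \<nu> \<mu> s \<Longrightarrow> \<phi> \<in> borel_measurable borel \<Longrightarrow> (\<And>x. \<bar>\<phi> x\<bar> \<le> B) \<Longrightarrow>
     (\<integral>x. \<phi> x \<partial>\<nu>) \<le> s + ln (\<integral>x. exp (\<phi> x) \<partial>\<mu>)"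
  by (auto simp: ent_le_def)

lemma ent_le_nonneg: "real_distribution \<mu> \<Longrightarrow> ent_le \<nu> \<mu> s \<Longrightarrow> 0 \<le> s"
  using ent_leD[of \<nu> \<mu> s "\<lambda>_. 0" 0] by (simp add: real_distribution_def prob_space.prob_space)

lemma ent_le_mono: "ent_le \<nu> \<mu> s \<Longrightarrow> s \<le> t \<Longrightarrow> ent_le \<nu> \<mu> t"
  unfolding ent_le_def by (meson add_right_mono order_trans)

lemma (in real_distribution) exp_integral_bounds:
  fixes \<phi> :: "real \<Rightarrow> real"
  assumes "\<phi> \<in> borel_measurable borel" "\<And>x. \<bar>\<phi> x\<bar> \<le> B"
  shows "integrable M (\<lambda>x. exp (\<phi> x))" "exp (- B) \<le> (\<integral>x. exp (\<phi> x) \<partial>M)" "(\<integral>x. exp (\<phi> x) \<partial>M) \<le> exp B"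
proof -
  have b: "- B \<le> \<phi> x \<and> \<phi> x \<le> B" for x using assms(2)[of x] by linarith
  show int: "integrable M (\<lambda>x. exp (\<phi> x))"
    by (rule integrable_bdd[of _ "exp B"]) (use assms b in auto)
  show "exp (- B) \<le> (\<integral>x. exp (\<phi> x) \<partial>M)" by (rule integral_ge_const[OF int]) (use b in auto)
  show "(\<integral>x. exp (\<phi> x) \<partial>M) \<le> exp B" by (rule integral_le_const[OF int]) (use b in auto)
qed

section \<open>Equivalence of relative entropy with its dual form\<close>

lemma exp_lipschitz: "\<lbrakk>x \<le> B; y \<le> (B::real)\<rbrakk> \<Longrightarrow> \<bar>exp x - exp y\<bar> \<le> exp B * \<bar>x - y\<bar>"
proof (induction x y rule: linorder_wlog)
  case (le a b)
  have "exp b * (1 + (a - b)) \<le> exp b * exp (a - b)" by (intro mult_left_mono exp_ge_add_one_self) auto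
  also have "\<dots> = exp a" by (simp add: exp_diff)
  finally have "exp b - exp a \<le> exp b * (b - a)" by (simp add: algebra_simps)
  also have "\<dots> \<le> exp B * (b - a)" using le by (intro mult_right_mono) auto
  finally show ?case using le by auto
qed (auto simp: abs_minus_commute)

text \<open>A measurable \<phi> is approximated in L1 of the average of \<nu> and \<mu>, which
  controls both sides at once at the price of a factor 2. Clipping to \<open>[-B, B]\<close> keeps
  the exponentials uniformly Lipschitz.\<close>

lemma ent_le_contI:
  assumes nu: "real_distribution \<nu>" and mu: "real_distribution \<mu>"
    and cont: "\<And>\<phi> B. continuous_on UNIV \<phi> \<Longrightarrow> (\<And>x. \<bar>\<phi> x\<bar> \<le> B) \<Longrightarrow> (\<integral>x. \<phi> x \<partial>\<nu>) \<le> s + ln (\<integral>x. exp (\<phi> x) \<partial>\<mu>)"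
  shows "ent_le \<nu> \<mu> s"
  unfolding ent_le_def
proof (intro allI impI)
  interpret nu: real_distribution \<nu> by fact
  interpret mu: real_distribution \<mu> by fact
  fix \<phi> :: "real \<Rightarrow> real" and B assume phi[measurable]: "\<phi> \<in> borel_measurable borel" and "\<forall>x. \<bar>\<phi> x\<bar> \<le> B"
  then have B: "\<bar>\<phi> x\<bar> \<le> B" for x by auto
  define N where "N b = (if b then \<nu> else \<mu>)" for b
  have N: "real_distribution (N b)" for b using nu mu by (simp add: N_def)
  define lam where "lam = cmix (bernoulli_pmf (1/2)) N"
  interpret l: real_distribution lam unfolding lam_def by (rule real_distribution_cmix[OF N])
  have approx: "\<exists>g. continuous_on UNIV g \<and> (\<forall>x. \<bar>g x\<bar> \<le> B) \<and> (\<integral>x. \<bar>\<phi> x - g x\<bar> \<partial>\<nu>) \<le> 2 * e \<and> (\<integral>x. \<bar>\<phi> x - g x\<bar> \<partial>\<mu>) \<le> 2 * e"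
    if e: "e > 0" for e :: real
  proof -
    obtain g0 C where g0: "continuous_on UNIV g0" "\<And>x. \<bar>g0 x\<bar> \<le> C" "(\<integral>x. \<bar>\<phi> x - g0 x\<bar> \<partial>lam) < e"
      using l.continuous_L1_dense[OF l.integrable_bdd[OF phi B] e] by blast
    define g where "g x = max (-B) (min B (g0 x))" for x
    have B0: "0 \<le> B" using B[of 0] by simp
    have gb: "\<bar>g x\<bar> \<le> B" for x using B0 by (auto simp: g_def)
    have gc: "continuous_on UNIV g" unfolding g_def using g0(1) by (intro continuous_intros)
    have [measurable]: "g \<in> borel_measurable borel" "g0 \<in> borel_measurable borel"
      using gc g0(1) by (auto intro: borel_measurable_continuous_onI)
    have le: "\<bar>\<phi> x - g x\<bar> \<le> \<bar>\<phi> x - g0 x\<bar>" for x using B[of x] by (auto simp: g_def)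
    have bd: "\<bar>\<phi> x - g x\<bar> \<le> 2 * B" "\<bar>\<phi> x - g0 x\<bar> \<le> B + C" for x using B[of x] gb[of x] g0(2)[of x] by auto
    have "(\<integral>x. \<bar>\<phi> x - g x\<bar> \<partial>lam) \<le> (\<integral>x. \<bar>\<phi> x - g0 x\<bar> \<partial>lam)"
    proof (rule integral_mono)
      show "integrable lam (\<lambda>x. \<bar>\<phi> x - g x\<bar>)" by (rule l.integrable_bdd[of _ "2 * B"]) (use bd in auto)
      show "integrable lam (\<lambda>x. \<bar>\<phi> x - g0 x\<bar>)" by (rule l.integrable_bdd[of _ "B + C"]) (use bd in auto)
    qed (rule le)
    then have "(\<integral>x. \<bar>\<phi> x - g x\<bar> \<partial>lam) < e" using g0(3) by simp
    also have "(\<integral>x. \<bar>\<phi> x - g x\<bar> \<partial>lam) = (\<integral>b. \<integral>x. \<bar>\<phi> x - g x\<bar> \<partial>N b \<partial>measure_pmf (bernoulli_pmf (1/2)))"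
      unfolding lam_def by (rule integral_cmix[OF N, of _ "2 * B"]) (use bd in auto)
    also have "\<dots> = (\<integral>x. \<bar>\<phi> x - g x\<bar> \<partial>\<nu>) / 2 + (\<integral>x. \<bar>\<phi> x - g x\<bar> \<partial>\<mu>) / 2"
      by (subst integral_bernoulli_pmf) (auto simp: N_def)
    finally have "(\<integral>x. \<bar>\<phi> x - g x\<bar> \<partial>\<nu>) / 2 + (\<integral>x. \<bar>\<phi> x - g x\<bar> \<partial>\<mu>) / 2 < e" .
    moreover have "0 \<le> (\<integral>x. \<bar>\<phi> x - g x\<bar> \<partial>\<nu>)" "0 \<le> (\<integral>x. \<bar>\<phi> x - g x\<bar> \<partial>\<mu>)" by auto
    ultimately have "(\<integral>x. \<bar>\<phi> x - g x\<bar> \<partial>\<nu>) \<le> 2 * e" "(\<integral>x. \<bar>\<phi> x - g x\<bar> \<partial>\<mu>) \<le> 2 * e" by linarith+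
    then show ?thesis using gc gb by blast
  qed
  have "\<exists>g. continuous_on UNIV g \<and> (\<forall>x. \<bar>g x\<bar> \<le> B) \<and> (\<integral>x. \<bar>\<phi> x - g x\<bar> \<partial>\<nu>) \<le> 2 * inverse (real (Suc n))
      \<and> (\<integral>x. \<bar>\<phi> x - g x\<bar> \<partial>\<mu>) \<le> 2 * inverse (real (Suc n))" for n
    by (rule approx) simp
  then have "\<forall>n. \<exists>g. continuous_on UNIV g \<and> (\<forall>x. \<bar>g x\<bar> \<le> B) \<and> (\<integral>x. \<bar>\<phi> x - g x\<bar> \<partial>\<nu>) \<le> 2 * inverse (real (Suc n))
      \<and> (\<integral>x. \<bar>\<phi> x - g x\<bar> \<partial>\<mu>) \<le> 2 * inverse (real (Suc n))" by blast
  from choice[OF this] obtain g where g0: "\<forall>n. continuous_on UNIV (g n) \<and> (\<forall>x. \<bar>g n x\<bar> \<le> B) \<and>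
      (\<integral>x. \<bar>\<phi> x - g n x\<bar> \<partial>\<nu>) \<le> 2 * inverse (real (Suc n)) \<and> (\<integral>x. \<bar>\<phi> x - g n x\<bar> \<partial>\<mu>) \<le> 2 * inverse (real (Suc n))" ..
  have g: "continuous_on UNIV (g n)" "\<bar>g n x\<bar> \<le> B" "(\<integral>x. \<bar>\<phi> x - g n x\<bar> \<partial>\<nu>) \<le> 2 * inverse (real (Suc n))"
    "(\<integral>x. \<bar>\<phi> x - g n x\<bar> \<partial>\<mu>) \<le> 2 * inverse (real (Suc n))" for n x
    using spec[OF g0, of n] by blast+
  have gm[measurable]: "g n \<in> borel_measurable borel" for n using g(1) by (rule borel_measurable_continuous_onI)
  have null: "(\<lambda>n. c * inverse (real (Suc n))) \<longlonglongrightarrow> 0" for c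
    using tendsto_mult[OF tendsto_const LIMSEQ_inverse_real_of_nat, of c] by simp
  have l1: "(\<lambda>n. \<integral>x. g n x \<partial>\<nu>) \<longlonglongrightarrow> (\<integral>x. \<phi> x \<partial>\<nu>)"
  proof (rule Lim_null[THEN iffD2], rule Lim_null_comparison[OF _ null[of 2]], rule always_eventually, rule allI)
    fix n
    have "(\<integral>x. g n x \<partial>\<nu>) - (\<integral>x. \<phi> x \<partial>\<nu>) = (\<integral>x. g n x - \<phi> x \<partial>\<nu>)"
      by (rule Bochner_Integration.integral_diff[symmetric]) (use g B in \<open>auto intro!: nu.integrable_bdd\<close>)
    also have "norm \<dots> \<le> (\<integral>x. \<bar>g n x - \<phi> x\<bar> \<partial>\<nu>)" using integral_norm_bound[of \<nu> "\<lambda>x. g n x - \<phi> x"] by simp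
    also have "\<dots> \<le> 2 * inverse (real (Suc n))" using g(3)[of n] by (simp add: abs_minus_commute)
    finally show "norm ((\<integral>x. g n x \<partial>\<nu>) - (\<integral>x. \<phi> x \<partial>\<nu>)) \<le> 2 * inverse (real (Suc n))" .
  qed
  have l2: "(\<lambda>n. \<integral>x. exp (g n x) \<partial>\<mu>) \<longlonglongrightarrow> (\<integral>x. exp (\<phi> x) \<partial>\<mu>)"
  proof (rule Lim_null[THEN iffD2], rule Lim_null_comparison[OF _ null[of "exp B * 2"]], rule always_eventually, rule allI)
    fix n
    have i: "integrable \<mu> (\<lambda>x. exp (g n x))" "integrable \<mu> (\<lambda>x. exp (\<phi> x))"
      using mu.exp_integral_bounds(1)[OF gm g(2)] mu.exp_integral_bounds(1)[OF phi B] .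
    have "(\<integral>x. exp (g n x) \<partial>\<mu>) - (\<integral>x. exp (\<phi> x) \<partial>\<mu>) = (\<integral>x. exp (g n x) - exp (\<phi> x) \<partial>\<mu>)"
      by (rule Bochner_Integration.integral_diff[symmetric]) (use i in auto)
    also have "norm \<dots> \<le> (\<integral>x. \<bar>exp (g n x) - exp (\<phi> x)\<bar> \<partial>\<mu>)" using integral_norm_bound[of \<mu> "\<lambda>x. exp (g n x) - exp (\<phi> x)"] by simp
    also have "\<dots> \<le> (\<integral>x. exp B * \<bar>\<phi> x - g n x\<bar> \<partial>\<mu>)"
    proof (rule integral_mono)
      show "integrable \<mu> (\<lambda>x. exp B * \<bar>\<phi> x - g n x\<bar>)"
        by (intro integrable_mult_right integrable_abs Bochner_Integration.integrable_diff mu.integrable_bdd[OF phi B] mu.integrable_bdd[OF gm g(2)])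
      fix x show "\<bar>exp (g n x) - exp (\<phi> x)\<bar> \<le> exp B * \<bar>\<phi> x - g n x\<bar>"
        using exp_lipschitz[of "g n x" B "\<phi> x"] g(2)[of n x] B[of x] by (auto simp: abs_minus_commute)
    qed (use i in auto)
    also have "\<dots> \<le> exp B * 2 * inverse (real (Suc n))" using g(4)[of n] by (simp add: mult.assoc)
    finally show "norm ((\<integral>x. exp (g n x) \<partial>\<mu>) - (\<integral>x. exp (\<phi> x) \<partial>\<mu>)) \<le> exp B * 2 * inverse (real (Suc n))" .
  qed
  have pos: "(\<integral>x. exp (\<phi> x) \<partial>\<mu>) > 0"
    using mu.exp_integral_bounds(2)[OF phi B] exp_gt_zero[of "-B"] by linarith
  have "(\<lambda>n. s + ln (\<integral>x. exp (g n x) \<partial>\<mu>)) \<longlonglongrightarrow> s + ln (\<integral>x. exp (\<phi> x) \<partial>\<mu>)"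
    using pos by (intro tendsto_intros l2) auto
  with l1 show "(\<integral>x. \<phi> x \<partial>\<nu>) \<le> s + ln (\<integral>x. exp (\<phi> x) \<partial>\<mu>)"
    by (rule LIMSEQ_le) (use cont g in blast)
qed

text \<open>Fenchel--Young for the conjugate pair \<open>t * ln t - t\<close> and
  \<open>exp\<close>. At \<open>t = 0\<close> the value of \<open>ln 0\<close> is multiplied
  away.\<close>

lemma young_entropy: "0 \<le> (t::real) \<Longrightarrow> t * a \<le> t * ln t - t + exp a"
proof (cases "t = 0")
  case False
  assume "0 \<le> t"
  with False have t: "t > 0" by simp
  have "ln (exp a / t) \<le> exp a / t - 1" using t by (intro ln_le_minus_one) auto
  then have "t * (a - ln t) \<le> t * (exp a / t - 1)" using t by (intro mult_left_mono) (auto simp: ln_div)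
  then show ?thesis using t by (simp add: algebra_simps)
qed auto

lemma integral_bound_of_nn_integral:
  assumes "f \<in> borel_measurable M" "\<And>x. 0 \<le> f x" "(\<integral>\<^sup>+x. ennreal (f x) \<partial>M) \<le> ennreal c" "0 \<le> c"
  shows "integrable M f" "(\<integral>x. f x \<partial>M) \<le> c"
proof -
  show "integrable M f"
    by (rule integrableI_nonneg) (use assms in \<open>auto intro: le_less_trans\<close>)
  then have "ennreal (\<integral>x. f x \<partial>M) \<le> ennreal c"
    using assms nn_integral_eq_integral[of M f] by auto
  then show "(\<integral>x. f x \<partial>M) \<le> c" using assms(4) by (simp add: ennreal_le_iff)
qed

text \<open>\<open>t * ln t\<close> is bounded below and the total mass is 1, so the negative part
  is integrable and the difference of the two integrals is never of the form infinity minus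
  infinity.\<close>

lemma rel_entropy_density_le_iff:
  assumes mu: "real_distribution \<mu>" and [measurable]: "h \<in> borel_measurable borel" and h0: "\<And>x. 0 \<le> (h x :: real)"
  shows "enn2ereal (\<integral>\<^sup>+ x. ennreal (h x * ln (h x)) \<partial>\<mu>) - enn2ereal (\<integral>\<^sup>+ x. ennreal (- (h x * ln (h x))) \<partial>\<mu>) \<le> ereal s
    \<longleftrightarrow> integrable \<mu> (\<lambda>x. h x * ln (h x)) \<and> (\<integral>x. h x * ln (h x) \<partial>\<mu>) \<le> s"
proof -
  interpret real_distribution \<mu> by fact
  let ?k = "\<lambda>x. h x * ln (h x)"
  have lb: "- ?k x \<le> 1" for x using young_entropy[OF h0[of x], of 0] h0[of x] by auto
  have neg: "(\<integral>\<^sup>+ x. ennreal (- ?k x) \<partial>\<mu>) \<le> ennreal 1"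
  proof -
    have "(\<integral>\<^sup>+ x. ennreal (- ?k x) \<partial>\<mu>) \<le> (\<integral>\<^sup>+ x. 1 \<partial>\<mu>)" using lb by (intro nn_integral_mono) (auto intro!: ennreal_leI simp: ennreal_1[symmetric] simp del: ennreal_1)
    also have "\<dots> = 1" using emeasure_space_1 by simp
    finally show ?thesis by simp
  qed
  have nneq: "(\<integral>\<^sup>+ x. ennreal (max 0 (g x)) \<partial>\<mu>) = (\<integral>\<^sup>+ x. ennreal (g x) \<partial>\<mu>)" for g :: "real \<Rightarrow> real"
    by (intro nn_integral_cong) (auto simp: max_def ennreal_neg)
  have int_neg: "integrable \<mu> (\<lambda>x. max 0 (- ?k x))"
    by (rule integral_bound_of_nn_integral[of _ _ 1]) (use neg in \<open>auto simp: nneq\<close>)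
  have eqn: "(\<integral>\<^sup>+ x. ennreal (- ?k x) \<partial>\<mu>) = ennreal (\<integral>x. max 0 (- ?k x) \<partial>\<mu>)"
    using nn_integral_eq_integral[OF int_neg] by (simp add: nneq)
  show ?thesis
  proof (cases "integrable \<mu> ?k")
    case True
    then have int_pos: "integrable \<mu> (\<lambda>x. max 0 (?k x))" by (intro integrable_max) auto
    have eqp: "(\<integral>\<^sup>+ x. ennreal (?k x) \<partial>\<mu>) = ennreal (\<integral>x. max 0 (?k x) \<partial>\<mu>)"
      using nn_integral_eq_integral[OF int_pos] by (simp add: nneq)
    have "(\<integral>x. ?k x \<partial>\<mu>) = (\<integral>x. max 0 (?k x) - max 0 (- ?k x) \<partial>\<mu>)"
      by (rule Bochner_Integration.integral_cong) (auto simp: max_def)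
    also have "\<dots> = (\<integral>x. max 0 (?k x) \<partial>\<mu>) - (\<integral>x. max 0 (- ?k x) \<partial>\<mu>)"
      by (rule Bochner_Integration.integral_diff[OF int_pos int_neg])
    finally have e: "(\<integral>x. ?k x \<partial>\<mu>) = \<dots>" .
    have nn: "0 \<le> (\<integral>x. max 0 (?k x) \<partial>\<mu>)" "0 \<le> (\<integral>x. max 0 (- ?k x) \<partial>\<mu>)" by auto
    show ?thesis unfolding eqn eqp using True e nn by (simp add: enn2ereal_ennreal)
  next
    case False
    have "(\<integral>\<^sup>+ x. ennreal (?k x) \<partial>\<mu>) = \<infinity>"
    proof (rule ccontr)
      assume "(\<integral>\<^sup>+ x. ennreal (?k x) \<partial>\<mu>) \<noteq> \<infinity>"
      then have "integrable \<mu> (\<lambda>x. max 0 (?k x))"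
        by (intro integrableI_nonneg) (auto simp: nneq less_top)
      then have "integrable \<mu> (\<lambda>x. max 0 (?k x) - max 0 (- ?k x))" using int_neg by auto
      also have "(\<lambda>x. max 0 (?k x) - max 0 (- ?k x)) = ?k" by (auto simp: max_def fun_eq_iff)
      finally show False using False by simp
    qed
    then show ?thesis using False unfolding eqn by (simp add: enn2ereal_ennreal)
  qed
qed

text \<open>One direction is Fenchel--Young at \<open>\<phi> x - ln Z\<close>. For the other,
  multiples of indicators of null sets force absolute continuity; the truncated logarithm of the
  density is then the optimal test function, up to an error that disappears under Fatou's
  lemma.\<close>

lemma rel_entropy_le_iff:
  assumes nu: "real_distribution \<nu>" and mu: "real_distribution \<mu>"
  shows "rel_entropy \<nu> \<mu> \<le> ereal s \<longleftrightarrow> ent_le \<nu> \<mu> s"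
proof -
  interpret nu: real_distribution \<nu> by fact
  interpret mu: real_distribution \<mu> by fact
  define h where "h = (\<lambda>x. enn2real (RN_deriv \<mu> \<nu> x))"
  have [measurable]: "h \<in> borel_measurable borel"
  proof -
    have "h \<in> borel_measurable \<mu>" unfolding h_def by measurable
    then show ?thesis by (simp cong: measurable_cong_sets)
  qed
  have h0: "0 \<le> h x" for x by (simp add: h_def)
  have dens: "\<nu> = density \<mu> (\<lambda>x. ennreal (h x))" if ac: "absolutely_continuous \<mu> \<nu>"
  proof -
    have "AE x in \<mu>. RN_deriv \<mu> \<nu> x \<noteq> \<infinity>"
      by (rule mu.RN_deriv_finite[OF _ ac]) (auto intro: nu.sigma_finite_measure_axioms)
    then have "density \<mu> (\<lambda>x. ennreal (h x)) = density \<mu> (RN_deriv \<mu> \<nu>)"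
      by (intro density_cong) (auto simp: h_def less_top elim!: eventually_mono)
    also have "\<dots> = \<nu>" by (rule mu.density_RN_deriv[OF ac]) simp
    finally show ?thesis ..
  qed
  have int_h: "integrable \<mu> h \<and> (\<integral>x. h x \<partial>\<mu>) = 1" if ac: "absolutely_continuous \<mu> \<nu>"
  proof -
    have "(\<integral>\<^sup>+x. ennreal (h x) \<partial>\<mu>) = emeasure \<nu> UNIV"
      by (subst dens[OF ac]) (simp add: emeasure_density)
    also have "\<dots> = 1" using nu.emeasure_space_1 by simp
    finally have nn: "(\<integral>\<^sup>+x. ennreal (h x) \<partial>\<mu>) = 1" .
    have i: "integrable \<mu> h" by (rule integrableI_nonneg) (use nn h0 in auto)
    have "ennreal (\<integral>x. h x \<partial>\<mu>) = 1" using nn_integral_eq_integral[OF i] nn h0 by simp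
    then show ?thesis using i by simp
  qed
  have int_dens: "integrable \<mu> (\<lambda>x. h x * \<phi> x) \<and> (\<integral>x. \<phi> x \<partial>\<nu>) = (\<integral>x. h x * \<phi> x \<partial>\<mu>)"
    if ac: "absolutely_continuous \<mu> \<nu>" and [measurable]: "\<phi> \<in> borel_measurable borel" and B: "\<And>x. \<bar>\<phi> x\<bar> \<le> B" for \<phi> :: "real \<Rightarrow> real" and B
  proof -
    have "integrable \<nu> \<phi>" by (rule nu.integrable_bdd[OF that(2) B])
    then have "integrable (density \<mu> (\<lambda>x. ennreal (h x))) \<phi>" using dens[OF ac] by simp
    then have "integrable \<mu> (\<lambda>x. h x *\<^sub>R \<phi> x)" by (subst (asm) integrable_density) (use h0 in auto)
    moreover have "(\<integral>x. \<phi> x \<partial>\<nu>) = (\<integral>x. h x * \<phi> x \<partial>\<mu>)"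
      by (subst dens[OF ac], subst integral_density) (use h0 in auto)
    ultimately show ?thesis by simp
  qed
  have rel: "rel_entropy \<nu> \<mu> \<le> ereal s \<longleftrightarrow> absolutely_continuous \<mu> \<nu> \<and> integrable \<mu> (\<lambda>x. h x * ln (h x)) \<and> (\<integral>x. h x * ln (h x) \<partial>\<mu>) \<le> s"
    using rel_entropy_density_le_iff[OF mu _ h0, where s=s]
    by (auto simp: rel_entropy_def Let_def h_def[symmetric] fun_cong[OF h_def, symmetric])
  show ?thesis
    unfolding rel
  proof (intro iffI conjI)
    assume *: "absolutely_continuous \<mu> \<nu> \<and> integrable \<mu> (\<lambda>x. h x * ln (h x)) \<and> (\<integral>x. h x * ln (h x) \<partial>\<mu>) \<le> s"
    show "ent_le \<nu> \<mu> s"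
      unfolding ent_le_def
    proof (intro allI impI)
      fix \<phi> :: "real \<Rightarrow> real" and B assume [measurable]: "\<phi> \<in> borel_measurable borel" and "\<forall>x. \<bar>\<phi> x\<bar> \<le> B"
      then have B: "\<bar>\<phi> x\<bar> \<le> B" for x by auto
      note eb = mu.exp_integral_bounds[of \<phi>, OF _ B, simplified]
      define Z where "Z = (\<integral>x. exp (\<phi> x) \<partial>\<mu>)"
      have Z: "Z > 0" using eb(2) exp_gt_zero[of "-B"] unfolding Z_def by linarith
      have d: "integrable \<mu> (\<lambda>x. h x * \<phi> x)" "(\<integral>x. \<phi> x \<partial>\<nu>) = (\<integral>x. h x * \<phi> x \<partial>\<mu>)"
        using int_dens[of \<phi> B] * B by auto
      have hh: "integrable \<mu> h" "(\<integral>x. h x \<partial>\<mu>) = 1" using int_h * by auto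
      have "(\<integral>x. h x * \<phi> x - h x * ln Z \<partial>\<mu>) \<le> (\<integral>x. h x * ln (h x) - h x + exp (\<phi> x) / Z \<partial>\<mu>)"
      proof (rule integral_mono)
        show "integrable \<mu> (\<lambda>x. h x * \<phi> x - h x * ln Z)" using d hh by auto
        show "integrable \<mu> (\<lambda>x. h x * ln (h x) - h x + exp (\<phi> x) / Z)" using * hh eb by auto
        fix x
        show "h x * \<phi> x - h x * ln Z \<le> h x * ln (h x) - h x + exp (\<phi> x) / Z"
          using young_entropy[OF h0[of x], of "\<phi> x - ln Z"] Z by (simp add: algebra_simps exp_diff)
      qed
      also have "\<dots> = (\<integral>x. h x * ln (h x) \<partial>\<mu>) - 1 + Z / Z"
        using * hh eb by (simp add: Z_def)
      also have "\<dots> \<le> s" using * Z by simp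
      finally show "(\<integral>x. \<phi> x \<partial>\<nu>) \<le> s + ln (\<integral>x. exp (\<phi> x) \<partial>\<mu>)"
        using d hh by (simp add: Z_def)
    qed
  next
    assume ent: "ent_le \<nu> \<mu> s"
    have s0: "0 \<le> s" by (rule ent_le_nonneg[OF mu ent])
    show ac: "absolutely_continuous \<mu> \<nu>"
      unfolding absolutely_continuous_def
    proof
      fix A assume A: "A \<in> null_sets \<mu>"
      then have Ab[measurable]: "A \<in> sets borel" by (auto dest: null_setsD2)
      \<comment> \<open>On a \<mu>-null set the exponential moment stays 1 for every
        \<open>t\<close>, so a large \<open>t\<close> forces the \<nu>-mass to be 0.\<close>
      have "t * measure \<nu> A \<le> s" if t: "t > 0" for t
      proof -
        have "(\<integral>x. t * indicator A x \<partial>\<nu>) \<le> s + ln (\<integral>x. exp (t * indicator A x) \<partial>\<mu>)"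
          by (rule ent_leD[OF ent, of _ t]) (use t in \<open>auto simp: indicator_def\<close>)
        also have "(\<integral>x. exp (t * indicator A x) \<partial>\<mu>) = (\<integral>x. 1 \<partial>\<mu>)"
        proof (rule integral_cong_AE)
          show "AE x in \<mu>. exp (t * indicator A x) = 1"
            using AE_not_in[OF A] by eventually_elim simp
        qed auto
        finally show ?thesis using mu.prob_space by simp
      qed
      note le = this
      have "measure \<nu> A = 0"
      proof (rule ccontr)
        assume "measure \<nu> A \<noteq> 0"
        then have p: "measure \<nu> A > 0" by (simp add: zero_less_measure_iff)
        then have "(s + 1) / measure \<nu> A * measure \<nu> A \<le> s" using s0 by (intro le) auto
        then show False using p by simp
      qed
      then show "A \<in> null_sets \<nu>" using Ab by (auto simp: null_sets_def nu.emeasure_eq_measure)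
    qed
    have hh: "integrable \<mu> h" "(\<integral>x. h x \<partial>\<mu>) = 1" using int_h[OF ac] by auto
    \<comment> \<open>Clipped on both sides, so that the logarithm is a bounded test function; the
      lower clip adds at most \<open>exp (- real n)\<close> to the integral.\<close>
    define hk where "hk n x = max (exp (- real n)) (min (exp (real n)) (h x))" for n x
    have hk_pos: "hk n x > 0" for n x unfolding hk_def by (meson exp_gt_zero less_max_iff_disj)
    have hk_b: "exp (- real n) \<le> hk n x" "hk n x \<le> exp (real n)" for n x by (auto simp: hk_def)
    have lnb: "\<bar>ln (hk n x)\<bar> \<le> real n" for n x
    proof -
      have "ln (exp (- real n)) \<le> ln (hk n x)" "ln (hk n x) \<le> ln (exp (real n))"
        using hk_b[of n x] hk_pos[of n x] by (subst ln_le_cancel_iff; simp)+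
      then show ?thesis by auto
    qed
    have [measurable]: "hk n \<in> borel_measurable borel" for n unfolding hk_def by measurable
    have bound: "(\<integral>x. h x * ln (hk n x) \<partial>\<mu>) \<le> s + exp (- real n) \<and> integrable \<mu> (\<lambda>x. h x * ln (hk n x))" for n
    proof -
      have d: "integrable \<mu> (\<lambda>x. h x * ln (hk n x))" "(\<integral>x. ln (hk n x) \<partial>\<nu>) = (\<integral>x. h x * ln (hk n x) \<partial>\<mu>)"
        using int_dens[OF ac _ lnb, of n] by auto
      have ihk: "integrable \<mu> (hk n)"
        by (rule mu.integrable_bdd[of _ "exp (real n)"]) (use hk_b[of n] hk_pos[of n] in \<open>auto simp: abs_of_pos\<close>)
      have "(\<integral>x. hk n x \<partial>\<mu>) \<le> (\<integral>x. h x + exp (- real n) \<partial>\<mu>)"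
      proof (rule integral_mono[OF ihk])
        fix x
        have "min (exp (real n)) (h x) \<le> h x + exp (- real n)" by (rule order_trans[OF min.cobounded2]) simp
        moreover have "exp (- real n) \<le> h x + exp (- real n)" using h0[of x] by simp
        ultimately show "hk n x \<le> h x + exp (- real n)" by (simp add: hk_def)
      qed (use hh in auto)
      also have "\<dots> = 1 + exp (- real n)" using hh mu.prob_space by simp
      finally have hk1: "(\<integral>x. hk n x \<partial>\<mu>) \<le> 1 + exp (- real n)" .
      have "exp (- real n) \<le> (\<integral>x. hk n x \<partial>\<mu>)" by (rule mu.integral_ge_const[OF ihk]) (use hk_b in auto)
      then have pos: "0 < (\<integral>x. hk n x \<partial>\<mu>)" using exp_gt_zero[of "- real n"] by linarith
      have "(\<integral>x. ln (hk n x) \<partial>\<nu>) \<le> s + ln (\<integral>x. exp (ln (hk n x)) \<partial>\<mu>)"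
        by (rule ent_leD[OF ent _ lnb]) auto
      also have "(\<integral>x. exp (ln (hk n x)) \<partial>\<mu>) = (\<integral>x. hk n x \<partial>\<mu>)" using hk_pos by simp
      also have "ln (\<integral>x. hk n x \<partial>\<mu>) \<le> (\<integral>x. hk n x \<partial>\<mu>) - 1" by (rule ln_le_minus_one[OF pos])
      finally show ?thesis using d hk1 by simp
    qed
    \<comment> \<open>A lower bound independent of \<open>n\<close>, as Fatou's lemma
      requires.\<close>
    have ge: "0 \<le> h x * ln (hk n x) + 1" for n x
    proof (cases "h x \<ge> 1")
      case True
      then have "1 \<le> min (exp (real n)) (h x)" by simp
      then have "hk n x \<ge> 1" by (simp add: hk_def le_max_iff_disj)
      then show ?thesis using True h0[of x] by simp
    next
      case False
      show ?thesis
      proof (cases "h x = 0")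
        case nz: False
        then have hp: "h x > 0" using h0[of x] by simp
        have "1 \<le> exp (real n)" by simp
        then have "h x \<le> exp (real n)" using False by linarith
        then have "h x \<le> hk n x" by (simp add: hk_def le_max_iff_disj)
        then have "ln (h x) \<le> ln (hk n x)" using hp hk_pos[of n x] by simp
        then have "h x * ln (h x) \<le> h x * ln (hk n x)" using hp by (intro mult_left_mono) auto
        moreover have "0 \<le> h x * ln (h x) - h x + 1" using young_entropy[OF h0[of x], of 0] by simp
        ultimately show ?thesis using hp by linarith
      qed simp
    qed
    have conv: "(\<lambda>n. ennreal (h x * ln (hk n x) + 1)) \<longlonglongrightarrow> ennreal (h x * ln (h x) + 1)" for x
    proof (rule tendsto_eventually)
      show "\<forall>\<^sub>F n in sequentially. ennreal (h x * ln (hk n x) + 1) = ennreal (h x * ln (h x) + 1)"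
      proof (cases "h x = 0")
        case False
        then have hp: "h x > 0" using h0[of x] by simp
        show ?thesis
          using eventually_ge_at_top[of "nat \<lceil>\<bar>ln (h x)\<bar>\<rceil>"]
        proof eventually_elim
          case (elim n)
          then have "\<bar>ln (h x)\<bar> \<le> real n" by linarith
          then have "exp (- real n) \<le> exp (ln (h x))" "exp (ln (h x)) \<le> exp (real n)" by auto
          then have "hk n x = h x" using hp by (auto simp: hk_def)
          then show ?case by simp
        qed
      qed simp
    qed
    have "(\<integral>\<^sup>+x. ennreal (h x * ln (h x) + 1) \<partial>\<mu>) = (\<integral>\<^sup>+x. liminf (\<lambda>n. ennreal (h x * ln (hk n x) + 1)) \<partial>\<mu>)"
      by (intro nn_integral_cong) (metis conv lim_imp_Liminf sequentially_bot)
    also have "\<dots> \<le> liminf (\<lambda>n. \<integral>\<^sup>+x. ennreal (h x * ln (hk n x) + 1) \<partial>\<mu>)"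
      by (rule nn_integral_liminf) simp
    also have "\<dots> \<le> liminf (\<lambda>n. ennreal (s + 1 + exp (- real n)))"
    proof (rule Liminf_mono, rule always_eventually, rule allI)
      fix n
      have i: "integrable \<mu> (\<lambda>x. h x * ln (hk n x) + 1)" using bound[of n] by auto
      have "(\<integral>\<^sup>+x. ennreal (h x * ln (hk n x) + 1) \<partial>\<mu>) = ennreal (\<integral>x. h x * ln (hk n x) + 1 \<partial>\<mu>)"
        by (rule nn_integral_eq_integral[OF i]) (use ge in auto)
      also have "\<dots> \<le> ennreal (s + 1 + exp (- real n))"
        using bound[of n] mu.prob_space by (intro ennreal_leI) simp
      finally show "(\<integral>\<^sup>+x. ennreal (h x * ln (hk n x) + 1) \<partial>\<mu>) \<le> ennreal (s + 1 + exp (- real n))" .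
    qed
    also have "\<dots> = ennreal (s + 1 + 0)"
    proof (rule lim_imp_Liminf[OF sequentially_bot], rule tendsto_ennrealI, intro tendsto_intros)
      show "(\<lambda>n. exp (- real n)) \<longlonglongrightarrow> 0"
        by (rule filterlim_compose[OF exp_at_bot]) (simp add: filterlim_uminus_at_bot filterlim_real_sequentially)
    qed
    finally have nn: "(\<integral>\<^sup>+x. ennreal (h x * ln (h x) + 1) \<partial>\<mu>) \<le> ennreal (s + 1)" by simp
    have ge': "0 \<le> h x * ln (h x) + 1" for x using young_entropy[OF h0[of x], of 0] h0[of x] by simp
    have i: "integrable \<mu> (\<lambda>x. h x * ln (h x) + 1)" "(\<integral>x. h x * ln (h x) + 1 \<partial>\<mu>) \<le> s + 1"
      using integral_bound_of_nn_integral[OF _ ge' nn] s0 by auto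
    have "integrable \<mu> (\<lambda>x. (h x * ln (h x) + 1) - 1)" by (rule Bochner_Integration.integrable_diff[OF i(1)]) simp
    then show ii: "integrable \<mu> (\<lambda>x. h x * ln (h x))" by simp
    show "(\<integral>x. h x * ln (h x) \<partial>\<mu>) \<le> s" using i(2) ii mu.prob_space by simp
  qed
qed

text \<open>Lower semicontinuity of entropy: every inequality with a continuous \<phi> passes to the
  weak limit, and these inequalities imply all others.\<close>

lemma ent_le_weak_conv:
  assumes nu: "\<And>n. real_distribution (\<nu> n)" "real_distribution \<nu>'" and mu: "real_distribution \<mu>"
    and wc: "weak_conv_m \<nu> \<nu>'" and ent: "\<forall>\<^sub>F n in sequentially. ent_le (\<nu> n) \<mu> s"
  shows "ent_le \<nu>' \<mu> s"
proof (rule ent_le_contI[OF nu(2) mu])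
  fix \<phi> :: "real \<Rightarrow> real" and B assume c: "continuous_on UNIV \<phi>" and B: "\<And>x. \<bar>\<phi> x\<bar> \<le> B"
  have "(\<lambda>n. \<integral>x. \<phi> x \<partial>\<nu> n) \<longlonglongrightarrow> (\<integral>x. \<phi> x \<partial>\<nu>')"
    by (rule weak_conv_imp_integral_bdd_continuous_conv[OF nu wc])
       (use c B in \<open>auto simp: continuous_on_eq_continuous_at\<close>)
  then show "(\<integral>x. \<phi> x \<partial>\<nu>') \<le> s + ln (\<integral>x. exp (\<phi> x) \<partial>\<mu>)"
    by (rule tendsto_upperbound)
       (use ent ent_leD[OF _ borel_measurable_continuous_onI[OF c] B] in \<open>auto elim!: eventually_mono\<close>)
qed

text \<open>Jensen's inequality, obtained by integrating \<open>1 + y \<le> exp y\<close> at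
  \<open>y = \<phi> x - ln Z\<close>.\<close>

lemma (in real_distribution) integral_le_ln_exp:
  fixes \<phi> :: "real \<Rightarrow> real"
  assumes "\<phi> \<in> borel_measurable borel" "\<And>x. \<bar>\<phi> x\<bar> \<le> B"
  shows "(\<integral>x. \<phi> x \<partial>M) \<le> ln (\<integral>x. exp (\<phi> x) \<partial>M)"
proof -
  note eb = exp_integral_bounds[OF assms]
  define Z where "Z = (\<integral>x. exp (\<phi> x) \<partial>M)"
  have Z: "Z > 0" using eb(2) exp_gt_zero[of "-B"] unfolding Z_def by linarith
  have i: "integrable M \<phi>" by (rule integrable_bdd[OF assms])
  have "(\<integral>x. \<phi> x - ln Z + 1 \<partial>M) \<le> (\<integral>x. exp (\<phi> x) / Z \<partial>M)"
  proof (rule integral_mono)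
    fix x show "\<phi> x - ln Z + 1 \<le> exp (\<phi> x) / Z"
      using exp_ge_add_one_self[of "\<phi> x - ln Z"] Z by (simp add: exp_diff algebra_simps)
  qed (use i eb in auto)
  also have "\<dots> = 1" using Z by (simp add: Z_def)
  finally show ?thesis using i prob_space by (simp add: Z_def)
qed

section \<open>Entropy of conditioned laws, mixtures and products\<close>

lemma ent_le_refl: "real_distribution \<mu> \<Longrightarrow> ent_le \<mu> \<mu> 0"
  unfolding ent_le_def by (auto intro: real_distribution.integral_le_ln_exp)

lemma real_distribution_uniform_measure:
  assumes "real_distribution \<mu>" "A \<in> sets borel" "measure \<mu> A > 0"
  shows "real_distribution (uniform_measure \<mu> A)"
proof -
  interpret real_distribution \<mu> by fact
  have "prob_space (uniform_measure \<mu> A)"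
    by (rule prob_space_uniform_measure) (use assms in \<open>auto simp: emeasure_eq_measure\<close>)
  then show ?thesis by (auto simp: real_distribution_def real_distribution_axioms_def)
qed

text \<open>Conditioning multiplies integrals of nonnegative functions by at most
  \<open>1 / measure \<mu> A\<close>; Jensen under the conditioned law turns this into the entropy
  bound.\<close>

lemma ent_le_uniform_measure:
  assumes mu: "real_distribution \<mu>" and A[measurable]: "A \<in> sets borel" and p: "measure \<mu> A > 0"
  shows "ent_le (uniform_measure \<mu> A) \<mu> (- ln (measure \<mu> A))"
  unfolding ent_le_def
proof (intro allI impI)
  interpret mu: real_distribution \<mu> by fact
  interpret nu: real_distribution "uniform_measure \<mu> A" by (rule real_distribution_uniform_measure[OF mu A p])
  fix \<phi> :: "real \<Rightarrow> real" and B assume [measurable]: "\<phi> \<in> borel_measurable borel" and "\<forall>x. \<bar>\<phi> x\<bar> \<le> B"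
  then have B: "\<bar>\<phi> x\<bar> \<le> B" for x by auto
  note eb = mu.exp_integral_bounds[of \<phi>, OF _ B, simplified] and eb' = nu.exp_integral_bounds[of \<phi>, OF _ B, simplified]
  have "ennreal (\<integral>x. exp (\<phi> x) \<partial>uniform_measure \<mu> A) = (\<integral>\<^sup>+x. ennreal (exp (\<phi> x)) \<partial>uniform_measure \<mu> A)"
    by (rule nn_integral_eq_integral[symmetric]) (use eb' in auto)
  also have "\<dots> = (\<integral>\<^sup>+x. ennreal (exp (\<phi> x)) * indicator A x \<partial>\<mu>) / emeasure \<mu> A"
    by (rule nn_integral_uniform_measure) auto
  also have "\<dots> \<le> (\<integral>\<^sup>+x. ennreal (exp (\<phi> x)) \<partial>\<mu>) / emeasure \<mu> A"
    by (intro divide_right_mono_ennreal nn_integral_mono) (auto simp: indicator_def)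
  also have "(\<integral>\<^sup>+x. ennreal (exp (\<phi> x)) \<partial>\<mu>) = ennreal (\<integral>x. exp (\<phi> x) \<partial>\<mu>)"
    by (rule nn_integral_eq_integral) (use eb in auto)
  also have "\<dots> / emeasure \<mu> A = ennreal ((\<integral>x. exp (\<phi> x) \<partial>\<mu>) / measure \<mu> A)"
    using p by (simp add: mu.emeasure_eq_measure divide_ennreal)
  finally have le: "(\<integral>x. exp (\<phi> x) \<partial>uniform_measure \<mu> A) \<le> (\<integral>x. exp (\<phi> x) \<partial>\<mu>) / measure \<mu> A"
    using p by (simp add: ennreal_le_iff)
  have pos: "0 < (\<integral>x. exp (\<phi> x) \<partial>\<mu>)" "0 < (\<integral>x. exp (\<phi> x) \<partial>uniform_measure \<mu> A)"
    using eb(2) eb'(2) exp_gt_zero[of "-B"] by linarith+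
  have "(\<integral>x. \<phi> x \<partial>uniform_measure \<mu> A) \<le> ln (\<integral>x. exp (\<phi> x) \<partial>uniform_measure \<mu> A)"
    by (rule nu.integral_le_ln_exp[OF _ B]) simp
  also have "\<dots> \<le> ln ((\<integral>x. exp (\<phi> x) \<partial>\<mu>) / measure \<mu> A)"
    using le pos p by (intro ln_mono) auto
  also have "\<dots> = - ln (measure \<mu> A) + ln (\<integral>x. exp (\<phi> x) \<partial>\<mu>)"
    using pos p by (simp add: ln_div)
  finally show "(\<integral>x. \<phi> x \<partial>uniform_measure \<mu> A) \<le> - ln (measure \<mu> A) + ln (\<integral>x. exp (\<phi> x) \<partial>\<mu>)" .
qed

text \<open>Convexity of entropy, for infinitely many components as well: the dual inequality is
  affine in the law.\<close>

lemma ent_le_cmix: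
  assumes N: "\<And>i. real_distribution (N i)" and ent: "\<And>i. ent_le (N i) \<mu> (s i)" and s: "integrable (measure_pmf p) s"
  shows "ent_le (cmix p N) \<mu> (\<integral>i. s i \<partial>measure_pmf p)"
  unfolding ent_le_def
proof (intro allI impI)
  fix \<phi> :: "real \<Rightarrow> real" and B assume m: "\<phi> \<in> borel_measurable borel" and "\<forall>x. \<bar>\<phi> x\<bar> \<le> B"
  then have B: "\<bar>\<phi> x\<bar> \<le> B" for x by auto
  have "\<bar>\<integral>x. \<phi> x \<partial>N i\<bar> \<le> B" for i
  proof -
    interpret real_distribution "N i" by (rule N)
    have "\<bar>\<integral>x. \<phi> x \<partial>N i\<bar> \<le> (\<integral>x. \<bar>\<phi> x\<bar> \<partial>N i)" by (rule integral_abs_bound)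
    also have "\<dots> \<le> B" by (rule integral_le_const) (use B integrable_bdd[OF m B] in auto)
    finally show ?thesis .
  qed
  then have i: "integrable (measure_pmf p) (\<lambda>i. \<integral>x. \<phi> x \<partial>N i)"
    by (intro measure_pmf.integrable_const_bound[where B=B]) auto
  have "(\<integral>x. \<phi> x \<partial>cmix p N) = (\<integral>i. \<integral>x. \<phi> x \<partial>N i \<partial>measure_pmf p)" by (rule integral_cmix[OF N m B])
  also have "\<dots> \<le> (\<integral>i. s i + ln (\<integral>x. exp (\<phi> x) \<partial>\<mu>) \<partial>measure_pmf p)"
    by (rule integral_mono[OF i]) (use s ent_leD[OF ent m B] in auto)
  also have "\<dots> = (\<integral>i. s i \<partial>measure_pmf p) + ln (\<integral>x. exp (\<phi> x) \<partial>\<mu>)"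
    using s measure_pmf.prob_space by simp
  finally show "(\<integral>x. \<phi> x \<partial>cmix p N) \<le> (\<integral>i. s i \<partial>measure_pmf p) + ln (\<integral>x. exp (\<phi> x) \<partial>\<mu>)" .
qed

text \<open>Truncation at \<open>n\<close> and Fatou's lemma reach unbounded \<psi>. This is how an
  exponential moment under \<mu> becomes an integrability bound under every law of bounded
  entropy.\<close>

lemma ent_le_nn_integral:
  assumes nu: "real_distribution \<nu>" and mu: "real_distribution \<mu>" and ent: "ent_le \<nu> \<mu> s"
    and [measurable]: "\<psi> \<in> borel_measurable borel" and psi0: "\<And>x. 0 \<le> (\<psi> x :: real)"
    and Z: "(\<integral>\<^sup>+x. ennreal (exp (\<psi> x)) \<partial>\<mu>) \<le> ennreal Z"
  shows "(\<integral>\<^sup>+x. ennreal (\<psi> x) \<partial>\<nu>) \<le> ennreal (s + ln Z)"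
proof -
  interpret nu: real_distribution \<nu> by fact
  interpret mu: real_distribution \<mu> by fact
  define f where "f n x = min (\<psi> x) (real n)" for n x
  have [measurable]: "f n \<in> borel_measurable borel" for n unfolding f_def by measurable
  have fb: "\<bar>f n x\<bar> \<le> real n" "0 \<le> f n x" for n x using psi0[of x] by (auto simp: f_def)
  have "(\<integral>\<^sup>+x. ennreal (f n x) \<partial>\<nu>) \<le> ennreal (s + ln Z)" for n
  proof -
    note eb = mu.exp_integral_bounds[of "f n" "real n", OF _ fb(1)]
    have i: "integrable \<mu> (\<lambda>x. exp (f n x))" by (rule eb(1)) simp
    have "ennreal (\<integral>x. exp (f n x) \<partial>\<mu>) = (\<integral>\<^sup>+x. ennreal (exp (f n x)) \<partial>\<mu>)"
      by (rule nn_integral_eq_integral[symmetric, OF i]) simp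
    also have "\<dots> \<le> (\<integral>\<^sup>+x. ennreal (exp (\<psi> x)) \<partial>\<mu>)" by (intro nn_integral_mono ennreal_leI) (simp add: f_def)
    also note Z
    finally have *: "ennreal (\<integral>x. exp (f n x) \<partial>\<mu>) \<le> ennreal Z" .
    have p: "0 < (\<integral>x. exp (f n x) \<partial>\<mu>)" using eb(2) by (rule less_le_trans[OF exp_gt_zero]) simp
    then have le: "(\<integral>x. exp (f n x) \<partial>\<mu>) \<le> Z" using * by (simp add: ennreal_le_iff2)
    have "(\<integral>x. f n x \<partial>\<nu>) \<le> s + ln (\<integral>x. exp (f n x) \<partial>\<mu>)" by (rule ent_leD[OF ent _ fb(1)]) simp
    also have "\<dots> \<le> s + ln Z" using le p by simp
    finally have "ennreal (\<integral>x. f n x \<partial>\<nu>) \<le> ennreal (s + ln Z)" by (rule ennreal_leI)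
    moreover have "integrable \<nu> (f n)" by (rule nu.integrable_bdd[of "f n" "real n"]) (use fb in auto)
    then have "(\<integral>\<^sup>+x. ennreal (f n x) \<partial>\<nu>) = ennreal (\<integral>x. f n x \<partial>\<nu>)"
      by (rule nn_integral_eq_integral) (use fb in auto)
    ultimately show ?thesis by simp
  qed
  note le = this
  have "(\<integral>\<^sup>+x. ennreal (\<psi> x) \<partial>\<nu>) = (\<integral>\<^sup>+x. liminf (\<lambda>n. ennreal (f n x)) \<partial>\<nu>)"
  proof (rule nn_integral_cong)
    fix x
    have "(\<lambda>n. ennreal (f n x)) \<longlonglongrightarrow> ennreal (\<psi> x)"
    proof (rule tendsto_eventually)
      show "\<forall>\<^sub>F n in sequentially. ennreal (f n x) = ennreal (\<psi> x)"
        using eventually_ge_at_top[of "nat \<lceil>\<psi> x\<rceil>"]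
      proof eventually_elim
        case (elim n)
        then have "\<psi> x \<le> real n" by linarith
        then show ?case by (simp add: f_def)
      qed
    qed
    then show "ennreal (\<psi> x) = liminf (\<lambda>n. ennreal (f n x))" by (simp add: lim_imp_Liminf)
  qed
  also have "\<dots> \<le> liminf (\<lambda>n. \<integral>\<^sup>+x. ennreal (f n x) \<partial>\<nu>)" by (rule nn_integral_liminf) simp
  also have "\<dots> \<le> liminf (\<lambda>n. ennreal (s + ln Z))" by (rule Liminf_mono) (use le in auto)
  also have "\<dots> = ennreal (s + ln Z)" by (simp add: Liminf_const)
  finally show ?thesis .
qed

text \<open>Entropy bounds add over independent coordinates. The test function is written
  \<open>ln (u x)\<close> with \<open>u\<close> bounded away from 0, because integrating out one
  coordinate of \<open>u\<close> against \<mu> gives a function of the same kind, to which the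
  induction hypothesis applies.\<close>

lemma ent_le_tensor:
  assumes nu: "real_distribution \<nu>" and mu: "real_distribution \<mu>" and ent: "ent_le \<nu> \<mu> s"
  shows "finite I \<Longrightarrow> u \<in> borel_measurable (Pi\<^sub>M I (\<lambda>_. borel)) \<Longrightarrow> (\<And>x. a \<le> u x \<and> u x \<le> b) \<Longrightarrow> 0 < a \<Longrightarrow>
    (\<integral>x. ln (u x) \<partial>Pi\<^sub>M I (\<lambda>_. \<nu>)) \<le> real (card I) * s + ln (\<integral>x. u x \<partial>Pi\<^sub>M I (\<lambda>_::nat. \<mu>))"
proof (induction I arbitrary: u rule: finite_induct)
  case empty
  have "(\<integral>x. f x \<partial>Pi\<^sub>M {} (\<lambda>_::nat. \<kappa>)) = f (\<lambda>_. undefined)" for f :: "_ \<Rightarrow> real" and \<kappa> :: "real measure"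
    by (simp add: PiM_empty lebesgue_integral_count_space_finite)
  then show ?case by simp
next
  case (insert i I)
  interpret nu: real_distribution \<nu> by fact
  interpret mu: real_distribution \<mu> by fact
  interpret pn: product_prob_space "\<lambda>_::nat. \<nu>" UNIV by standard
  interpret pm: product_prob_space "\<lambda>_::nat. \<mu>" UNIV by standard
  interpret nI: prob_space "Pi\<^sub>M I (\<lambda>_::nat. \<nu>)" by (rule prob_space_PiM) (rule nu.prob_space_axioms)
  interpret mI: prob_space "Pi\<^sub>M I (\<lambda>_::nat. \<mu>)" by (rule prob_space_PiM) (rule mu.prob_space_axioms)
  interpret nJ: prob_space "Pi\<^sub>M (insert i I) (\<lambda>_::nat. \<nu>)" by (rule prob_space_PiM) (rule nu.prob_space_axioms)
  interpret mJ: prob_space "Pi\<^sub>M (insert i I) (\<lambda>_::nat. \<mu>)" by (rule prob_space_PiM) (rule mu.prob_space_axioms)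
  have sN: "sets (Pi\<^sub>M J (\<lambda>_::nat. \<nu>)) = sets (Pi\<^sub>M J (\<lambda>_. borel))"
    and sM: "sets (Pi\<^sub>M J (\<lambda>_::nat. \<mu>)) = sets (Pi\<^sub>M J (\<lambda>_. borel))" for J
    by (intro sets_PiM_cong; simp)+
  note ub = insert.prems(2)[THEN conjunct1] insert.prems(2)[THEN conjunct2]
  have [measurable]: "u \<in> borel_measurable (Pi\<^sub>M (insert i I) (\<lambda>_. borel))" by fact
  have up: "0 < u x" for x using ub(1)[of x] insert.prems(3) by linarith
  have um: "u \<in> borel_measurable (Pi\<^sub>M (insert i I) (\<lambda>_. \<mu>))" "u \<in> borel_measurable (Pi\<^sub>M (insert i I) (\<lambda>_. \<nu>))"
    unfolding measurable_cong_sets[OF sN refl] measurable_cong_sets[OF sM refl] by measurable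
  have lub: "ln a \<le> ln (u x) \<and> ln (u x) \<le> ln b" for x
  proof -
    have "0 < b" using ub[of x] up[of x] by linarith
    then show ?thesis using ub[of x] up[of x] insert.prems(3) by simp
  qed
  define L where "L = \<bar>ln a\<bar> + \<bar>ln b\<bar>"
  have lL: "\<bar>ln (u x)\<bar> \<le> L" for x using lub[of x] unfolding L_def by linarith
  define v where "v x = (\<integral>y. u (x(i:=y)) \<partial>\<mu>)" for x
  have upd: "(\<lambda>(x, y). u (x(i := y))) \<in> borel_measurable (Pi\<^sub>M I (\<lambda>_. borel) \<Otimes>\<^sub>M borel)"
    by measurable
  have upd1: "(\<lambda>y. u (x(i := y))) \<in> borel_measurable borel" if "x \<in> space (Pi\<^sub>M I (\<lambda>_. borel))" for x
    using measurable_compose[OF measurable_Pair1'[OF that] upd] by simp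
  have spc: "space (Pi\<^sub>M I (\<lambda>_. \<nu>)) = space (Pi\<^sub>M I (\<lambda>_. borel))" by (simp add: space_PiM)
  have vm: "v \<in> borel_measurable (Pi\<^sub>M I (\<lambda>_. borel))"
    unfolding v_def
  proof (rule mu.borel_measurable_lebesgue_integral)
    show "(\<lambda>(x, y). u (x(i := y))) \<in> borel_measurable (Pi\<^sub>M I (\<lambda>_. borel) \<Otimes>\<^sub>M \<mu>)"
      using upd by (subst measurable_cong_sets[OF sets_pair_measure_cong[OF refl mu.events_eq_borel] refl])
  qed
  have iu: "integrable \<mu> (\<lambda>y. u (x(i := y)))" if "x \<in> space (Pi\<^sub>M I (\<lambda>_. borel))" for x
    by (rule mu.integrable_const_bound[of _ b]) (use upd1[OF that] ub up in \<open>auto simp: abs_of_pos\<close>)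
  \<comment> \<open>Off the product space the slices of \<open>u\<close> are not known to be
    measurable, and the bounds on \<open>v\<close> are lost there. Clipping restores them everywhere
    and changes nothing on the space.\<close>
  define v' where "v' x = max a (min b (v x))" for x
  have ab: "a \<le> b" using ub[of undefined] by linarith
  have vv: "v' x = v x" if "x \<in> space (Pi\<^sub>M I (\<lambda>_. borel))" for x
  proof -
    have "a \<le> v x" unfolding v_def by (rule mu.integral_ge_const[OF iu[OF that]]) (use ub in auto)
    moreover have "v x \<le> b" unfolding v_def by (rule mu.integral_le_const[OF iu[OF that]]) (use ub in auto)
    ultimately show ?thesis by (simp add: v'_def)
  qed
  have v'm: "v' \<in> borel_measurable (Pi\<^sub>M I (\<lambda>_. borel))" unfolding v'_def using vm by measurable
  have v'b: "a \<le> v' x \<and> v' x \<le> b" for x using ab by (auto simp: v'_def)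
  have lv': "\<bar>ln (v' x)\<bar> \<le> L" for x
  proof -
    have "ln a \<le> ln (v' x)" "ln (v' x) \<le> ln b" using v'b[of x] insert.prems(3) ab by simp_all
    then show ?thesis unfolding L_def by linarith
  qed
  have step: "(\<integral>y. ln (u (x(i := y))) \<partial>\<nu>) \<le> s + ln (v' x)" if x: "x \<in> space (Pi\<^sub>M I (\<lambda>_. borel))" for x
  proof -
    have "(\<integral>y. ln (u (x(i := y))) \<partial>\<nu>) \<le> s + ln (\<integral>y. exp (ln (u (x(i := y)))) \<partial>\<mu>)"
      by (rule ent_leD[OF ent, of _ L]) (use upd1[OF x] lL in auto)
    also have "(\<integral>y. exp (ln (u (x(i := y)))) \<partial>\<mu>) = v x" using up by (simp add: v_def)
    finally show ?thesis unfolding vv[OF x] .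
  qed
  have "(\<integral>x. ln (u x) \<partial>Pi\<^sub>M (insert i I) (\<lambda>_. \<nu>)) = (\<integral>x. (\<integral>y. ln (u (x(i := y))) \<partial>\<nu>) \<partial>Pi\<^sub>M I (\<lambda>_. \<nu>))"
  proof (rule pn.product_integral_insert[OF insert.hyps(1,2)])
    show "integrable (Pi\<^sub>M (insert i I) (\<lambda>_. \<nu>)) (\<lambda>x. ln (u x))"
      by (rule nJ.integrable_const_bound[of _ L]) (use lL um in auto)
  qed
  also have "\<dots> \<le> (\<integral>x. s + ln (v' x) \<partial>Pi\<^sub>M I (\<lambda>_. \<nu>))"
  proof (rule integral_mono)
    show "integrable (Pi\<^sub>M I (\<lambda>_. \<nu>)) (\<lambda>x. s + ln (v' x))"
      by (rule nI.integrable_const_bound[of _ "\<bar>s\<bar> + L"])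
         (use lv' v'm in \<open>auto simp: measurable_cong_sets[OF sN refl] intro!: order_trans[OF abs_triangle_ineq] add_mono\<close>)
    have m: "(\<lambda>x. \<integral>y. ln (u (x(i := y))) \<partial>\<nu>) \<in> borel_measurable (Pi\<^sub>M I (\<lambda>_. borel))"
    proof (rule nu.borel_measurable_lebesgue_integral)
      have "(\<lambda>(x, y). ln (u (x(i := y)))) \<in> borel_measurable (Pi\<^sub>M I (\<lambda>_. borel) \<Otimes>\<^sub>M borel)"
        by measurable
      then show "(\<lambda>(x, y). ln (u (x(i := y)))) \<in> borel_measurable (Pi\<^sub>M I (\<lambda>_. borel) \<Otimes>\<^sub>M \<nu>)"
        by (subst measurable_cong_sets[OF sets_pair_measure_cong[OF refl nu.events_eq_borel] refl])
    qed
    show "integrable (Pi\<^sub>M I (\<lambda>_. \<nu>)) (\<lambda>x. \<integral>y. ln (u (x(i := y))) \<partial>\<nu>)"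
    proof (rule nI.integrable_const_bound[of _ L])
      show "AE x in Pi\<^sub>M I (\<lambda>_. \<nu>). norm (\<integral>y. ln (u (x(i := y))) \<partial>\<nu>) \<le> L"
      proof (rule AE_I2)
        fix x assume "x \<in> space (Pi\<^sub>M I (\<lambda>_. \<nu>))"
        then have x: "x \<in> space (Pi\<^sub>M I (\<lambda>_. borel))" using spc by simp
        have i: "integrable \<nu> (\<lambda>y. ln (u (x(i := y))))"
          by (rule nu.integrable_bdd[of _ L]) (use upd1[OF x] lL in auto)
        have "norm (\<integral>y. ln (u (x(i := y))) \<partial>\<nu>) \<le> (\<integral>y. \<bar>ln (u (x(i := y)))\<bar> \<partial>\<nu>)"
          using integral_abs_bound by simp
        also have "\<dots> \<le> L" by (rule nu.integral_le_const) (use i lL in auto)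
        finally show "norm (\<integral>y. ln (u (x(i := y))) \<partial>\<nu>) \<le> L" .
      qed
    qed (use m in \<open>simp add: measurable_cong_sets[OF sN refl]\<close>)
  qed (use step spc in auto)
  also have "\<dots> = s + (\<integral>x. ln (v' x) \<partial>Pi\<^sub>M I (\<lambda>_. \<nu>))"
  proof -
    have "integrable (Pi\<^sub>M I (\<lambda>_. \<nu>)) (\<lambda>x. ln (v' x))"
      by (rule nI.integrable_const_bound[of _ L]) (use lv' v'm in \<open>auto simp: measurable_cong_sets[OF sN refl]\<close>)
    then show ?thesis using nI.prob_space by simp
  qed
  also have "\<dots> \<le> s + (real (card I) * s + ln (\<integral>x. v' x \<partial>Pi\<^sub>M I (\<lambda>_. \<mu>)))"
    using insert.IH[OF v'm v'b insert.prems(3)] by simp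
  also have "(\<integral>x. v' x \<partial>Pi\<^sub>M I (\<lambda>_. \<mu>)) = (\<integral>x. v x \<partial>Pi\<^sub>M I (\<lambda>_. \<mu>))"
    by (rule Bochner_Integration.integral_cong) (use vv in \<open>auto simp: space_PiM\<close>)
  also have "\<dots> = (\<integral>x. u x \<partial>Pi\<^sub>M (insert i I) (\<lambda>_. \<mu>))"
    unfolding v_def
  proof (rule pm.product_integral_insert[OF insert.hyps(1,2), symmetric])
    show "integrable (Pi\<^sub>M (insert i I) (\<lambda>_. \<mu>)) u"
      by (rule mJ.integrable_const_bound[of _ b]) (use ub up um in \<open>auto simp: abs_of_pos\<close>)
  qed
  also have "s + (real (card I) * s + ln (\<integral>x. u x \<partial>Pi\<^sub>M (insert i I) (\<lambda>_. \<mu>))) =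
      real (card (insert i I)) * s + ln (\<integral>x. u x \<partial>Pi\<^sub>M (insert i I) (\<lambda>_. \<mu>))"
    using insert.hyps by (simp add: algebra_simps)
  finally show ?case .
qed

text \<open>A change of measure without densities: testing with \<open>t\<close> times the indicator
  of \<open>E\<close> bounds from below the \<mu>-probability of an event that is not rare under
  \<nu>.\<close>

lemma ent_le_PiM_measure:
  fixes I :: "nat set"
  assumes nu: "real_distribution \<nu>" and mu: "real_distribution \<mu>" and ent: "ent_le \<nu> \<mu> s" and I: "finite I"
    and E: "E \<in> sets (Pi\<^sub>M I (\<lambda>_. borel))" and q: "measure (Pi\<^sub>M I (\<lambda>_. \<nu>)) E > 0"
  shows "measure (Pi\<^sub>M I (\<lambda>_. \<mu>)) E > 0"
    "- (real (card I) * s + ln 2) / measure (Pi\<^sub>M I (\<lambda>_. \<nu>)) E \<le> ln (measure (Pi\<^sub>M I (\<lambda>_. \<mu>)) E)"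
proof -
  interpret nu: real_distribution \<nu> by fact
  interpret mu: real_distribution \<mu> by fact
  let ?N = "Pi\<^sub>M I (\<lambda>_. \<nu>)" and ?M = "Pi\<^sub>M I (\<lambda>_. \<mu>)"
  interpret nI: prob_space ?N by (rule prob_space_PiM) (rule nu.prob_space_axioms)
  interpret mI: prob_space ?M by (rule prob_space_PiM) (rule mu.prob_space_axioms)
  have "sets ?N = sets (Pi\<^sub>M I (\<lambda>_. borel))" "sets ?M = sets (Pi\<^sub>M I (\<lambda>_. borel))"
    by (intro sets_PiM_cong; simp)+
  then have EN[measurable]: "E \<in> sets ?N" and EM[measurable]: "E \<in> sets ?M" using E by auto
  define p q where "p = measure ?M E" and "q = measure ?N E"
  have key: "t * q \<le> real (card I) * s + ln (1 + (exp t - 1) * p)" if t: "t \<ge> 0" for t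
  proof -
    define u where "u x = 1 + (exp t - 1) * indicator E x" for x
    have "(\<integral>x. ln (u x) \<partial>?N) \<le> real (card I) * s + ln (\<integral>x. u x \<partial>?M)"
    proof (rule ent_le_tensor[OF nu mu ent I, of _ 1 "exp t"])
      show "u \<in> borel_measurable (Pi\<^sub>M I (\<lambda>_. borel))" unfolding u_def using E by measurable
    qed (use t in \<open>auto simp: u_def indicator_def\<close>)
    also have "(\<integral>x. ln (u x) \<partial>?N) = (\<integral>x. t * indicator E x \<partial>?N)"
      by (rule Bochner_Integration.integral_cong) (auto simp: u_def indicator_def)
    also have "\<dots> = t * q" by (simp add: q_def)
    also have "(\<integral>x. u x \<partial>?M) = 1 + (exp t - 1) * p"
    proof -
      have "integrable ?M (\<lambda>x. indicator E x :: real)" by (rule mI.integrable_const_bound[of _ 1]) auto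
      then show ?thesis using mI.prob_space by (simp add: u_def p_def)
    qed
    finally show ?thesis .
  qed
  have qp: "q > 0" using q by (simp add: q_def)
  have s0: "0 \<le> s" by (rule ent_le_nonneg[OF mu ent])
  show p0: "measure ?M E > 0"
  proof (rule ccontr)
    assume "\<not> measure ?M E > 0"
    then have "p = 0" by (simp add: p_def zero_less_measure_iff)
    then have "(real (card I) * s + 1) / q * q \<le> real (card I) * s"
      using key[of "(real (card I) * s + 1) / q"] qp s0 by simp
    then show False using qp by simp
  qed
  have p1: "p \<le> 1" "0 < p" using p0 by (auto simp: p_def)
  \<comment> \<open>At \<open>t = - ln p\<close> the exponential moment is \<open>2 - p\<close>, so
    the logarithm contributes a constant, negligible after division by the sample size.\<close>
  have "- ln p * q \<le> real (card I) * s + ln (1 + (exp (- ln p) - 1) * p)"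
    by (rule key) (use p1 in auto)
  also have "1 + (exp (- ln p) - 1) * p = 2 - p" using p1 by (simp add: exp_minus algebra_simps)
  also have "ln (2 - p) \<le> ln 2" using p1 by simp
  finally have "- ln p * q \<le> real (card I) * s + ln 2" by simp
  then have "- (real (card I) * s + ln 2) / q \<le> ln p" using qp by (simp add: field_simps)
  then show "- (real (card I) * s + ln 2) / measure ?N E \<le> ln (measure ?M E)" by (simp add: p_def q_def)
qed

section \<open>Moment generating functions\<close>

lemma mgf_le_iff: "0 \<le> c \<Longrightarrow> mgf \<nu> \<theta> \<le> ereal c \<longleftrightarrow> (\<integral>\<^sup>+x. ennreal (exp (\<theta> * x)) \<partial>\<nu>) \<le> ennreal c"
  by (metis enn2ereal_ennreal less_eq_ennreal.rep_eq mgf_def)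

lemma mgf_finite_iff: "mgf \<nu> \<theta> < \<infinity> \<longleftrightarrow> (\<integral>\<^sup>+x. ennreal (exp (\<theta> * x)) \<partial>\<nu>) < \<infinity>"
  by (simp add: mgf_def less_ennreal.rep_eq)

lemma mgf_nonneg: "0 \<le> mgf \<nu> \<theta>" by (simp add: mgf_def)

lemma (in real_distribution) mgf_0: "mgf M 0 = 1"
  using emeasure_space_1 by (simp add: mgf_def one_ereal_def[symmetric] one_ennreal.rep_eq)

lemma (in real_distribution) mgf_pos: "0 < mgf M \<theta>"
proof -
  have "(\<integral>\<^sup>+x. ennreal (exp (\<theta> * x)) \<partial>M) \<noteq> 0"
  proof
    assume "(\<integral>\<^sup>+x. ennreal (exp (\<theta> * x)) \<partial>M) = 0"
    then have "AE x in M. ennreal (exp (\<theta> * x)) = 0" using nn_integral_0_iff_AE[of "\<lambda>x. ennreal (exp (\<theta> * x))" M] by simp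
    then have "AE x in M. False" by eventually_elim (simp add: ennreal_eq_0_iff)
    then show False by simp
  qed
  then have "0 < (\<integral>\<^sup>+x. ennreal (exp (\<theta> * x)) \<partial>M)" by (simp add: zero_less_iff_neq_zero)
  then show ?thesis by (simp add: mgf_def less_ennreal.rep_eq zero_ennreal.rep_eq)
qed

lemma (in real_distribution) mgf_eq_integral:
  assumes "mgf M \<theta> < \<infinity>"
  shows "integrable M (\<lambda>x. exp (\<theta> * x))" "mgf M \<theta> = ereal (\<integral>x. exp (\<theta> * x) \<partial>M)" "(\<integral>x. exp (\<theta> * x) \<partial>M) > 0"
proof -
  show i: "integrable M (\<lambda>x. exp (\<theta> * x))"
    by (rule integrableI_nonneg) (use mgf_finite_iff[THEN iffD1, OF assms] in auto)
  show e: "mgf M \<theta> = ereal (\<integral>x. exp (\<theta> * x) \<partial>M)"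
    unfolding mgf_def by (subst nn_integral_eq_integral[OF i]) auto
  show "(\<integral>x. exp (\<theta> * x) \<partial>M) > 0" using mgf_pos[of \<theta>] e by simp
qed

lemma (in real_distribution) mgf_finiteI: "integrable M (\<lambda>x. exp (\<theta> * x)) \<Longrightarrow> mgf M \<theta> < \<infinity>"
  unfolding mgf_finite_iff integrable_iff_bounded by simp

text \<open>Log-convexity (Hoelder), obtained by integrating the convexity inequality of \<open>exp\<close> after normalising.\<close>
lemma (in real_distribution) mgf_log_convex:
  assumes x: "mgf M x = ereal a" and y: "mgf M y = ereal b" and t: "0 \<le> t" "t \<le> 1"
  shows "mgf M (t * x + (1 - t) * y) \<le> ereal (exp (t * ln a + (1 - t) * ln b))"
proof -
  have fx: "integrable M (\<lambda>u. exp (x * u))" "a = (\<integral>u. exp (x * u) \<partial>M)" "a > 0"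
    using mgf_eq_integral[of x] x by auto
  have fy: "integrable M (\<lambda>u. exp (y * u))" "b = (\<integral>u. exp (y * u) \<partial>M)" "b > 0"
    using mgf_eq_integral[of y] y by auto
  define C where "C = exp (t * ln a + (1 - t) * ln b)"
  have le: "exp ((t * x + (1 - t) * y) * u) \<le> C * (t * (exp (x * u) / a) + (1 - t) * (exp (y * u) / b))" for u
  proof -
    have "exp (t * (x * u - ln a) + (1 - t) * (y * u - ln b)) \<le> t * exp (x * u - ln a) + (1 - t) * exp (y * u - ln b)"
      using convex_onD[OF exp_convex, of "1 - t" "x * u - ln a" "y * u - ln b"] t by simp
    then have "C * exp (t * (x * u - ln a) + (1 - t) * (y * u - ln b)) \<le> C * (t * (exp (x * u) / a) + (1 - t) * (exp (y * u) / b))"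
      using fx fy by (intro mult_left_mono) (auto simp: exp_diff C_def)
    also have "C * exp (t * (x * u - ln a) + (1 - t) * (y * u - ln b)) = exp ((t * x + (1 - t) * y) * u)"
      unfolding C_def exp_add[symmetric] by (simp add: algebra_simps)
    finally show ?thesis .
  qed
  let ?R = "\<lambda>u. C * (t * (exp (x * u) / a) + (1 - t) * (exp (y * u) / b))"
  have iR: "integrable M ?R" using fx fy by auto
  have "(\<integral>\<^sup>+u. ennreal (exp ((t * x + (1 - t) * y) * u)) \<partial>M) \<le> (\<integral>\<^sup>+u. ennreal (?R u) \<partial>M)"
    by (intro nn_integral_mono ennreal_leI le)
  also have "\<dots> = ennreal (\<integral>u. ?R u \<partial>M)"
    by (rule nn_integral_eq_integral[OF iR]) (use t fx fy in \<open>auto simp: C_def\<close>)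
  also have "(\<integral>u. ?R u \<partial>M) = C * (t * (a / a) + (1 - t) * (b / b))"
    using fx fy by simp
  also have "\<dots> = C" using fx fy by simp
  finally show ?thesis by (subst mgf_le_iff) (auto simp: C_def)
qed

lemma weighted_am_gm:
  assumes "a > 0" "b > 0" "0 \<le> t" "t \<le> (1::real)"
  shows "exp (t * ln a + (1 - t) * ln b) \<le> t * a + (1 - t) * b"
  using convex_onD[OF exp_convex, of "1 - t" "ln a" "ln b"] assms by simp

lemma (in real_distribution) convex_mgf: "convex_efun (mgf M)"
  unfolding convex_efun_def
proof (intro allI impI)
  fix x y t :: real assume t: "0 < t \<and> t < 1"
  show "mgf M (t * x + (1 - t) * y) \<le> ereal t * mgf M x + ereal (1 - t) * mgf M y"
  proof (cases "mgf M x = \<infinity> \<or> mgf M y = \<infinity>")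
    case True
    then show ?thesis using t mgf_nonneg[of M x] mgf_nonneg[of M y] by auto
  next
    case False
    then obtain a b where ab: "mgf M x = ereal a" "mgf M y = ereal b"
      using mgf_eq_integral(2)[of x] mgf_eq_integral(2)[of y] by (auto simp: less_top[symmetric] top_ereal_def)
    have "a > 0" "b > 0" using mgf_pos[of x] mgf_pos[of y] ab by auto
    have "mgf M (t * x + (1 - t) * y) \<le> ereal (exp (t * ln a + (1 - t) * ln b))"
      by (rule mgf_log_convex[OF ab]) (use t in auto)
    also have "\<dots> \<le> ereal (t * a + (1 - t) * b)"
      using weighted_am_gm[OF \<open>a > 0\<close> \<open>b > 0\<close>, of t] t by simp
    finally show ?thesis using ab by simp
  qed
qed

text \<open>Fatou's lemma along a convergent sequence of arguments.\<close>

lemma (in real_distribution) lsc_mgf: "lsc_fun (mgf M)"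
  unfolding lsc_fun_def
proof
  fix c :: ereal
  show "closed {\<theta>. mgf M \<theta> \<le> c}"
  proof (cases "0 \<le> c")
    case False
    then have "{\<theta>. mgf M \<theta> \<le> c} = {}" using mgf_nonneg by (auto simp: not_le intro: less_le_trans)
    then show ?thesis by simp
  next
    case True
    show ?thesis
      unfolding closed_sequential_limits
    proof (intro allI impI, elim conjE)
      fix s l assume s: "\<forall>n. s n \<in> {\<theta>. mgf M \<theta> \<le> c}" and l: "s \<longlonglongrightarrow> l"
      let ?n = "\<lambda>\<theta>. \<integral>\<^sup>+x. ennreal (exp (\<theta> * x)) \<partial>M"
      have le: "?n (s n) \<le> e2ennreal c" for n
        using s[rule_format, of n] e2ennreal_mono[of "mgf M (s n)" c] by (simp add: mgf_def)
      have "?n l = (\<integral>\<^sup>+x. liminf (\<lambda>n. ennreal (exp (s n * x))) \<partial>M)"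
      proof (rule nn_integral_cong)
        fix x
        have "(\<lambda>n. ennreal (exp (s n * x))) \<longlonglongrightarrow> ennreal (exp (l * x))"
          by (intro tendsto_ennrealI tendsto_intros l)
        then show "ennreal (exp (l * x)) = liminf (\<lambda>n. ennreal (exp (s n * x)))"
          by (rule lim_imp_Liminf[OF sequentially_bot, symmetric])
      qed
      also have "\<dots> \<le> liminf (\<lambda>n. ?n (s n))" by (rule nn_integral_liminf) simp
      also have "\<dots> \<le> liminf (\<lambda>n. e2ennreal c)" by (rule Liminf_mono) (use le in auto)
      also have "\<dots> = e2ennreal c" by (simp add: Liminf_const)
      finally have "mgf M l \<le> enn2ereal (e2ennreal c)" by (simp add: mgf_def less_eq_ennreal.rep_eq)
      then show "l \<in> {\<theta>. mgf M \<theta> \<le> c}" using True by (simp add: enn2ereal_e2ennreal)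
    qed
  qed
qed

section \<open>The function spaces and the maps between them\<close>

lemma XM_iff: "f \<in> XM \<longleftrightarrow> lsc_fun f \<and> convex_efun f \<and> (\<forall>\<theta>. 0 < f \<theta>) \<and> f 0 < \<infinity> \<and>
    (\<exists>\<nu>. real_distribution \<nu> \<and> (\<forall>\<theta>. f \<theta> < \<infinity> \<longrightarrow> f \<theta> = mgf \<nu> \<theta>))"
  by (auto simp: XM_def XMp_def prob_measure_real_iff intro: less_imp_le)

lemma XM_0: "f \<in> XM \<Longrightarrow> f 0 = 1"
  using real_distribution.mgf_0 by (fastforce simp: XM_iff)

lemma mgf_in_XM: "real_distribution \<nu> \<Longrightarrow> mgf \<nu> \<in> XM"
  using real_distribution.lsc_mgf[of \<nu>] real_distribution.convex_mgf[of \<nu>] real_distribution.mgf_pos[of \<nu>]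
    real_distribution.mgf_0[of \<nu>] by (auto simp: XM_iff)

lemma epi_sep_lsc:
  assumes "\<And>f. f \<in> S \<Longrightarrow> lsc_fun f" "\<And>f. f \<in> S \<Longrightarrow> \<exists>x. f x < \<infinity>"
  shows "epi_sep S"
  unfolding epi_sep_def inj_on_def
proof (intro conjI ballI impI)
  fix f assume "f \<in> S"
  then obtain x where "f x < \<infinity>" using assms by blast
  then obtain b where "f x < ereal b" by (rule ereal_dense_real)
  then show "epi f \<noteq> {}" by (auto simp: epi_def intro: less_imp_le)
next
  fix f g assume fg: "f \<in> S" "g \<in> S" "closure (epi f) = closure (epi g)"
  then have "epi f = epi g" using assms(1) by (simp add: closed_epi)
  then have iff: "f x \<le> ereal b \<longleftrightarrow> g x \<le> ereal b" for x b by (auto simp: epi_def set_eq_iff)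
  show "f = g"
  proof (rule ext, rule antisym)
    fix x
    show "f x \<le> g x" using iff[of x] by (meson ereal_dense_real leD less_imp_le not_le)
    show "g x \<le> f x" using iff[of x] by (meson ereal_dense_real leD less_imp_le not_le)
  qed
qed

lemma epi_sep_XM: "epi_sep XM"
  by (rule epi_sep_lsc) (auto simp: XM_iff)

lemma ln_le_iff_le_exp: "0 < x \<Longrightarrow> ln x \<le> c \<longleftrightarrow> x \<le> exp (c::real)"
  using exp_le_cancel_iff[of "ln x" c] by simp

lemma elog_le_iff: "0 < x \<Longrightarrow> elog x \<le> c \<longleftrightarrow> x \<le> eexp c"
  by (cases x; cases c) (auto simp: elog_def eexp_def ln_le_iff_le_exp)

lemma eexp_elog: "0 < x \<Longrightarrow> eexp (elog x) = x"
  by (cases x) (auto simp: elog_def eexp_def)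

lemma less_elog_iff: "0 < x \<Longrightarrow> c < elog x \<longleftrightarrow> eexp c < x"
  using elog_le_iff[of x c] by (simp add: not_le[symmetric])

lemma eexp_less_iff: "eexp x < eexp y \<longleftrightarrow> x < y"
  by (cases x; cases y) (auto simp: eexp_def)

lemma elog_less_iff: "0 < x \<Longrightarrow> elog x < c \<longleftrightarrow> x < eexp c"
  by (metis eexp_elog eexp_less_iff)

text \<open>Log-convexity comes from the law, although \<open>f\<close> agrees with its moment
  generating function on the domain only: convexity of \<open>f\<close> itself puts the intermediate
  point into the domain.\<close>

lemma elog_convex:
  assumes f: "f \<in> XM" shows "convex_efun (elog \<circ> f)"
  unfolding convex_efun_def
proof (intro allI impI)
  fix x y t :: real assume t: "0 < t \<and> t < 1"
  obtain \<nu> where nu: "real_distribution \<nu>" "\<And>\<theta>. f \<theta> < \<infinity> \<Longrightarrow> f \<theta> = mgf \<nu> \<theta>" and pos: "\<And>\<theta>. 0 < f \<theta>" and cf: "convex_efun f"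
    using f by (auto simp: XM_iff)
  interpret real_distribution \<nu> by fact
  show "(elog \<circ> f) (t * x + (1 - t) * y) \<le> ereal t * (elog \<circ> f) x + ereal (1 - t) * (elog \<circ> f) y"
  proof (cases "f x < \<infinity> \<and> f y < \<infinity>")
    case False
    have "elog (f z) \<noteq> - \<infinity>" for z using pos[of z] by (auto simp: elog_def)
    moreover have "elog (f x) = \<infinity> \<or> elog (f y) = \<infinity>" using False by (auto simp: elog_def)
    ultimately show ?thesis using t by (cases "elog (f x)"; cases "elog (f y)") auto
  next
    case True
    then obtain a b where ab: "f x = ereal a" "f y = ereal b" using pos[of x] pos[of y] by (cases "f x"; cases "f y") auto
    have ab0: "a > 0" "b > 0" using pos[of x] pos[of y] ab by auto
    have "f (t * x + (1 - t) * y) \<le> ereal (t * a + (1 - t) * b)"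
      by (rule convex_efun_le[OF cf]) (use ab t in auto)
    then have "f (t * x + (1 - t) * y) < \<infinity>" by (rule le_less_trans) simp
    then have "f (t * x + (1 - t) * y) = mgf \<nu> (t * x + (1 - t) * y)" by (rule nu(2))
    also have "\<dots> \<le> ereal (exp (t * ln a + (1 - t) * ln b))"
      by (rule mgf_log_convex) (use nu(2)[of x] nu(2)[of y] True ab t in auto)
    also have "\<dots> = eexp (ereal (t * ln a + (1 - t) * ln b))" by (simp add: eexp_def)
    finally have "elog (f (t * x + (1 - t) * y)) \<le> ereal (t * ln a + (1 - t) * ln b)"
      using elog_le_iff[OF pos] by blast
    then show ?thesis using ab ab0 by (simp add: elog_def)
  qed
qed

lemma elog_lsc: "f \<in> XM \<Longrightarrow> lsc_fun (elog \<circ> f)"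
  by (auto simp: lsc_fun_def XM_iff elog_le_iff)

lemma elog_XM_0: "f \<in> XM \<Longrightarrow> (elog \<circ> f) 0 = 0"
  by (simp add: XM_0 elog_def)

lemma epi_sep_XLam: "epi_sep XLam"
proof (rule epi_sep_lsc)
  fix f assume "f \<in> XLam"
  then obtain g where g: "g \<in> XM" "f = elog \<circ> g" by (auto simp: XLam_def)
  show "lsc_fun f" unfolding g(2) by (rule elog_lsc[OF g(1)])
  show "\<exists>x. f x < \<infinity>" using elog_XM_0[OF g(1)] unfolding g(2) by (intro exI[of _ 0]) simp
qed

text \<open>\<open>exp\<close> carries levels of the logarithm to levels of the function, so both
  local conditions transfer at the same arguments.\<close>

lemma epi_conv_elog:
  assumes ec: "epi_conv g f" and f: "f \<in> XM" and g: "\<And>n. g n \<in> XM"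
  shows "epi_conv (\<lambda>n. elog \<circ> g n) (elog \<circ> f)"
proof (rule epi_conv_localI)
  have pos: "0 < f x" "0 < g n x" for x n using f g by (auto simp: XM_iff)
  have e: "eexp (ereal c) = ereal (exp c)" for c by (simp add: eexp_def)
  {
    fix x c assume "ereal c < (elog \<circ> f) x"
    then have "ereal (exp c) < f x" using less_elog_iff[OF pos(1)] by (simp add: e)
    then show "\<exists>e>0. \<forall>\<^sub>F n in sequentially. \<forall>y. \<bar>y - x\<bar> < e \<longrightarrow> ereal c < (elog \<circ> g n) y"
      using epi_conv_lowerD[OF ec, of "exp c" x] f less_elog_iff[OF pos(2)] by (auto simp: XM_iff e)
  next
    fix x c e assume "(elog \<circ> f) x < ereal c" and "(0::real) < e"
    then show "\<forall>\<^sub>F n in sequentially. \<exists>y. \<bar>y - x\<bar> < e \<and> (elog \<circ> g n) y < ereal c"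
      using epi_conv_upperD[OF ec, of x "exp c" e] elog_less_iff[OF pos(1)] elog_less_iff[OF pos(2)] by (auto simp: e)
  }
qed

text \<open>The slope of any affine minorant is a point of finiteness.\<close>

lemma legendre_XLam_finite:
  assumes "f \<in> XM" shows "\<exists>x. legendre (elog \<circ> f) x < \<infinity>"
proof -
  have "ereal (-1) < (elog \<circ> f) 0" using elog_XM_0[OF assms] by simp
  then obtain s B where "\<And>t. ereal (t * s - B) \<le> (elog \<circ> f) t"
    by (rule affine_minorant[OF elog_convex[OF assms] elog_lsc[OF assms] elog_XM_0[OF assms]]) blast
  then have "legendre (elog \<circ> f) s \<le> ereal B" using legendre_le_iff by blast
  then have "legendre (elog \<circ> f) s < \<infinity>" by (rule le_less_trans) simp
  then show ?thesis ..
qed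

lemma epi_sep_XI: "epi_sep XI"
proof (rule epi_sep_lsc)
  fix f assume "f \<in> XI"
  then obtain g where g: "g \<in> XM" "f = legendre (elog \<circ> g)" by (auto simp: XI_def XLam_def)
  show "lsc_fun f" unfolding g(2) by (rule lsc_legendre)
  show "\<exists>x. f x < \<infinity>" unfolding g(2) by (rule legendre_XLam_finite[OF g(1)])
qed

lemma epi_conv_XI:
  assumes ec: "epi_conv g f" and f: "f \<in> XM" and g: "\<And>n. g n \<in> XM"
  shows "epi_conv (\<lambda>n. legendre (elog \<circ> g n)) (legendre (elog \<circ> f))"
  by (rule epi_conv_legendre[OF epi_conv_elog[OF assms] elog_convex[OF g] elog_lsc[OF f] elog_XM_0[OF g] elog_XM_0[OF f]])

text \<open>Epi-convergence of convex functions is pointwise except possibly at end points of the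
  limiting domain: lower bounds are local, while upper bounds need finite values on both
  sides.\<close>

lemma epi_conv_pointwise:
  assumes ec: "epi_conv g f" and cg: "\<And>n. convex_efun (g n)" and cf: "convex_efun f" and lsc: "lsc_fun f"
    and q: "f q = \<infinity> \<or> (\<exists>a b. a < q \<and> q < b \<and> f a < \<infinity> \<and> f b < \<infinity>)"
  shows "(\<lambda>n. g n q) \<longlonglongrightarrow> f q"
proof (rule order_tendstoI)
  fix c assume "c < f q"
  then obtain c' where c': "c < ereal c'" "ereal c' < f q" by (rule ereal_dense_real)
  then obtain e where e: "e > 0" "\<forall>\<^sub>F n in sequentially. \<forall>y. \<bar>y - q\<bar> < e \<longrightarrow> ereal c' < g n y"
    using epi_conv_lowerD[OF ec lsc] by blast
  show "\<forall>\<^sub>F n in sequentially. c < g n q"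
    using e(2)
  proof eventually_elim
    case (elim n)
    then have "ereal c' < g n q" using e(1) by simp
    then show ?case using c'(1) by simp
  qed
next
  fix c assume c: "f q < c"
  then obtain c' where c': "f q < ereal c'" "ereal c' < c" by (rule ereal_dense_real)
  have "f q \<noteq> \<infinity>" using c by auto
  then obtain a b where "a < q" "q < b" "f a < \<infinity>" "f b < \<infinity>" using q by blast
  from epi_conv_interior_upper[OF ec cg cf this c'(1)]
  show "\<forall>\<^sub>F n in sequentially. g n q < c" by eventually_elim (use c' in simp)
qed

section \<open>Slopes through the origin\<close>

lemma jfun_pos_le_iff: "0 < t \<Longrightarrow> jfun h t \<le> ereal b \<longleftrightarrow> h t \<le> ereal (b * t)"
  by (cases "h t") (auto simp: jfun_def pos_divide_le_eq)

lemma jfun_neg_ge_iff: "t < 0 \<Longrightarrow> ereal b \<le> jfun h t \<longleftrightarrow> h t \<le> ereal (b * t)"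
  by (cases "h t") (auto simp: jfun_def neg_le_divide_eq)

text \<open>\<open>jfun h x\<close> is the slope of the chord from the origin to the graph of
  \<open>h\<close> over \<open>x\<close>, and such slopes increase for convex \<open>h\<close>. For
  \<open>x < 0 < y\<close> the chord from \<open>x\<close> to \<open>y\<close> has to pass on or
  above the origin.\<close>

lemma jfun_mono_ne:
  assumes ch: "convex_efun h" and h0: "h 0 = 0" and xy: "x < y" "x \<noteq> 0" "y \<noteq> 0"
  shows "jfun h x \<le> jfun h y"
proof (rule ccontr)
  assume "\<not> jfun h x \<le> jfun h y"
  then have "jfun h y < jfun h x" by simp
  then obtain b' where b': "jfun h y < ereal b'" "ereal b' < jfun h x" by (rule ereal_dense_real)
  obtain b where b: "ereal b' < ereal b" "ereal b < jfun h x" using b'(2) by (rule ereal_dense_real)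
  consider "0 < x" | "y < 0" | "x < 0" "0 < y" using xy by linarith
  then show False
  proof cases
    case 1
    then have "h y \<le> ereal (b' * y)" using less_imp_le[OF b'(1)] 1 xy jfun_pos_le_iff[of y h b'] by simp
    then have "h (x / y * y + (1 - x / y) * 0) \<le> ereal (x / y * (b' * y) + (1 - x / y) * 0)"
      using 1 xy h0 by (intro convex_efun_le[OF ch]) auto
    then have "h x \<le> ereal (b' * x)" using 1 xy by (simp add: mult.commute)
    then have "jfun h x \<le> ereal b'" using jfun_pos_le_iff[OF 1] by blast
    then show False using b' by simp
  next
    case 2
    then have "h x \<le> ereal (b * x)" using less_imp_le[OF b(2)] 2 xy jfun_neg_ge_iff[of x b h] by simp
    then have "h (y / x * x + (1 - y / x) * 0) \<le> ereal (y / x * (b * x) + (1 - y / x) * 0)"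
      using 2 xy h0 by (intro convex_efun_le[OF ch]) (auto simp: divide_le_eq zero_le_divide_iff)
    then have "h y \<le> ereal (b * y)" using 2 xy by (simp add: mult.commute)
    then have "ereal b \<le> jfun h y" using jfun_neg_ge_iff[OF 2] by blast
    then have "ereal b < ereal b'" using b'(1) by (rule le_less_trans)
    then show False using b by simp
  next
    case 3
    have hx: "h x \<le> ereal (b * x)" using less_imp_le[OF b(2)] 3 jfun_neg_ge_iff[of x b h] by simp
    have hy: "h y \<le> ereal (b' * y)" using less_imp_le[OF b'(1)] 3 jfun_pos_le_iff[of y h b'] by simp
    define t where "t = y / (y - x)"
    have t: "0 \<le> t" "t \<le> 1" "t * x + (1 - t) * y = 0"
      using 3 by (auto simp: t_def divide_simps algebra_simps)
    have "h 0 \<le> ereal (t * (b * x) + (1 - t) * (b' * y))"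
      using convex_efun_le[OF ch hx hy t(1,2)] t(3) by simp
    then have "0 \<le> t * (b * x) + (1 - t) * (b' * y)" using h0 by simp
    also have "t * (b * x) + (1 - t) * (b' * y) = t * x * (b - b') + b' * (t * x + (1 - t) * y)" by (simp add: algebra_simps)
    also have "\<dots> = t * x * (b - b')" using t(3) by simp
    finally have "0 \<le> t * x * (b - b')" .
    moreover have "0 < t" using 3 by (simp add: t_def)
    then have "t * x < 0" using 3 by (simp add: mult_pos_neg)
    then have "t * x * (b - b') < 0" using b mult_neg_pos[of "t * x" "b - b'"] by simp
    ultimately show False by simp
  qed
qed

text \<open>The lower limit at 0 lies between all slopes on the left and all slopes on the right,
  whether or not these meet.\<close>

lemma jfun_mono:
  assumes ch: "convex_efun h" and h0: "h 0 = 0" shows "mono (jfun h)"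
proof (rule monoI)
  have eq: "jfun h 0 = Liminf (at 0) (jfun h)"
  proof -
    have "Liminf (at 0) (\<lambda>t. h t / ereal t) = Liminf (at 0) (jfun h)"
      by (rule Liminf_eq) (auto simp: jfun_def eventually_at intro!: exI[of _ 1])
    then show ?thesis by (simp add: jfun_def)
  qed
  have right: "jfun h 0 \<le> jfun h y" if "0 < y" for y
  proof -
    have "\<forall>\<^sub>F t in at 0. jfun h t \<le> jfun h y"
      unfolding eventually_at using that by (intro exI[of _ y]) (auto simp: dist_real_def intro!: jfun_mono_ne[OF ch h0])
    then have "Limsup (at 0) (jfun h) \<le> jfun h y" by (rule Limsup_bounded)
    then show ?thesis unfolding eq using Liminf_le_Limsup[of "at (0::real)" "jfun h"] by simp
  qed
  have left: "jfun h x \<le> jfun h 0" if "x < 0" for x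
  proof -
    have "\<forall>\<^sub>F t in at 0. jfun h x \<le> jfun h t"
      unfolding eventually_at using that by (intro exI[of _ "-x"]) (auto simp: dist_real_def intro!: jfun_mono_ne[OF ch h0])
    then show ?thesis unfolding eq by (rule Liminf_bounded)
  qed
  fix x y :: real assume "x \<le> y"
  then consider "x = y" | "x < y" "x \<noteq> 0" "y \<noteq> 0" | "x = 0" "0 < y" | "x < 0" "y = 0" by linarith
  then show "jfun h x \<le> jfun h y"
    by cases (use left right jfun_mono_ne[OF ch h0] in auto)
qed

text \<open>After 0 is cut off, an interval either contains a point where \<open>h\<close> is
  infinite, or has finite values throughout, and then its midpoint has finite neighbours on both
  sides.\<close>

lemma dense_convergence_points:
  fixes a b :: real and h :: "real \<Rightarrow> ereal"
  assumes "a < b"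
  shows "\<exists>q\<in>{q. q \<noteq> 0 \<and> (h q = \<infinity> \<or> (\<exists>a b. a < q \<and> q < b \<and> h a < \<infinity> \<and> h b < \<infinity>))}. a < q \<and> q < b"
proof -
  obtain a' b' where ab: "a \<le> a'" "a' < b'" "b' \<le> b" "\<And>q. a' < q \<Longrightarrow> q < b' \<Longrightarrow> q \<noteq> 0"
  proof (cases "b > 0")
    case True then show ?thesis using that[of "max a 0" b] assms by auto
  next
    case False then show ?thesis using that[of a b] assms by auto
  qed
  show ?thesis
  proof (cases "\<exists>p. a' < p \<and> p < b' \<and> h p = \<infinity>")
    case True
    then obtain p where "a' < p" "p < b'" "h p = \<infinity>" by blast
    then show ?thesis using ab by (intro bexI[of _ p]) auto
  next
    case False
    define q p1 p2 where "q = (a' + b') / 2" and "p1 = (a' + q) / 2" and "p2 = (q + b') / 2"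
    have o: "a' < p1" "p1 < q" "q < p2" "p2 < b'" using ab(2) by (auto simp: q_def p1_def p2_def field_simps)
    then have "h p1 < \<infinity>" "h p2 < \<infinity>" using False by (auto simp: less_top[symmetric] top_ereal_def)
    moreover have "q \<noteq> 0" using ab(4)[of q] o by linarith
    ultimately have "q \<noteq> 0 \<and> (h q = \<infinity> \<or> (\<exists>a b. a < q \<and> q < b \<and> h a < \<infinity> \<and> h b < \<infinity>))" using o by blast
    then show ?thesis using ab o by (intro bexI[of _ q]) auto
  qed
qed

lemma epi_conv_XJ:
  assumes ec: "epi_conv g f" and f: "f \<in> XM" and g: "\<And>n. g n \<in> XM"
  shows "epi_conv (\<lambda>n. jfun (elog \<circ> g n)) (jfun (elog \<circ> f))"
proof (rule epi_conv_mono_funI[OF _ _ dense_convergence_points])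
  show "mono (jfun (elog \<circ> g n))" for n by (rule jfun_mono[OF elog_convex[OF g] elog_XM_0[OF g]])
  show "mono (jfun (elog \<circ> f))" by (rule jfun_mono[OF elog_convex[OF f] elog_XM_0[OF f]])
  fix q assume q: "q \<in> {q. q \<noteq> 0 \<and> ((elog \<circ> f) q = \<infinity> \<or> (\<exists>a b. a < q \<and> q < b \<and> (elog \<circ> f) a < \<infinity> \<and> (elog \<circ> f) b < \<infinity>))}"
  have "(\<lambda>n. (elog \<circ> g n) q) \<longlonglongrightarrow> (elog \<circ> f) q"
    by (rule epi_conv_pointwise[OF epi_conv_elog[OF assms] elog_convex[OF g] elog_convex[OF f] elog_lsc[OF f]]) (use q in blast)
  then have "(\<lambda>n. inverse (ereal q) * (elog \<circ> g n) q) \<longlonglongrightarrow> inverse (ereal q) * (elog \<circ> f) q"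
    using q by (intro tendsto_cmult_ereal) auto
  then show "(\<lambda>n. jfun (elog \<circ> g n) q) \<longlonglongrightarrow> jfun (elog \<circ> f) q"
    using q by (simp add: jfun_def divide_ereal_def mult.commute)
qed

text \<open>Closures of epigraphs determine monotone functions up to their jumps, which gives
  \<open>j1 x \<le> j2 y\<close> for \<open>x < y\<close>. Multiplying the slopes by the argument
  recovers \<open>log f\<close> at \<open>s * x\<close> with \<open>s\<close> close to 1, and lower
  semicontinuity of \<open>log f\<close> closes the gap.\<close>

lemma epi_sep_XJ: "epi_sep XJ"
  unfolding epi_sep_def
proof (intro conjI ballI inj_onI)
  fix j assume "j \<in> XJ"
  then obtain f where f: "f \<in> XM" "j = jfun (elog \<circ> f)" by (auto simp: XJ_def XLam_def)
  show "epi j \<noteq> {}"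
  proof (cases "\<exists>t<0. True \<and> jfun (elog \<circ> f) t < \<infinity>")
    case True
    then obtain t b where "jfun (elog \<circ> f) t < ereal b" using ereal_dense_real by metis
    then show ?thesis using f by (auto simp: epi_def intro: less_imp_le)
  next
    case False
    \<comment> \<open>Impossible: at a negative argument an infinite slope would mean
      \<open>log f = -\<infinity>\<close>, but \<open>f\<close> is positive.\<close>
    then have "jfun (elog \<circ> f) (-1) = \<infinity>" by (auto simp: less_top[symmetric] top_ereal_def dest!: spec[of _ "-1"])
    moreover have "(elog \<circ> f) (-1) \<noteq> -\<infinity>" using f by (auto simp: XM_iff elog_def)
    ultimately show ?thesis by (cases "elog (f (-1))") (auto simp: jfun_def)
  qed
next
  fix j1 j2 assume "j1 \<in> XJ" "j2 \<in> XJ" and cl: "closure (epi j1) = closure (epi j2)"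
  then obtain f1 f2 where f: "f1 \<in> XM" "f2 \<in> XM" and j: "j1 = jfun (elog \<circ> f1)" "j2 = jfun (elog \<circ> f2)"
    by (auto simp: XJ_def XLam_def)
  have le: "jfun (elog \<circ> f1) x \<le> jfun (elog \<circ> f2) y"
    if cl: "closure (epi (jfun (elog \<circ> f1))) = closure (epi (jfun (elog \<circ> f2)))" and f: "f1 \<in> XM" and xy: "x < y" for f1 f2 x y
  proof (rule ccontr)
    assume "\<not> jfun (elog \<circ> f1) x \<le> jfun (elog \<circ> f2) y"
    then have "jfun (elog \<circ> f2) y < jfun (elog \<circ> f1) x" by simp
    then obtain b' where b': "jfun (elog \<circ> f2) y < ereal b'" "ereal b' < jfun (elog \<circ> f1) x" by (rule ereal_dense_real)
    obtain b where b: "ereal b' < ereal b" "ereal b < jfun (elog \<circ> f1) x" using b'(2) by (rule ereal_dense_real)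
    have "(y, b') \<in> closure (epi (jfun (elog \<circ> f1)))"
      unfolding cl using b'(1) by (intro closure_subset[THEN subsetD]) (auto simp: epi_def)
    moreover have "min (b - b') (y - x) > 0" using b xy by simp
    ultimately obtain z where z: "z \<in> epi (jfun (elog \<circ> f1))" "box_dist (y, b') z < min (b - b') (y - x)"
      using closure_box_dist by blast
    obtain z1 z2 where zz: "z = (z1, z2)" by (cases z)
    have zb: "x < z1" "z2 < b" using z(2) by (auto simp: zz box_dist_def)
    have "jfun (elog \<circ> f1) x \<le> jfun (elog \<circ> f1) z1"
      by (rule monoD[OF jfun_mono[OF elog_convex[OF f] elog_XM_0[OF f]]]) (use zb in simp)
    also have "\<dots> \<le> ereal z2" using z(1) by (auto simp: zz epi_def)
    also have "\<dots> \<le> ereal b" using zb by simp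
    finally show False using b by simp
  qed
  have key: "(elog \<circ> f1) x \<le> (elog \<circ> f2) x"
    if le: "\<And>x y. x < y \<Longrightarrow> jfun (elog \<circ> f1) x \<le> jfun (elog \<circ> f2) y" "\<And>x y. x < y \<Longrightarrow> jfun (elog \<circ> f2) x \<le> jfun (elog \<circ> f1) y"
      and f: "f1 \<in> XM" "f2 \<in> XM" and x: "x \<noteq> 0" for f1 f2 x
  proof (rule ccontr)
    assume "\<not> (elog \<circ> f1) x \<le> (elog \<circ> f2) x"
    then have "(elog \<circ> f2) x < (elog \<circ> f1) x" by simp
    then obtain c' where c': "(elog \<circ> f2) x < ereal c'" "ereal c' < (elog \<circ> f1) x" by (rule ereal_dense_real)
    obtain c where c: "ereal c' < ereal c" "ereal c < (elog \<circ> f1) x" using c'(2) by (rule ereal_dense_real)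
    obtain e where e: "e > 0" "\<And>y. \<bar>y - x\<bar> < e \<Longrightarrow> ereal c < (elog \<circ> f1) y" using lsc_funD[OF elog_lsc[OF f(1)] c(2)] by blast
    have "\<exists>s. 0 < s \<and> s < 1 \<and> \<bar>s * x - x\<bar> < e \<and> c' * s < c"
    proof -
      have l1: "((\<lambda>s. s * x) \<longlongrightarrow> 1 * x) (at_left 1)" and l2: "((\<lambda>s. c' * s) \<longlongrightarrow> c' * 1) (at_left 1)"
        by (intro tendsto_intros)+
      have l3: "\<forall>\<^sub>F s in at_left 1. c' * s < c" using order_tendstoD(2)[OF l2, of c] c by simp
      have "\<forall>\<^sub>F s in at_left 1. 0 < s \<and> s < 1 \<and> \<bar>s * x - x\<bar> < e \<and> c' * s < c"
        using tendstoD[OF l1 e(1)] l3 eventually_at_left_real[OF zero_less_one]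
        by eventually_elim (auto simp: dist_real_def)
      then show ?thesis using eventually_happens'[of "at_left (1::real)"] by auto
    qed
    then obtain s where s: "0 < s" "s < 1" "\<bar>s * x - x\<bar> < e" "c' * s < c" by blast
    have hs: "ereal c < (elog \<circ> f1) (s * x)" using e(2) s by blast
    have A: "(elog \<circ> f1) (s * x) \<le> ereal (c' / x * (s * x))"
    proof (cases "x > 0")
      case True
      then have sx: "0 < s * x" "s * x < x" using s by auto
      have "jfun (elog \<circ> f1) (s * x) \<le> jfun (elog \<circ> f2) x" by (rule le(1)[OF sx(2)])
      also have "\<dots> \<le> ereal (c' / x)"
        using jfun_pos_le_iff[OF True, of "elog \<circ> f2" "c' / x"] less_imp_le[OF c'(1)] True by simp
      finally show ?thesis using jfun_pos_le_iff[OF sx(1)] by blast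
    next
      case False
      then have x0: "x < 0" using x by simp
      then have sx: "s * x < 0" "x < s * x" using s by (auto simp: mult_pos_neg mult_less_cancel_right2)
      have "ereal (c' / x) \<le> jfun (elog \<circ> f2) x"
        using jfun_neg_ge_iff[OF x0, of "c' / x" "elog \<circ> f2"] less_imp_le[OF c'(1)] x0 by simp
      also have "\<dots> \<le> jfun (elog \<circ> f1) (s * x)" by (rule le(2)[OF sx(2)])
      finally show ?thesis using jfun_neg_ge_iff[OF sx(1)] by blast
    qed
    have "ereal c < ereal (c' / x * (s * x))" using hs A by (rule less_le_trans)
    then have "c < c' * s" using x by simp
    then show False using s by simp
  qed
  have "(elog \<circ> f1) x = (elog \<circ> f2) x" for x
  proof (cases "x = 0")
    case True then show ?thesis using elog_XM_0 f by metis
  next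
    case False
    have 1: "jfun (elog \<circ> f1) x \<le> jfun (elog \<circ> f2) y" "jfun (elog \<circ> f2) x \<le> jfun (elog \<circ> f1) y" if "x < y" for x y
      using le[OF _ f(1) that, of f2] le[OF _ f(2) that, of f1] cl j by auto
    show ?thesis using key[OF 1 f False] key[OF 1(2,1) f(2,1) False] by (rule antisym)
  qed
  then show "j1 = j2" using j by (metis ext)
qed

section \<open>Sequential criteria and the contraction principle\<close>

lemma AW_top_topspace: "epi_sep S \<Longrightarrow> topspace (AW_top S) = S"
  by (simp add: AW_top_eq_mtopology Metric_space.topspace_mtopology epi_sep_Metric_space)

lemma AW_limitin:
  assumes S: "epi_sep S" and g: "\<And>n. g n \<in> S" and f: "f \<in> S"
  shows "limitin (AW_top S) g f sequentially \<longleftrightarrow> epi_conv g f"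
proof -
  interpret Metric_space S aw_dist by (rule epi_sep_Metric_space[OF S])
  have ne: "epi f \<noteq> {}" "epi (g n) \<noteq> {}" for n using S f g by (auto simp: epi_sep_def)
  have "limitin mtopology g f sequentially \<longleftrightarrow> (\<lambda>n. aw_dist (g n) f) \<longlonglongrightarrow> 0"
    using f g by (simp add: limitin_metric_dist_null)
  then show ?thesis unfolding AW_top_eq_mtopology[OF S] epi_conv_iff[OF ne] .
qed

lemma AW_closedin_iff:
  assumes S: "epi_sep S"
  shows "closedin (AW_top S) F \<longleftrightarrow> F \<subseteq> S \<and> (\<forall>g f. (\<forall>n. g n \<in> F) \<longrightarrow> f \<in> S \<longrightarrow> epi_conv g f \<longrightarrow> f \<in> F)"
proof -
  interpret Metric_space S aw_dist by (rule epi_sep_Metric_space[OF S])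
  have "closedin mtopology F \<longleftrightarrow> F \<subseteq> S \<and> (\<forall>g f. range g \<subseteq> F \<and> limitin mtopology g f sequentially \<longrightarrow> f \<in> F)"
    by (rule metric_closedin_iff_sequentially_closed)
  also have "\<dots> \<longleftrightarrow> F \<subseteq> S \<and> (\<forall>g f. (\<forall>n. g n \<in> F) \<longrightarrow> f \<in> S \<longrightarrow> epi_conv g f \<longrightarrow> f \<in> F)"
  proof (rule conj_cong[OF refl], intro all_cong1)
    fix g f assume F: "F \<subseteq> S"
    show "(range g \<subseteq> F \<and> limitin mtopology g f sequentially \<longrightarrow> f \<in> F) \<longleftrightarrow>
        ((\<forall>n. g n \<in> F) \<longrightarrow> f \<in> S \<longrightarrow> epi_conv g f \<longrightarrow> f \<in> F)"
    proof (cases "(\<forall>n. g n \<in> F) \<and> f \<in> S")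
      case True
      then have "limitin mtopology g f sequentially \<longleftrightarrow> epi_conv g f"
        using AW_limitin[OF S, of g f] F by (auto simp: AW_top_eq_mtopology[OF S])
      then show ?thesis using True by blast
    next
      case False
      then show ?thesis by (auto dest: limitin_mspace)
    qed
  qed
  finally show ?thesis unfolding AW_top_eq_mtopology[OF S] .
qed

lemma AW_compactin_iff:
  assumes S: "epi_sep S"
  shows "compactin (AW_top S) K \<longleftrightarrow> K \<subseteq> S \<and>
    (\<forall>g :: nat \<Rightarrow> real \<Rightarrow> ereal. (\<forall>n. g n \<in> K) \<longrightarrow> (\<exists>f\<in>K. \<exists>r. strict_mono r \<and> epi_conv (g \<circ> r) f))"
proof -
  interpret Metric_space S aw_dist by (rule epi_sep_Metric_space[OF S])
  have lim: "limitin mtopology (g \<circ> r) f sequentially \<longleftrightarrow> epi_conv (g \<circ> r) f"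
    if "K \<subseteq> S" "\<forall>n. g n \<in> K" "f \<in> K" for g :: "nat \<Rightarrow> real \<Rightarrow> ereal" and f r
    using AW_limitin[OF S, of "g \<circ> r" f] that by (auto simp: AW_top_eq_mtopology[OF S])
  have iff: "(range g \<subseteq> K \<longrightarrow> (\<exists>l r. l \<in> K \<and> strict_mono r \<and> limitin mtopology (g \<circ> r) l sequentially)) \<longleftrightarrow>
      ((\<forall>n. g n \<in> K) \<longrightarrow> (\<exists>f\<in>K. \<exists>r. strict_mono r \<and> epi_conv (g \<circ> r) f))" if "K \<subseteq> S" for g :: "nat \<Rightarrow> real \<Rightarrow> ereal"
    using lim[OF that, of g] by (auto simp: image_subset_iff)
  show ?thesis
    unfolding AW_top_eq_mtopology[OF S] compactin_sequentially
    using iff by blast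
qed

lemma AW_continuous_preimage:
  assumes S: "epi_sep S" and T: "epi_sep T" and Phi: "\<And>f. f \<in> S \<Longrightarrow> \<Phi> f \<in> T"
    and conv: "\<And>g f. (\<And>n. g n \<in> S) \<Longrightarrow> f \<in> S \<Longrightarrow> epi_conv g f \<Longrightarrow> epi_conv (\<lambda>n. \<Phi> (g n)) (\<Phi> f)"
  shows "closedin (AW_top T) F \<Longrightarrow> closedin (AW_top S) {f \<in> S. \<Phi> f \<in> F}"
    "openin (AW_top T) U \<Longrightarrow> openin (AW_top S) {f \<in> S. \<Phi> f \<in> U}"
proof -
  show c: "closedin (AW_top S) {f \<in> S. \<Phi> f \<in> F}" if "closedin (AW_top T) F" for F
    unfolding AW_closedin_iff[OF S]
  proof (intro conjI allI impI)
    fix g f assume g: "\<forall>n. g n \<in> {f \<in> S. \<Phi> f \<in> F}" and f: "f \<in> S" and ec: "epi_conv g f"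
    have "epi_conv (\<lambda>n. \<Phi> (g n)) (\<Phi> f)" by (rule conv) (use g f ec in auto)
    moreover have "\<forall>n. \<Phi> (g n) \<in> F" using g by auto
    moreover have "\<forall>g f. (\<forall>n. g n \<in> F) \<longrightarrow> f \<in> T \<longrightarrow> epi_conv g f \<longrightarrow> f \<in> F"
      using that unfolding AW_closedin_iff[OF T] by (rule conjunct2)
    ultimately have "\<Phi> f \<in> F" using Phi[OF f] by simp
    then show "f \<in> {f \<in> S. \<Phi> f \<in> F}" using f by simp
  qed auto
  show "openin (AW_top S) {f \<in> S. \<Phi> f \<in> U}" if "openin (AW_top T) U"
  proof -
    have "closedin (AW_top T) (T - U)" using that by (simp add: openin_closedin_eq AW_top_topspace[OF T])
    then have "closedin (AW_top S) {f \<in> S. \<Phi> f \<in> T - U}" by (rule c)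
    moreover have "{f \<in> S. \<Phi> f \<in> T - U} = S - {f \<in> S. \<Phi> f \<in> U}" using Phi by auto
    ultimately show ?thesis
      unfolding openin_closedin_eq AW_top_topspace[OF S] by auto
  qed
qed

lemma measurable_borel_of_top:
  assumes "\<And>\<omega>. \<omega> \<in> space P \<Longrightarrow> Y \<omega> \<in> topspace T" "\<And>U. openin T U \<Longrightarrow> Y -` U \<inter> space P \<in> sets P"
  shows "Y \<in> measurable P (borel_of_top T)"
  unfolding borel_of_top_def
  by (rule measurable_measure_of) (auto dest: openin_subset intro: assms)

text \<open>The contraction principle for a map on whose fibres the rate is constant, so that no
  infimum over fibres appears. That level sets stay closed uses goodness: a convergent sequence of
  images is lifted, a subsequence of the lifts converges, and limits in the target are
  unique.\<close>

lemma LDP_contraction: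
  assumes S: "epi_sep S" and T: "epi_sep T" and TS: "T = \<Phi> ` S"
    and conv: "\<And>g f. (\<And>n. g n \<in> S) \<Longrightarrow> f \<in> S \<Longrightarrow> epi_conv g f \<Longrightarrow> epi_conv (\<lambda>n. \<Phi> (g n)) (\<Phi> f)"
    and ldp: "LDP P (AW_top S) Y I" and good: "good_rate_function (AW_top S) I"
    and Y': "\<And>n \<omega>. Y' n \<omega> = \<Phi> (Y n \<omega>)" and I': "\<And>f. f \<in> S \<Longrightarrow> I' (\<Phi> f) = I f"
  shows "LDP P (AW_top T) Y' I'"
proof -
  have Phi: "\<Phi> f \<in> T" if "f \<in> S" for f using that TS by blast
  have pre1: "closedin (AW_top S) {f \<in> S. \<Phi> f \<in> F}" if "closedin (AW_top T) F" for F
    by (rule AW_continuous_preimage(1)[OF S T _ _ that]) (fact Phi, fact conv)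
  have pre2: "openin (AW_top S) {f \<in> S. \<Phi> f \<in> U}" if "openin (AW_top T) U" for U
    by (rule AW_continuous_preimage(2)[OF S T _ _ that]) (fact Phi, fact conv)
  have I0: "0 \<le> I f" if "f \<in> S" for f
    using ldp that AW_top_topspace[OF S] by (auto simp: LDP_def rate_function_def)
  have Ym: "Y n \<in> measurable P (borel_of_top (AW_top S))" if "n \<ge> 1" for n using ldp that by (auto simp: LDP_def)
  have YS: "Y n \<omega> \<in> S" if "n \<ge> 1" "\<omega> \<in> space P" for n \<omega>
    using measurable_space[OF Ym[OF that(1)] that(2)] AW_top_topspace[OF S]
    by (simp add: borel_of_top_def space_measure_of_conv)
  have vim: "Y' n -` A \<inter> space P = Y n -` {f \<in> S. \<Phi> f \<in> A} \<inter> space P" if "n \<ge> 1" for n A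
    using YS[OF that] by (auto simp: Y')
  have INF: "(INF f\<in>{f \<in> S. \<Phi> f \<in> A}. I f) = (INF f\<in>A. I' f)" if "A \<subseteq> T" for A
  proof -
    have "A = \<Phi> ` {f \<in> S. \<Phi> f \<in> A}" using that TS by auto
    then have "(INF f\<in>A. I' f) = (INF f\<in>\<Phi> ` {f \<in> S. \<Phi> f \<in> A}. I' f)" by simp
    also have "\<dots> = (INF f\<in>{f \<in> S. \<Phi> f \<in> A}. I f)"
      unfolding image_image by (rule INF_cong) (auto simp: I')
    finally show ?thesis ..
  qed
  have meas: "Y' n \<in> measurable P (borel_of_top (AW_top T))" if n: "n \<ge> 1" for n
  proof (rule measurable_borel_of_top)
    show "Y' n \<omega> \<in> topspace (AW_top T)" if "\<omega> \<in> space P" for \<omega>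
      using Phi[OF YS[OF n that]] by (simp add: AW_top_topspace[OF T] Y')
    fix U assume U: "openin (AW_top T) U"
    have "{f \<in> S. \<Phi> f \<in> U} \<in> sets (borel_of_top (AW_top S))"
      unfolding borel_of_top_def using pre2[OF U] by (subst sets_measure_of) (auto dest: openin_subset)
    then show "Y' n -` U \<inter> space P \<in> sets P"
      unfolding vim[OF n] using Ym[OF n] by (rule measurable_sets[rotated])
  qed
  have rate: "rate_function (AW_top T) I'"
    unfolding rate_function_def AW_top_topspace[OF T]
  proof (intro conjI ballI allI)
    fix f assume "f \<in> T" then show "0 \<le> I' f" using TS I0 I' by auto
  next
    fix c :: ereal
    show "closedin (AW_top T) {x \<in> T. I' x \<le> c}"
    proof (cases c)
      case PInf
      then show ?thesis using AW_top_topspace[OF T] by (simp add: closedin_topspace[of "AW_top T", unfolded AW_top_topspace[OF T]])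
    next
      case MInf
      have "I' x \<noteq> - \<infinity>" if "x \<in> T" for x using that TS I0 I' by fastforce
      then have eq: "{x \<in> T. I' x \<le> c} = {}" using MInf by auto
      show ?thesis unfolding eq by simp
    next
      case (real r)
      have comp: "compactin (AW_top S) {f \<in> S. I f \<le> ereal r}"
        using good AW_top_topspace[OF S] by (simp add: good_rate_function_def)
      show ?thesis
        unfolding AW_closedin_iff[OF T]
      proof (intro conjI allI impI)
        fix g f assume g: "\<forall>n. g n \<in> {x \<in> T. I' x \<le> c}" and f: "f \<in> T" and ec: "epi_conv g f"
        have "\<exists>h. h \<in> S \<and> g n = \<Phi> h \<and> I h \<le> ereal r" for n
        proof -
          have gn: "g n \<in> T" "I' (g n) \<le> ereal r" using g real by auto
          then obtain h where "h \<in> S" "g n = \<Phi> h" using TS by blast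
          then show ?thesis using gn(2) I' by auto
        qed
        from choice[OF allI, OF this] obtain h where h0: "\<forall>n. h n \<in> S \<and> g n = \<Phi> (h n) \<and> I (h n) \<le> ereal r" ..
        then have h: "h n \<in> S" "g n = \<Phi> (h n)" "I (h n) \<le> ereal r" for n by blast+
        have "\<forall>n. h n \<in> {f \<in> S. I f \<le> ereal r}" using h by blast
        with conjunct2[OF iffD1[OF AW_compactin_iff[OF S] comp], rule_format, of h]
        obtain k s where k: "k \<in> S" "I k \<le> ereal r" "strict_mono s" "epi_conv (h \<circ> s) k"
          by blast
        have "epi_conv (\<lambda>n. \<Phi> ((h \<circ> s) n)) (\<Phi> k)" 
          by (rule conv) (use h(1) k in \<open>simp_all add: comp_def\<close>)
        then have "epi_conv (g \<circ> s) (\<Phi> k)" by (simp add: comp_def h(2)[symmetric])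
        then have l1: "limitin (AW_top T) (g \<circ> s) (\<Phi> k) sequentially"
          using AW_limitin[OF T, of "g \<circ> s" "\<Phi> k"] g Phi[OF k(1)] by auto
        have "limitin (AW_top T) g f sequentially" using AW_limitin[OF T, of g f] g f ec by auto
        then have l2: "limitin (AW_top T) (g \<circ> s) f sequentially" by (rule limitin_subsequence[OF k(3)])
        interpret Metric_space T aw_dist by (rule epi_sep_Metric_space[OF T])
        have "f = \<Phi> k"
          using l1 l2 limitin_metric_unique[of "g \<circ> s"] by (simp add: AW_top_eq_mtopology[OF T])
        then show "f \<in> {x \<in> T. I' x \<le> c}" using f I'[OF k(1)] k real by simp
      qed auto
    qed
  qed
  have ev: "\<forall>\<^sub>F n in sequentially. ereal (1 / real n) * elog_prob (measure P (Y' n -` A \<inter> space P)) =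
      ereal (1 / real n) * elog_prob (measure P (Y n -` {f \<in> S. \<Phi> f \<in> A} \<inter> space P))" for A
    using eventually_ge_at_top[of 1] by eventually_elim (simp add: vim)
  show ?thesis
    unfolding LDP_def
  proof (intro conjI allI impI rate meas)
    fix G assume G: "openin (AW_top T) G"
    have GT: "G \<subseteq> T" using openin_subset[OF G] AW_top_topspace[OF T] by simp
    show "- (INF x\<in>G. I' x) \<le> liminf (\<lambda>n. ereal (1 / real n) * elog_prob (measure P (Y' n -` G \<inter> space P)))"
      unfolding Liminf_eq[OF ev] INF[OF GT, symmetric]
      using ldp pre2[OF G] unfolding LDP_def by blast
  next
    fix F assume F: "closedin (AW_top T) F"
    have FT: "F \<subseteq> T" using closedin_subset[OF F] AW_top_topspace[OF T] by simp
    show "limsup (\<lambda>n. ereal (1 / real n) * elog_prob (measure P (Y' n -` F \<inter> space P))) \<le> - (INF x\<in>F. I' x)"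
      unfolding Limsup_eq[OF ev] INF[OF FT, symmetric]
      using ldp pre1[OF F] unfolding LDP_def by blast
  qed
qed

section \<open>Uniqueness, tightness and weak limits\<close>

lemma norm_exp_minus_one_le: "norm (exp w - 1) \<le> norm w * exp (norm (w::complex))"
proof -
  have "norm (exp w - exp 0) \<le> exp (norm w) * norm (w - 0)"
  proof (rule field_differentiable_bound[where S="cball 0 (norm w)"])
    fix z :: complex assume z: "z \<in> cball 0 (norm w)"
    show "(exp has_field_derivative exp z) (at z within cball 0 (norm w))" by (rule DERIV_subset[OF DERIV_exp]) simp
    have "Re z \<le> norm w" using z complex_Re_le_cmod[of z] by (auto simp: intro: order_trans)
    then show "norm (exp z) \<le> exp (norm w)" by (simp add: norm_exp_eq_Re)
  qed auto
  then show ?thesis by (simp add: mult.commute)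
qed

lemma exp_mult_le_one_plus: "0 \<le> s \<Longrightarrow> s \<le> 1 \<Longrightarrow> exp (s * u) \<le> 1 + exp (u::real)"
proof (cases "u \<ge> 0")
  case True
  assume "0 \<le> s" "s \<le> 1"
  then have "exp (s * u) \<le> exp u" using True by (simp add: mult_left_le_one_le)
  then show ?thesis by (simp add: add_increasing)
next
  case False
  assume "0 \<le> s"
  then have "exp (s * u) \<le> 1" using False by (simp add: mult_nonneg_nonpos)
  then show ?thesis by (simp add: add_increasing2)
qed

text \<open>The two-sided Laplace transform in the direction \<open>p\<close>, scaled so that
  integrability of \<open>exp (p * x)\<close> gives convergence for
  \<open>0 \<le> Re z \<le> 1\<close>, whatever the sign of \<open>p\<close>. Real \<open>z\<close>
  give values of \<open>mgf\<close>, imaginary \<open>z\<close> the characteristic function.\<close>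

definition cmgf :: "real measure \<Rightarrow> real \<Rightarrow> complex \<Rightarrow> complex" where
  "cmgf M p z = (\<integral>x. exp (z * of_real (p * x)) \<partial>M)"

lemma (in real_distribution) cmgf_integrable:
  assumes "integrable M (\<lambda>x. exp (p * x))" "0 \<le> Re z" "Re z \<le> 1"
  shows "integrable M (\<lambda>x. exp (z * of_real (p * x)))"
proof (rule Bochner_Integration.integrable_bound)
  show "integrable M (\<lambda>x. 1 + exp (p * x))" using assms by auto
  show "AE x in M. norm (exp (z * of_real (p * x))) \<le> norm (1 + exp (p * x))"
  proof (rule AE_I2)
    fix x
    have "norm (exp (z * of_real (p * x))) = exp (Re z * (p * x))" by (simp add: norm_exp_eq_Re)
    also have "\<dots> \<le> 1 + exp (p * x)" using assms by (intro exp_mult_le_one_plus) auto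
    also have "\<dots> = norm (1 + exp (p * x))" by (simp add: add_pos_pos)
    finally show "norm (exp (z * of_real (p * x))) \<le> norm (1 + exp (p * x))" .
  qed
qed measurable

text \<open>Differentiation under the integral. The linear factor of the derivative is paid for by a
  small exponential, for which the distance from the boundary of the strip leaves room.\<close>

lemma (in real_distribution) cmgf_holomorphic:
  assumes i: "integrable M (\<lambda>x. exp (p * x))"
  shows "cmgf M p holomorphic_on {z. 0 < Re z \<and> Re z < 1}"
  unfolding holomorphic_on_def
proof
  fix z assume "z \<in> {z. 0 < Re z \<and> Re z < 1}"
  then have z: "0 < Re z" "Re z < 1" by auto
  \<comment> \<open>Moving \<open>Re z\<close> by \<open>2 * d\<close> stays in the strip: one
    \<open>d\<close> bounds the increment \<open>h\<close>, the other absorbs the linear factor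
    \<open>u\<close>.\<close>
  define d where "d = min (Re z) (1 - Re z) / 2"
  have d: "d > 0" "2 * d \<le> Re z" "Re z + 2 * d \<le> 1" using z by (auto simp: d_def min_def)
  define D where "D = (\<integral>x. of_real (p * x) * exp (z * of_real (p * x)) \<partial>M)"
  have key: "norm ((exp (h * of_real u) - 1) / h * exp (z * of_real u)) \<le> 2 / d * (1 + exp u)"
    if h: "h \<noteq> 0" "norm h < d" for h :: complex and u :: real
  proof -
    have "norm (exp (h * of_real u) - 1) \<le> norm (h * of_real u) * exp (norm (h * of_real u))"
      by (rule norm_exp_minus_one_le)
    also have "\<dots> = norm h * (\<bar>u\<bar> * exp (norm h * \<bar>u\<bar>))" by (simp add: norm_mult)
    finally have "norm ((exp (h * of_real u) - 1) / h) \<le> \<bar>u\<bar> * exp (norm h * \<bar>u\<bar>)"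
      using h by (simp add: norm_divide divide_le_eq mult.commute)
    also have "\<dots> \<le> \<bar>u\<bar> * exp (d * \<bar>u\<bar>)" using h by (intro mult_left_mono) (auto intro: mult_right_mono)
    also have "\<dots> \<le> exp (d * \<bar>u\<bar>) / d * exp (d * \<bar>u\<bar>)"
    proof (rule mult_right_mono)
      have "d * \<bar>u\<bar> \<le> exp (d * \<bar>u\<bar>)" using exp_ge_add_one_self[of "d * \<bar>u\<bar>"] by linarith
      then show "\<bar>u\<bar> \<le> exp (d * \<bar>u\<bar>) / d" using d by (simp add: pos_le_divide_eq mult.commute)
    qed simp
    also have "\<dots> = exp (2 * d * \<bar>u\<bar>) / d" by (simp add: exp_add[symmetric])
    finally have 1: "norm ((exp (h * of_real u) - 1) / h) \<le> exp (2 * d * \<bar>u\<bar>) / d" .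
    have "exp (2 * d * \<bar>u\<bar>) * exp (Re z * u) \<le> exp ((Re z + 2 * d) * u) + exp ((Re z - 2 * d) * u)"
      by (cases "u \<ge> 0") (auto simp: exp_add[symmetric] algebra_simps)
    also have "\<dots> \<le> (1 + exp u) + (1 + exp u)"
      using d z by (intro add_mono exp_mult_le_one_plus) auto
    finally have 2: "exp (2 * d * \<bar>u\<bar>) * exp (Re z * u) \<le> 2 * (1 + exp u)" by simp
    have "norm ((exp (h * of_real u) - 1) / h * exp (z * of_real u)) = norm ((exp (h * of_real u) - 1) / h) * exp (Re z * u)"
      unfolding norm_mult by (simp add: norm_exp_eq_Re)
    also have "\<dots> \<le> exp (2 * d * \<bar>u\<bar>) / d * exp (Re z * u)" using 1 by (rule mult_right_mono) simp
    also have "\<dots> \<le> 2 / d * (1 + exp u)" using 2 d by (simp add: divide_simps)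
    finally show ?thesis .
  qed
  have "(cmgf M p has_field_derivative D) (at z)"
    unfolding has_field_derivative_iff tendsto_at_iff_sequentially comp_def
  proof (intro allI impI)
    fix X assume X: "\<forall>i. X i \<in> UNIV - {z}" and Xl: "X \<longlonglongrightarrow> z"
    from tendstoD[OF Xl d(1)] obtain N where N: "\<And>n. n \<ge> N \<Longrightarrow> dist (X n) z < d"
      unfolding eventually_sequentially by blast
    \<comment> \<open>The beginning of the sequence is dropped so that the domination holds for
      every index.\<close>
    define Y where "Y n = X (n + N) - z" for n
    have Y: "Y n \<noteq> 0" "norm (Y n) < d" for n using X N[of "n + N"] by (auto simp: Y_def dist_norm)
    have Yl: "Y \<longlonglongrightarrow> 0" unfolding Y_def using LIMSEQ_ignore_initial_segment[OF Xl, of N] by (simp add: LIM_zero)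
    have "(\<lambda>n. \<integral>x. (exp (Y n * of_real (p * x)) - 1) / Y n * exp (z * of_real (p * x)) \<partial>M) \<longlonglongrightarrow> D"
      unfolding D_def
    proof (rule integral_dominated_convergence[where w="\<lambda>x. 2 / d * (1 + exp (p * x))"])
      show "integrable M (\<lambda>x. 2 / d * (1 + exp (p * x)))" using i by auto
      show "AE x in M. norm ((exp (Y n * of_real (p * x)) - 1) / Y n * exp (z * of_real (p * x))) \<le> 2 / d * (1 + exp (p * x))" for n
        using key[OF Y] by (intro AE_I2)
      show "AE x in M. (\<lambda>n. (exp (Y n * of_real (p * x)) - 1) / Y n * exp (z * of_real (p * x))) \<longlonglongrightarrow> of_real (p * x) * exp (z * of_real (p * x))"
      proof (rule AE_I2)
        fix x
        have "((\<lambda>h. exp (h * of_real (p * x))) has_field_derivative of_real (p * x)) (at (0::complex))"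
          by (auto intro!: derivative_eq_intros)
        then have "((\<lambda>h. (exp (h * of_real (p * x)) - 1) / h) \<longlongrightarrow> of_real (p * x)) (at (0::complex))"
          by (simp add: has_field_derivative_iff)
        then have "(\<lambda>n. (exp (Y n * of_real (p * x)) - 1) / Y n) \<longlonglongrightarrow> of_real (p * x)"
          unfolding tendsto_at_iff_sequentially comp_def using Y Yl by auto
        then show "(\<lambda>n. (exp (Y n * of_real (p * x)) - 1) / Y n * exp (z * of_real (p * x))) \<longlonglongrightarrow> of_real (p * x) * exp (z * of_real (p * x))"
          by (intro tendsto_intros)
      qed
    qed measurable
    also have "(\<lambda>n. \<integral>x. (exp (Y n * of_real (p * x)) - 1) / Y n * exp (z * of_real (p * x)) \<partial>M) =
        (\<lambda>n. (cmgf M p (X (n + N)) - cmgf M p z) / (X (n + N) - z))"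
    proof
      fix n
      have Xz: "X (n + N) = z + Y n" by (simp add: Y_def)
      have "\<bar>Re (Y n)\<bar> < d" using Y(2)[of n] abs_Re_le_cmod[of "Y n"] by linarith
      then have re: "0 \<le> Re (X (n + N))" "Re (X (n + N)) \<le> 1" using d by (auto simp: Xz)
      have "(cmgf M p (X (n + N)) - cmgf M p z) / (X (n + N) - z) =
          (\<integral>x. exp (X (n + N) * of_real (p * x)) - exp (z * of_real (p * x)) \<partial>M) / Y n"
        unfolding cmgf_def
        using cmgf_integrable[OF i re] cmgf_integrable[OF i, of z] z by (simp add: Y_def)
      also have "\<dots> = (\<integral>x. (exp (X (n + N) * of_real (p * x)) - exp (z * of_real (p * x))) / Y n \<partial>M)" by simp
      also have "\<dots> = (\<integral>x. (exp (Y n * of_real (p * x)) - 1) / Y n * exp (z * of_real (p * x)) \<partial>M)"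
        by (rule Bochner_Integration.integral_cong) (auto simp: Xz ring_distribs exp_add diff_divide_distrib)
      finally show "(\<integral>x. (exp (Y n * of_real (p * x)) - 1) / Y n * exp (z * of_real (p * x)) \<partial>M) =
        (cmgf M p (X (n + N)) - cmgf M p z) / (X (n + N) - z)" ..
    qed
    finally show "(\<lambda>n. (cmgf M p (X n) - cmgf M p z) / (X n - z)) \<longlonglongrightarrow> D" by (rule LIMSEQ_offset)
  qed
  then show "cmgf M p field_differentiable at z within {z. 0 < Re z \<and> Re z < 1}"
    using field_differentiable_at_within field_differentiable_def by blast
qed

text \<open>Dominated convergence from inside the strip. With \<open>n + 2\<close> the abscissae are
  strictly below 1 from the first one on.\<close>

lemma (in real_distribution) cmgf_boundary:
  assumes i: "integrable M (\<lambda>x. exp (p * x))"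
  shows "(\<lambda>n. cmgf M p (Complex (1 / real (n + 2)) t)) \<longlonglongrightarrow> char M (t * p)"
  unfolding cmgf_def char_def
proof (rule integral_dominated_convergence[where w="\<lambda>x. 1 + exp (p * x)"])
  show "integrable M (\<lambda>x. 1 + exp (p * x))" using i by auto
  show "AE x in M. norm (exp (Complex (1 / real (n + 2)) t * of_real (p * x))) \<le> 1 + exp (p * x)" for n
  proof (rule AE_I2)
    fix x
    have "norm (exp (Complex (1 / real (n + 2)) t * of_real (p * x))) = exp (1 / real (n + 2) * (p * x))" by (simp add: norm_exp_eq_Re)
    also have "\<dots> \<le> 1 + exp (p * x)" by (intro exp_mult_le_one_plus) auto
    finally show "norm (exp (Complex (1 / real (n + 2)) t * of_real (p * x))) \<le> 1 + exp (p * x)" .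
  qed
  show "AE x in M. (\<lambda>n. exp (Complex (1 / real (n + 2)) t * of_real (p * x))) \<longlonglongrightarrow> iexp (t * p * x)"
  proof (rule AE_I2)
    fix x
    have "(\<lambda>n. 1 / real (n + 2)) \<longlonglongrightarrow> 0"
      using LIMSEQ_ignore_initial_segment[OF lim_1_over_n, of 2] by simp
    then have "(\<lambda>n. Complex (1 / real (n + 2)) t) \<longlonglongrightarrow> Complex 0 t"
      by (intro tendsto_intros)
    then have "(\<lambda>n. exp (Complex (1 / real (n + 2)) t * of_real (p * x))) \<longlonglongrightarrow> exp (Complex 0 t * of_real (p * x))"
      by (rule tendsto_exp[OF tendsto_mult[OF _ tendsto_const]])
    also have "Complex 0 t * of_real (p * x) = \<i> * of_real (t * p * x)" by (simp add: complex_eq_iff)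
    finally show "(\<lambda>n. exp (Complex (1 / real (n + 2)) t * of_real (p * x))) \<longlonglongrightarrow> iexp (t * p * x)" .
  qed
qed measurable

text \<open>Equality on a real segment extends to the open strip by the identity theorem and then to
  its boundary line, where it is equality of characteristic functions. Only one side of 0 enters,
  which matters when 0 is an end point of the domain.\<close>

lemma mgf_unique:
  assumes nu: "real_distribution \<nu>1" "real_distribution \<nu>2" and p: "p \<noteq> 0"
    and fin: "mgf \<nu>1 p < \<infinity>" and eq: "\<And>s. 0 \<le> s \<Longrightarrow> s \<le> 1 \<Longrightarrow> mgf \<nu>1 (s * p) = mgf \<nu>2 (s * p)"
  shows "\<nu>1 = \<nu>2"
proof (rule Levy_uniqueness[OF nu])
  interpret n1: real_distribution \<nu>1 by fact
  interpret n2: real_distribution \<nu>2 by fact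
  have i1: "integrable \<nu>1 (\<lambda>x. exp (p * x))" by (rule n1.mgf_eq_integral(1)[OF fin])
  have i2: "integrable \<nu>2 (\<lambda>x. exp (p * x))" by (rule n2.mgf_eq_integral(1)) (use fin eq[of 1] in simp)
  let ?S = "{z. 0 < Re z \<and> Re z < 1}"
  have opS: "open ?S"
    by (intro open_Collect_conj open_halfspace_Re_gt open_halfspace_Re_lt)
  have "convex ?S"
    using convex_Int[OF convex_halfspace_Re_gt[of 0] convex_halfspace_Re_lt[of 1]] by (simp add: Collect_conj_eq)
  then have conS: "connected ?S" by (rule convex_connected)
  define U where "U = (of_real ` {0<..<1::real} :: complex set)"
  have US: "U \<subseteq> ?S" by (auto simp: U_def)
  have half: "of_real (1/2) islimpt U"
    unfolding islimpt_approachable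
  proof (intro allI impI)
    fix e :: real assume e: "e > 0"
    define r where "r = 1/2 + min e (1/2) / 2"
    have r: "1/2 < r" "r < 1" "r - 1/2 < e" using e by (auto simp: r_def min_def)
    then have "of_real r \<in> U" "(of_real r :: complex) \<noteq> of_real (1/2)" by (auto simp: U_def simp del: of_real_divide)
    moreover have "dist (of_real r :: complex) (of_real (1/2)) < e"
      unfolding dist_norm of_real_diff[symmetric] norm_of_real using r by auto
    ultimately show "\<exists>x'\<in>U. x' \<noteq> of_real (1/2) \<and> dist x' (of_real (1/2) :: complex) < e" by blast
  qed
  have zero: "cmgf \<nu>1 p z - cmgf \<nu>2 p z = 0" if zU: "z \<in> U" for z
  proof -
    obtain s where s: "z = of_real s" "0 < s" "s < 1" using zU unfolding U_def by auto
    have fin1: "mgf \<nu>1 (s * p) < \<infinity>"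
    proof -
      have "mgf \<nu>1 (s * p + (1 - s) * 0) \<le> ereal (s * (\<integral>x. exp (p * x) \<partial>\<nu>1) + (1 - s) * 1)"
        using s n1.mgf_eq_integral(2)[OF fin] n1.mgf_0
        by (intro convex_efun_le[OF n1.convex_mgf]) (auto simp: one_ereal_def)
      then have "mgf \<nu>1 (s * p) \<le> ereal (s * (\<integral>x. exp (p * x) \<partial>\<nu>1) + (1 - s) * 1)" by simp
      then show ?thesis by (rule le_less_trans) simp
    qed
    then have fin2: "mgf \<nu>2 (s * p) < \<infinity>" using eq[of s] s by simp
    have "(\<integral>x. exp (s * p * x) \<partial>\<nu>1) = (\<integral>x. exp (s * p * x) \<partial>\<nu>2)"
      using n1.mgf_eq_integral(2)[OF fin1] n2.mgf_eq_integral(2)[OF fin2] eq[of s] s by simp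
    moreover have "cmgf \<nu> p z = of_real (\<integral>x. exp (s * p * x) \<partial>\<nu>)" for \<nu>
      unfolding cmgf_def s(1) integral_complex_of_real[symmetric]
      by (rule Bochner_Integration.integral_cong) (auto simp: exp_of_real[symmetric] mult.assoc)
    ultimately show ?thesis by simp
  qed
  have ext: "cmgf \<nu>1 p z - cmgf \<nu>2 p z = 0" if "z \<in> ?S" for z
  proof (rule analytic_continuation[of "\<lambda>z. cmgf \<nu>1 p z - cmgf \<nu>2 p z" ?S U "of_real (1/2)" z])
    show "(\<lambda>z. cmgf \<nu>1 p z - cmgf \<nu>2 p z) holomorphic_on ?S"
      by (intro holomorphic_intros n1.cmgf_holomorphic[OF i1] n2.cmgf_holomorphic[OF i2])
  qed (use opS conS US half zero that in auto)
  show "char \<nu>1 = char \<nu>2"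
  proof
    fix t
    have "(\<lambda>n. cmgf \<nu>1 p (Complex (1 / real (n + 2)) (t / p))) \<longlonglongrightarrow> char \<nu>1 (t / p * p)" by (rule n1.cmgf_boundary[OF i1])
    moreover have "(\<lambda>n. cmgf \<nu>2 p (Complex (1 / real (n + 2)) (t / p))) \<longlonglongrightarrow> char \<nu>2 (t / p * p)" by (rule n2.cmgf_boundary[OF i2])
    moreover have "cmgf \<nu>1 p (Complex (1 / real (n + 2)) (t / p)) = cmgf \<nu>2 p (Complex (1 / real (n + 2)) (t / p))" for n
      using ext[of "Complex (1 / real (n + 2)) (t / p)"] by simp
    ultimately show "char \<nu>1 t = char \<nu>2 t" using LIMSEQ_unique p by simp
  qed
qed

section \<open>Tightness through bounded test functions\<close>

definition ramp :: "(nat \<Rightarrow> real) \<Rightarrow> nat \<Rightarrow> real \<Rightarrow> real" where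
  "ramp k J x = (\<Sum>j<J. max 0 (min 1 (\<bar>x\<bar> - k j)))"

text \<open>\<open>ramp\<close> is a continuous count of the thresholds \<open>k j\<close>,
  \<open>j < J\<close>, that lie below the absolute value of \<open>x\<close>. Bounding the means
  for all \<open>J\<close> by one constant is a tightness condition that survives weak limits and
  can be enforced by Chernoff's inequality.\<close>

definition tight_class :: "(nat \<Rightarrow> real) \<Rightarrow> real \<Rightarrow> real measure \<Rightarrow> bool" where
  "tight_class k c \<nu> \<longleftrightarrow> real_distribution \<nu> \<and> (\<forall>J. (\<integral>x. ramp k J x \<partial>\<nu>) \<le> c)"

lemma ramp_bounds: "0 \<le> ramp k J x" "ramp k J x \<le> real J"
proof -
  show "0 \<le> ramp k J x" unfolding ramp_def by (intro sum_nonneg) auto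
  have "ramp k J x \<le> (\<Sum>j<J. 1)" unfolding ramp_def by (intro sum_mono) auto
  then show "ramp k J x \<le> real J" by simp
qed

lemma ramp_abs: "\<bar>ramp k J x\<bar> \<le> real J" using ramp_bounds[of k J x] by auto

lemma continuous_ramp: "continuous_on UNIV (ramp k J)"
  unfolding ramp_def by (intro continuous_intros)

lemma ramp_measurable [measurable]: "ramp k J \<in> borel_measurable borel"
  by (rule borel_measurable_continuous_onI[OF continuous_ramp])

lemma ramp_Suc: "ramp k (Suc J) x = ramp k J x + max 0 (min 1 (\<bar>x\<bar> - k J))"
  by (simp add: ramp_def)

lemma ramp_mono: "J \<le> J' \<Longrightarrow> ramp k J x \<le> ramp k J' x"
  unfolding ramp_def by (intro sum_mono2) auto

lemma ramp_eventually_full: "\<exists>R>0. \<forall>x. \<bar>x\<bar> \<ge> R \<longrightarrow> ramp k J x = real J"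
proof (induction J)
  case 0 then show ?case by (auto simp: ramp_def intro: exI[of _ 1])
next
  case (Suc J)
  then obtain R where "R > 0" "\<forall>x. \<bar>x\<bar> \<ge> R \<longrightarrow> ramp k J x = real J" by blast
  then show ?case by (intro exI[of _ "max R (k J + 1)"]) (auto simp: ramp_Suc)
qed

text \<open>If \<open>j\<close> is the last index whose threshold is exceeded, the ramp is at most
  \<open>j + 1\<close>, and the summand with that index alone suffices.\<close>

lemma exp_ramp_le: "exp (ramp k J x) \<le> 1 + (\<Sum>j<J. exp (real j + 1) * indicator {x. k j < \<bar>x\<bar>} x)"
proof (induction J)
  case 0 then show ?case by (simp add: ramp_def)
next
  case (Suc J)
  show ?case
  proof (cases "k J < \<bar>x\<bar>")
    case True
    have "exp (ramp k (Suc J) x) \<le> exp (real J + 1)" using ramp_bounds(2)[of k "Suc J" x] by simp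
    also have "\<dots> \<le> 1 + (\<Sum>j<Suc J. exp (real j + 1) * indicator {x. k j < \<bar>x\<bar>} x)"
      using True by (auto simp: intro!: add_increasing sum_nonneg)
    finally show ?thesis .
  next
    case False
    then show ?thesis using Suc by (simp add: ramp_Suc)
  qed
qed

lemma exists_ramp:
  assumes "real_distribution \<mu>"
  shows "\<exists>k. \<forall>J. (\<integral>\<^sup>+x. ennreal (exp (ramp k J x)) \<partial>\<mu>) \<le> ennreal 2"
proof -
  interpret real_distribution \<mu> by fact
  have ex: "\<exists>K. measure \<mu> {x. K < \<bar>x\<bar>} < e" if e: "e > 0" for e :: real
  proof -
    have "(\<lambda>n. measure \<mu> {x. real n < \<bar>x\<bar>}) \<longlonglongrightarrow> measure \<mu> (\<Inter>n. {x. real n < \<bar>x\<bar>})"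
      by (rule finite_Lim_measure_decseq) (auto simp: decseq_def)
    also have "(\<Inter>n. {x::real. real n < \<bar>x\<bar>}) = {}"
    proof -
      have False if "\<forall>n. real n < \<bar>x\<bar>" for x :: real
        using reals_Archimedean2[of "\<bar>x\<bar>"] that less_asym by blast
      then show ?thesis by blast
    qed
    finally have "(\<lambda>n. measure \<mu> {x. real n < \<bar>x\<bar>}) \<longlonglongrightarrow> 0" by simp
    from order_tendstoD(2)[OF this e] show ?thesis using eventually_happens'[OF sequentially_bot] by blast
  qed
  \<comment> \<open>The tail mass cancels the factor \<open>exp (real j + 1)\<close> of the
    pointwise bound and leaves a geometric series of sum at most 1; the constant term makes it
    2.\<close>
  have "\<forall>j::nat. \<exists>K. measure \<mu> {x. K < \<bar>x\<bar>} < exp (- (real j + 1)) * (1/2) ^ (Suc j)" by (intro allI ex) simp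
  from choice[OF this] obtain k where "\<forall>j. measure \<mu> {x. k j < \<bar>x\<bar>} < exp (- (real j + 1)) * (1/2) ^ (Suc j)" ..
  then have k: "measure \<mu> {x. k j < \<bar>x\<bar>} < exp (- (real j + 1)) * (1/2) ^ (Suc j)" for j by blast
  have "(\<integral>\<^sup>+x. ennreal (exp (ramp k J x)) \<partial>\<mu>) \<le> ennreal 2" for J
  proof -
    let ?f = "\<lambda>x. 1 + (\<Sum>j<J. exp (real j + 1) * indicator {x. k j < \<bar>x\<bar>} x)"
    have ii: "integrable \<mu> (\<lambda>x. exp (real j + 1) * indicator {x. k j < \<bar>x\<bar>} x)" for j
      by (rule integrable_bdd[of _ "exp (real j + 1)"]) (auto simp: indicator_def)
    have isum: "integrable \<mu> (\<lambda>x. \<Sum>j<J. exp (real j + 1) * indicator {x. k j < \<bar>x\<bar>} x)"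
      by (rule Bochner_Integration.integrable_sum) (rule ii)
    then have i: "integrable \<mu> ?f" by (intro Bochner_Integration.integrable_add) simp_all
    have "(\<integral>\<^sup>+x. ennreal (exp (ramp k J x)) \<partial>\<mu>) \<le> (\<integral>\<^sup>+x. ennreal (?f x) \<partial>\<mu>)"
      by (intro nn_integral_mono ennreal_leI exp_ramp_le)
    also have "\<dots> = ennreal (\<integral>x. ?f x \<partial>\<mu>)"
      by (rule nn_integral_eq_integral[OF i]) (auto intro!: add_nonneg_nonneg sum_nonneg)
    also have "(\<integral>x. ?f x \<partial>\<mu>) = 1 + (\<Sum>j<J. exp (real j + 1) * measure \<mu> {x. k j < \<bar>x\<bar>})"
    proof -
      have "(\<integral>x. ?f x \<partial>\<mu>) = (\<integral>x. 1 \<partial>\<mu>) + (\<integral>x. (\<Sum>j<J. exp (real j + 1) * indicator {x. k j < \<bar>x\<bar>} x) \<partial>\<mu>)"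
        by (rule Bochner_Integration.integral_add) (simp, rule isum)
      also have "(\<integral>x. (\<Sum>j<J. exp (real j + 1) * indicator {x. k j < \<bar>x\<bar>} x) \<partial>\<mu>) =
          (\<Sum>j<J. \<integral>x. exp (real j + 1) * indicator {x. k j < \<bar>x\<bar>} x \<partial>\<mu>)"
        by (rule Bochner_Integration.integral_sum) (rule ii)
      finally show ?thesis using prob_space by simp
    qed
    also have "(\<Sum>j<J. exp (real j + 1) * measure \<mu> {x. k j < \<bar>x\<bar>}) \<le> (\<Sum>j<J. (1/2) ^ (Suc j))"
    proof (rule sum_mono)
      fix j
      have "exp (real j + 1) * measure \<mu> {x. k j < \<bar>x\<bar>} \<le> exp (real j + 1) * (exp (- (real j + 1)) * (1/2) ^ (Suc j))"
        using k[of j] by (intro mult_left_mono) auto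
      also have "\<dots> = (exp (real j + 1) * exp (- (real j + 1))) * (1/2) ^ (Suc j)" by (simp only: mult.assoc)
      also have "exp (real j + 1) * exp (- (real j + 1)) = 1" by (simp only: exp_add[symmetric]) simp
      finally show "exp (real j + 1) * measure \<mu> {x. k j < \<bar>x\<bar>} \<le> (1/2) ^ (Suc j)" by simp
    qed
    also have "(\<Sum>j<J. (1/2::real) ^ (Suc j)) \<le> 1"
    proof -
      have "(\<Sum>j<J. (1/2::real) ^ (Suc j)) = 1 - (1/2)^J" by (induction J) auto
      then show ?thesis by simp
    qed
    finally show ?thesis by (simp add: ennreal_leI)
  qed
  then show ?thesis by blast
qed

text \<open>The exponential moments of all ramps are at most 2, so a bound on the entropy bounds all
  means, with \<open>ln 2\<close> added.\<close>

lemma ent_le_tight_class: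
  assumes nu: "real_distribution \<nu>" and mu: "real_distribution \<mu>" and ent: "ent_le \<nu> \<mu> s"
    and k: "\<And>J. (\<integral>\<^sup>+x. ennreal (exp (ramp k J x)) \<partial>\<mu>) \<le> ennreal 2"
  shows "tight_class k (s + ln 2) \<nu>"
  unfolding tight_class_def
proof (intro conjI allI nu)
  fix J
  interpret real_distribution \<nu> by fact
  have i: "integrable \<nu> (ramp k J)" by (rule integrable_bdd[OF _ ramp_abs]) simp
  have "ennreal (\<integral>x. ramp k J x \<partial>\<nu>) = (\<integral>\<^sup>+x. ennreal (ramp k J x) \<partial>\<nu>)"
    by (rule nn_integral_eq_integral[OF i, symmetric]) (simp add: ramp_bounds)
  also have "\<dots> \<le> ennreal (s + ln 2)" by (rule ent_le_nn_integral[OF nu mu ent _ ramp_bounds(1) k]) simp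
  finally show "(\<integral>x. ramp k J x \<partial>\<nu>) \<le> s + ln 2"
    by (rule ennreal_le_iff[THEN iffD1, rotated]) (use ent_le_nonneg[OF mu ent] in simp)
qed

text \<open>Markov's inequality: far out the ramp equals \<open>J\<close>, and \<open>J\<close>
  exceeds \<open>c / e\<close>. The interval depends on the class only.\<close>

lemma tight_class_interval:
  assumes "e > 0" shows "\<exists>K>0. \<forall>\<nu>. tight_class k c \<nu> \<longrightarrow> measure \<nu> {-K<..K} > 1 - e"
proof -
  obtain J :: nat where J: "\<bar>c\<bar> / e < real J" "J > 0"
    using reals_Archimedean2[of "max 0 (\<bar>c\<bar> / e)"] by (metis gr0I max_less_iff_conj of_nat_0 less_irrefl)
  obtain R where R: "R > 0" "\<forall>x. \<bar>x\<bar> \<ge> R \<longrightarrow> ramp k J x = real J" using ramp_eventually_full by blast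
  have "measure \<nu> {-R<..R} > 1 - e" if t: "tight_class k c \<nu>" for \<nu>
  proof -
    interpret real_distribution \<nu> using t by (simp add: tight_class_def)
    have "real J * measure \<nu> (- {-R<..R}) = (\<integral>x. real J * indicator (- {-R<..R}) x \<partial>\<nu>)" by simp
    also have "\<dots> \<le> (\<integral>x. ramp k J x \<partial>\<nu>)"
    proof (rule integral_mono)
      show "integrable \<nu> (\<lambda>x. real J * indicator (- {-R<..R}) x)"
        by (rule integrable_bdd[of _ "real J"]) (auto simp: indicator_def)
      show "integrable \<nu> (ramp k J)" by (rule integrable_bdd[OF _ ramp_abs]) simp
      fix x show "real J * indicator (- {-R<..R}) x \<le> ramp k J x"
        using R(2)[rule_format, of x] ramp_bounds(1)[of k J x] by (auto simp: indicator_def)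
    qed
    also have "\<dots> \<le> c" using t by (simp add: tight_class_def)
    also have "\<dots> < real J * e" using J assms by (auto simp: divide_less_eq)
    finally have "measure \<nu> (- {-R<..R}) < e" using J by simp
    moreover have "measure \<nu> (- {-R<..R}) = 1 - measure \<nu> {-R<..R}"
      using prob_compl[of "{-R<..R}"] by (simp add: Compl_eq_Diff_UNIV)
    ultimately show ?thesis by simp
  qed
  then show ?thesis using R(1) by blast
qed

lemma tight_class_tight: "(\<And>n. tight_class k c (\<nu> n)) \<Longrightarrow> tight \<nu>"
  unfolding tight_def
proof (intro conjI allI impI)
  assume t: "\<And>n. tight_class k c (\<nu> n)"
  show "real_distribution (\<nu> n)" for n using t[of n] by (simp add: tight_class_def)
  fix e :: real assume "e > 0"
  then obtain K where "K > 0" "\<forall>\<nu>. tight_class k c \<nu> \<longrightarrow> measure \<nu> {-K<..K} > 1 - e" using tight_class_interval by blast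
  then show "\<exists>a b. a < b \<and> (\<forall>n. 1 - e < measure (\<nu> n) {a<..b})"
    using t by (intro exI[of _ "-K"] exI[of _ K]) auto
qed

lemma tight_class_weak_conv:
  assumes t: "\<And>n. tight_class k c (\<nu> n)" and nu: "real_distribution \<nu>'" and wc: "weak_conv_m \<nu> \<nu>'"
  shows "tight_class k c \<nu>'"
  unfolding tight_class_def
proof (intro conjI allI nu)
  fix J
  have n: "real_distribution (\<nu> n)" for n using t[of n] by (simp add: tight_class_def)
  have "(\<lambda>n. \<integral>x. ramp k J x \<partial>\<nu> n) \<longlonglongrightarrow> (\<integral>x. ramp k J x \<partial>\<nu>')"
    by (rule weak_conv_imp_integral_bdd_continuous_conv[OF n nu wc])
       (use continuous_ramp[of k J] ramp_abs[of k J] in \<open>auto simp: continuous_on_eq_continuous_at\<close>)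
  then show "(\<integral>x. ramp k J x \<partial>\<nu>') \<le> c"
    by (rule LIMSEQ_le_const2) (use t in \<open>auto simp: tight_class_def\<close>)
qed

text \<open>Mass near the origin prevents steep minima next to 0. Uniformly over a tight class this
  is the lower bound that \<open>epi_conv_convexI\<close> requires there.\<close>

lemma (in real_distribution) mgf_lower_near_0:
  assumes "measure M {-K<..K} > 1 - e" "\<bar>\<theta>\<bar> \<le> d" "K > 0"
  shows "ereal (exp (- d * K) * (1 - e)) \<le> mgf M \<theta>"
proof (cases "mgf M \<theta> < \<infinity>")
  case True
  note m = mgf_eq_integral[OF True]
  have "exp (- d * K) * (1 - e) \<le> exp (- d * K) * measure M {-K<..K}" using assms by (intro mult_left_mono) auto
  also have "\<dots> = (\<integral>x. exp (- d * K) * indicator {-K<..K} x \<partial>M)" by simp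
  also have "\<dots> \<le> (\<integral>x. exp (\<theta> * x) \<partial>M)"
  proof (rule integral_mono)
    show "integrable M (\<lambda>x. exp (- d * K) * indicator {-K<..K} x)"
      by (rule integrable_bdd[of _ "exp (- d * K)"]) (auto simp: indicator_def)
    fix x
    have "- d * K \<le> \<theta> * x" if "x \<in> {-K<..K}"
    proof -
      have "\<bar>\<theta> * x\<bar> \<le> d * K" unfolding abs_mult using that assms by (intro mult_mono) auto
      then show ?thesis by simp
    qed
    then show "exp (- d * K) * indicator {-K<..K} x \<le> exp (\<theta> * x)" by (auto simp: indicator_def)
  qed (rule m)
  finally show ?thesis using m by simp
qed auto

text \<open>The exponential is truncated at \<open>L\<close>, the truncated integrals converge
  weakly, and Fatou's lemma removes \<open>L\<close>.\<close>

lemma mgf_weak_conv_le: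
  assumes n: "\<And>n. real_distribution (\<nu> n)" and nu: "real_distribution \<nu>'" and wc: "weak_conv_m \<nu> \<nu>'"
    and le: "\<forall>\<^sub>F n in sequentially. mgf (\<nu> n) \<theta> \<le> ereal B"
  shows "mgf \<nu>' \<theta> \<le> ereal B"
proof -
  interpret nu: real_distribution \<nu>' by fact
  obtain N where "mgf (\<nu> N) \<theta> \<le> ereal B" using eventually_happens'[OF sequentially_bot le] by blast
  then have B0: "0 \<le> B" using mgf_nonneg[of "\<nu> N" \<theta>] by (metis ereal_less_eq(5) order_trans)
  define g where "g L x = min (exp (\<theta> * x)) (real L)" for L :: nat and x
  have g: "0 \<le> g L x" "\<bar>g L x\<bar> \<le> real L" for L x by (auto simp: g_def)
  have gc: "continuous_on UNIV (g L)" for L unfolding g_def by (intro continuous_intros)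
  have gm[measurable]: "g L \<in> borel_measurable borel" for L by (rule borel_measurable_continuous_onI[OF gc])
  have gle: "(\<integral>x. g L x \<partial>\<nu>') \<le> B" for L
  proof (rule tendsto_upperbound)
    show "(\<lambda>n. \<integral>x. g L x \<partial>\<nu> n) \<longlonglongrightarrow> (\<integral>x. g L x \<partial>\<nu>')"
      by (rule weak_conv_imp_integral_bdd_continuous_conv[OF n nu wc])
         (use gc[of L] g(2)[of L] in \<open>auto simp: continuous_on_eq_continuous_at\<close>)
    show "\<forall>\<^sub>F n in sequentially. (\<integral>x. g L x \<partial>\<nu> n) \<le> B"
      using le
    proof eventually_elim
      case (elim m)
      interpret m: real_distribution "\<nu> m" by (rule n)
      have fin: "mgf (\<nu> m) \<theta> < \<infinity>" using elim by (rule le_less_trans) simp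
      note mm = m.mgf_eq_integral[OF fin]
      have "(\<integral>x. g L x \<partial>\<nu> m) \<le> (\<integral>x. exp (\<theta> * x) \<partial>\<nu> m)"
      proof (rule integral_mono)
        show "integrable (\<nu> m) (g L)" by (rule m.integrable_bdd[OF gm g(2)])
      qed (use mm in \<open>auto simp: g_def\<close>)
      also have "\<dots> \<le> B" using mm elim by simp
      finally show ?case .
    qed
  qed simp
  have "(\<integral>\<^sup>+x. ennreal (exp (\<theta> * x)) \<partial>\<nu>') = (\<integral>\<^sup>+x. liminf (\<lambda>L. ennreal (g L x)) \<partial>\<nu>')"
  proof (rule nn_integral_cong)
    fix x
    have "(\<lambda>L. ennreal (g L x)) \<longlonglongrightarrow> ennreal (exp (\<theta> * x))"
    proof (rule tendsto_eventually)
      show "\<forall>\<^sub>F L in sequentially. ennreal (g L x) = ennreal (exp (\<theta> * x))"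
        using eventually_ge_at_top[of "nat \<lceil>exp (\<theta> * x)\<rceil>"]
      proof eventually_elim
        case (elim L)
        then have "exp (\<theta> * x) \<le> real L" by linarith
        then show ?case by (simp add: g_def)
      qed
    qed
    then show "ennreal (exp (\<theta> * x)) = liminf (\<lambda>L. ennreal (g L x))"
      by (rule lim_imp_Liminf[OF sequentially_bot, symmetric])
  qed
  also have "\<dots> \<le> liminf (\<lambda>L. \<integral>\<^sup>+x. ennreal (g L x) \<partial>\<nu>')" by (rule nn_integral_liminf) simp
  also have "\<dots> \<le> liminf (\<lambda>L. ennreal B)"
  proof (rule Liminf_mono, rule always_eventually, rule allI)
    fix L
    have "integrable \<nu>' (g L)" by (rule nu.integrable_bdd[OF gm g(2)])
    then have "(\<integral>\<^sup>+x. ennreal (g L x) \<partial>\<nu>') = ennreal (\<integral>x. g L x \<partial>\<nu>')"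
      by (rule nn_integral_eq_integral) (simp add: g)
    also have "\<dots> \<le> ennreal B" by (rule ennreal_leI[OF gle])
    finally show "(\<integral>\<^sup>+x. ennreal (g L x) \<partial>\<nu>') \<le> ennreal B" .
  qed
  also have "\<dots> = ennreal B" by (simp add: Liminf_const)
  finally show ?thesis using B0 by (simp add: mgf_le_iff)
qed

text \<open>Boundedness at \<open>s * q\<close> with \<open>s > 1\<close> makes \<open>exp (q * x)\<close> uniformly integrable.\<close>
lemma mgf_weak_conv_tendsto:
  assumes n: "\<And>n. real_distribution (\<nu> n)" and nu: "real_distribution \<nu>'" and wc: "weak_conv_m \<nu> \<nu>'"
    and s: "s > 1" and le: "\<forall>\<^sub>F n in sequentially. mgf (\<nu> n) (s * q) \<le> ereal B"
  shows "(\<lambda>n. mgf (\<nu> n) q) \<longlonglongrightarrow> mgf \<nu>' q"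
proof -
  obtain N where "mgf (\<nu> N) (s * q) \<le> ereal B" using eventually_happens'[OF sequentially_bot le] by blast
  then have B0: "0 \<le> B" using mgf_nonneg[of "\<nu> N" "s * q"] by (metis ereal_less_eq(5) order_trans)
  have le': "mgf \<nu>' (s * q) \<le> ereal B" by (rule mgf_weak_conv_le[OF n nu wc le])
  define g where "g L x = min (exp (q * x)) L" for L x :: real
  have gc: "continuous_on UNIV (g L)" for L unfolding g_def by (intro continuous_intros)
  have gm[measurable]: "g L \<in> borel_measurable borel" for L by (rule borel_measurable_continuous_onI[OF gc])
  have gb: "\<bar>g L x\<bar> \<le> L" if "L \<ge> 1" for L x using that by (auto simp: g_def abs_le_iff min_def intro: order_trans[of _ 0])
  \<comment> \<open>Where \<open>exp (q * x)\<close> exceeds \<open>L\<close>, it is at most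
    \<open>L powr (1 - s)\<close> times its own power with exponent \<open>s\<close>, since
    \<open>1 - s\<close> is negative.\<close>
  have pt: "exp (q * x) \<le> g L x + L powr (1 - s) * exp (s * q * x)" if L: "L \<ge> 1" for L x
  proof (cases "exp (q * x) \<le> L")
    case True then show ?thesis by (simp add: g_def)
  next
    case False
    then have qx: "ln L \<le> q * x" using L by (simp add: ln_le_iff_le_exp)
    have "L powr (1 - s) * exp (s * q * x) = exp ((1 - s) * ln L + s * q * x)"
      using L by (simp add: powr_def exp_add)
    also have "\<dots> \<ge> exp (q * x)"
    proof -
      have "(1 - s) * (q * x) \<le> (1 - s) * ln L" using qx s by (intro mult_left_mono_neg) auto
      then show ?thesis by (simp add: algebra_simps)
    qed
    finally have "exp (q * x) \<le> L powr (1 - s) * exp (s * q * x)" .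
    then show ?thesis using L by (simp add: g_def min_def)
  qed
  have sand: "(\<integral>x. g L x \<partial>\<kappa>) \<le> (\<integral>x. exp (q * x) \<partial>\<kappa>)" "(\<integral>x. exp (q * x) \<partial>\<kappa>) \<le> (\<integral>x. g L x \<partial>\<kappa>) + L powr (1 - s) * B"
    "mgf \<kappa> q = ereal (\<integral>x. exp (q * x) \<partial>\<kappa>)"
    if k: "real_distribution \<kappa>" "mgf \<kappa> (s * q) \<le> ereal B" and L: "L \<ge> 1" for \<kappa> L
  proof -
    interpret k: real_distribution \<kappa> by fact
    have fin: "mgf \<kappa> (s * q) < \<infinity>" using k(2) by (rule le_less_trans) simp
    note ms = k.mgf_eq_integral[OF fin]
    have gi: "integrable \<kappa> (g L')" if "L' \<ge> 1" for L' by (rule k.integrable_bdd[OF gm gb[OF that]])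
    have iq: "integrable \<kappa> (\<lambda>x. exp (q * x))"
    proof (rule Bochner_Integration.integrable_bound)
      show "integrable \<kappa> (\<lambda>x. g 1 x + 1 powr (1 - s) * exp (s * q * x))" using gi[of 1] ms by auto
      show "AE x in \<kappa>. norm (exp (q * x)) \<le> norm (g 1 x + 1 powr (1 - s) * exp (s * q * x))"
        using pt[of 1] by (intro AE_I2) (auto intro: order_trans[OF _ abs_ge_self])
    qed simp
    show "(\<integral>x. g L x \<partial>\<kappa>) \<le> (\<integral>x. exp (q * x) \<partial>\<kappa>)"
      by (rule integral_mono[OF gi[OF L] iq]) (simp add: g_def)
    have "(\<integral>x. exp (q * x) \<partial>\<kappa>) \<le> (\<integral>x. g L x + L powr (1 - s) * exp (s * q * x) \<partial>\<kappa>)"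
      by (rule integral_mono[OF iq]) (use gi[OF L] ms pt[OF L] in auto)
    also have "\<dots> = (\<integral>x. g L x \<partial>\<kappa>) + L powr (1 - s) * (\<integral>x. exp (s * q * x) \<partial>\<kappa>)" using gi[OF L] ms by simp
    also have "\<dots> \<le> (\<integral>x. g L x \<partial>\<kappa>) + L powr (1 - s) * B"
      using ms k(2) by (intro add_left_mono mult_left_mono) auto
    finally show "(\<integral>x. exp (q * x) \<partial>\<kappa>) \<le> (\<integral>x. g L x \<partial>\<kappa>) + L powr (1 - s) * B" .
    show "mgf \<kappa> q = ereal (\<integral>x. exp (q * x) \<partial>\<kappa>)" by (rule k.mgf_eq_integral(2)[OF k.mgf_finiteI[OF iq]])
  qed
  have "(\<lambda>n. \<integral>x. exp (q * x) \<partial>\<nu> n) \<longlonglongrightarrow> (\<integral>x. exp (q * x) \<partial>\<nu>')"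
  proof (rule tendstoI)
    fix e :: real assume e: "e > 0"
    have "((\<lambda>L. L powr (1 - s) * B) \<longlongrightarrow> 0 * B) at_top"
      using s by (intro tendsto_intros tendsto_neg_powr filterlim_ident) auto
    then have "\<forall>\<^sub>F L in at_top. L powr (1 - s) * B < e / 3" using e by (intro order_tendstoD) auto
    then have "\<forall>\<^sub>F L in at_top. L powr (1 - s) * B < e / 3 \<and> L \<ge> 1"
      using eventually_ge_at_top[of 1] by (rule eventually_conj)
    then obtain L where L: "L powr (1 - s) * B < e / 3" "L \<ge> 1"
      using eventually_happens'[of "at_top :: real filter"] by auto
    have "(\<lambda>n. \<integral>x. g L x \<partial>\<nu> n) \<longlonglongrightarrow> (\<integral>x. g L x \<partial>\<nu>')"
      by (rule weak_conv_imp_integral_bdd_continuous_conv[OF n nu wc])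
         (use gc[of L] gb[OF L(2)] in \<open>auto simp: continuous_on_eq_continuous_at\<close>)
    then have "\<forall>\<^sub>F n in sequentially. dist (\<integral>x. g L x \<partial>\<nu> n) (\<integral>x. g L x \<partial>\<nu>') < e / 3" using e by (intro tendstoD) auto
    then show "\<forall>\<^sub>F n in sequentially. dist (\<integral>x. exp (q * x) \<partial>\<nu> n) (\<integral>x. exp (q * x) \<partial>\<nu>') < e"
      using le
    proof eventually_elim
      case (elim m)
      show ?case
        using elim(1) sand(1,2)[OF n elim(2) L(2)] sand(1,2)[OF nu le' L(2)] L(1)
        unfolding dist_real_def by linarith
    qed
  qed
  then have "(\<lambda>n. ereal (\<integral>x. exp (q * x) \<partial>\<nu> n)) \<longlonglongrightarrow> mgf \<nu>' q"
    unfolding sand(3)[OF nu le' order_refl] by simp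
  then show ?thesis
  proof (rule Lim_transform_eventually)
    show "\<forall>\<^sub>F n in sequentially. ereal (\<integral>x. exp (q * x) \<partial>\<nu> n) = mgf (\<nu> n) q"
      using le by eventually_elim (simp add: sand(3)[OF n _ order_refl])
  qed
qed

section \<open>Extraction of epi-convergent subsequences\<close>

lemma convergent_on_rats_subseq:
  fixes h :: "nat \<Rightarrow> real \<Rightarrow> ereal"
  shows "\<exists>r. strict_mono r \<and> (\<forall>q\<in>\<rat>. \<exists>l. (\<lambda>n. h (r n) q) \<longlonglongrightarrow> l)"
proof -
  define Q :: "nat \<Rightarrow> real" where "Q i = of_rat (from_nat i)" for i
  have QR: "\<exists>i. q = Q i" if "q \<in> \<rat>" for q
    using that by (elim Rats_cases) (metis Q_def from_nat_to_nat)
  interpret subseqs "\<lambda>i s. \<exists>l. (\<lambda>n. h (s n) (Q i)) \<longlonglongrightarrow> l"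
  proof
    fix i and s :: "nat \<Rightarrow> nat" assume "strict_mono s"
    obtain l r where "strict_mono r" "((\<lambda>n. h (s n) (Q i)) \<circ> r) \<longlonglongrightarrow> l"
      using compact_complete_linorder[of "\<lambda>n. h (s n) (Q i)"] by blast
    then show "\<exists>r'. strict_mono r' \<and> (\<exists>l. (\<lambda>n. h ((s \<circ> r') n) (Q i)) \<longlonglongrightarrow> l)" by (auto simp: comp_def)
  qed
  have "\<exists>l. (\<lambda>n. h (diagseq n) (Q i)) \<longlonglongrightarrow> l" for i
  proof -
    have "\<exists>l. (\<lambda>n. h ((diagseq \<circ> ((+) (Suc i))) n) (Q i)) \<longlonglongrightarrow> l"
    proof (rule diagseq_holds)
      fix r s :: "nat \<Rightarrow> nat" and n assume "strict_mono r" "\<exists>l. (\<lambda>m. h (s m) (Q n)) \<longlonglongrightarrow> l"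
      then show "\<exists>l. (\<lambda>m. h ((s \<circ> r) m) (Q n)) \<longlonglongrightarrow> l"
        using LIMSEQ_subseq_LIMSEQ[of "\<lambda>m. h (s m) (Q n)" _ r] by (auto simp: comp_def)
    qed
    then obtain l where "(\<lambda>n. h (diagseq (n + Suc i)) (Q i)) \<longlonglongrightarrow> l" by (auto simp: comp_def add.commute)
    then show ?thesis using LIMSEQ_offset[of "\<lambda>n. h (diagseq n) (Q i)" "Suc i"] by blast
  qed
  then show ?thesis using subseq_diagseq QR by blast
qed

lemma rats_dense:
  fixes a b :: real assumes "a < b" shows "\<exists>q\<in>\<rat>. a < q \<and> q < b"
  using Rats_dense_in_real[OF assms] by blast

text \<open>Limits of moment generating functions are produced in this shape: the function of the
  limit law, cut down to a closed interval that contains 0.\<close>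

lemma restricted_mgf_in_XM:
  assumes nu: "real_distribution \<nu>" and C: "closed C" "convex C" "0 \<in> C"
  shows "(\<lambda>\<theta>. if \<theta> \<in> C then mgf \<nu> \<theta> else \<infinity>) \<in> XM"
proof -
  interpret real_distribution \<nu> by fact
  define f where "f \<theta> = (if \<theta> \<in> C then mgf \<nu> \<theta> else \<infinity>)" for \<theta>
  have "lsc_fun f"
    unfolding lsc_fun_def
  proof
    fix c
    show "closed {\<theta>. f \<theta> \<le> c}"
    proof (cases "c = \<infinity>")
      case False
      then have eq: "{\<theta>. f \<theta> \<le> c} = C \<inter> {\<theta>. mgf \<nu> \<theta> \<le> c}" by (auto simp: f_def top_unique)
      show ?thesis unfolding eq using C(1) lsc_mgf by (auto simp: lsc_fun_def)
    qed simp
  qed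
  moreover have "convex_efun f"
    unfolding convex_efun_def
  proof (intro allI impI)
    fix x y t :: real assume t: "0 < t \<and> t < 1"
    show "f (t * x + (1 - t) * y) \<le> ereal t * f x + ereal (1 - t) * f y"
    proof (cases "x \<in> C \<and> y \<in> C")
      case True
      then have "t * x + (1 - t) * y \<in> C" using convexD[OF C(2), of x y t "1 - t"] t by simp
      then show ?thesis using True convex_mgf t by (simp add: f_def convex_efun_def)
    next
      case False
      have "0 \<le> f z" for z by (simp add: f_def mgf_nonneg)
      then have "f x \<noteq> -\<infinity>" "f y \<noteq> -\<infinity>" by (metis ereal_infty_less_eq(2) zero_ereal_def PInfty_neq_ereal(2) MInfty_neq_ereal(2))+
      moreover have "f x = \<infinity> \<or> f y = \<infinity>" using False by (auto simp: f_def)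
      ultimately show ?thesis using t by (cases "f x"; cases "f y") auto
    qed
  qed
  ultimately show ?thesis
    unfolding XM_iff f_def[abs_def] using nu mgf_pos mgf_0 C(3) by (auto intro!: exI[of _ \<nu>] split: if_splits)
qed

text \<open>In the limit the domains of \<open>f n\<close> and \<open>mgf (\<nu> n)\<close> may separate, which is how mimicking functions arise.\<close>
lemma tight_subsequence:
  fixes \<nu> :: "nat \<Rightarrow> real measure" and f :: "nat \<Rightarrow> real \<Rightarrow> ereal"
  assumes t: "\<And>n. tight_class k c (\<nu> n)" and f: "\<And>n. f n \<in> XM"
    and fm: "\<And>n \<theta>. f n \<theta> < \<infinity> \<Longrightarrow> f n \<theta> = mgf (\<nu> n) \<theta>"
  obtains r \<nu>' f' where "strict_mono r" "tight_class k c \<nu>'" "weak_conv_m (\<nu> \<circ> r) \<nu>'" "f' \<in> XM"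
    "\<And>\<theta>. f' \<theta> < \<infinity> \<Longrightarrow> f' \<theta> = mgf \<nu>' \<theta>" "epi_conv (f \<circ> r) f'"
proof -
  have rd: "real_distribution (\<nu> n)" for n using t[of n] by (simp add: tight_class_def)
  obtain r1 \<nu>' where r1: "strict_mono r1" "real_distribution \<nu>'" "weak_conv_m (\<nu> \<circ> id \<circ> r1) \<nu>'"
    using tight_imp_convergent_subsubsequence[OF tight_class_tight[of k c \<nu>, OF t] strict_mono_id] by blast
  obtain r2 where r2: "strict_mono r2" "\<forall>q\<in>\<rat>. \<exists>l. (\<lambda>n. f (r1 (r2 n)) q) \<longlonglongrightarrow> l"
    using convergent_on_rats_subseq[of "\<lambda>n. f (r1 n)"] by blast
  define r where "r = r1 \<circ> r2"
  have r: "strict_mono r" unfolding r_def by (rule strict_mono_o[OF r1(1) r2(1)])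
  define h where "h n = f (r n)" for n
  define N where "N n = \<nu> (r n)" for n
  have Nrd: "real_distribution (N n)" and Nt: "tight_class k c (N n)" for n using rd t by (auto simp: N_def)
  have hX: "h n \<in> XM" and hm: "h n \<theta> < \<infinity> \<Longrightarrow> h n \<theta> = mgf (N n) \<theta>" for n \<theta> using f fm by (auto simp: h_def N_def)
  have "weak_conv_m (\<nu> \<circ> r1 \<circ> r2) \<nu>'"
    using r1(3) LIMSEQ_subseq_LIMSEQ[OF _ r2(1)] unfolding weak_conv_m_def weak_conv_def comp_def by auto
  then have wc: "weak_conv_m N \<nu>'" by (simp add: N_def[abs_def] r_def comp_def)
  interpret nu: real_distribution \<nu>' by (rule r1(2))
  have "\<forall>q\<in>\<rat>. \<exists>l. (\<lambda>n. h n q) \<longlonglongrightarrow> l" using r2(2) by (simp add: h_def r_def)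
  from bchoice[OF this] obtain F where F: "\<forall>q\<in>\<rat>. (\<lambda>n. h n q) \<longlonglongrightarrow> F q" ..
  define A where "A = {q\<in>\<rat>. F q < \<infinity>}"
  \<comment> \<open>The closed interval spanned by 0 and \<open>A\<close>, written with half-lines
    so that an unbounded \<open>A\<close> needs no case distinction.\<close>
  define C where "C = (\<Inter>q\<in>{q. q > 0 \<and> (\<forall>p\<in>A. p \<le> q)}. {..q}) \<inter> (\<Inter>q\<in>{q. q < 0 \<and> (\<forall>p\<in>A. q \<le> p)}. {q..})"
  have C: "closed C" "convex C" "0 \<in> C"
    unfolding C_def by (auto intro!: closed_Int closed_INT convex_Int convex_INT)
  define f' where "f' \<theta> = (if \<theta> \<in> C then mgf \<nu>' \<theta> else \<infinity>)" for \<theta>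
  have f'X: "f' \<in> XM" unfolding f'_def[abs_def] by (rule restricted_mgf_in_XM[OF r1(2) C])
  have f'm: "f' \<theta> < \<infinity> \<Longrightarrow> f' \<theta> = mgf \<nu>' \<theta>" for \<theta> by (auto simp: f'_def split: if_splits)
  have h_ge: "mgf (N n) \<theta> \<le> h n \<theta>" for n \<theta> using hm[of n \<theta>] by (cases "h n \<theta> < \<infinity>") auto
  have outside: "(\<lambda>n. h n q) \<longlonglongrightarrow> f' q" if q: "q \<in> \<rat>" "q \<notin> C" for q
  proof -
    have "q \<notin> A" using q(2) unfolding C_def by (auto simp: not_le)
    then have "F q = \<infinity>" using q by (simp add: A_def)
    then show ?thesis using F q by (auto simp: f'_def)
  qed
  \<comment> \<open>A point of \<open>A\<close> further out on the same ray bounds the functions at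
    \<open>s * q\<close> with \<open>s > 1\<close>, which gives the uniform integrability needed at
    \<open>q\<close>.\<close>
  have inside: "(\<lambda>n. h n q) \<longlonglongrightarrow> f' q" if q: "q \<in> C" and p: "p \<in> A" "p = s * q" "s > 1" for q p s
  proof -
    have "F p < \<infinity>" using p(1) by (simp add: A_def)
    then obtain B where B: "F p < ereal B" by (rule ereal_dense_real)
    have "(\<lambda>n. h n p) \<longlonglongrightarrow> F p" using F p(1) by (auto simp: A_def)
    then have ev: "\<forall>\<^sub>F n in sequentially. h n p < ereal B" using B by (rule order_tendstoD)
    then have ev2: "\<forall>\<^sub>F n in sequentially. mgf (N n) (s * q) \<le> ereal B"
      by eventually_elim (use h_ge p(2) in \<open>meson le_less_trans less_imp_le\<close>)
    have "(\<lambda>n. mgf (N n) q) \<longlonglongrightarrow> mgf \<nu>' q" by (rule mgf_weak_conv_tendsto[OF Nrd r1(2) wc p(3) ev2])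
    then have "(\<lambda>n. h n q) \<longlonglongrightarrow> mgf \<nu>' q"
    proof (rule Lim_transform_eventually)
      show "\<forall>\<^sub>F n in sequentially. mgf (N n) q = h n q"
        using ev
      proof eventually_elim
        case (elim n)
        have "h n ((1 / s) * p + (1 - 1 / s) * 0) \<le> ereal ((1 / s) * B + (1 - 1 / s) * 1)"
          using hX[of n] elim p XM_0[OF hX, of n] by (intro convex_efun_le) (auto simp: XM_iff one_ereal_def)
        then have "h n q < \<infinity>" using p by (auto intro: le_less_trans)
        then show ?case using hm by simp
      qed
    qed
    then show ?thesis using q by (simp add: f'_def)
  qed
  define Q where "Q = {q. (\<lambda>n. h n q) \<longlonglongrightarrow> f' q}"
  have ec: "epi_conv h f'"
  proof (rule epi_conv_convexI[where z=1 and Q=Q])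
    show "convex_efun (h n)" for n using hX[of n] by (simp add: XM_iff)
    show "convex_efun f'" "lsc_fun f'" using f'X by (simp_all add: XM_iff)
    show "h n 0 = ereal 1" for n using XM_0[OF hX, of n] by (simp add: one_ereal_def)
    show "f' 0 = ereal 1" using XM_0[OF f'X] by (simp add: one_ereal_def)
    show "(\<lambda>n. h n q) \<longlonglongrightarrow> f' q" if "q \<in> Q" for q using that by (simp add: Q_def)
    show "\<exists>q\<in>Q. a < q \<and> q < b" if ab: "a < b" for a b
    proof (cases "\<exists>q\<in>\<rat>. a < q \<and> q < b \<and> q \<notin> C")
      case True then show ?thesis using outside by (auto simp: Q_def)
    next
      case False
      then have inC: "q \<in> C" if "q \<in> \<rat>" "a < q" "q < b" for q using that by blast
      show ?thesis
      proof (cases "b > 0")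
        case True
        obtain q where q: "q \<in> \<rat>" "max a 0 < q" "q < b" using rats_dense[of "max a 0" b] ab True by auto
        obtain q1 where q1: "q1 \<in> \<rat>" "q < q1" "q1 < b" using rats_dense[OF q(3)] by blast
        have "q1 \<in> C" using q q1 by (intro inC) auto
        then obtain p where p: "p \<in> A" "q < p" using q q1 unfolding C_def by (auto simp: not_le) (meson not_le)
        then have "(\<lambda>n. h n q) \<longlonglongrightarrow> f' q" using q by (intro inside[of q p "p / q"] inC) auto
        then show ?thesis using q by (auto simp: Q_def)
      next
        case b: False
        obtain q where q: "q \<in> \<rat>" "a < q" "q < b" using rats_dense[OF ab] by blast
        obtain q1 where q1: "q1 \<in> \<rat>" "a < q1" "q1 < q" using rats_dense[OF q(2)] by blast
        have "q1 \<in> C" using q q1 by (intro inC) auto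
        have "\<not> (\<forall>p\<in>A. q \<le> p)"
        proof
          assume "\<forall>p\<in>A. q \<le> p"
          then have "q \<le> q1" using \<open>q1 \<in> C\<close> q b unfolding C_def by auto
          then show False using q1 by simp
        qed
        then obtain p where p: "p \<in> A" "p < q" by (auto simp: not_le)
        then have "(\<lambda>n. h n q) \<longlonglongrightarrow> f' q" using q b by (intro inside[of q p "p / q"] inC) (auto simp: neg_less_divide_eq)
        then show ?thesis using q by (auto simp: Q_def)
      qed
    qed
    show "\<exists>e>0. \<forall>\<^sub>F n in sequentially. \<forall>y. \<bar>y\<bar> < e \<longrightarrow> ereal c < h n y" if c: "c < 1" for c
    proof -
      define e where "e = (1 - c) / 2"
      have e: "e > 0" "c < 1 - e" using c by (auto simp: e_def field_simps)
      obtain K where K: "K > 0" "\<And>n. measure (N n) {-K<..K} > 1 - e"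
        using tight_class_interval[OF e(1)] Nt by meson
      have "((\<lambda>d. exp (- d * K) * (1 - e)) \<longlongrightarrow> exp (- 0 * K) * (1 - e)) (at_right 0)" by (intro tendsto_intros)
      then have "\<forall>\<^sub>F d in at_right 0. c < exp (- d * K) * (1 - e)" using e by (intro order_tendstoD) auto
      then obtain d0 where d0: "d0 > 0" "\<And>d. 0 < d \<Longrightarrow> d < d0 \<Longrightarrow> c < exp (- d * K) * (1 - e)"
        unfolding eventually_at_right_field by blast
      have "ereal c < h n y" if "\<bar>y\<bar> < d0 / 2" for n y
      proof -
        interpret n: real_distribution "N n" by (rule Nrd)
        have "ereal c < ereal (exp (- (d0 / 2) * K) * (1 - e))" using d0(2)[of "d0 / 2"] d0(1) by simp
        also have "\<dots> \<le> mgf (N n) y" by (rule n.mgf_lower_near_0[OF K(2)]) (use that K in auto)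
        also have "\<dots> \<le> h n y" by (rule h_ge)
        finally show ?thesis .
      qed
      then show ?thesis using d0(1) by (intro exI[of _ "d0 / 2"]) (auto intro: always_eventually)
    qed
  qed
  show ?thesis
  proof (rule that[OF r _ _ f'X f'm])
    show "tight_class k c \<nu>'" by (rule tight_class_weak_conv[OF Nt r1(2) wc])
    show "weak_conv_m (\<nu> \<circ> r) \<nu>'" using wc by (simp add: N_def[abs_def] comp_def)
    show "epi_conv (f \<circ> r) f'" using ec by (simp add: h_def[abs_def] comp_def)
  qed
qed

section \<open>The rate function\<close>

text \<open>The exponential moment of the test function \<open>exp (b * x)\<close>, hence the
  quantity that bounds \<open>mgf \<nu> b\<close> in terms of the entropy of \<nu>.\<close>

definition dexp :: "real measure \<Rightarrow> real \<Rightarrow> ennreal" where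
  "dexp \<mu> b = (\<integral>\<^sup>+x. ennreal (exp (exp (b * x))) \<partial>\<mu>)"

text \<open>Asking for all \<open>s > 1\<close> leaves the end points of the domain free, which keeps the condition closed.\<close>
definition admissible :: "real measure \<Rightarrow> (real \<Rightarrow> ereal) \<Rightarrow> bool" where
  "admissible \<mu> f \<longleftrightarrow> (\<forall>b s. 1 < s \<longrightarrow> f b = \<infinity> \<longrightarrow> dexp \<mu> (s * b) = \<infinity>)"

text \<open>Unlike \<open>mimics\<close>, this includes the moment generating function of \<nu>
  itself.\<close>

definition matches :: "(real \<Rightarrow> ereal) \<Rightarrow> real measure \<Rightarrow> bool" where
  "matches f \<nu> \<longleftrightarrow> real_distribution \<nu> \<and> (\<forall>\<theta>. f \<theta> < \<infinity> \<longrightarrow> f \<theta> = mgf \<nu> \<theta>)"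

text \<open>For \<open>f\<close> in \<open>XM\<close> that is finite somewhere off 0 the infimum is
  over a single law. If \<open>f\<close> is finite at 0 only, every law matches and the infimum is
  0.\<close>

definition mgf_rate :: "real measure \<Rightarrow> (real \<Rightarrow> ereal) \<Rightarrow> ereal" where
  "mgf_rate \<mu> f = (if admissible \<mu> f then INF \<nu>\<in>{\<nu>. matches f \<nu>}. rel_entropy \<nu> \<mu> else \<infinity>)"

section \<open>Convexity and compact level sets\<close>

lemma rel_entropy_nonneg:
  assumes "real_distribution \<nu>" "real_distribution \<mu>" shows "0 \<le> rel_entropy \<nu> \<mu>"
proof (rule ccontr)
  assume "\<not> 0 \<le> rel_entropy \<nu> \<mu>"
  then have "rel_entropy \<nu> \<mu> < ereal 0" by (simp add: zero_ereal_def)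
  then obtain c where c: "rel_entropy \<nu> \<mu> \<le> ereal c" "c < 0" by (rule ereal_less_dense_real)
  then have "ent_le \<nu> \<mu> c" using rel_entropy_le_iff assms by blast
  then show False using ent_le_nonneg[OF assms(2)] c(2) by fastforce
qed

lemma rel_entropy_self: "real_distribution \<mu> \<Longrightarrow> rel_entropy \<mu> \<mu> = 0"
  using rel_entropy_nonneg[of \<mu> \<mu>] ent_le_refl[of \<mu>] rel_entropy_le_iff[of \<mu> \<mu> 0]
  by (simp add: zero_ereal_def antisym)

lemma rel_entropy_finiteD:
  assumes "real_distribution \<nu>" "real_distribution \<mu>" "rel_entropy \<nu> \<mu> < \<infinity>"
  obtains s where "rel_entropy \<nu> \<mu> = ereal s" "ent_le \<nu> \<mu> s"
proof -
  obtain s where s: "rel_entropy \<nu> \<mu> = ereal s"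
    using rel_entropy_nonneg[OF assms(1,2)] assms(3) by (cases "rel_entropy \<nu> \<mu>") auto
  then have "ent_le \<nu> \<mu> s" using rel_entropy_le_iff[OF assms(1,2), of s] by simp
  with s show ?thesis by (rule that)
qed

lemma XM_scale_finite:
  assumes f: "f \<in> XM" and "f b < \<infinity>" "0 \<le> t" "t \<le> 1" shows "f (t * b) < \<infinity>"
proof -
  obtain B where B: "f b < ereal B" using assms(2) by (rule ereal_dense_real)
  have "f (t * b + (1 - t) * 0) \<le> ereal (t * B + (1 - t) * 1)"
    using f B assms XM_0[OF f] by (intro convex_efun_le) (auto simp: XM_iff one_ereal_def)
  then have "f (t * b) \<le> ereal (t * B + (1 - t) * 1)" by simp
  then show ?thesis by (rule le_less_trans) simp
qed

text \<open>Domains are star-shaped about 0, so \<open>f\<close> is finite on the whole segment from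
  0 to \<open>p\<close>, where both laws are then known.\<close>

lemma matches_unique:
  assumes f: "f \<in> XM" and p: "p \<noteq> 0" "f p < \<infinity>" and m: "matches f \<nu>1" "matches f \<nu>2"
  shows "\<nu>1 = \<nu>2"
proof (rule mgf_unique[OF _ _ p(1)])
  show "real_distribution \<nu>1" "real_distribution \<nu>2" "mgf \<nu>1 p < \<infinity>"
    using m p by (auto simp: matches_def)
  fix s :: real assume "0 \<le> s" "s \<le> 1"
  then have "f (s * p) < \<infinity>" using XM_scale_finite[OF f p(2)] by blast
  then show "mgf \<nu>1 (s * p) = mgf \<nu>2 (s * p)" using m by (auto simp: matches_def)
qed

lemma XM_matches: "f \<in> XM \<Longrightarrow> \<exists>\<nu>. matches f \<nu>"
  by (auto simp: XM_iff matches_def)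

lemma mgf_rate_eq:
  assumes f: "f \<in> XM" and adm: "admissible \<mu> f" and p: "p \<noteq> 0" "f p < \<infinity>" and m: "matches f \<nu>"
  shows "mgf_rate \<mu> f = rel_entropy \<nu> \<mu>"
proof -
  have "matches f \<kappa> \<longleftrightarrow> \<kappa> = \<nu>" for \<kappa> using matches_unique[OF f p _ m, of \<kappa>] m by blast
  then have "{\<kappa>. matches f \<kappa>} = {\<nu>}" by blast
  then show ?thesis using adm by (simp add: mgf_rate_def)
qed

text \<open>Either the matching law is unique, or \<open>f\<close> is finite at 0 only and \<mu>
  itself attains the value 0.\<close>

lemma mgf_rate_attained:
  assumes mu: "real_distribution \<mu>" and f: "f \<in> XM" and adm: "admissible \<mu> f"
  shows "\<exists>\<nu>. matches f \<nu> \<and> mgf_rate \<mu> f = rel_entropy \<nu> \<mu>"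
proof (cases "\<exists>p. p \<noteq> 0 \<and> f p < \<infinity>")
  case True
  then show ?thesis using mgf_rate_eq[OF f adm] XM_matches[OF f] by blast
next
  case False
  interpret real_distribution \<mu> by fact
  have m: "matches f \<mu>" 
    unfolding matches_def
  proof (intro conjI allI impI mu)
    fix \<theta> assume "f \<theta> < \<infinity>"
    then have "\<theta> = 0" using False by blast
    then show "f \<theta> = mgf \<mu> \<theta>" using XM_0[OF f] mgf_0 by simp
  qed
  have "mgf_rate \<mu> f \<le> rel_entropy \<mu> \<mu>" using adm m by (auto simp: mgf_rate_def intro: INF_lower)
  moreover have "0 \<le> mgf_rate \<mu> f"
    using adm rel_entropy_nonneg[OF _ mu] by (auto simp: mgf_rate_def matches_def intro!: INF_greatest)
  ultimately show ?thesis using m rel_entropy_self[OF mu] by (metis antisym)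
qed

lemma mgf_rate_nonneg:
  assumes "real_distribution \<mu>" shows "0 \<le> mgf_rate \<mu> f"
  using rel_entropy_nonneg[OF _ assms] by (auto simp: mgf_rate_def matches_def intro!: INF_greatest)

lemma mgf_rate_finiteD:
  assumes mu: "real_distribution \<mu>" and f: "f \<in> XM" and fin: "mgf_rate \<mu> f \<le> ereal c"
  obtains \<nu> s where "admissible \<mu> f" "matches f \<nu>" "mgf_rate \<mu> f = ereal s" "s \<le> c" "ent_le \<nu> \<mu> s"
proof -
  have adm: "admissible \<mu> f" using fin by (auto simp: mgf_rate_def split: if_splits)
  obtain \<nu> where nu: "matches f \<nu>" "mgf_rate \<mu> f = rel_entropy \<nu> \<mu>" using mgf_rate_attained[OF mu f adm] by blast
  have rd: "real_distribution \<nu>" using nu by (simp add: matches_def)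
  have "rel_entropy \<nu> \<mu> < \<infinity>" using fin nu by (auto intro: le_less_trans)
  then obtain s where s: "rel_entropy \<nu> \<mu> = ereal s" "ent_le \<nu> \<mu> s" using rel_entropy_finiteD[OF rd mu] by blast
  show ?thesis by (rule that[OF adm nu(1) _ _ s(2)]) (use nu s fin in auto)
qed

text \<open>\<open>1 \<le> Z\<close> makes the bound nonnegative, so that it survives the conversion
  between \<open>ennreal\<close> and \<open>ereal\<close>.\<close>

lemma ent_le_mgf_le:
  assumes nu: "real_distribution \<nu>" and mu: "real_distribution \<mu>" and ent: "ent_le \<nu> \<mu> s"
    and Z: "dexp \<mu> b \<le> ennreal Z" and Z1: "1 \<le> Z"
  shows "mgf \<nu> b \<le> ereal (s + ln Z)"
proof -
  have "(\<integral>\<^sup>+x. ennreal (exp (b * x)) \<partial>\<nu>) \<le> ennreal (s + ln Z)"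
    by (rule ent_le_nn_integral[OF nu mu ent]) (use Z in \<open>auto simp: dexp_def\<close>)
  then show ?thesis using ent_le_nonneg[OF mu ent] Z1 by (subst mgf_le_iff) auto
qed

lemma dexp_finiteD:
  assumes "dexp \<mu> b \<noteq> \<infinity>" obtains Z where "dexp \<mu> b \<le> ennreal Z" "1 \<le> Z"
proof -
  obtain r where "r \<ge> 0" "dexp \<mu> b = ennreal r" using assms by (cases "dexp \<mu> b") auto
  then show ?thesis by (intro that[of "max 1 r"]) (auto intro!: ennreal_leI)
qed

text \<open>Entropy bounds the moment generating function at \<open>t * b\<close> as soon as
  \<open>dexp\<close> is finite there, and finiteness is inherited by points closer to 0, here by
  \<open>b\<close>.\<close>

lemma ent_le_admissible:
  assumes nu: "real_distribution \<nu>" and mu: "real_distribution \<mu>" and ent: "ent_le \<nu> \<mu> s"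
  shows "admissible \<mu> (mgf \<nu>)"
  unfolding admissible_def
proof (intro allI impI, rule ccontr)
  fix b t :: real assume t: "1 < t" and inf: "mgf \<nu> b = \<infinity>" and "dexp \<mu> (t * b) \<noteq> \<infinity>"
  then obtain Z where "dexp \<mu> (t * b) \<le> ennreal Z" "1 \<le> Z" using dexp_finiteD by blast
  then have "mgf \<nu> (t * b) \<le> ereal (s + ln Z)" by (rule ent_le_mgf_le[OF nu mu ent])
  then have "mgf \<nu> (t * b) < \<infinity>" by (rule le_less_trans) simp
  then have "mgf \<nu> (1 / t * (t * b)) < \<infinity>" by (rule XM_scale_finite[OF mgf_in_XM[OF nu]]) (use t in auto)
  then show False using inf t by simp
qed

abbreviation mix :: "real \<Rightarrow> real measure \<Rightarrow> real measure \<Rightarrow> real measure" where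
  "mix t \<nu>1 \<nu>2 \<equiv> cmix (bernoulli_pmf t) (\<lambda>b. if b then \<nu>1 else \<nu>2)"

lemma real_distribution_mix: "real_distribution \<nu>1 \<Longrightarrow> real_distribution \<nu>2 \<Longrightarrow> real_distribution (mix t \<nu>1 \<nu>2)"
  by (rule real_distribution_cmix) simp

lemma mgf_mix:
  assumes "real_distribution \<nu>1" "real_distribution \<nu>2" "0 \<le> t" "t \<le> 1"
  shows "mgf (mix t \<nu>1 \<nu>2) \<theta> = ereal t * mgf \<nu>1 \<theta> + ereal (1 - t) * mgf \<nu>2 \<theta>"
proof -
  have "(\<integral>\<^sup>+x. ennreal (exp (\<theta> * x)) \<partial>mix t \<nu>1 \<nu>2) =
      (\<integral>\<^sup>+x. ennreal (exp (\<theta> * x)) \<partial>\<nu>1) * ennreal t + (\<integral>\<^sup>+x. ennreal (exp (\<theta> * x)) \<partial>\<nu>2) * ennreal (1 - t)"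
    by (subst nn_integral_cmix) (use assms in auto)
  then show ?thesis
    using assms by (simp add: mgf_def plus_ennreal.rep_eq times_ennreal.rep_eq mult.commute)
qed

lemma ent_le_mix:
  assumes "real_distribution \<nu>1" "real_distribution \<nu>2" "ent_le \<nu>1 \<mu> s1" "ent_le \<nu>2 \<mu> s2" "0 \<le> t" "t \<le> 1"
  shows "ent_le (mix t \<nu>1 \<nu>2) \<mu> (t * s1 + (1 - t) * s2)"
proof -
  have "ent_le (mix t \<nu>1 \<nu>2) \<mu> (\<integral>b. (if b then s1 else s2) \<partial>measure_pmf (bernoulli_pmf t))"
    by (rule ent_le_cmix) (use assms in \<open>auto intro: integrable_measure_pmf_finite\<close>)
  then show ?thesis using assms by (simp add: mult.commute)
qed

text \<open>The mixture of two optimal laws matches the combination, which is infinite exactly where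
  one of the two functions is.\<close>

lemma mgf_rate_convex:
  assumes mu: "real_distribution \<mu>" and f: "f \<in> XM" and g: "g \<in> XM" and t: "0 < t" "t < 1"
  shows "mgf_rate \<mu> (\<lambda>\<theta>. ereal t * f \<theta> + ereal (1 - t) * g \<theta>) \<le> ereal t * mgf_rate \<mu> f + ereal (1 - t) * mgf_rate \<mu> g"
proof (cases "mgf_rate \<mu> f = \<infinity> \<or> mgf_rate \<mu> g = \<infinity>")
  case True
  then show ?thesis using t mgf_rate_nonneg[OF mu, of f] mgf_rate_nonneg[OF mu, of g] by auto
next
  case False
  have ex: "\<exists>\<nu> s. admissible \<mu> h \<and> matches h \<nu> \<and> mgf_rate \<mu> h = ereal s \<and> ent_le \<nu> \<mu> s" if h: "h \<in> XM" and fin: "mgf_rate \<mu> h \<noteq> \<infinity>" for h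
  proof -
    obtain c where "mgf_rate \<mu> h = ereal c" using fin mgf_rate_nonneg[OF mu, of h] by (cases "mgf_rate \<mu> h") auto
    then have "mgf_rate \<mu> h \<le> ereal c" by simp
    then show ?thesis by (rule mgf_rate_finiteD[OF mu h]) blast
  qed
  obtain \<nu>1 s1 where 1: "admissible \<mu> f" "matches f \<nu>1" "mgf_rate \<mu> f = ereal s1" "ent_le \<nu>1 \<mu> s1"
    using ex[OF f] False by blast
  obtain \<nu>2 s2 where 2: "admissible \<mu> g" "matches g \<nu>2" "mgf_rate \<mu> g = ereal s2" "ent_le \<nu>2 \<mu> s2"
    using ex[OF g] False by blast
  have rd: "real_distribution \<nu>1" "real_distribution \<nu>2" using 1 2 by (auto simp: matches_def)
  let ?h = "\<lambda>\<theta>. ereal t * f \<theta> + ereal (1 - t) * g \<theta>"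
  let ?m = "mix t \<nu>1 \<nu>2"
  have pos: "0 < f \<theta>" "0 < g \<theta>" for \<theta> using f g by (auto simp: XM_iff)
  have inf: "?h \<theta> = \<infinity> \<longleftrightarrow> f \<theta> = \<infinity> \<or> g \<theta> = \<infinity>" for \<theta>
    using pos[of \<theta>] t by (cases "f \<theta>"; cases "g \<theta>") auto
  have m: "matches ?h ?m"
    unfolding matches_def
  proof (intro conjI allI impI)
    show "real_distribution ?m" by (rule real_distribution_mix[OF rd])
    fix \<theta> assume "?h \<theta> < \<infinity>"
    then have "f \<theta> < \<infinity>" "g \<theta> < \<infinity>" using inf[of \<theta>] by (auto simp: less_top[symmetric] top_ereal_def)
    then show "?h \<theta> = mgf ?m \<theta>" using 1 2 t by (simp add: mgf_mix[OF rd] matches_def)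
  qed
  have adm: "admissible \<mu> ?h" using 1(1) 2(1) unfolding admissible_def inf by blast
  have "mgf_rate \<mu> ?h \<le> rel_entropy ?m \<mu>" using adm m by (auto simp: mgf_rate_def intro: INF_lower)
  also have "\<dots> \<le> ereal (t * s1 + (1 - t) * s2)"
    using rel_entropy_le_iff[OF real_distribution_mix[OF rd] mu] ent_le_mix[OF rd 1(4) 2(4)] t by simp
  finally show ?thesis using 1 2 by simp
qed

text \<open>Bounded entropy gives one tight class, from which a limit law and a limit function are
  extracted together. The delicate point is that admissibility survives, since domains may shrink in
  the limit.\<close>

lemma mgf_rate_compact:
  assumes mu: "real_distribution \<mu>"
  shows "compactin (AW_top XM) {f \<in> XM. mgf_rate \<mu> f \<le> ereal c}"
  unfolding AW_compactin_iff[OF epi_sep_XM]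
proof (intro conjI allI impI)
  fix g :: "nat \<Rightarrow> real \<Rightarrow> ereal" assume "\<forall>n. g n \<in> {f \<in> XM. mgf_rate \<mu> f \<le> ereal c}"
  then have g: "g n \<in> XM" "mgf_rate \<mu> (g n) \<le> ereal c" for n by auto
  have "\<forall>n. \<exists>\<nu>. admissible \<mu> (g n) \<and> matches (g n) \<nu> \<and> ent_le \<nu> \<mu> c"
  proof
    fix n
    show "\<exists>\<nu>. admissible \<mu> (g n) \<and> matches (g n) \<nu> \<and> ent_le \<nu> \<mu> c"
      by (rule mgf_rate_finiteD[OF mu g(1) g(2), of n]) (use ent_le_mono in blast)
  qed
  from choice[OF this] obtain \<nu> where nu: "\<forall>n. admissible \<mu> (g n) \<and> matches (g n) (\<nu> n) \<and> ent_le (\<nu> n) \<mu> c" ..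
  have rd: "real_distribution (\<nu> n)" for n using nu by (simp add: matches_def)
  obtain k where k: "\<And>J. (\<integral>\<^sup>+x. ennreal (exp (ramp k J x)) \<partial>\<mu>) \<le> ennreal 2" using exists_ramp[OF mu] by blast
  have t: "tight_class k (c + ln 2) (\<nu> n)" for n by (rule ent_le_tight_class[OF rd mu _ k]) (use nu in blast)
  have fm: "g n \<theta> = mgf (\<nu> n) \<theta>" if "g n \<theta> < \<infinity>" for n \<theta> using nu that by (simp add: matches_def)
  obtain r \<nu>' f' where r: "strict_mono r" "tight_class k (c + ln 2) \<nu>'" "weak_conv_m (\<nu> \<circ> r) \<nu>'" "f' \<in> XM"
    "\<And>\<theta>. f' \<theta> < \<infinity> \<Longrightarrow> f' \<theta> = mgf \<nu>' \<theta>" "epi_conv (g \<circ> r) f'"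
    by (rule tight_subsequence[of k "c + ln 2" \<nu> g, OF t g(1) fm]) blast+
  have rd': "real_distribution \<nu>'" using r by (simp add: tight_class_def)
  have "ent_le \<nu>' \<mu> c" by (rule ent_le_weak_conv[OF _ rd' mu r(3)]) (use rd nu in auto)
  then have ent': "rel_entropy \<nu>' \<mu> \<le> ereal c" using rel_entropy_le_iff[OF rd' mu] by blast
  have m': "matches f' \<nu>'" using rd' r by (auto simp: matches_def)
  have adm: "admissible \<mu> f'"
    unfolding admissible_def
  proof (intro allI impI, rule ccontr)
    fix b s :: real assume s: "1 < s" and inf: "f' b = \<infinity>" and "dexp \<mu> (s * b) \<noteq> \<infinity>"
    then obtain Z where Z: "dexp \<mu> (s * b) \<le> ennreal Z" "1 \<le> Z" using dexp_finiteD by blast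
    \<comment> \<open>The room in \<open>s\<close> is split. The factor \<open>s / s'\<close> is
      spent on admissibility of the \<open>g n\<close>, which makes them uniformly bounded at
      \<open>s' * b\<close>; the factor \<open>s'\<close> leads from \<open>b\<close> to this point,
      where the limit is still infinite.\<close>
    define s' where "s' = (1 + s) / 2"
    have s': "1 < s'" "s' < s" using s by (auto simp: s'_def)
    define B where "B = max 1 (c + ln Z)"
    have gB: "g n (s' * b) \<le> ereal B" for n
    proof -
      interpret n: real_distribution "\<nu> n" by (rule rd)
      have "g n (s' * b) \<noteq> \<infinity>"
      proof
        assume "g n (s' * b) = \<infinity>"
        moreover have "admissible \<mu> (g n)" "1 < s / s'" using nu s' by auto
        ultimately have "dexp \<mu> (s / s' * (s' * b)) = \<infinity>" unfolding admissible_def by blast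
        then show False using \<open>dexp \<mu> (s * b) \<noteq> \<infinity>\<close> s' by simp
      qed
      then have "g n (s' * b) = mgf (\<nu> n) (s' * b)" using fm by simp
      also have "mgf (\<nu> n) (s' * b) = mgf (\<nu> n) (s' / s * (s * b) + (1 - s' / s) * 0)" using s by simp
      also have "\<dots> \<le> ereal (s' / s * B + (1 - s' / s) * B)"
      proof (rule convex_efun_le[OF n.convex_mgf])
        have "mgf (\<nu> n) (s * b) \<le> ereal (c + ln Z)" by (rule ent_le_mgf_le[OF rd mu _ Z]) (use nu in blast)
        also have "\<dots> \<le> ereal B" by (simp add: B_def)
        finally show "mgf (\<nu> n) (s * b) \<le> ereal B" .
        show "mgf (\<nu> n) 0 \<le> ereal B" using n.mgf_0 by (simp add: B_def one_ereal_def)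
      qed (use s s' in auto)
      also have "s' / s * B + (1 - s' / s) * B = B" by (simp add: algebra_simps)
      finally show ?thesis .
    qed
    have "f' (s' * b) = \<infinity>"
    proof (rule ccontr)
      assume "f' (s' * b) \<noteq> \<infinity>"
      then have "f' (s' * b) < \<infinity>" by simp
      then have "f' (1 / s' * (s' * b)) < \<infinity>" by (rule XM_scale_finite[OF r(4)]) (use s' in auto)
      then show False using inf s' by simp
    qed
    then have "ereal B < f' (s' * b)" by simp
    have "lsc_fun f'" using r(4) by (simp add: XM_iff)
    from epi_conv_lowerD[OF r(6) this \<open>ereal B < f' (s' * b)\<close>]
    obtain e where "e > 0" "\<forall>\<^sub>F n in sequentially. \<forall>y. \<bar>y - s' * b\<bar> < e \<longrightarrow> ereal B < (g \<circ> r) n y" by blast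
    then obtain n where "\<forall>y. \<bar>y - s' * b\<bar> < e \<longrightarrow> ereal B < (g \<circ> r) n y"
      using eventually_happens'[OF sequentially_bot] by blast
    then have "ereal B < g (r n) (s' * b)" using \<open>e > 0\<close> by simp
    then show False using gB[of "r n"] by simp
  qed
  have "mgf_rate \<mu> f' \<le> rel_entropy \<nu>' \<mu>" using adm m' by (auto simp: mgf_rate_def intro: INF_lower)
  then have "f' \<in> {f \<in> XM. mgf_rate \<mu> f \<le> ereal c}" using r(4) ent' by auto
  then show "\<exists>f\<in>{f \<in> XM. mgf_rate \<mu> f \<le> ereal c}. \<exists>r. strict_mono r \<and> epi_conv (g \<circ> r) f" using r by blast
qed auto

lemma mgf_rate_good:
  assumes mu: "real_distribution \<mu>" shows "good_rate_function (AW_top XM) (mgf_rate \<mu>)"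
proof -
  interpret Metric_space XM aw_dist by (rule epi_sep_Metric_space[OF epi_sep_XM])
  have ts: "topspace (AW_top XM) = XM" by (rule AW_top_topspace[OF epi_sep_XM])
  have "closedin (AW_top XM) {x \<in> XM. mgf_rate \<mu> x \<le> c}" for c
  proof (cases c)
    case PInf
    then show ?thesis using closedin_topspace[of "AW_top XM"] ts by simp
  next
    case MInf
    have "mgf_rate \<mu> x \<noteq> - \<infinity>" for x using mgf_rate_nonneg[OF mu, of x] by auto
    then have eq: "{x \<in> XM. mgf_rate \<mu> x \<le> c} = {}" using MInf by auto
    show ?thesis unfolding eq by simp
  next
    case (real r)
    have "Hausdorff_space (AW_top XM)" unfolding AW_top_eq_mtopology[OF epi_sep_XM] by (rule Hausdorff_space_mtopology)
    then show ?thesis using mgf_rate_compact[OF mu, of r] real compactin_imp_closedin by blast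
  qed
  then show ?thesis
    unfolding good_rate_function_def rate_function_def ts
    using mgf_rate_nonneg[OF mu] mgf_rate_compact[OF mu] by blast
qed

section \<open>Laws of finite entropy with a prescribed domain\<close>

lemma nat_floor_bounds:
  fixes x :: real assumes "0 \<le> x" shows "x < real (nat \<lfloor>x\<rfloor>) + 1" "real (nat \<lfloor>x\<rfloor>) \<le> x"
  using assms by linarith+

lemma nn_integral_uniform_measure_bounds:
  assumes mu: "real_distribution \<mu>" and A[measurable]: "A \<in> sets borel" and p: "measure \<mu> A > 0" and [measurable]: "g \<in> borel_measurable borel"
  shows "(\<And>x. x \<in> A \<Longrightarrow> g x \<le> c) \<Longrightarrow> (\<integral>\<^sup>+x. g x \<partial>uniform_measure \<mu> A) \<le> (c::ennreal)"
    "(\<And>x. x \<in> A \<Longrightarrow> c \<le> g x) \<Longrightarrow> c \<le> (\<integral>\<^sup>+x. g x \<partial>uniform_measure \<mu> A)"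
proof -
  interpret mu: real_distribution \<mu> by fact
  interpret nu: real_distribution "uniform_measure \<mu> A" by (rule real_distribution_uniform_measure[OF mu A p])
  have AE: "AE x in uniform_measure \<mu> A. x \<in> A" by (rule AE_uniform_measureI) auto
  have c: "(\<integral>\<^sup>+x. c \<partial>uniform_measure \<mu> A) = c" using nu.emeasure_space_1 by simp
  show "(\<integral>\<^sup>+x. g x \<partial>uniform_measure \<mu> A) \<le> c" if "\<And>x. x \<in> A \<Longrightarrow> g x \<le> c"
  proof -
    have "(\<integral>\<^sup>+x. g x \<partial>uniform_measure \<mu> A) \<le> (\<integral>\<^sup>+x. c \<partial>uniform_measure \<mu> A)"
      by (rule nn_integral_mono_AE) (use AE that in \<open>auto elim: eventually_mono\<close>)
    then show ?thesis unfolding c .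
  qed
  show "c \<le> (\<integral>\<^sup>+x. g x \<partial>uniform_measure \<mu> A)" if "\<And>x. x \<in> A \<Longrightarrow> c \<le> g x"
  proof -
    have "(\<integral>\<^sup>+x. c \<partial>uniform_measure \<mu> A) \<le> (\<integral>\<^sup>+x. g x \<partial>uniform_measure \<mu> A)"
      by (rule nn_integral_mono_AE) (use AE that in \<open>auto elim: eventually_mono\<close>)
    then show ?thesis unfolding c .
  qed
qed

lemma ennreal_le_suminf: "(f k :: ennreal) \<le> (\<Sum>k. f k)"
  using sum_le_suminf[of f "{k}"] by simp

text \<open>If all bands far out had smaller mass, summation over the bands would give a finite
  double exponential moment at some \<open>b'\<close> strictly between \<beta> and
  \<open>b\<close>.\<close>

lemma band_mass_lower:
  fixes \<sigma> :: real
  assumes mu: "real_distribution \<mu>" and b0: "0 \<le> \<beta>" and b: "\<beta> < b"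
    and inf: "\<And>b'. \<beta> < b' \<Longrightarrow> dexp \<mu> (\<sigma> * b') = \<infinity>"
  shows "\<exists>k\<ge>m. exp (- exp (b * real k)) \<le> measure \<mu> {x. real k \<le> \<sigma> * x \<and> \<sigma> * x < real k + 1}"
proof (rule ccontr)
  assume "\<not> ?thesis"
  then have small: "measure \<mu> {x. real k \<le> \<sigma> * x \<and> \<sigma> * x < real k + 1} \<le> exp (- exp (b * real k))" if "k \<ge> m" for k
    using that by (meson not_le less_imp_le)
  interpret real_distribution \<mu> by fact
  define b' where "b' = (\<beta> + b) / 2"
  have b': "\<beta> < b'" "b' < b" "0 < b'" using b b0 by (auto simp: b'_def)
  define I where "I k = {x. real k \<le> \<sigma> * x \<and> \<sigma> * x < real k + 1}" for k
  have [measurable]: "I k \<in> sets borel" for k unfolding I_def by measurable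
  define a where "a k = (if k \<ge> m then exp (exp (b' * (real k + 1))) * measure \<mu> (I k) else 0)" for k
  have a0: "0 \<le> a k" for k by (simp add: a_def)
  have sum_a: "summable a"
  proof (rule summable_comparison_test_ev)
    show "summable (\<lambda>k. exp (- b / 2) ^ k)" using b b0 by (intro summable_geometric) auto
    show "\<forall>\<^sub>F k in sequentially. norm (a k) \<le> exp (- b / 2) ^ k"
      \<comment> \<open>From this index on \<open>exp (b' * (k + 1))\<close> is at most half of
        \<open>exp (b * k)\<close>, which leaves terms below a geometric sequence.\<close>
      using eventually_ge_at_top[of "nat \<lceil>(b' + ln 2) / (b - b')\<rceil>"]
    proof eventually_elim
      case (elim k)
      then have "(b' + ln 2) / (b - b') \<le> real k" by linarith
      then have "b' * (real k + 1) + ln 2 \<le> b * real k" using b' by (simp add: pos_divide_le_eq algebra_simps)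
      then have "exp (b' * (real k + 1) + ln 2) \<le> exp (b * real k)" by simp
      then have le: "2 * exp (b' * (real k + 1)) \<le> exp (b * real k)" by (simp add: exp_add mult.commute)
      have "b * real k \<le> exp (b * real k)" using exp_ge_add_one_self[of "b * real k"] by linarith
      show ?case
      proof (cases "k \<ge> m")
        case True
        have "a k \<le> exp (exp (b' * (real k + 1))) * exp (- exp (b * real k))"
          unfolding a_def using True small[OF True] by (auto simp: I_def)
        also have "\<dots> = exp (exp (b' * (real k + 1)) - exp (b * real k))" by (simp add: exp_diff exp_minus divide_inverse)
        also have "\<dots> \<le> exp (real k * (- b / 2))"
          using le \<open>b * real k \<le> exp (b * real k)\<close> by (simp add: field_simps)
        also have "\<dots> = exp (- b / 2) ^ k" by (rule exp_of_nat_mult)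
        finally show ?thesis using a0[of k] by simp
      qed (simp add: a_def)
    qed
  qed
  have pt: "ennreal (exp (exp (\<sigma> * b' * x))) \<le> ennreal (exp (exp (b' * real m))) +
      (\<Sum>k. ennreal (if k \<ge> m then exp (exp (b' * (real k + 1))) else 0) * indicator (I k) x)" for x
  proof (cases "\<sigma> * x < real m")
    case True
    have "\<sigma> * b' * x = b' * (\<sigma> * x)" by simp
    also have "\<dots> \<le> b' * real m" using True b' by (intro mult_left_mono) auto
    finally have "ennreal (exp (exp (\<sigma> * b' * x))) \<le> ennreal (exp (exp (b' * real m)))" by (intro ennreal_leI) simp
    then show ?thesis by (rule add_increasing2[rotated]) simp
  next
    case False
    define k where "k = nat \<lfloor>\<sigma> * x\<rfloor>"
    have sx: "0 \<le> \<sigma> * x" using False by linarith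
    have k: "real k \<le> \<sigma> * x" "\<sigma> * x < real k + 1" "k \<ge> m"
      using nat_floor_bounds[OF sx] False by (auto simp: k_def le_nat_floor)
    let ?t = "\<lambda>k. ennreal (if k \<ge> m then exp (exp (b' * (real k + 1))) else 0) * indicator (I k) x"
    have "\<sigma> * b' * x = b' * (\<sigma> * x)" by simp
    also have "\<dots> \<le> b' * (real k + 1)" using k b' by (intro mult_left_mono) auto
    finally have "exp (exp (\<sigma> * b' * x)) \<le> exp (exp (b' * (real k + 1)))" by simp
    moreover have "indicator (I k) x = (1::ennreal)" using k by (simp add: I_def)
    ultimately have "ennreal (exp (exp (\<sigma> * b' * x))) \<le> ?t k" using k(3) by (simp add: ennreal_leI del: exp_le_cancel_iff)
    also have "\<dots> \<le> (\<Sum>k. ?t k)" by (rule ennreal_le_suminf)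
    finally show ?thesis by (rule add_increasing[rotated]) simp
  qed
  have "dexp \<mu> (\<sigma> * b') \<le> (\<integral>\<^sup>+x. ennreal (exp (exp (b' * real m))) +
      (\<Sum>k. ennreal (if k \<ge> m then exp (exp (b' * (real k + 1))) else 0) * indicator (I k) x) \<partial>\<mu>)"
    unfolding dexp_def by (intro nn_integral_mono pt)
  also have "\<dots> = (\<integral>\<^sup>+x. ennreal (exp (exp (b' * real m))) \<partial>\<mu>) +
      (\<integral>\<^sup>+x. (\<Sum>k. ennreal (if k \<ge> m then exp (exp (b' * (real k + 1))) else 0) * indicator (I k) x) \<partial>\<mu>)"
    by (rule nn_integral_add) measurable
  also have "(\<integral>\<^sup>+x. (\<Sum>k. ennreal (if k \<ge> m then exp (exp (b' * (real k + 1))) else 0) * indicator (I k) x) \<partial>\<mu>) =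
      (\<Sum>k. \<integral>\<^sup>+x. ennreal (if k \<ge> m then exp (exp (b' * (real k + 1))) else 0) * indicator (I k) x \<partial>\<mu>)"
    by (rule nn_integral_suminf) measurable
  also have "\<dots> = (\<Sum>k. ennreal (a k))"
  proof (rule suminf_cong)
    fix k
    have "(\<integral>\<^sup>+x. ennreal (if k \<ge> m then exp (exp (b' * (real k + 1))) else 0) * indicator (I k) x \<partial>\<mu>) =
        ennreal (if k \<ge> m then exp (exp (b' * (real k + 1))) else 0) * emeasure \<mu> (I k)"
      by (rule nn_integral_cmult_indicator) simp
    also have "\<dots> = ennreal (a k)"
      by (cases "k \<ge> m") (simp_all add: a_def emeasure_eq_measure ennreal_mult)
    finally show "(\<integral>\<^sup>+x. ennreal (if k \<ge> m then exp (exp (b' * (real k + 1))) else 0) * indicator (I k) x \<partial>\<mu>) = ennreal (a k)" .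
  qed
  also have "(\<Sum>k. ennreal (a k)) = ennreal (suminf a)" by (rule suminf_ennreal2[OF a0 sum_a])
  also have "(\<integral>\<^sup>+x. ennreal (exp (exp (b' * real m))) \<partial>\<mu>) = ennreal (exp (exp (b' * real m)))"
    using emeasure_space_1 by simp
  finally have "dexp \<mu> (\<sigma> * b') < \<infinity>" by (rule le_less_trans) simp
  then show False using inf[OF b'(1)] by simp
qed

lemma divide_divide_cancel: "1 \<le> s \<Longrightarrow> c / s / W * s = c / W" for s :: real
  by simp

text \<open>\<mu> is conditioned on one band for each \<open>j\<close>, at entropy at most
  \<open>s j\<close>, and the weights, proportional to \<open>2^(-j) / s j\<close>, make the total
  entropy finite. At \<open>b\<close> the band contributes about
  \<open>2^(-j) * exp ((b - B j) * K j)\<close>: for \<open>b < \<beta>\<close> this is summable,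
  and for \<open>b > \<beta>\<close> the choice \<open>K j \<ge> j^2\<close> outweighs the factor
  \<open>2^(-j)\<close>.\<close>

lemma half_line_construction:
  fixes \<sigma> :: real
  assumes mu: "real_distribution \<mu>" and b0: "0 \<le> \<beta>" and inf: "\<And>b. \<beta> < b \<Longrightarrow> dexp \<mu> (\<sigma> * b) = \<infinity>"
  shows "\<exists>\<nu> s. real_distribution \<nu> \<and> ent_le \<nu> \<mu> s \<and> (\<forall>b\<le>0. mgf \<nu> (\<sigma> * b) < \<infinity>) \<and>
    (\<forall>b. 0 \<le> b \<longrightarrow> b < \<beta> \<longrightarrow> mgf \<nu> (\<sigma> * b) < \<infinity>) \<and> (\<forall>b>\<beta>. mgf \<nu> (\<sigma> * b) = \<infinity>)"
proof -
  define I where "I k = {x. real k \<le> \<sigma> * x \<and> \<sigma> * x < real k + 1}" for k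
  have [measurable]: "I k \<in> sets borel" for k unfolding I_def by measurable
  \<comment> \<open>Strictly above \<beta>, where the moments are infinite, and tending to it, so
    that every \<open>b > \<beta>\<close> eventually exceeds \<open>B j\<close> by a fixed
    amount.\<close>
  define B where "B j = \<beta> + 1 / (real j + 1)" for j :: nat
  have B: "\<beta> < B j" for j by (simp add: B_def)
  have "\<forall>j::nat. \<exists>k\<ge>j^2. exp (- exp (B j * real k)) \<le> measure \<mu> (I k)"
    using band_mass_lower[OF mu b0 B inf] unfolding I_def by blast
  from choice[OF this] obtain K where K0: "\<forall>j. j^2 \<le> K j \<and> exp (- exp (B j * real (K j))) \<le> measure \<mu> (I (K j))" by blast
  then have K: "j^2 \<le> K j" "exp (- exp (B j * real (K j))) \<le> measure \<mu> (I (K j))" for j by blast+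
  have p: "measure \<mu> (I (K j)) > 0" for j using K(2)[of j] exp_gt_zero[of "- exp (B j * real (K j))"] by linarith
  define N where "N j = uniform_measure \<mu> (I (K j))" for j
  have N: "real_distribution (N j)" for j unfolding N_def by (rule real_distribution_uniform_measure[OF mu _ p]) simp
  define s where "s j = exp (B j * real (K j))" for j
  have ent: "ent_le (N j) \<mu> (s j)" for j
  proof (rule ent_le_mono)
    show "ent_le (N j) \<mu> (- ln (measure \<mu> (I (K j))))" unfolding N_def by (rule ent_le_uniform_measure[OF mu _ p]) simp
    have "ln (exp (- s j)) \<le> ln (measure \<mu> (I (K j)))" using K(2)[of j] p[of j] by (subst ln_le_cancel_iff) (auto simp: s_def)
    then show "- ln (measure \<mu> (I (K j))) \<le> s j" by simp
  qed
  define w where "w j = (1/2) ^ j / s j" for j :: nat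
  have s1: "s j \<ge> 1" for j using B[of j] b0 by (auto simp: s_def)
  have w0: "w j > 0" for j using s1[of j] by (auto simp: w_def)
  have geo: "summable (\<lambda>j. (1/2::real) ^ j)" by (rule summable_geometric) simp
  have wle: "w j \<le> (1/2) ^ j" for j
  proof -
    have "w j \<le> (1/2) ^ j / 1" unfolding w_def using s1[of j] by (intro divide_left_mono) auto
    then show ?thesis by simp
  qed
  have sw: "summable w" by (rule summable_comparison_test[OF _ geo]) (use wle w0 in \<open>auto simp: less_imp_le intro!: exI[of _ 0]\<close>)
  define W where "W = suminf w"
  have W: "W > 0" unfolding W_def by (rule suminf_pos[OF sw w0])
  define P where "P = embed_pmf (\<lambda>j. w j / W)"
  have swW: "(\<lambda>j. w j / W) sums 1" using sums_divide[OF summable_sums[OF sw], of W] W_def less_imp_neq[OF W, symmetric] by (metis divide_self)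
  have wW: "0 \<le> w j / W" for j by (rule divide_nonneg_nonneg[OF less_imp_le[OF w0] less_imp_le[OF W]])
  have pmfP: "pmf P j = w j / W" for j
    unfolding P_def
  proof (rule pmf_embed_pmf)
    show "(\<integral>\<^sup>+j. ennreal (w j / W) \<partial>count_space UNIV) = 1"
      unfolding nn_integral_count_space_nat suminf_ennreal2[OF wW sums_summable[OF swW]] sums_unique[OF swW, symmetric]
      by (rule ennreal_1)
  qed (rule wW)
  have nnP: "(\<integral>\<^sup>+j. g j \<partial>measure_pmf P) = (\<Sum>j. ennreal (w j / W) * g j)" for g
    by (simp add: nn_integral_measure_pmf nn_integral_count_space_nat pmfP)
  have intsP: "(\<integral>\<^sup>+j. ennreal (s j) \<partial>measure_pmf P) < \<infinity>"
  proof -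
    have "(\<integral>\<^sup>+j. ennreal (s j) \<partial>measure_pmf P) = (\<Sum>j. ennreal ((1/2)^j / W))"
      unfolding nnP
    proof (rule suminf_cong)
      fix j
      have a: "w j / W * s j = (1/2)^j / W"
        unfolding w_def by (rule divide_divide_cancel[OF s1])
      have b: "ennreal (w j / W) * ennreal (s j) = ennreal (w j / W * s j)"
        by (rule ennreal_mult[symmetric, OF divide_nonneg_nonneg[OF less_imp_le[OF w0] less_imp_le[OF W]] order_trans[OF zero_le_one s1]])
      show "ennreal (w j / W) * ennreal (s j) = ennreal ((1/2)^j / W)" by (simp only: b a)
    qed
    also have "\<dots> = ennreal (\<Sum>j. (1/2)^j / W)" 
      by (rule suminf_ennreal2[OF divide_nonneg_nonneg[OF _ less_imp_le[OF W]] summable_divide[OF geo]]) simp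
    also have "\<dots> < \<infinity>" unfolding infinity_ennreal_def by (rule ennreal_less_top)
    finally show ?thesis .
  qed
  have sint: "integrable (measure_pmf P) s"
    by (rule integrableI_nonneg[OF _ _ intsP]) (simp_all add: s_def)
  define \<nu> where "\<nu> = cmix P N"
  have rd: "real_distribution \<nu>" unfolding \<nu>_def by (rule real_distribution_cmix[OF N])
  have e: "ent_le \<nu> \<mu> (\<integral>j. s j \<partial>measure_pmf P)" unfolding \<nu>_def by (rule ent_le_cmix[OF N ent sint])
  have nn: "(\<integral>\<^sup>+x. ennreal (exp (\<theta> * x)) \<partial>\<nu>) = (\<integral>\<^sup>+j. \<integral>\<^sup>+x. ennreal (exp (\<theta> * x)) \<partial>N j \<partial>measure_pmf P)" for \<theta>
    unfolding \<nu>_def by (rule nn_integral_cmix[OF N]) simp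
  have Nle: "(\<integral>\<^sup>+x. ennreal (exp (\<theta> * x)) \<partial>N j) \<le> c" if "\<And>x. x \<in> I (K j) \<Longrightarrow> ennreal (exp (\<theta> * x)) \<le> c" for \<theta> j c
    unfolding N_def by (rule nn_integral_uniform_measure_bounds(1)[OF mu _ p]) (use that in auto)
  have Nge: "c \<le> (\<integral>\<^sup>+x. ennreal (exp (\<theta> * x)) \<partial>N j)" if "\<And>x. x \<in> I (K j) \<Longrightarrow> c \<le> ennreal (exp (\<theta> * x))" for \<theta> j c
    unfolding N_def by (rule nn_integral_uniform_measure_bounds(2)[OF mu _ p]) (use that in auto)
  have A: "mgf \<nu> (\<sigma> * b) < \<infinity>" if "b \<le> 0" for b
  proof -
    have "(\<integral>\<^sup>+x. ennreal (exp (\<sigma> * b * x)) \<partial>N j) \<le> 1" for j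
    proof (rule Nle)
      fix x assume "x \<in> I (K j)"
      then have "0 \<le> \<sigma> * x" by (auto simp: I_def intro: order_trans[of _ "real (K j)"])
      then have "b * (\<sigma> * x) \<le> 0" using that by (simp add: mult_nonpos_nonneg)
      then show "ennreal (exp (\<sigma> * b * x)) \<le> 1" by (simp add: mult.assoc mult.left_commute)
    qed
    then have "(\<integral>\<^sup>+x. ennreal (exp (\<sigma> * b * x)) \<partial>\<nu>) \<le> (\<integral>\<^sup>+j. 1 \<partial>measure_pmf P)" unfolding nn by (intro nn_integral_mono)
    then have "(\<integral>\<^sup>+x. ennreal (exp (\<sigma> * b * x)) \<partial>\<nu>) < \<infinity>" by (rule le_less_trans) simp
    then show ?thesis unfolding mgf_finite_iff .
  qed
  have Bf: "mgf \<nu> (\<sigma> * b) < \<infinity>" if b: "0 \<le> b" "b < \<beta>" for b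
  proof -
    have "(\<integral>\<^sup>+x. ennreal (exp (\<sigma> * b * x)) \<partial>N j) \<le> ennreal (exp b * s j)" for j
    proof (rule Nle)
      fix x assume "x \<in> I (K j)"
      then have x: "\<sigma> * x \<le> real (K j) + 1" by (simp add: I_def)
      have "\<sigma> * b * x = b * (\<sigma> * x)" by simp
      also have "\<dots> \<le> b * (real (K j) + 1)" using x b by (intro mult_left_mono) auto
      also have "\<dots> = b + b * real (K j)" by (simp add: algebra_simps)
      also have "\<dots> \<le> b + B j * real (K j)" using b B[of j] by (intro add_left_mono mult_right_mono) auto
      finally have "exp (\<sigma> * b * x) \<le> exp b * s j" by (simp add: s_def exp_add[symmetric])
      then show "ennreal (exp (\<sigma> * b * x)) \<le> ennreal (exp b * s j)" by (rule ennreal_leI)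
    qed
    then have "(\<integral>\<^sup>+x. ennreal (exp (\<sigma> * b * x)) \<partial>\<nu>) \<le> (\<integral>\<^sup>+j. ennreal (exp b * s j) \<partial>measure_pmf P)" unfolding nn by (intro nn_integral_mono)
    also have "\<dots> = ennreal (exp b) * (\<integral>\<^sup>+j. ennreal (s j) \<partial>measure_pmf P)"
      by (subst nn_integral_cmult[symmetric]) (simp_all add: ennreal_mult s_def)
    also have "\<dots> < \<infinity>" using intsP by (simp add: ennreal_mult_less_top)
    finally show ?thesis unfolding mgf_finite_iff .
  qed
  have Cf: "mgf \<nu> (\<sigma> * b) = \<infinity>" if b: "\<beta> < b" for b
  proof (rule ccontr)
    assume "mgf \<nu> (\<sigma> * b) \<noteq> \<infinity>"
    then have "mgf \<nu> (\<sigma> * b) < \<infinity>" by simp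
    then have "(\<integral>\<^sup>+x. ennreal (exp (\<sigma> * b * x)) \<partial>\<nu>) < \<infinity>" unfolding mgf_finite_iff .
    then obtain M where M: "M \<ge> 0" "(\<integral>\<^sup>+x. ennreal (exp (\<sigma> * b * x)) \<partial>\<nu>) = ennreal M"
      by (cases "\<integral>\<^sup>+x. ennreal (exp (\<sigma> * b * x)) \<partial>\<nu>") auto
    define d where "d = (b - \<beta>) / 2"
    have d: "d > 0" using b by (simp add: d_def)
    \<comment> \<open>The three terms ensure in turn that \<open>b - B j \<ge> d\<close>, that the
      exponent is at least \<open>j\<close>, and that \<open>j\<close> is at least
      \<open>(M + 1) * W\<close>.\<close>
    define j where "j = nat \<lceil>1 / d + (1 + ln 2) / d + (M + 1) * W\<rceil>"
    have jr: "1 / d + (1 + ln 2) / d + (M + 1) * W \<le> real j" unfolding j_def by linarith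
    have pos3: "0 \<le> 1 / d" "0 \<le> (1 + ln 2) / d" "0 \<le> (M + 1) * W" using d W M by auto
    have j: "1 / d \<le> real j" "(1 + ln 2) / d \<le> real j" "(M + 1) * W \<le> real j" using jr pos3 by linarith+
    have "1 / (real j + 1) \<le> d" using j(1) d by (simp add: field_simps)
    then have "d \<le> b - B j" by (simp add: B_def d_def field_simps)
    have "ennreal (exp (b * real (K j))) \<le> (\<integral>\<^sup>+x. ennreal (exp (\<sigma> * b * x)) \<partial>N j)"
    proof (rule Nge)
      fix x assume "x \<in> I (K j)"
      then have "b * real (K j) \<le> b * (\<sigma> * x)" using b b0 by (intro mult_left_mono) (auto simp: I_def)
      then show "ennreal (exp (b * real (K j))) \<le> ennreal (exp (\<sigma> * b * x))" by (intro ennreal_leI) (simp add: mult.assoc mult.left_commute)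
    qed
    then have "ennreal (w j / W) * ennreal (exp (b * real (K j))) \<le> ennreal (w j / W) * (\<integral>\<^sup>+x. ennreal (exp (\<sigma> * b * x)) \<partial>N j)"
      by (intro mult_left_mono) auto
    also have "\<dots> \<le> (\<Sum>j. ennreal (w j / W) * (\<integral>\<^sup>+x. ennreal (exp (\<sigma> * b * x)) \<partial>N j))"
      by (rule ennreal_le_suminf)
    also have "\<dots> = ennreal M" unfolding M(2)[symmetric] nn nnP ..
    finally have "ennreal (w j / W * exp (b * real (K j))) \<le> ennreal M"
      using w0[of j] W by (subst ennreal_mult) (auto simp: less_imp_le)
    then have le: "w j / W * exp (b * real (K j)) \<le> M" using M(1) by (simp add: ennreal_le_iff)
    have "w j * exp (b * real (K j)) = (1/2)^j * exp ((b - B j) * real (K j))"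
      by (simp add: w_def s_def left_diff_distrib exp_diff)
    also have "(1/2::real)^j = exp (- (real j * ln 2))" by (simp add: exp_minus exp_of_nat_mult power_one_over inverse_eq_divide)
    also have "exp (- (real j * ln 2)) * exp ((b - B j) * real (K j)) = exp ((b - B j) * real (K j) - real j * ln 2)"
      by (simp add: exp_add[symmetric])
    finally have weq: "w j * exp (b * real (K j)) = exp ((b - B j) * real (K j) - real j * ln 2)" .
    have "real j ^ 2 \<le> real (K j)" using K(1)[of j] by (metis of_nat_le_iff of_nat_power)
    then have "d * real j ^ 2 \<le> (b - B j) * real (K j)" using \<open>d \<le> b - B j\<close> d by (intro mult_mono) auto
    moreover have "real j * (1 + ln 2) \<le> real j * (d * real j)"
      using j(2) d by (intro mult_left_mono) (auto simp: pos_divide_le_eq mult.commute)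
    ultimately have "real j \<le> (b - B j) * real (K j) - real j * ln 2" by (simp add: algebra_simps power2_eq_square)
    also have "\<dots> < exp ((b - B j) * real (K j) - real j * ln 2)"
      using exp_ge_add_one_self[of "(b - B j) * real (K j) - real j * ln 2"] by linarith
    finally have "(M + 1) * W < w j * exp (b * real (K j))" using j(3) weq by linarith
    then have "M + 1 < w j / W * exp (b * real (K j))" using W by (simp add: pos_less_divide_eq)
    then show False using le by simp
  qed
  show ?thesis using rd e A Bf Cf by blast
qed

text \<open>Serves a direction in which \<open>f\<close> is finite on the whole half-line, so that
  nothing is to be truncated.\<close>

lemma bounded_conditioning:
  assumes mu: "real_distribution \<mu>"
  shows "\<exists>\<nu> s. real_distribution \<nu> \<and> ent_le \<nu> \<mu> s \<and> (\<forall>\<theta>. mgf \<nu> \<theta> < \<infinity>)"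
proof -
  interpret real_distribution \<mu> by fact
  have "(\<lambda>n. measure \<mu> {- real n..real n}) \<longlonglongrightarrow> measure \<mu> (\<Union>n. {- real n..real n})"
    by (rule finite_Lim_measure_incseq) (auto simp: incseq_def)
  also have "(\<Union>n. {- real n..real n}) = (UNIV :: real set)"
  proof -
    have "\<exists>n. - real n \<le> x \<and> x \<le> real n" for x :: real
      using real_arch_simple[of "\<bar>x\<bar>"] by (auto simp: abs_le_iff) (metis minus_le_iff)
    then show ?thesis by auto
  qed
  finally have "(\<lambda>n. measure \<mu> {- real n..real n}) \<longlonglongrightarrow> 1" using prob_space by simp
  then have "\<forall>\<^sub>F n in sequentially. 0 < measure \<mu> {- real n..real n}" by (rule order_tendstoD) simp
  then obtain n where p: "0 < measure \<mu> {- real n..real n}" using eventually_happens'[OF sequentially_bot] by blast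
  let ?A = "{- real n..real n}"
  have "mgf (uniform_measure \<mu> ?A) \<theta> < \<infinity>" for \<theta>
  proof -
    have "(\<integral>\<^sup>+x. ennreal (exp (\<theta> * x)) \<partial>uniform_measure \<mu> ?A) \<le> ennreal (exp (\<bar>\<theta>\<bar> * real n))"
    proof (rule nn_integral_uniform_measure_bounds(1)[OF mu _ p])
      fix x assume "x \<in> ?A"
      then have "\<bar>\<theta> * x\<bar> \<le> \<bar>\<theta>\<bar> * real n" unfolding abs_mult by (intro mult_left_mono) auto
      then show "ennreal (exp (\<theta> * x)) \<le> ennreal (exp (\<bar>\<theta>\<bar> * real n))" by (intro ennreal_leI) simp
    qed simp_all
    then have "(\<integral>\<^sup>+x. ennreal (exp (\<theta> * x)) \<partial>uniform_measure \<mu> ?A) < \<infinity>" by (rule le_less_trans) simp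
    then show ?thesis unfolding mgf_finite_iff .
  qed
  then show ?thesis using real_distribution_uniform_measure[OF mu _ p] ent_le_uniform_measure[OF mu _ p] by auto
qed

text \<open>Domains are compared up to a factor \<open>t < 1\<close>, since the construction decides
  nothing at the end point itself. Opposite to \<sigma> the law has all exponential moments, so that
  the two directions can be treated one at a time.\<close>

lemma directional_construction:
  fixes \<sigma> :: real
  assumes mu: "real_distribution \<mu>" and f: "f \<in> XM" and adm: "admissible \<mu> f"
  shows "\<exists>\<nu> s. real_distribution \<nu> \<and> ent_le \<nu> \<mu> s \<and> (\<forall>b\<le>0. mgf \<nu> (\<sigma> * b) < \<infinity>) \<and>
    (\<forall>b t. 0 \<le> b \<longrightarrow> 0 \<le> t \<longrightarrow> t < 1 \<longrightarrow> f (\<sigma> * b) < \<infinity> \<longrightarrow> mgf \<nu> (t * (\<sigma> * b)) < \<infinity>) \<and>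
    (\<forall>b t. 0 \<le> b \<longrightarrow> 0 \<le> t \<longrightarrow> t < 1 \<longrightarrow> mgf \<nu> (\<sigma> * b) < \<infinity> \<longrightarrow> f (t * (\<sigma> * b)) < \<infinity>)"
proof (cases "\<exists>b>0. f (\<sigma> * b) = \<infinity>")
  case False
  have "f (t * (\<sigma> * b)) < \<infinity>" if "0 \<le> b" "0 \<le> t" for b t
  proof (cases "t * b = 0")
    case True
    then have eq: "t * (\<sigma> * b) = 0" by (auto simp del: mult_eq_0_iff simp: mult.left_commute)
    show ?thesis unfolding eq using XM_0[OF f] by simp
  next
    case F: False
    then have "f (\<sigma> * (t * b)) \<noteq> \<infinity>" using False that by (metis less_eq_real_def mult_nonneg_nonneg)
    then show ?thesis by (simp add: mult.left_commute)
  qed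
  then show ?thesis using bounded_conditioning[OF mu] by blast
next
  case True
  then obtain b1 where b1: "b1 > 0" "f (\<sigma> * b1) = \<infinity>" by blast
  define S where "S = {b. 0 \<le> b \<and> f (\<sigma> * b) < \<infinity>}"
  have S0: "0 \<in> S" using XM_0[OF f] by (simp add: S_def)
  have down: "b' \<in> S" if "b \<in> S" "0 \<le> b'" "b' \<le> b" for b b'
  proof (cases "b = 0")
    case False
    have "f (b' / b * (\<sigma> * b)) < \<infinity>"
      by (rule XM_scale_finite[OF f, of "\<sigma> * b" "b' / b"]) (use that False in \<open>auto simp: S_def\<close>)
    then show ?thesis using False that by (simp add: S_def mult.commute)
  qed (use that S0 in auto)
  have Sb: "b < b1" if "b \<in> S" for b
  proof (rule ccontr)
    assume "\<not> b < b1"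
    then have "b1 \<in> S" using down[OF that, of b1] b1 by simp
    then show False using b1 by (simp add: S_def)
  qed
  then have bdd: "bdd_above S" by (intro bdd_aboveI[of _ b1]) (simp add: less_imp_le)
  define \<beta> where "\<beta> = Sup S"
  have \<beta>0: "0 \<le> \<beta>" unfolding \<beta>_def by (rule cSup_upper[OF S0 bdd])
  have above: "b \<notin> S" if "\<beta> < b" for b using cSup_upper[OF _ bdd, of b] that by (auto simp: \<beta>_def)
  have below: "b \<in> S" if b: "0 \<le> b" "b < \<beta>" for b
  proof -
    obtain b' where "b' \<in> S" "b < b'" using less_cSup_iff[OF _ bdd, of b] S0 b unfolding \<beta>_def by blast
    then show ?thesis using down b by simp
  qed
  have inf: "dexp \<mu> (\<sigma> * b) = \<infinity>" if b: "\<beta> < b" for b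
  proof -
    \<comment> \<open>An intermediate point, since \<open>f\<close> may be finite at the end point
      and admissibility asks for a factor above 1.\<close>
    define b' where "b' = (\<beta> + b) / 2"
    have b': "\<beta> < b'" "b' < b" "0 < b'" using b \<beta>0 by (auto simp: b'_def)
    have "f (\<sigma> * b') = \<infinity>" using above[OF b'(1)] b' by (auto simp: S_def)
    moreover have "1 < b / b'" using b' by simp
    ultimately have "dexp \<mu> (b / b' * (\<sigma> * b')) = \<infinity>" using adm unfolding admissible_def by blast
    then show ?thesis using b' by (simp add: mult.commute)
  qed
  obtain \<nu> s where nu: "real_distribution \<nu>" "ent_le \<nu> \<mu> s" "\<forall>b\<le>0. mgf \<nu> (\<sigma> * b) < \<infinity>"
    "\<forall>b. 0 \<le> b \<longrightarrow> b < \<beta> \<longrightarrow> mgf \<nu> (\<sigma> * b) < \<infinity>" "\<forall>b>\<beta>. mgf \<nu> (\<sigma> * b) = \<infinity>"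
    using half_line_construction[OF mu \<beta>0 inf] by blast
  have 1: "mgf \<nu> (t * (\<sigma> * b)) < \<infinity>" if b: "0 \<le> b" "0 \<le> t" "t < 1" "f (\<sigma> * b) < \<infinity>" for b t
  proof -
    have "b \<le> \<beta>" using above[of b] b by (force simp: S_def)
    show ?thesis
    proof (cases "b = 0")
      case True then show ?thesis using nu(3)[rule_format, of 0] by simp
    next
      case False
      then have "t * b < \<beta>" using b \<open>b \<le> \<beta>\<close> by (smt (verit) mult_less_cancel_right2)
      then have "mgf \<nu> (\<sigma> * (t * b)) < \<infinity>" using nu(4) b by (meson mult_nonneg_nonneg)
      then show ?thesis by (simp add: mult.left_commute)
    qed
  qed
  have 2: "f (t * (\<sigma> * b)) < \<infinity>" if b: "0 \<le> b" "0 \<le> t" "t < 1" "mgf \<nu> (\<sigma> * b) < \<infinity>" for b t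
  proof -
    have "b \<le> \<beta>" using nu(5) b by (force simp: not_le)
    show ?thesis
    proof (cases "b = 0")
      case True then show ?thesis using XM_0[OF f] by simp
    next
      case False
      then have "t * b < \<beta>" using b \<open>b \<le> \<beta>\<close> by (smt (verit) mult_less_cancel_right2)
      then have "t * b \<in> S" using below b by simp
      then show ?thesis by (simp add: S_def mult.left_commute)
    qed
  qed
  show ?thesis using nu 1 2 by blast
qed

text \<open>A mixture with positive weights is finite exactly where both components are, and each
  directional law is finite on the half-line of the other.\<close>

lemma same_domain_construction:
  assumes mu: "real_distribution \<mu>" and f: "f \<in> XM" and adm: "admissible \<mu> f"
  obtains \<nu> s where "real_distribution \<nu>" "ent_le \<nu> \<mu> s"
    "\<And>\<theta> t. f \<theta> < \<infinity> \<Longrightarrow> 0 \<le> t \<Longrightarrow> t < 1 \<Longrightarrow> mgf \<nu> (t * \<theta>) < \<infinity>"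
    "\<And>\<theta> t. mgf \<nu> \<theta> < \<infinity> \<Longrightarrow> 0 \<le> t \<Longrightarrow> t < 1 \<Longrightarrow> f (t * \<theta>) < \<infinity>"
proof -
  obtain \<nu>1 s1 where 1: "real_distribution \<nu>1" "ent_le \<nu>1 \<mu> s1" "\<And>b. b \<le> 0 \<Longrightarrow> mgf \<nu>1 (1 * b) < \<infinity>"
    "\<And>b t. 0 \<le> b \<Longrightarrow> 0 \<le> t \<Longrightarrow> t < 1 \<Longrightarrow> f (1 * b) < \<infinity> \<Longrightarrow> mgf \<nu>1 (t * (1 * b)) < \<infinity>"
    "\<And>b t. 0 \<le> b \<Longrightarrow> 0 \<le> t \<Longrightarrow> t < 1 \<Longrightarrow> mgf \<nu>1 (1 * b) < \<infinity> \<Longrightarrow> f (t * (1 * b)) < \<infinity>"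
    using directional_construction[OF mu f adm, of 1] by blast
  obtain \<nu>2 s2 where 2: "real_distribution \<nu>2" "ent_le \<nu>2 \<mu> s2" "\<And>b. b \<le> 0 \<Longrightarrow> mgf \<nu>2 (- 1 * b) < \<infinity>"
    "\<And>b t. 0 \<le> b \<Longrightarrow> 0 \<le> t \<Longrightarrow> t < 1 \<Longrightarrow> f (- 1 * b) < \<infinity> \<Longrightarrow> mgf \<nu>2 (t * (- 1 * b)) < \<infinity>"
    "\<And>b t. 0 \<le> b \<Longrightarrow> 0 \<le> t \<Longrightarrow> t < 1 \<Longrightarrow> mgf \<nu>2 (- 1 * b) < \<infinity> \<Longrightarrow> f (t * (- 1 * b)) < \<infinity>"
    using directional_construction[OF mu f adm, of "-1"] by blast
  let ?m = "mix (1/2) \<nu>1 \<nu>2"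
  have m: "mgf ?m \<theta> < \<infinity> \<longleftrightarrow> mgf \<nu>1 \<theta> < \<infinity> \<and> mgf \<nu>2 \<theta> < \<infinity>" for \<theta>
    using mgf_mix[OF 1(1) 2(1), of "1/2" \<theta>] mgf_nonneg[of \<nu>1 \<theta>] mgf_nonneg[of \<nu>2 \<theta>]
    by (cases "mgf \<nu>1 \<theta>"; cases "mgf \<nu>2 \<theta>") auto
  show ?thesis
  proof (rule that[OF real_distribution_mix[OF 1(1) 2(1)] ent_le_mix[OF 1(1) 2(1) 1(2) 2(2), of "1/2"]])
    fix \<theta> t :: real assume t: "0 \<le> t" "t < 1"
    {
      assume a: "f \<theta> < \<infinity>"
      show "mgf ?m (t * \<theta>) < \<infinity>"
      proof (cases "0 \<le> \<theta>")
        case True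
        then show ?thesis unfolding m using 1(4)[of \<theta> t] 2(3)[of "- (t * \<theta>)"] a t by simp
      next
        case False
        then show ?thesis unfolding m using 2(4)[of "- \<theta>" t] 1(3)[of "t * \<theta>"] a t by (simp add: mult_nonneg_nonpos)
      qed
    next
      assume a: "mgf ?m \<theta> < \<infinity>"
      show "f (t * \<theta>) < \<infinity>"
      proof (cases "0 \<le> \<theta>")
        case True
        then show ?thesis using 1(5)[of \<theta> t] a t unfolding m by simp
      next
        case False
        then show ?thesis using 2(5)[of "- \<theta>" t] a t unfolding m by simp
      qed
    }
  qed simp_all
qed

section \<open>Neighbourhoods of a moment generating function\<close>

text \<open>The sample points with equal weights, counted with multiplicity. For
  \<open>n = 0\<close> the index set is empty and the law unspecified, hence
  \<open>n \<ge> 1\<close> in the formulas for it.\<close>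

definition emp :: "(nat \<Rightarrow> real) \<Rightarrow> nat \<Rightarrow> real measure" where
  "emp x n = distr (measure_pmf (pmf_of_set {1..n})) borel x"

abbreviation emgf :: "nat \<Rightarrow> (nat \<Rightarrow> real) \<Rightarrow> real \<Rightarrow> ereal" where
  "emgf n x \<equiv> Mn (\<lambda>i x. x i) n x"

section \<open>Empirical moment generating functions and measurability\<close>

lemma Mn_eq_emgf: "Mn X n \<omega> = emgf n (\<lambda>i. X i \<omega>)"
  by (simp add: Mn_def)

lemma real_distribution_emp: "real_distribution (emp x n)"
  unfolding emp_def by (rule prob_space.real_distribution_distr[OF prob_space_measure_pmf]) simp

lemma integral_emp:
  fixes \<phi> :: "real \<Rightarrow> real"
  assumes "n \<ge> 1" "\<phi> \<in> borel_measurable borel"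
  shows "(\<integral>y. \<phi> y \<partial>emp x n) = (\<Sum>i\<in>{1..n}. \<phi> (x i)) / real n"
  using assms unfolding emp_def by (subst integral_distr) (auto simp: integral_pmf_of_set)

lemma mgf_emp: "n \<ge> 1 \<Longrightarrow> mgf (emp x n) = emgf n x"
proof
  fix \<theta> assume n: "n \<ge> 1"
  interpret real_distribution "emp x n" by (rule real_distribution_emp)
  have "integrable (emp x n) (\<lambda>y. exp (\<theta> * y))"
    unfolding emp_def using n by (subst integrable_distr_eq) (auto intro!: integrable_measure_pmf_finite)
  then show "mgf (emp x n) \<theta> = emgf n x \<theta>"
    using mgf_eq_integral(2)[OF mgf_finiteI] n by (simp add: integral_emp Mn_def)
qed

lemma emgf_in_XM: "n \<ge> 1 \<Longrightarrow> emgf n x \<in> XM"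
  using mgf_in_XM[OF real_distribution_emp, of x n] mgf_emp by simp

text \<open>By continuity in the argument a rational one suffices, so the event is a countable union
  of measurable conditions on the sample.\<close>

lemma epi_dist_emgf_less_iff:
  assumes n: "n \<ge> 1"
  shows "epi_dist (emgf n x) p < r \<longleftrightarrow> (\<exists>q::rat. \<bar>fst p - of_rat q\<bar> < r \<and> (1 / real n) * (\<Sum>i\<in>{1..n}. exp (of_rat q * x i)) < snd p + r)"
    (is "?L \<longleftrightarrow> ?R")
proof -
  let ?M = "\<lambda>\<theta>. (1 / real n) * (\<Sum>i\<in>{1..n}. exp (\<theta> * x i))"
  have "(0, ?M 0) \<in> epi (emgf n x)" by (simp add: epi_def Mn_def)
  then have ne: "epi (emgf n x) \<noteq> {}" by blast
  show ?thesis
  proof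
    assume ?L
    then obtain \<theta> b where y: "?M \<theta> \<le> b" "\<bar>fst p - \<theta>\<bar> < r" "\<bar>snd p - b\<bar> < r"
      unfolding epi_dist_less_iff[OF ne] by (auto simp: epi_def Mn_def box_dist_def)
    have "isCont ?M \<theta>" by (intro continuous_intros)
    then have "(?M \<longlongrightarrow> ?M \<theta>) (nhds \<theta>)" using tendsto_at_iff_tendsto_nhds[of ?M \<theta>] by (simp only: isCont_def)
    then have "\<forall>\<^sub>F t in nhds \<theta>. ?M t < snd p + r" by (rule order_tendstoD(2)) (use y in linarith)
    moreover have "\<forall>\<^sub>F t in nhds \<theta>. \<bar>fst p - t\<bar> < r"
      by (rule order_tendstoD(2)[of "\<lambda>t. \<bar>fst p - t\<bar>" "\<bar>fst p - \<theta>\<bar>"]) (use y in \<open>auto intro!: tendsto_intros filterlim_ident\<close>)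
    ultimately have "\<forall>\<^sub>F t in nhds \<theta>. ?M t < snd p + r \<and> \<bar>fst p - t\<bar> < r" by eventually_elim blast
    then obtain d where d: "d > 0" "\<forall>t. dist t \<theta> < d \<longrightarrow> ?M t < snd p + r \<and> \<bar>fst p - t\<bar> < r"
      unfolding eventually_nhds_metric by blast
    obtain q where "q \<in> \<rat>" "\<theta> < q" "q < \<theta> + d" using Rats_dense_in_real[of \<theta> "\<theta> + d"] d(1) by auto
    then show ?R using d(2)[rule_format, of q] by (auto simp: dist_real_def Rats_def)
  next
    assume ?R
    then obtain q :: rat where q: "\<bar>fst p - of_rat q\<bar> < r" "?M (of_rat q) < snd p + r" by blast
    have "(of_rat q, max (?M (of_rat q)) (snd p)) \<in> epi (emgf n x)" by (simp add: epi_def Mn_def)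
    moreover have "box_dist p (of_rat q, max (?M (of_rat q)) (snd p)) < r" using q by (auto simp: box_dist_def max_def)
    ultimately show ?L unfolding epi_dist_less_iff[OF ne] by blast
  qed
qed

text \<open>Measurability is checked in the countable product of distances from rational points:
  \<open>U\<close> is the trace of an open set \<open>W\<close> of that product, built from the
  metric balls inside \<open>U\<close>.\<close>

lemma Mn_vimage_measurable:
  fixes X :: "nat \<Rightarrow> 'a \<Rightarrow> real"
  assumes n: "n \<ge> 1" and X: "\<And>i. i \<in> {1..n} \<Longrightarrow> X i \<in> borel_measurable M" and U: "openin (AW_top XM) U"
  shows "Mn X n -` U \<inter> space M \<in> sets M"
proof -
  interpret Metric_space XM aw_dist by (rule epi_sep_Metric_space[OF epi_sep_XM])
  have [measurable]: "(\<lambda>\<omega>. (1 / real n) * (\<Sum>i\<in>{1..n}. exp (\<theta> * X i \<omega>))) \<in> borel_measurable M" for \<theta>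
    using X by (intro borel_measurable_times borel_measurable_sum borel_measurable_exp borel_measurable_const) auto
  have c: "(\<lambda>\<omega>. epi_dist (Mn X n \<omega>) p) \<in> borel_measurable M" for p
  proof (rule borel_measurable_iff_less[THEN iffD2, rule_format])
    fix r
    show "{\<omega> \<in> space M. epi_dist (Mn X n \<omega>) p < r} \<in> sets M"
      unfolding Mn_eq_emgf[of X] epi_dist_emgf_less_iff[OF n] by measurable
  qed
  have m: "(\<lambda>\<omega>. epi_coord (Mn X n \<omega>)) \<in> borel_measurable M"
    by (rule measurable_coordinatewise_then_product) (simp add: epi_coord_def c)
  define W where "W = (\<Union>(f, r)\<in>{(f, r). f \<in> U \<and> r > 0 \<and> mball f r \<subseteq> U}. ball (epi_coord f) r)"
  have "open W" unfolding W_def by (intro open_UN ballI) (simp add: case_prod_beta)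
  have UXM: "U \<subseteq> XM" and balls: "\<And>f. f \<in> U \<Longrightarrow> \<exists>r>0. mball f r \<subseteq> U"
    using U unfolding AW_top_eq_mtopology[OF epi_sep_XM] openin_mtopology by blast+
  have "Mn X n \<omega> \<in> U \<longleftrightarrow> epi_coord (Mn X n \<omega>) \<in> W" for \<omega>
  proof
    assume "Mn X n \<omega> \<in> U"
    with balls obtain r where "r > 0" "mball (Mn X n \<omega>) r \<subseteq> U" by blast
    with \<open>Mn X n \<omega> \<in> U\<close> show "epi_coord (Mn X n \<omega>) \<in> W" 
      unfolding W_def by (intro UN_I[of "(Mn X n \<omega>, r)"]) simp_all
  next
    assume "epi_coord (Mn X n \<omega>) \<in> W"
    then obtain f r where f: "f \<in> U" "mball f r \<subseteq> U" "dist (epi_coord f) (epi_coord (Mn X n \<omega>)) < r" by (auto simp: W_def)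
    have "Mn X n \<omega> \<in> XM" unfolding Mn_eq_emgf[of X] by (rule emgf_in_XM[OF n])
    then have "Mn X n \<omega> \<in> mball f r" using f UXM unfolding in_mball aw_dist_def by blast
    then show "Mn X n \<omega> \<in> U" using f by blast
  qed
  then have "Mn X n -` U \<inter> space M = (\<lambda>\<omega>. epi_coord (Mn X n \<omega>)) -` W \<inter> space M" by auto
  then show ?thesis using measurable_sets[OF m] \<open>open W\<close> by simp
qed

lemma Mn_measurable:
  fixes X :: "nat \<Rightarrow> 'a \<Rightarrow> real"
  assumes n: "n \<ge> 1" and X: "\<And>i. i \<in> {1..n} \<Longrightarrow> X i \<in> borel_measurable M"
  shows "Mn X n \<in> measurable M (borel_of_top (AW_top XM))"
proof (rule measurable_borel_of_top)
  show "Mn X n \<omega> \<in> topspace (AW_top XM)" for \<omega>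
    using emgf_in_XM[OF n] by (simp add: AW_top_topspace[OF epi_sep_XM] Mn_eq_emgf[of X])
qed (rule Mn_vimage_measurable[OF n X])

text \<open>By metrisability, a property that cannot fail all along a sequence converging to
  \<open>f\<close> holds on a neighbourhood of \<open>f\<close>.\<close>

lemma AW_nbhd_seq:
  assumes S: "epi_sep S" and f: "f \<in> S"
    and Q: "\<And>g. (\<And>n. g n \<in> S) \<Longrightarrow> (\<And>n. \<not> Q (g n)) \<Longrightarrow> epi_conv g f \<Longrightarrow> False"
  shows "\<exists>U. openin (AW_top S) U \<and> f \<in> U \<and> (\<forall>g\<in>U. Q g)"
proof (rule ccontr)
  interpret Metric_space S aw_dist by (rule epi_sep_Metric_space[OF S])
  assume no: "\<not> ?thesis"
  have "\<forall>n. \<exists>g. g \<in> mball f (1 / real (Suc n)) \<and> \<not> Q g"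
  proof
    fix n
    have "openin (AW_top S) (mball f (1 / real (Suc n)))" unfolding AW_top_eq_mtopology[OF S] by (rule openin_mball)
    moreover have "f \<in> mball f (1 / real (Suc n))" using f by (rule centre_in_mball_iff[THEN iffD2, OF conjI]) simp
    ultimately show "\<exists>g. g \<in> mball f (1 / real (Suc n)) \<and> \<not> Q g" using no by blast
  qed
  from choice[OF this] obtain g where g: "\<forall>n. g n \<in> mball f (1 / real (Suc n)) \<and> \<not> Q (g n)" by blast
  then have gS: "g n \<in> S" and gd: "aw_dist f (g n) < 1 / real (Suc n)" for n unfolding in_mball by blast+
  have "(\<lambda>n. aw_dist (g n) f) \<longlonglongrightarrow> 0"
  proof (rule tendsto_sandwich[OF _ _ tendsto_const LIMSEQ_inverse_real_of_nat])
    show "\<forall>\<^sub>F n in sequentially. 0 \<le> aw_dist (g n) f" by simp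
    show "\<forall>\<^sub>F n in sequentially. aw_dist (g n) f \<le> inverse (real (Suc n))"
      using gd by (intro always_eventually) (simp add: commute inverse_eq_divide less_imp_le)
  qed
  moreover have "epi f \<noteq> {}" "epi (g n) \<noteq> {}" for n using S f gS by (auto simp: epi_sep_def)
  ultimately have "epi_conv g f" using epi_conv_iff by blast
  then show False using Q gS g by blast
qed

section \<open>Compact sets and basic neighbourhoods\<close>

lemma AW_open_eventually:
  assumes S: "epi_sep S" and G: "openin (AW_top S) G" "f \<in> G" and g: "\<And>n. g n \<in> S" "epi_conv g f"
  shows "\<forall>\<^sub>F n in sequentially. g n \<in> G"
proof -
  have "f \<in> S" using openin_subset[OF G(1)] G(2) AW_top_topspace[OF S] by blast
  then have "limitin (AW_top S) g f sequentially" using AW_limitin[OF S, of g f] g by blast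
  then show ?thesis using G unfolding limitin_def by blast
qed

lemma epi_conv_unique:
  assumes S: "epi_sep S" and g: "\<And>n. g n \<in> S" and f: "f \<in> S" "f' \<in> S" and "epi_conv g f" "epi_conv g f'"
  shows "f = f'"
proof -
  interpret Metric_space S aw_dist by (rule epi_sep_Metric_space[OF S])
  have H: "Hausdorff_space (AW_top S)" unfolding AW_top_eq_mtopology[OF S] by (rule Hausdorff_space_mtopology)
  show ?thesis
    by (rule limitin_Hausdorff_unique[OF _ _ sequentially_bot H, of g])
       (use assms AW_limitin[OF S, of g f] AW_limitin[OF S, of g f'] in blast)+
qed

lemma epi_conv_subseq:
  assumes g: "epi_conv g f" and r: "strict_mono r" shows "epi_conv (g \<circ> r) f"
  unfolding epi_conv_def comp_def
proof (intro conjI ballI allI impI)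
  fix y and e :: real assume "y \<in> epi f" "e > 0"
  then have "\<forall>\<^sub>F n in sequentially. \<exists>z\<in>epi (g n). box_dist y z < e" using g by (simp add: epi_conv_def)
  then show "\<forall>\<^sub>F n in sequentially. \<exists>z\<in>epi (g (r n)). box_dist y z < e" by (rule eventually_subseq[OF r])
next
  fix y assume "y \<notin> closure (epi f)"
  then obtain e where e: "e > 0" "\<forall>\<^sub>F n in sequentially. \<forall>z\<in>epi (g n). e \<le> box_dist y z"
    using g unfolding epi_conv_def by blast
  show "\<exists>e>0. \<forall>\<^sub>F n in sequentially. \<forall>z\<in>epi (g (r n)). e \<le> box_dist y z"
    using e(1) eventually_subseq[OF r e(2)] by blast
qed

text \<open>The compact sets behind exponential tightness: empirical functions leave them with
  exponentially small probability.\<close>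

lemma tight_class_compact:
  "compactin (AW_top XM) {f \<in> XM. \<exists>\<nu>. tight_class k c \<nu> \<and> matches f \<nu>}"
  unfolding AW_compactin_iff[OF epi_sep_XM]
proof (intro conjI allI impI)
  fix g :: "nat \<Rightarrow> real \<Rightarrow> ereal" assume "\<forall>n. g n \<in> {f \<in> XM. \<exists>\<nu>. tight_class k c \<nu> \<and> matches f \<nu>}"
  then have g: "g n \<in> XM" and ex: "\<forall>n. \<exists>\<nu>. tight_class k c \<nu> \<and> matches (g n) \<nu>" for n by auto
  from choice[OF ex] obtain \<nu> where nu: "\<forall>n. tight_class k c (\<nu> n) \<and> matches (g n) (\<nu> n)" by blast
  have t: "tight_class k c (\<nu> n)" for n using nu by blast
  have fm: "g n \<theta> = mgf (\<nu> n) \<theta>" if "g n \<theta> < \<infinity>" for n \<theta> using nu that by (simp add: matches_def)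
  obtain r \<nu>' f' where r: "strict_mono r" "tight_class k c \<nu>'" "f' \<in> XM"
    "\<And>\<theta>. f' \<theta> < \<infinity> \<Longrightarrow> f' \<theta> = mgf \<nu>' \<theta>" "epi_conv (g \<circ> r) f'"
    by (rule tight_subsequence[of k c \<nu> g, OF t g(1) fm]) blast+
  have "matches f' \<nu>'" using r(2,4) by (simp add: matches_def tight_class_def)
  then show "\<exists>f\<in>{f \<in> XM. \<exists>\<nu>. tight_class k c \<nu> \<and> matches f \<nu>}. \<exists>r. strict_mono r \<and> epi_conv (g \<circ> r) f"
    using r by blast
qed auto

text \<open>Values at finitely many arguments do not control a function near 0, where
  epi-convergence needs a separate lower bound; interval probabilities supply it. If no finite set
  of conditions sufficed, laws meeting more and more of them outside \<open>G\<close> would converge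
  to \<open>mgf \<nu>\<close>.\<close>

lemma mgf_nbhd_test_functions:
  assumes nu: "real_distribution \<nu>" and G: "openin (AW_top XM) G" "mgf \<nu> \<in> G"
  shows "\<exists>(D :: (real \<times> ereal set) set) (E :: (real \<times> real) set). finite D \<and> finite E \<and>
    (\<forall>(q, V)\<in>D. open V \<and> mgf \<nu> q \<in> V) \<and> (\<forall>(K, c)\<in>E. c < measure \<nu> {-K<..K}) \<and>
    (\<forall>\<kappa>. real_distribution \<kappa> \<longrightarrow> (\<forall>(q, V)\<in>D. mgf \<kappa> q \<in> V) \<longrightarrow> (\<forall>(K, c)\<in>E. c < measure \<kappa> {-K<..K}) \<longrightarrow> mgf \<kappa> \<in> G)"
proof (rule ccontr)
  assume no: "\<not> ?thesis"
  interpret nu: real_distribution \<nu> by fact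
  have "\<forall>q. \<exists>A :: nat \<Rightarrow> ereal set. (\<forall>i. open (A i) \<and> mgf \<nu> q \<in> A i) \<and> (\<forall>V. open V \<longrightarrow> mgf \<nu> q \<in> V \<longrightarrow> (\<exists>i. A i \<subseteq> V))"
  proof
    fix q
    obtain A :: "nat \<Rightarrow> ereal set" where A: "\<And>i. open (A i)" "\<And>i. mgf \<nu> q \<in> A i"
      "\<And>V. open V \<Longrightarrow> mgf \<nu> q \<in> V \<Longrightarrow> eventually (\<lambda>i. A i \<subseteq> V) sequentially"
      by (rule countable_basis_at_decseq[of "mgf \<nu> q"]) blast
    have ex: "\<exists>i. A i \<subseteq> V" if "open V" "mgf \<nu> q \<in> V" for V
      using eventually_happens'[OF sequentially_bot A(3)[OF that]] .
    show "\<exists>A :: nat \<Rightarrow> ereal set. (\<forall>i. open (A i) \<and> mgf \<nu> q \<in> A i) \<and> (\<forall>V. open V \<longrightarrow> mgf \<nu> q \<in> V \<longrightarrow> (\<exists>i. A i \<subseteq> V))"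
      by (intro exI[of _ A] conjI allI impI A(1,2) ex)
  qed
  from choice[OF this] obtain A :: "real \<Rightarrow> nat \<Rightarrow> ereal set" where
    "\<forall>q. (\<forall>i. open (A q i) \<and> mgf \<nu> q \<in> A q i) \<and> (\<forall>V. open V \<longrightarrow> mgf \<nu> q \<in> V \<longrightarrow> (\<exists>i. A q i \<subseteq> V))" ..
  then have A: "open (A q i)" "mgf \<nu> q \<in> A q i" "open V \<Longrightarrow> mgf \<nu> q \<in> V \<Longrightarrow> \<exists>i. A q i \<subseteq> V" for q i V
    by blast+
  have "\<forall>j::nat. \<exists>K>0. 1 - 1 / real (Suc j) < measure \<nu> {-K<..K}"
  proof
    fix j
    obtain k where k: "\<And>J. (\<integral>\<^sup>+x. ennreal (exp (ramp k J x)) \<partial>\<nu>) \<le> ennreal 2" using exists_ramp[OF nu] by blast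
    have "tight_class k (0 + ln 2) \<nu>" by (rule ent_le_tight_class[OF nu nu ent_le_refl[OF nu] k])
    then show "\<exists>K>0. 1 - 1 / real (Suc j) < measure \<nu> {-K<..K}"
      using tight_class_interval[of "1 / real (Suc j)" k "0 + ln 2"] by auto
  qed
  from choice[OF this] obtain K where "\<forall>j::nat. K j > 0 \<and> 1 - 1 / real (Suc j) < measure \<nu> {-K j<..K j}" ..
  then have K: "K j > 0" "1 - 1 / real (Suc j) < measure \<nu> {-K j<..K j}" for j by blast+
  define q where "q i = (of_rat (from_nat i) :: real)" for i
  \<comment> \<open>Stage \<open>m\<close> asks for the first \<open>m\<close> basic neighbourhoods
    at the first \<open>m\<close> rational points, so every single condition is met from some stage
    on.\<close>
  define D where "D m = (\<lambda>(i, j). (q i, A (q i) j)) ` ({..<m} \<times> {..<m})" for m :: nat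
  define E where "E m = (\<lambda>j. (K j, 1 - 1 / real (Suc j))) ` {..<m}" for m
  have "\<forall>m. \<exists>\<kappa>. real_distribution \<kappa> \<and> (\<forall>(q, V)\<in>D m. mgf \<kappa> q \<in> V) \<and> (\<forall>(K, c)\<in>E m. c < measure \<kappa> {-K<..K}) \<and> mgf \<kappa> \<notin> G"
  proof (rule allI, rule ccontr)
    fix m assume "\<nexists>\<kappa>. real_distribution \<kappa> \<and> (\<forall>(q, V)\<in>D m. mgf \<kappa> q \<in> V) \<and> (\<forall>(K, c)\<in>E m. c < measure \<kappa> {-K<..K}) \<and> mgf \<kappa> \<notin> G"
    then have "\<forall>\<kappa>. real_distribution \<kappa> \<longrightarrow> (\<forall>(q, V)\<in>D m. mgf \<kappa> q \<in> V) \<longrightarrow> (\<forall>(K, c)\<in>E m. c < measure \<kappa> {-K<..K}) \<longrightarrow> mgf \<kappa> \<in> G"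
      by blast
    moreover have "finite (D m)" "finite (E m)" by (simp_all add: D_def E_def)
    moreover have "\<forall>(q, V)\<in>D m. open V \<and> mgf \<nu> q \<in> V" using A(1,2) by (auto simp: D_def)
    moreover have "\<forall>(K, c)\<in>E m. c < measure \<nu> {-K<..K}" using K(2) by (auto simp: E_def)
    ultimately show False using no by blast
  qed
  from choice[OF this] obtain \<kappa> where kap: "\<forall>m. real_distribution (\<kappa> m) \<and> (\<forall>(q, V)\<in>D m. mgf (\<kappa> m) q \<in> V) \<and>
    (\<forall>(K, c)\<in>E m. c < measure (\<kappa> m) {-K<..K}) \<and> mgf (\<kappa> m) \<notin> G" ..
  have rd: "real_distribution (\<kappa> m)" and nG: "mgf (\<kappa> m) \<notin> G" for m using kap by auto
  have kD: "mgf (\<kappa> m) (q i) \<in> A (q i) j" if "i < m" "j < m" for i j m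
  proof -
    have "(q i, A (q i) j) \<in> D m" using that by (auto simp: D_def)
    then show ?thesis using kap by blast
  qed
  have kE: "1 - 1 / real (Suc j) < measure (\<kappa> m) {-K j<..K j}" if "j < m" for j m
  proof -
    have "(K j, 1 - 1 / real (Suc j)) \<in> E m" using that by (auto simp: E_def)
    then show ?thesis using kap by blast
  qed
  have "epi_conv (\<lambda>m. mgf (\<kappa> m)) (mgf \<nu>)"
  proof (rule epi_conv_convexI[where z=1 and Q="range q"])
    show "convex_efun (mgf (\<kappa> m))" for m by (rule real_distribution.convex_mgf[OF rd])
    show "mgf (\<kappa> m) 0 = ereal 1" for m using real_distribution.mgf_0[OF rd] by (simp add: one_ereal_def)
    show "mgf \<nu> 0 = ereal 1" using nu.mgf_0 by (simp add: one_ereal_def)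
    show "convex_efun (mgf \<nu>)" "lsc_fun (mgf \<nu>)" by (rule nu.convex_mgf nu.lsc_mgf)+
    show "\<exists>p\<in>range q. a < p \<and> p < b" if "a < b" for a b
    proof -
      obtain p where p: "p \<in> \<rat>" "a < p" "p < b" using rats_dense[OF \<open>a < b\<close>] by blast
      then obtain p' where "p = of_rat p'" by (auto simp: Rats_def)
      then have "p = q (to_nat p')" by (simp add: q_def)
      then show ?thesis using p by blast
    qed
    fix p assume "p \<in> range q"
    then obtain i where p: "p = q i" by blast
    show "(\<lambda>m. mgf (\<kappa> m) p) \<longlonglongrightarrow> mgf \<nu> p"
    proof (rule topological_tendstoI)
      fix V assume "open V" "mgf \<nu> p \<in> V"
      then obtain j where j: "A p j \<subseteq> V" using A(3) by blast
      show "\<forall>\<^sub>F m in sequentially. mgf (\<kappa> m) p \<in> V"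
        using eventually_gt_at_top[of i] eventually_gt_at_top[of j] by eventually_elim (use kD j p in blast)
    qed
  next
    fix c :: real assume c: "c < 1"
    define c' where "c' = max 0 ((1 + c) / 2)"
    have c': "0 \<le> c'" "c' < 1" "c < c'" using c by (auto simp: c'_def max_def)
    obtain j where j: "1 / real (Suc j) < 1 - c'" using nat_approx_posE[of "1 - c'"] c' by auto
    let ?e = "1 / real (Suc j)"
    have "((\<lambda>d. exp (- d * K j) * (1 - ?e)) \<longlongrightarrow> exp (- 0 * K j) * (1 - ?e)) (at_right 0)"
      by (intro tendsto_intros)
    then have "\<forall>\<^sub>F d in at_right 0. c < exp (- d * K j) * (1 - ?e)"
      by (rule order_tendstoD(1)) (use j c' in simp)
    moreover have "\<forall>\<^sub>F d::real in at_right 0. 0 < d" by (rule eventually_at_right_less)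
    ultimately have "\<forall>\<^sub>F d::real in at_right 0. 0 < d \<and> c < exp (- d * K j) * (1 - ?e)" by eventually_elim blast
    then obtain d where d: "0 < d" "c < exp (- d * K j) * (1 - ?e)"
      using eventually_happens'[OF trivial_limit_at_right_real] by blast
    have "\<forall>\<^sub>F m in sequentially. \<forall>y. \<bar>y\<bar> < d \<longrightarrow> ereal c < mgf (\<kappa> m) y"
      using eventually_gt_at_top[of j]
    proof eventually_elim
      case (elim m)
      show ?case
      proof (intro allI impI)
        fix y :: real assume "\<bar>y\<bar> < d"
        then have "ereal (exp (- d * K j) * (1 - ?e)) \<le> mgf (\<kappa> m) y"
          by (intro real_distribution.mgf_lower_near_0[OF rd kE[OF elim] _ K(1)]) simp
        moreover have "ereal c < ereal (exp (- d * K j) * (1 - ?e))" using d(2) by (simp only: less_ereal.simps)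
        ultimately show "ereal c < mgf (\<kappa> m) y" by (rule less_le_trans[rotated])
      qed
    qed
    then show "\<exists>e>0. \<forall>\<^sub>F m in sequentially. \<forall>y. \<bar>y\<bar> < e \<longrightarrow> ereal c < mgf (\<kappa> m) y" using d(1) by blast
  qed
  then have "\<forall>\<^sub>F m in sequentially. mgf (\<kappa> m) \<in> G"
    by (rule AW_open_eventually[OF epi_sep_XM G mgf_in_XM[OF rd]])
  then show False using eventually_happens'[OF sequentially_bot] nG by blast
qed

text \<open>A small admixture of a law whose domain is that of \<open>f\<close> up to end points
  truncates the domain and hardly moves the finite values. Its entropy enters with the weight
  \<open>t j\<close> and disappears in the limit.\<close>

lemma mgf_rate_approx:
  assumes mu: "real_distribution \<mu>" and f: "f \<in> XM" and fin: "mgf_rate \<mu> f = ereal s" and e: "e > 0"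
    and G: "openin (AW_top XM) G" "f \<in> G"
  shows "\<exists>\<kappa>. real_distribution \<kappa> \<and> ent_le \<kappa> \<mu> (s + e) \<and> mgf \<kappa> \<in> G"
proof -
  have "mgf_rate \<mu> f \<le> ereal s" by (simp add: fin)
  then obtain \<nu> s2 where nu2: "admissible \<mu> f" "matches f \<nu>" "s2 \<le> s" "ent_le \<nu> \<mu> s2"
    by (rule mgf_rate_finiteD[OF mu f]) blast
  note nu = nu2(1,2) ent_le_mono[OF nu2(4,3)]
  have rd: "real_distribution \<nu>" using nu by (simp add: matches_def)
  obtain \<nu>' s' where nu': "real_distribution \<nu>'" "ent_le \<nu>' \<mu> s'"
    "\<And>\<theta> t. f \<theta> < \<infinity> \<Longrightarrow> 0 \<le> t \<Longrightarrow> t < 1 \<Longrightarrow> mgf \<nu>' (t * \<theta>) < \<infinity>"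
    "\<And>\<theta> t. mgf \<nu>' \<theta> < \<infinity> \<Longrightarrow> 0 \<le> t \<Longrightarrow> t < 1 \<Longrightarrow> f (t * \<theta>) < \<infinity>"
    using same_domain_construction[OF mu f nu(1)] by blast
  interpret nu: real_distribution \<nu> by fact
  interpret nu': real_distribution \<nu>' by fact
  define t where "t j = 1 / real (Suc j)" for j
  have t: "0 < t j" "t j \<le> 1" for j by (auto simp: t_def)
  have t0: "t \<longlonglongrightarrow> 0" unfolding t_def using LIMSEQ_inverse_real_of_nat by (simp add: inverse_eq_divide)
  define \<kappa> where "\<kappa> j = mix (t j) \<nu>' \<nu>" for j
  have k: "real_distribution (\<kappa> j)" for j unfolding \<kappa>_def by (rule real_distribution_mix[OF nu'(1) rd])
  have km: "mgf (\<kappa> j) \<theta> = ereal (t j) * mgf \<nu>' \<theta> + ereal (1 - t j) * mgf \<nu> \<theta>" for j \<theta>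
    unfolding \<kappa>_def by (rule mgf_mix[OF nu'(1) rd]) (use t[of j] in auto)
  have ke: "ent_le (\<kappa> j) \<mu> (t j * s' + (1 - t j) * s)" for j
    unfolding \<kappa>_def by (rule ent_le_mix[OF nu'(1) rd nu'(2) nu(3)]) (use t[of j] in auto)
  \<comment> \<open>Leaves out at most end points, where the two domains may differ, and is
    therefore dense.\<close>
  define Q where "Q = {q. f q < \<infinity> \<longleftrightarrow> mgf \<nu>' q < \<infinity>}"
  have "epi_conv (\<lambda>j. mgf (\<kappa> j)) f"
  proof (rule epi_conv_convexI[where z=1 and Q=Q])
    show "convex_efun (mgf (\<kappa> j))" for j by (rule real_distribution.convex_mgf[OF k])
    show "mgf (\<kappa> j) 0 = ereal 1" for j using real_distribution.mgf_0[OF k] by (simp add: one_ereal_def)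
    show "f 0 = ereal 1" using XM_0[OF f] by (simp add: one_ereal_def)
    show "convex_efun f" "lsc_fun f" using f by (simp_all add: XM_iff)
    show "\<exists>p\<in>Q. a < p \<and> p < b" if ab: "a < b" for a b :: real
    proof -
      have "\<exists>x. a < x \<and> x < b \<and> x \<noteq> 0"
      proof (cases "(a + b) / 2 = 0")
        case True then show ?thesis using ab by (intro exI[of _ "(a + 3 * b) / 4"]) auto
      next
        case False then show ?thesis using ab by (intro exI[of _ "(a + b) / 2"]) auto
      qed
      then obtain x where x: "a < x" "x < b" "x \<noteq> 0" by blast
      have "\<forall>\<^sub>F u in at_left (1::real). a < u * x \<and> u * x < b"
      proof -
        have "((\<lambda>u. u * x) \<longlongrightarrow> 1 * x) (at_left 1)" by (intro tendsto_intros)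
        then have l: "((\<lambda>u. u * x) \<longlongrightarrow> x) (at_left 1)" by simp
        show ?thesis using order_tendstoD(1)[OF l x(1)] order_tendstoD(2)[OF l x(2)] by eventually_elim blast
      qed
      moreover have "\<forall>\<^sub>F u in at_left (1::real). 0 < u \<and> u < 1" by (rule eventually_at_leftI[of 0]) auto
      ultimately have "\<forall>\<^sub>F u in at_left (1::real). (a < u * x \<and> u * x < b) \<and> 0 < u \<and> u < 1" by eventually_elim blast
      then obtain u where u: "a < u * x" "u * x < b" "0 < u" "u < 1"
        using eventually_happens'[OF trivial_limit_at_left_real] by blast
      show ?thesis
      proof (cases "f x < \<infinity> \<or> mgf \<nu>' x < \<infinity>")
        case True
        then have "f (u * x) < \<infinity> \<and> mgf \<nu>' (u * x) < \<infinity>"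
        proof
          assume a: "f x < \<infinity>"
          show ?thesis using XM_scale_finite[OF f a, of u] nu'(3)[OF a, of u] u by auto
        next
          assume a: "mgf \<nu>' x < \<infinity>"
          show ?thesis using XM_scale_finite[OF mgf_in_XM[OF nu'(1)] a, of u] nu'(4)[OF a, of u] u by auto
        qed
        then show ?thesis using u by (intro bexI[of _ "u * x"]) (auto simp: Q_def)
      next
        case False
        then show ?thesis using x by (intro bexI[of _ x]) (auto simp: Q_def)
      qed
    qed
    fix p assume p: "p \<in> Q"
    show "(\<lambda>j. mgf (\<kappa> j) p) \<longlonglongrightarrow> f p"
    proof (cases "f p < \<infinity>")
      case True
      then have fin: "mgf \<nu>' p < \<infinity>" "f p = mgf \<nu> p" using p nu(2) by (auto simp: Q_def matches_def)
      obtain u v where uv: "mgf \<nu>' p = ereal u" "mgf \<nu> p = ereal v"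
        using nu'.mgf_eq_integral(2)[OF fin(1)] nu.mgf_eq_integral(2) True fin(2) by metis
      have "(\<lambda>j. t j * u + (1 - t j) * v) \<longlonglongrightarrow> 0 * u + (1 - 0) * v" by (intro tendsto_intros t0)
      then show ?thesis unfolding km fin(2) uv by simp
    next
      case False
      then have "mgf \<nu>' p = \<infinity>" "f p = \<infinity>" using p by (auto simp: Q_def)
      moreover have "mgf (\<kappa> j) p = \<infinity>" for j
        unfolding km using \<open>mgf \<nu>' p = \<infinity>\<close> t[of j] mgf_nonneg[of \<nu> p] by (cases "mgf \<nu> p") auto
      ultimately show ?thesis by simp
    qed
  next
    fix c :: real assume c: "c < 1"
    then have "ereal c < mgf \<nu> 0" "ereal c < mgf \<nu>' 0" using nu.mgf_0 nu'.mgf_0 by (simp_all add: one_ereal_def)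
    then obtain e1 e2 where e: "e1 > 0" "\<And>y. \<bar>y - 0\<bar> < e1 \<Longrightarrow> ereal c < mgf \<nu> y" "e2 > 0" "\<And>y. \<bar>y - 0\<bar> < e2 \<Longrightarrow> ereal c < mgf \<nu>' y"
      using lsc_funD[OF nu.lsc_mgf, of "ereal c" 0] lsc_funD[OF nu'.lsc_mgf, of "ereal c" 0] by metis
    have "ereal c < mgf (\<kappa> j) y" if "\<bar>y\<bar> < min e1 e2" for j y
    proof (cases "mgf \<nu> y = \<infinity> \<or> mgf \<nu>' y = \<infinity>")
      case True
      \<comment> \<open>For \<open>j = 0\<close> the weight of \<nu> is 0 and
        \<open>0 * \<infinity> = 0\<close>, so an infinite \<open>mgf \<nu> y\<close> does not help
        and the bound has to come from \<open>\<nu>'\<close>.\<close>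
      show ?thesis
      proof (cases "t j = 1")
        case True
        then show ?thesis unfolding km using e(4)[of y] that by (simp add: zero_ereal_def[symmetric])
      next
        case F: False
        then have "0 < 1 - t j" using t[of j] by auto
        then have "mgf (\<kappa> j) y = \<infinity>"
          unfolding km using True t[of j] mgf_nonneg[of \<nu> y] mgf_nonneg[of \<nu>' y] by (cases "mgf \<nu> y"; cases "mgf \<nu>' y") auto
        then show ?thesis by simp
      qed
    next
      case False
      obtain u v where uv: "mgf \<nu>' y = ereal u" "mgf \<nu> y = ereal v"
        using False mgf_nonneg[of \<nu> y] mgf_nonneg[of \<nu>' y] by (cases "mgf \<nu> y"; cases "mgf \<nu>' y") auto
      have "c < u" "c < v" using e(2,4)[of y] that uv by auto
      then have "0 < t j * (u - c)" "0 \<le> (1 - t j) * (v - c)" using t[of j] by auto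
      then have "c < t j * u + (1 - t j) * v" by (simp add: algebra_simps)
      then show ?thesis unfolding km uv by simp
    qed
    then show "\<exists>e>0. \<forall>\<^sub>F j in sequentially. \<forall>y. \<bar>y\<bar> < e \<longrightarrow> ereal c < mgf (\<kappa> j) y"
      using e by (intro exI[of _ "min e1 e2"]) auto
  qed
  then have "\<forall>\<^sub>F j in sequentially. mgf (\<kappa> j) \<in> G"
    by (rule AW_open_eventually[OF epi_sep_XM G mgf_in_XM[OF k]])
  moreover have "(\<lambda>j. t j * s' + (1 - t j) * s) \<longlonglongrightarrow> 0 * s' + (1 - 0) * s" by (intro tendsto_intros t0)
  then have "\<forall>\<^sub>F j in sequentially. t j * s' + (1 - t j) * s < s + e" by (rule order_tendstoD(2)) (use e in simp)
  ultimately have "\<forall>\<^sub>F j in sequentially. mgf (\<kappa> j) \<in> G \<and> t j * s' + (1 - t j) * s < s + e" by eventually_elim blast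
  then obtain j where "mgf (\<kappa> j) \<in> G" "t j * s' + (1 - t j) * s < s + e" using eventually_happens'[OF sequentially_bot] by blast
  then show ?thesis using k ent_le_mono[OF ke[of j], of "s + e"] by auto
qed

section \<open>Values of the rate function\<close>

text \<open>Near an \<open>f\<close> of rate above \<open>A\<close> one test function has a large
  empirical mean, with the gap over its log-moment that Chernoff's inequality needs. If the domain
  is not admissible, this mean is itself a value of the function. Otherwise \<phi> violates the dual
  inequality for the unique matching law, and along tight laws whose functions approach
  \<open>f\<close> the means of \<phi> converge, on a subsequence, to the mean under that
  law.\<close>

lemma mgf_rate_local_separation:
  assumes mu: "real_distribution \<mu>" and f: "f \<in> XM" and A: "0 \<le> A" "ereal A < mgf_rate \<mu> f"
  shows "\<exists>U \<phi> a Z. openin (AW_top XM) U \<and> f \<in> U \<and> \<phi> \<in> borel_measurable borel \<and>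
    (\<integral>\<^sup>+x. ennreal (exp (\<phi> x)) \<partial>\<mu>) \<le> ennreal (exp Z) \<and> A \<le> a - Z \<and>
    (\<forall>n x. n \<ge> 1 \<longrightarrow> emgf n x \<in> U \<longrightarrow> tight_class k c (emp x n) \<longrightarrow> a \<le> (\<Sum>i\<in>{1..n}. \<phi> (x i)) / real n)"
proof (cases "admissible \<mu> f")
  case False
  then obtain b s where bs: "1 < s" "f b = \<infinity>" "dexp \<mu> (s * b) \<noteq> \<infinity>" unfolding admissible_def by blast
  obtain Z where Z: "dexp \<mu> (s * b) \<le> ennreal Z" "1 \<le> Z" using dexp_finiteD[OF bs(3)] by blast
  have fin: "f (s * b) = \<infinity>"
  proof (rule ccontr)
    assume "f (s * b) \<noteq> \<infinity>"
    then have "f (1 / s * (s * b)) < \<infinity>" using bs by (intro XM_scale_finite[OF f, of "s * b"]) auto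
    then show False using bs by simp
  qed
  let ?Q = "\<lambda>g :: real \<Rightarrow> ereal. ereal (A + ln Z) < g (s * b)"
  have "\<exists>U. openin (AW_top XM) U \<and> f \<in> U \<and> (\<forall>g\<in>U. ?Q g)"
  proof (rule AW_nbhd_seq[OF epi_sep_XM f])
    fix g :: "nat \<Rightarrow> real \<Rightarrow> ereal" assume nQ: "\<And>n. \<not> ?Q (g n)" and ec: "epi_conv g f"
    have l: "lsc_fun f" using f by (simp add: XM_iff)
    have "ereal (A + ln Z) < f (s * b)" by (simp add: fin)
    from epi_conv_lowerD[OF ec l this] obtain e where e: "e > 0"
      "\<forall>\<^sub>F n in sequentially. \<forall>y. \<bar>y - s * b\<bar> < e \<longrightarrow> ereal (A + ln Z) < g n y" by blast
    obtain n where "\<forall>y. \<bar>y - s * b\<bar> < e \<longrightarrow> ereal (A + ln Z) < g n y"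
      using eventually_happens'[OF sequentially_bot e(2)] by blast
    then have "?Q (g n)" using e(1) by simp
    then show False using nQ by blast
  qed
  then obtain U where U: "openin (AW_top XM) U" "f \<in> U" "\<And>g. g \<in> U \<Longrightarrow> ?Q g" by blast
  have "A + ln Z \<le> (\<Sum>i\<in>{1..n}. exp (s * b * x i)) / real n" if "n \<ge> 1" "emgf n x \<in> U" for n x
    using U(3)[OF that(2)] by (simp add: Mn_def)
  moreover have "(\<integral>\<^sup>+x. ennreal (exp (exp (s * b * x))) \<partial>\<mu>) \<le> ennreal (exp (ln Z))" using Z by (simp add: dexp_def)
  ultimately show ?thesis using U(1,2)
    by (intro exI[of _ U] exI[of _ "\<lambda>x. exp (s * b * x)"] exI[of _ "A + ln Z"] exI[of _ "ln Z"]) auto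
next
  case adm: True
  show ?thesis
  proof (cases "\<exists>p. p \<noteq> 0 \<and> f p < \<infinity>")
    case False
    interpret real_distribution \<mu> by fact
    have "matches f \<mu>" unfolding matches_def
    proof (intro conjI allI impI mu)
      fix \<theta> assume "f \<theta> < \<infinity>"
      then have "\<theta> = 0" using False by blast
      then show "f \<theta> = mgf \<mu> \<theta>" using XM_0[OF f] mgf_0 by simp
    qed
    \<comment> \<open>With \<open>f\<close> finite at 0 only the rate is at most 0, which
      contradicts the hypotheses on \<open>A\<close>.\<close>
    then have "mgf_rate \<mu> f \<le> rel_entropy \<mu> \<mu>" using adm by (auto simp: mgf_rate_def intro: INF_lower)
    then have "mgf_rate \<mu> f \<le> 0" by (simp add: rel_entropy_self[OF mu])
    then have "ereal A < 0" using A(2) by (rule less_le_trans[rotated])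
    then show ?thesis using A(1) by simp
  next
    case True
    then obtain p where p: "p \<noteq> 0" "f p < \<infinity>" by blast
    obtain \<nu> where m: "matches f \<nu>" using XM_matches[OF f] by blast
    have rd: "real_distribution \<nu>" using m by (simp add: matches_def)
    have "\<not> ent_le \<nu> \<mu> A"
      using A(2) rel_entropy_le_iff[OF rd mu, of A] mgf_rate_eq[OF f adm p m] by (simp add: not_le[symmetric])
    then have "\<exists>\<phi> B. continuous_on UNIV \<phi> \<and> (\<forall>x. \<bar>\<phi> x\<bar> \<le> B) \<and> \<not> (\<integral>x. \<phi> x \<partial>\<nu>) \<le> A + ln (\<integral>x. exp (\<phi> x) \<partial>\<mu>)"
      using ent_le_contI[OF rd mu, of A] by blast
    then obtain \<phi> B where \<phi>: "continuous_on UNIV \<phi>" "\<And>x. \<bar>\<phi> x\<bar> \<le> B" "A + ln (\<integral>x. exp (\<phi> x) \<partial>\<mu>) < (\<integral>x. \<phi> x \<partial>\<nu>)"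
      by (auto simp: not_le)
    have pm[measurable]: "\<phi> \<in> borel_measurable borel" using \<phi>(1) by (rule borel_measurable_continuous_onI)
    define a where "a = A + ln (\<integral>x. exp (\<phi> x) \<partial>\<mu>)"
    let ?Q = "\<lambda>g. \<forall>\<kappa>. tight_class k c \<kappa> \<longrightarrow> g = mgf \<kappa> \<longrightarrow> a \<le> (\<integral>x. \<phi> x \<partial>\<kappa>)"
    have "\<exists>U. openin (AW_top XM) U \<and> f \<in> U \<and> (\<forall>g\<in>U. ?Q g)"
    proof (rule AW_nbhd_seq[OF epi_sep_XM f])
      fix g :: "nat \<Rightarrow> real \<Rightarrow> ereal" assume g: "\<And>n. g n \<in> XM" and nQ: "\<And>n. \<not> ?Q (g n)" and ec: "epi_conv g f"
      have "\<forall>n. \<exists>\<kappa>. tight_class k c \<kappa> \<and> g n = mgf \<kappa> \<and> (\<integral>x. \<phi> x \<partial>\<kappa>) < a" using nQ by (meson not_le)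
      from choice[OF this] obtain \<kappa> where "\<forall>n. tight_class k c (\<kappa> n) \<and> g n = mgf (\<kappa> n) \<and> (\<integral>x. \<phi> x \<partial>\<kappa> n) < a" ..
      then have t: "tight_class k c (\<kappa> n)" and gk: "g n = mgf (\<kappa> n)" and lt: "(\<integral>x. \<phi> x \<partial>\<kappa> n) < a" for n by blast+
      have fm: "g n \<theta> = mgf (\<kappa> n) \<theta>" if "g n \<theta> < \<infinity>" for n \<theta> by (simp add: gk)
      obtain r \<nu>' f' where r: "strict_mono r" "tight_class k c \<nu>'" "weak_conv_m (\<kappa> \<circ> r) \<nu>'" "f' \<in> XM"
        "\<And>\<theta>. f' \<theta> < \<infinity> \<Longrightarrow> f' \<theta> = mgf \<nu>' \<theta>" "epi_conv (g \<circ> r) f'"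
        by (rule tight_subsequence[of k c \<kappa> g, OF t g(1) fm]) blast+
      have rd': "real_distribution \<nu>'" using r(2) by (simp add: tight_class_def)
      have rdk: "real_distribution (\<kappa> n)" for n using t by (simp add: tight_class_def)
      have "f = f'"
        by (rule epi_conv_unique[OF epi_sep_XM _ f r(4) epi_conv_subseq[OF ec r(1)] r(6)]) (simp add: g)
      then have "matches f \<nu>'" using r(5) rd' by (simp add: matches_def)
      then have "\<nu>' = \<nu>" using matches_unique[OF f p _ m] by blast
      have "(\<lambda>n. \<integral>x. \<phi> x \<partial>(\<kappa> \<circ> r) n) \<longlonglongrightarrow> (\<integral>x. \<phi> x \<partial>\<nu>')"
        by (rule weak_conv_imp_integral_bdd_continuous_conv[OF _ rd' r(3), where B=B])
           (use rdk \<phi>(1,2) in \<open>auto simp: continuous_on_eq_continuous_at\<close>)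
      then have "(\<integral>x. \<phi> x \<partial>\<nu>') \<le> a" by (rule LIMSEQ_le_const2) (use lt in \<open>auto simp: less_imp_le intro!: exI[of _ 0]\<close>)
      then show False using \<phi>(3) \<open>\<nu>' = \<nu>\<close> by (simp add: a_def)
    qed
    then obtain U where U: "openin (AW_top XM) U" "f \<in> U" "\<And>g. g \<in> U \<Longrightarrow> ?Q g" by blast
    have "a \<le> (\<Sum>i\<in>{1..n}. \<phi> (x i)) / real n" if "n \<ge> 1" "emgf n x \<in> U" "tight_class k c (emp x n)" for n x
      using U(3)[OF that(2), rule_format, OF that(3) mgf_emp[OF that(1), symmetric]] unfolding integral_emp[OF that(1) pm] .
    moreover have "(\<integral>\<^sup>+x. ennreal (exp (\<phi> x)) \<partial>\<mu>) \<le> ennreal (exp (ln (\<integral>x. exp (\<phi> x) \<partial>\<mu>)))"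
    proof -
      interpret real_distribution \<mu> by fact
      have "0 < (\<integral>x. exp (\<phi> x) \<partial>\<mu>)" using exp_integral_bounds(2)[OF pm \<phi>(2)] by (rule less_le_trans[rotated]) simp
      then show ?thesis using nn_integral_eq_integral[OF exp_integral_bounds(1)[OF pm \<phi>(2)]] by simp
    qed
    ultimately show ?thesis using U(1,2) pm
      by (intro exI[of _ U] exI[of _ \<phi>] exI[of _ a] exI[of _ "ln (\<integral>x. exp (\<phi> x) \<partial>\<mu>)"]) (auto simp: a_def)
  qed
qed

text \<open>A point of the domain close enough to \<open>x\<close> lies beyond \<open>t * x\<close>
  on the same side of 0, and the domain is star-shaped about 0.\<close>

lemma closure_dom_scale:
  assumes g: "g \<in> XM" and f: "x \<in> closure (dom_fun g)" and t: "0 \<le> t" "t < 1"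
  shows "g (t * x) < \<infinity>"
proof (cases "x = 0")
  case True
  then show ?thesis using XM_0[OF g] by simp
next
  case False
  then have "0 < (1 - t) * \<bar>x\<bar>" using t by simp
  then obtain y where y: "g y < \<infinity>" "dist y x < (1 - t) * \<bar>x\<bar>"
    using f unfolding closure_approachable dom_fun_def by blast
  have y0: "y \<noteq> 0" and r: "0 \<le> t * x / y \<and> t * x / y \<le> 1"
  proof -
    have *: "\<bar>y - x\<bar> < \<bar>x\<bar> - t * \<bar>x\<bar>" using y(2) by (simp add: dist_real_def left_diff_distrib)
    show y0: "y \<noteq> 0" using * t by (auto simp: mult_nonneg_nonneg) (smt (verit) mult_nonneg_nonneg)
    show "0 \<le> t * x / y \<and> t * x / y \<le> 1"
    proof (cases "0 < x")
      case True
      then have "t * x < y" "0 \<le> t * x" using * t by (auto simp: abs_if split: if_splits)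
      then show ?thesis by (simp add: divide_le_eq)
    next
      case F: False
      then have "x < 0" using \<open>x \<noteq> 0\<close> by simp
      then have "y < t * x" "t * x \<le> 0" using * t by (auto simp: abs_if mult_nonneg_nonpos split: if_splits)
      then show ?thesis by (simp add: divide_le_eq divide_nonpos_neg zero_le_divide_iff)
    qed
  qed
  have "g (t * x / y * y) < \<infinity>" by (rule XM_scale_finite[OF g y(1)]) (use r in auto)
  then show ?thesis using y0 by simp
qed

lemma closure_dom_subset:
  assumes "\<And>\<theta> t. f \<theta> < \<infinity> \<Longrightarrow> 0 \<le> t \<Longrightarrow> t < 1 \<Longrightarrow> g (t * \<theta>) < \<infinity>"
  shows "closure (dom_fun f) \<subseteq> closure (dom_fun g)"
proof (rule closure_minimal[OF subsetI closed_closure])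
  fix \<theta> assume "\<theta> \<in> dom_fun f"
  then have *: "\<And>t. 0 \<le> t \<Longrightarrow> t < 1 \<Longrightarrow> t * \<theta> \<in> dom_fun g" using assms by (simp add: dom_fun_def)
  have "(\<lambda>n. (1 - 1 / real (Suc n)) * \<theta>) \<longlonglongrightarrow> (1 - 0) * \<theta>"
    by (intro tendsto_intros LIMSEQ_inverse_real_of_nat[unfolded inverse_eq_divide])
  then have l: "(\<lambda>n. (1 - 1 / real (Suc n)) * \<theta>) \<longlonglongrightarrow> \<theta>" by simp
  show "\<theta> \<in> closure (dom_fun g)"
    unfolding closure_sequential by (intro exI[of _ "\<lambda>n. (1 - 1 / real (Suc n)) * \<theta>"] conjI l allI *) auto
qed

text \<open>Admissibility is decided by the closure of the domain: part of the room in
  \<open>s > 1\<close> absorbs the end points, the rest is left for admissibility of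
  \<open>f\<close>.\<close>

lemma admissible_closure_dom:
  assumes g: "g \<in> XM" and f: "f \<in> XM" and adm: "admissible \<mu> f" and sub: "closure (dom_fun f) \<subseteq> closure (dom_fun g)"
  shows "admissible \<mu> g"
  unfolding admissible_def
proof (intro allI impI)
  fix b s :: real assume s: "1 < s" and gb: "g b = \<infinity>"
  define s' where "s' = (1 + s) / 2"
  have s': "1 < s'" "s' < s" using s by (auto simp: s'_def)
  have "f (s' * b) = \<infinity>"
  proof (rule ccontr)
    assume "f (s' * b) \<noteq> \<infinity>"
    then have "s' * b \<in> dom_fun f" by (simp add: dom_fun_def)
    then have "s' * b \<in> closure (dom_fun g)" using sub closure_subset by blast
    then have "g (1 / s' * (s' * b)) < \<infinity>" by (rule closure_dom_scale[OF g]) (use s' in auto)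
    then show False using gb s' by simp
  qed
  moreover have "1 < s / s'" using s' by simp
  ultimately have "dexp \<mu> (s / s' * (s' * b)) = \<infinity>" using adm unfolding admissible_def by blast
  then show "dexp \<mu> (s * b) = \<infinity>" using s' by simp
qed

section \<open>Moment generating functions and the functions that mimic them\<close>

definition point_fun :: "real \<Rightarrow> ereal" where
  "point_fun = (\<lambda>\<theta>. if \<theta> = 0 then 1 else \<infinity>)"

lemma point_fun_in_XM: "point_fun \<in> XM"
proof -
  define \<nu> where "\<nu> = distr (measure_pmf (return_pmf ())) borel (\<lambda>_. 0 :: real)"
  interpret real_distribution \<nu> unfolding \<nu>_def by (rule prob_space.real_distribution_distr[OF prob_space_measure_pmf]) simp
  have "(\<lambda>\<theta>. if \<theta> \<in> {0} then mgf \<nu> \<theta> else \<infinity>) \<in> XM"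
    by (rule restricted_mgf_in_XM[OF real_distribution_axioms]) auto
  then show ?thesis using mgf_0 by (simp add: point_fun_def cong: if_cong)
qed

lemma eq_point_funI:
  assumes "f \<in> XM" "\<And>p. p \<noteq> 0 \<Longrightarrow> f p = \<infinity>" shows "f = point_fun"
  using assms XM_0 by (auto simp: point_fun_def)

text \<open>Points of alternating sign and quadratic size with geometrically decaying masses leave
  no exponential moment in either direction. Hence \<open>point_fun\<close> mimics nothing, and a
  function that mimics a law is finite somewhere off 0.\<close>

lemma point_fun_is_MGF: "is_MGF point_fun"
proof -
  have aux: "M < y - l + 1" if "M \<le> r" "2 * (r + 1) \<le> y" "l \<le> (r + 1) * 1" "0 \<le> r" for M r y l :: real
    using that unfolding distrib_left distrib_right by linarith
  define x where "x j = (- 1) ^ j * (real j + 1)^2" for j :: nat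
  define \<nu> where "\<nu> = distr (measure_pmf (geometric_pmf (1/2))) borel x"
  have rd: "real_distribution \<nu>" unfolding \<nu>_def by (rule prob_space.real_distribution_distr[OF prob_space_measure_pmf]) simp
  have "mgf \<nu> p = \<infinity>" if p: "p \<noteq> 0" for p
  proof (rule ccontr)
    assume "mgf \<nu> p \<noteq> \<infinity>"
    then have "mgf \<nu> p < \<infinity>" by simp
    then have "(\<integral>\<^sup>+y. ennreal (exp (p * y)) \<partial>\<nu>) < \<infinity>" unfolding mgf_finite_iff .
    then obtain M where M: "0 \<le> M" "(\<integral>\<^sup>+y. ennreal (exp (p * y)) \<partial>\<nu>) = ennreal M"
      by (cases "\<integral>\<^sup>+y. ennreal (exp (p * y)) \<partial>\<nu>") auto
    obtain i :: nat where i: "2 / \<bar>p\<bar> + M \<le> real i" using real_arch_simple by blast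
    \<comment> \<open>The parity puts \<open>x j\<close> on the side where \<open>p * x j\<close> is
      positive.\<close>
    define j where "j = 2 * i + (if p > 0 then 0 else 1)"
    have "2 / \<bar>p\<bar> \<le> real j" "M \<le> real j" using i M(1) by (auto simp: j_def intro: order_trans[of _ "2 / \<bar>p\<bar> + M"])
    have px: "p * x j = \<bar>p\<bar> * (real j + 1)^2" using p by (auto simp: x_def j_def)
    have "2 \<le> \<bar>p\<bar> * (real j + 1)" using \<open>2 / \<bar>p\<bar> \<le> real j\<close> p by (simp add: field_simps)
    then have "2 * (real j + 1) \<le> \<bar>p\<bar> * (real j + 1) * (real j + 1)" by (intro mult_right_mono) auto
    then have ge: "2 * (real j + 1) \<le> p * x j" unfolding px by (simp add: power2_eq_square mult.assoc)
    have "ln 2 \<le> (1::real)" using ln_2_less_1 by simp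
    then have "(real j + 1) * ln 2 \<le> (real j + 1) * 1" by (intro mult_left_mono) auto
    then have "M < p * x j - (real j + 1) * ln 2 + 1" by (rule aux[OF \<open>M \<le> real j\<close> ge _ of_nat_0_le_iff])
    also have "\<dots> \<le> exp (p * x j - (real j + 1) * ln 2)" using exp_ge_add_one_self[of "p * x j - (real j + 1) * ln 2"] by linarith
    also have "\<dots> = exp (p * x j) * (1/2) ^ Suc j"
    proof -
      have "exp ((real j + 1) * ln 2) = (2::real) ^ Suc j"
      proof -
        have "real j + 1 = real (Suc j)" by simp
        then show ?thesis unfolding exp_of_nat_mult[symmetric] by (simp only: exp_of_nat_mult exp_ln[OF zero_less_numeral])
      qed
      then show ?thesis by (simp add: exp_diff power_one_over)
    qed
    finally have "M < exp (p * x j) * (1/2) ^ Suc j" .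
    moreover have "ennreal (exp (p * x j) * (1/2) ^ Suc j) \<le> ennreal M"
    proof -
      have "ennreal (exp (p * x j) * (1/2) ^ Suc j) = ennreal (pmf (geometric_pmf (1/2)) j) * ennreal (exp (p * x j))"
        by (subst ennreal_mult[symmetric]) (auto simp: mult.commute)
      also have "\<dots> \<le> (\<Sum>j. ennreal (pmf (geometric_pmf (1/2)) j) * ennreal (exp (p * x j)))" by (rule ennreal_le_suminf)
      also have "\<dots> = (\<integral>\<^sup>+y. ennreal (exp (p * y)) \<partial>\<nu>)"
        unfolding \<nu>_def by (subst nn_integral_distr) (simp_all add: nn_integral_measure_pmf nn_integral_count_space_nat)
      finally show ?thesis using M(2) by simp
    qed
    ultimately show False using M(1) by (simp add: ennreal_le_iff)
  qed
  then have "mgf \<nu> = point_fun" by (rule eq_point_funI[OF mgf_in_XM[OF rd]])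
  then show ?thesis using rd unfolding is_MGF_def prob_measure_real_iff by metis
qed

text \<open>A finite argument off 0 determines the law. If the domain is not admissible, both sides
  are infinite by \<open>ent_le_admissible\<close>.\<close>

lemma mgf_rate_mgf:
  assumes mu: "real_distribution \<mu>" and nu: "real_distribution \<nu>" and p: "p \<noteq> 0" "mgf \<nu> p < \<infinity>"
  shows "mgf_rate \<mu> (mgf \<nu>) = rel_entropy \<nu> \<mu>"
proof (cases "admissible \<mu> (mgf \<nu>)")
  case True
  then show ?thesis by (rule mgf_rate_eq[OF mgf_in_XM[OF nu] _ p]) (simp add: matches_def nu)
next
  case False
  have "rel_entropy \<nu> \<mu> = \<infinity>"
  proof (rule ccontr)
    assume "rel_entropy \<nu> \<mu> \<noteq> \<infinity>"
    then have "rel_entropy \<nu> \<mu> < \<infinity>" by simp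
    then obtain s where "ent_le \<nu> \<mu> s" using rel_entropy_finiteD[OF nu mu] by blast
    then show False using ent_le_admissible[OF nu mu] False by blast
  qed
  then show ?thesis using False by (simp add: mgf_rate_def)
qed

lemma mgf_rate_mgf_le:
  assumes mu: "real_distribution \<mu>" and nu: "real_distribution \<nu>" and ent: "ent_le \<nu> \<mu> s"
  shows "mgf_rate \<mu> (mgf \<nu>) \<le> ereal s"
proof -
  have "mgf_rate \<mu> (mgf \<nu>) \<le> rel_entropy \<nu> \<mu>"
    using ent_le_admissible[OF nu mu ent] nu by (auto simp: mgf_rate_def matches_def intro: INF_lower)
  also have "\<dots> \<le> ereal s" using rel_entropy_le_iff[OF nu mu] ent by blast
  finally show ?thesis .
qed

text \<open>In the admissible case both sides are 0: on the left because \<mu> matches, on the right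
  because \<mu> can be perturbed, at arbitrarily small entropy, into a law without exponential
  moments. Otherwise both are infinite.\<close>

lemma mgf_rate_point_fun:
  assumes mu: "real_distribution \<mu>"
  shows "mgf_rate \<mu> point_fun = (INF \<nu>\<in>{\<nu>. real_distribution \<nu> \<and> mgf \<nu> = point_fun}. rel_entropy \<nu> \<mu>)" (is "_ = ?I")
proof (cases "admissible \<mu> point_fun")
  case True
  interpret mu: real_distribution \<mu> by fact
  obtain \<nu> s where nu: "real_distribution \<nu>" "ent_le \<nu> \<mu> s"
    "\<And>\<theta> t. mgf \<nu> \<theta> < \<infinity> \<Longrightarrow> 0 \<le> t \<Longrightarrow> t < 1 \<Longrightarrow> point_fun (t * \<theta>) < \<infinity>"
    by (rule same_domain_construction[OF mu point_fun_in_XM True]) (rule that)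
  have inf: "mgf \<nu> p = \<infinity>" if p: "p \<noteq> 0" for p
  proof (rule ccontr)
    assume "mgf \<nu> p \<noteq> \<infinity>"
    then have "mgf \<nu> p < \<infinity>" by simp
    from nu(3)[OF this, of "1/2"] p show False by (simp add: point_fun_def)
  qed
  have "?I \<le> 0 + ereal e" if e: "e > 0" for e
  proof -
    \<comment> \<open>Makes \<open>t * s \<le> e\<close>; the 1 keeps the divisor positive.\<close>
    define t where "t = min 1 (e / (\<bar>s\<bar> + 1))"
    have t: "0 < t" "t \<le> 1" using e by (auto simp: t_def)
    let ?m = "mix t \<nu> \<mu>"
    have rm: "real_distribution ?m" by (rule real_distribution_mix[OF nu(1) mu])
    have "ent_le ?m \<mu> (t * s + (1 - t) * 0)" by (rule ent_le_mix[OF nu(1) mu nu(2) ent_le_refl[OF mu]]) (use t in auto)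
    then have ent: "rel_entropy ?m \<mu> \<le> ereal (t * s)" using rel_entropy_le_iff[OF rm mu] by simp
    have "mgf ?m p = \<infinity>" if "p \<noteq> 0" for p
      using mgf_mix[OF nu(1) mu, of t p] t inf[OF that] mgf_nonneg[of \<mu> p] by (cases "mgf \<mu> p") auto
    then have "mgf ?m = point_fun" by (rule eq_point_funI[OF mgf_in_XM[OF rm]])
    then have "?I \<le> rel_entropy ?m \<mu>" using rm by (intro INF_lower) simp
    also note ent
    also have "t * s \<le> t * (\<bar>s\<bar> + 1)" using t by (intro mult_left_mono) auto
    also have "t * (\<bar>s\<bar> + 1) \<le> e / (\<bar>s\<bar> + 1) * (\<bar>s\<bar> + 1)" by (intro mult_right_mono) (auto simp: t_def)
    finally show ?thesis by simp
  qed
  then have "?I \<le> 0" by (rule ereal_le_epsilon2[rule_format])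
  moreover have "0 \<le> ?I" using rel_entropy_nonneg[OF _ mu] by (auto intro!: INF_greatest)
  moreover have "matches point_fun \<mu>" using mu mu.mgf_0 by (auto simp: matches_def point_fun_def split: if_splits)
  then have "mgf_rate \<mu> point_fun \<le> rel_entropy \<mu> \<mu>" using True by (auto simp: mgf_rate_def intro: INF_lower)
  then have "mgf_rate \<mu> point_fun = 0" using rel_entropy_self[OF mu] mgf_rate_nonneg[OF mu, of point_fun] by simp
  ultimately show ?thesis by (simp add: antisym)
next
  case False
  have "rel_entropy \<nu> \<mu> = \<infinity>" if nu: "real_distribution \<nu>" "mgf \<nu> = point_fun" for \<nu>
  proof (rule ccontr)
    assume "rel_entropy \<nu> \<mu> \<noteq> \<infinity>"
    then have "rel_entropy \<nu> \<mu> < \<infinity>" by simp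
    then obtain s where "ent_le \<nu> \<mu> s" using rel_entropy_finiteD[OF nu(1) mu] by blast
    then show False using ent_le_admissible[OF nu(1) mu] False nu(2) by metis
  qed
  then have "\<infinity> \<le> ?I" by (intro INF_greatest) auto
  then show ?thesis using False by (simp add: mgf_rate_def)
qed

text \<open>The condition on \<open>g\<close> is admissibility of \<open>f\<close> in disguise:
  domains with the same closure are admissible together, and conversely an admissible domain
  carries, up to end points, a law of finite entropy.\<close>

lemma mgf_rate_mimics:
  assumes mu: "real_distribution \<mu>" and f: "f \<in> Dint \<alpha> \<beta>" and m: "mimics f \<nu>"
  shows "mgf_rate \<mu> f = (if \<exists>g. is_MGF g \<and> g \<in> Dint \<alpha> \<beta> \<and> mgf_rate \<mu> g < \<infinity> then mgf_rate \<mu> (mgf \<nu>) else \<infinity>)"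
proof -
  have fX: "f \<in> XM" and nu: "real_distribution \<nu>" and mt: "matches f \<nu>"
    using m by (auto simp: mimics_def prob_measure_real_iff matches_def dom_fun_def)
  have "f \<noteq> point_fun" using m point_fun_is_MGF by (auto simp: mimics_def)
  then obtain p where p: "p \<noteq> 0" "f p < \<infinity>" using eq_point_funI[OF fX] by fastforce
  show ?thesis
  proof (cases "\<exists>g. is_MGF g \<and> g \<in> Dint \<alpha> \<beta> \<and> mgf_rate \<mu> g < \<infinity>")
    case True
    then obtain g where g: "is_MGF g" "g \<in> Dint \<alpha> \<beta>" "mgf_rate \<mu> g < \<infinity>" by blast
    have gX: "g \<in> XM" using g(1) mgf_in_XM by (auto simp: is_MGF_def prob_measure_real_iff)
    have "admissible \<mu> g" using g(3) by (auto simp: mgf_rate_def split: if_splits)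
    then have adm: "admissible \<mu> f" by (rule admissible_closure_dom[OF fX gX]) (use f g(2) in \<open>auto simp: Dint_def\<close>)
    have "mgf_rate \<mu> f = rel_entropy \<nu> \<mu>" by (rule mgf_rate_eq[OF fX adm p mt])
    also have "\<dots> = mgf_rate \<mu> (mgf \<nu>)"
      by (rule mgf_rate_mgf[OF mu nu p(1), symmetric]) (use mt p in \<open>auto simp: matches_def\<close>)
    finally show ?thesis using True by simp
  next
    case False
    have "mgf_rate \<mu> f = \<infinity>"
    proof (rule ccontr)
      assume "mgf_rate \<mu> f \<noteq> \<infinity>"
      then have adm: "admissible \<mu> f" by (cases "admissible \<mu> f") (simp_all add: mgf_rate_def)
      obtain \<kappa> s where k: "real_distribution \<kappa>" "ent_le \<kappa> \<mu> s"
        "\<And>\<theta> t. f \<theta> < \<infinity> \<Longrightarrow> 0 \<le> t \<Longrightarrow> t < 1 \<Longrightarrow> mgf \<kappa> (t * \<theta>) < \<infinity>"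
        "\<And>\<theta> t. mgf \<kappa> \<theta> < \<infinity> \<Longrightarrow> 0 \<le> t \<Longrightarrow> t < 1 \<Longrightarrow> f (t * \<theta>) < \<infinity>"
        using same_domain_construction[OF mu fX adm] by blast
      have "closure (dom_fun f) = closure (dom_fun (mgf \<kappa>))"
        using closure_dom_subset[of f "mgf \<kappa>", OF k(3)] closure_dom_subset[of "mgf \<kappa>" f, OF k(4)] by blast
      then have "mgf \<kappa> \<in> Dint \<alpha> \<beta>" using f mgf_in_XM[OF k(1)] by (simp add: Dint_def XM_def)
      moreover have "is_MGF (mgf \<kappa>)" using k(1) by (auto simp: is_MGF_def prob_measure_real_iff)
      moreover have "mgf_rate \<mu> (mgf \<kappa>) < \<infinity>" using mgf_rate_mgf_le[OF mu k(1,2)] by (rule le_less_trans) simp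
      ultimately show False using False by blast
    qed
    then show ?thesis using False by (simp only: if_False)
  qed
qed

section \<open>Concentration for independent samples\<close>

abbreviation sample :: "real measure \<Rightarrow> nat \<Rightarrow> (nat \<Rightarrow> real) measure" where
  "sample \<nu> n \<equiv> Pi\<^sub>M {1..n} (\<lambda>_. \<nu>)"

lemma prob_space_sample: "real_distribution \<nu> \<Longrightarrow> prob_space (sample \<nu> n)"
  by (rule prob_space_PiM) (simp add: real_distribution_def)

lemma sets_sample: "real_distribution \<nu> \<Longrightarrow> sets (sample \<nu> n) = sets (Pi\<^sub>M {1..n} (\<lambda>_. borel))"
  by (rule sets_PiM_cong) (simp_all add: real_distribution_def real_distribution_axioms_def)

lemma measurable_sample_component:
  assumes "real_distribution \<nu>" "i \<in> {1..n}" shows "(\<lambda>x. x i) \<in> borel_measurable (sample \<nu> n)"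
  using measurable_component_singleton[OF assms(2), of "\<lambda>_. borel :: real measure"]
  unfolding measurable_cong_sets[OF sets_sample[OF assms(1)] refl] .

lemma measurable_sample_sum:
  fixes \<phi> :: "real \<Rightarrow> real"
  assumes "real_distribution \<nu>" "\<phi> \<in> borel_measurable borel"
  shows "(\<lambda>x. (\<Sum>i\<in>{1..n}. \<phi> (x i)) / real n) \<in> borel_measurable (sample \<nu> n)"
  using measurable_compose[OF measurable_sample_component[OF assms(1)] assms(2)]
  by (intro borel_measurable_divide borel_measurable_sum borel_measurable_const) auto

lemma sample_sets_ge:
  fixes \<phi> :: "real \<Rightarrow> real"
  assumes "real_distribution \<nu>" "\<phi> \<in> borel_measurable borel"
  shows "{x \<in> space (sample \<nu> n). a \<le> (\<Sum>i\<in>{1..n}. \<phi> (x i)) / real n} \<in> sets (sample \<nu> n)"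
  by (rule borel_measurable_le[OF borel_measurable_const measurable_sample_sum[OF assms]])

lemma emgf_open_sets:
  assumes nu: "real_distribution \<nu>" and n: "n \<ge> 1" and U: "openin (AW_top XM) U"
  shows "{x \<in> space (sample \<nu> n). emgf n x \<in> U} \<in> sets (sample \<nu> n)"
proof -
  have "Mn (\<lambda>i x. x i) n -` U \<inter> space (sample \<nu> n) \<in> sets (sample \<nu> n)"
    by (rule Mn_vimage_measurable[OF n measurable_sample_component[OF nu] U])
  also have "Mn (\<lambda>i x. x i) n -` U \<inter> space (sample \<nu> n) = {x \<in> space (sample \<nu> n). emgf n x \<in> U}" by blast
  finally show ?thesis .
qed

lemma emgf_closed_sets:
  assumes nu: "real_distribution \<nu>" and n: "n \<ge> 1" and F: "closedin (AW_top XM) F"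
  shows "{x \<in> space (sample \<nu> n). emgf n x \<in> F} \<in> sets (sample \<nu> n)"
proof -
  have "openin (AW_top XM) (XM - F)" using F unfolding closedin_def AW_top_topspace[OF epi_sep_XM] by blast
  then have "space (sample \<nu> n) - {x \<in> space (sample \<nu> n). emgf n x \<in> XM - F} \<in> sets (sample \<nu> n)"
    by (intro sets.compl_sets emgf_open_sets nu n)
  also have "space (sample \<nu> n) - {x \<in> space (sample \<nu> n). emgf n x \<in> XM - F} = {x \<in> space (sample \<nu> n). emgf n x \<in> F}"
    using emgf_in_XM[OF n] by blast
  finally show ?thesis .
qed

text \<open>The exponential moment is a nonnegative integral, so that the bound also serves the
  unbounded test function \<open>exp (s * b * x)\<close>.\<close>

lemma chernoff:
  fixes \<phi> :: "real \<Rightarrow> real"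
  assumes nu: "real_distribution \<nu>" and \<phi>[measurable]: "\<phi> \<in> borel_measurable borel"
    and Z: "(\<integral>\<^sup>+x. ennreal (exp (\<phi> x)) \<partial>\<nu>) \<le> ennreal (exp Z)" and n: "n \<ge> 1"
  shows "measure (sample \<nu> n) {x \<in> space (sample \<nu> n). a \<le> (\<Sum>i\<in>{1..n}. \<phi> (x i)) / real n} \<le> exp (- (real n * (a - Z)))"
proof -
  interpret nu: real_distribution \<nu> by fact
  interpret S: prob_space "sample \<nu> n" by (rule prob_space_sample[OF nu])
  interpret product_sigma_finite "\<lambda>_::nat. \<nu>" by standard
  have [measurable]: "(\<lambda>x. ennreal (exp (\<phi> x))) \<in> borel_measurable \<nu>" by simp
  let ?A = "{x \<in> space (sample \<nu> n). a \<le> (\<Sum>i\<in>{1..n}. \<phi> (x i)) / real n}"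
  have A: "?A \<in> sets (sample \<nu> n)" by (rule sample_sets_ge[OF nu \<phi>])
  have m: "(\<lambda>x. \<Prod>i\<in>{1..n}. ennreal (exp (\<phi> (x i)))) \<in> borel_measurable (sample \<nu> n)"
    using measurable_compose[OF measurable_sample_component[OF nu], of _ n "\<lambda>y. ennreal (exp (\<phi> y))" borel]
    by (intro borel_measurable_prod_ennreal) auto
  have "emeasure (sample \<nu> n) ?A = (\<integral>\<^sup>+x. indicator ?A x \<partial>sample \<nu> n)" using A by simp
  also have "\<dots> \<le> (\<integral>\<^sup>+x. ennreal (exp (- (real n * a))) * (\<Prod>i\<in>{1..n}. ennreal (exp (\<phi> (x i)))) \<partial>sample \<nu> n)"
  proof (rule nn_integral_mono)
    fix x
    have p: "ennreal (exp (- (real n * a))) * (\<Prod>i\<in>{1..n}. ennreal (exp (\<phi> (x i)))) = ennreal (exp ((\<Sum>i\<in>{1..n}. \<phi> (x i)) - real n * a))"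
    proof -
      have "(\<Prod>i\<in>{1..n}. ennreal (exp (\<phi> (x i)))) = ennreal (exp (\<Sum>i\<in>{1..n}. \<phi> (x i)))" by (simp add: prod_ennreal exp_sum)
      then show ?thesis by (simp only: ennreal_mult[symmetric] exp_ge_zero exp_add[symmetric]) (simp add: algebra_simps)
    qed
    show "indicator ?A x \<le> ennreal (exp (- (real n * a))) * (\<Prod>i\<in>{1..n}. ennreal (exp (\<phi> (x i))))"
    proof (cases "x \<in> ?A")
      case True
      then have "a \<le> (\<Sum>i\<in>{1..n}. \<phi> (x i)) / real n" by simp
      then have "real n * a \<le> (\<Sum>i\<in>{1..n}. \<phi> (x i))" using n by (simp add: pos_le_divide_eq mult.commute)
      then have "1 \<le> exp ((\<Sum>i\<in>{1..n}. \<phi> (x i)) - real n * a)" by simp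
      then have "ennreal 1 \<le> ennreal (exp ((\<Sum>i\<in>{1..n}. \<phi> (x i)) - real n * a))" by (rule ennreal_leI)
      then show ?thesis unfolding p using True by simp
    qed simp
  qed
  also have "\<dots> = ennreal (exp (- (real n * a))) * (\<integral>\<^sup>+x. (\<Prod>i\<in>{1..n}. ennreal (exp (\<phi> (x i)))) \<partial>sample \<nu> n)"
    by (rule nn_integral_cmult[OF m])
  also have "(\<integral>\<^sup>+x. (\<Prod>i\<in>{1..n}. ennreal (exp (\<phi> (x i)))) \<partial>sample \<nu> n) = (\<Prod>i\<in>{1..n}. \<integral>\<^sup>+x. ennreal (exp (\<phi> x)) \<partial>\<nu>)"
    by (rule product_nn_integral_prod) auto
  also have "\<dots> = (\<integral>\<^sup>+x. ennreal (exp (\<phi> x)) \<partial>\<nu>) ^ n" by simp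
  also have "ennreal (exp (- (real n * a))) * \<dots> \<le> ennreal (exp (- (real n * a))) * ennreal (exp Z) ^ n"
    by (intro mult_left_mono power_mono Z) auto
  also have "\<dots> = ennreal (exp (- (real n * (a - Z))))"
  proof -
    have "exp (- (real n * a)) * exp Z ^ n = exp (- (real n * (a - Z)))"
      unfolding exp_of_nat_mult[symmetric] exp_add[symmetric] by (simp add: algebra_simps)
    then show ?thesis by (simp add: ennreal_power ennreal_mult[symmetric])
  qed
  finally show ?thesis unfolding S.emeasure_eq_measure by (rule ennreal_le_iff[THEN iffD1, rotated]) simp
qed

lemma exp_le_quadratic: "x \<le> 1 \<Longrightarrow> exp x \<le> 1 + x + x^2" for x :: real
proof (cases "0 \<le> x")
  case True
  assume "x \<le> 1"
  then show ?thesis using exp_bound[OF True] by simp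
next
  case False
  \<comment> \<open>The product is \<open>1 - x^3\<close>, and \<open>x\<close> is negative.\<close>
  then have "1 \<le> (1 - x) * (1 + x + x^2)"
    by (simp add: algebra_simps power2_eq_square) (simp add: mult_nonneg_nonpos zero_le_mult_iff mult_le_0_iff)
  also have "\<dots> \<le> exp (- x) * (1 + x + x^2)"
  proof (rule mult_right_mono)
    show "1 - x \<le> exp (- x)" using exp_ge_add_one_self[of "- x"] by simp
    have "0 \<le> (x + 1/2)^2" by simp
    then show "0 \<le> 1 + x + x^2" by (simp add: power2_eq_square algebra_simps)
  qed
  finally show ?thesis by (simp add: exp_minus field_simps)
qed

text \<open>Chernoff's inequality at a small multiple of \<phi>, whose log-moment is linear in the
  mean up to a quadratic error.\<close>

lemma deviation_bounded:
  fixes \<phi> :: "real \<Rightarrow> real"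
  assumes nu: "real_distribution \<nu>" and \<phi>[measurable]: "\<phi> \<in> borel_measurable borel" and B: "\<And>x. \<bar>\<phi> x\<bar> \<le> B" and e: "e > 0"
  shows "(\<lambda>n. measure (sample \<nu> n) {x \<in> space (sample \<nu> n). (\<integral>x. \<phi> x \<partial>\<nu>) + e \<le> (\<Sum>i\<in>{1..n}. \<phi> (x i)) / real n}) \<longlonglongrightarrow> 0"
proof -
  interpret nu: real_distribution \<nu> by fact
  define m where "m = (\<integral>x. \<phi> x \<partial>\<nu>)"
  define C where "C = \<bar>B\<bar> + 1"
  have C: "C > 0" "\<And>x. \<bar>\<phi> x\<bar> \<le> C" using B by (auto simp: C_def intro: order_trans[OF B])
  \<comment> \<open>The first bound brings \<open>t * \<phi> x\<close> into the range of the
    quadratic estimate, the second limits the quadratic error to half of the gain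
    \<open>t * e\<close>.\<close>
  define t where "t = min (1 / C) (e / (2 * C^2))"
  have t: "0 < t" "t * C \<le> 1" "t * C^2 \<le> e / 2"
    using C e by (auto simp: t_def min_def field_simps power2_eq_square)
  have int: "integrable \<nu> \<phi>" by (rule nu.integrable_bdd[OF \<phi> C(2)])
  have bd: "exp (t * \<phi> x) \<le> 1 + t * \<phi> x + t^2 * C^2" for x
  proof -
    have "t * \<phi> x \<le> t * C" using t C(2)[of x] by (intro mult_left_mono) auto
    then have "t * \<phi> x \<le> 1" using t(2) by linarith
    then have "exp (t * \<phi> x) \<le> 1 + t * \<phi> x + (t * \<phi> x)^2" by (rule exp_le_quadratic)
    also have "(t * \<phi> x)^2 \<le> t^2 * C^2" using C(2)[of x] unfolding power_mult_distrib
      by (intro mult_left_mono) (auto simp: abs_le_square_iff[symmetric] C(1) less_imp_le)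
    finally show ?thesis by simp
  qed
  define Z where "Z = t * m + t^2 * C^2"
  have Z: "(\<integral>\<^sup>+x. ennreal (exp (t * \<phi> x)) \<partial>\<nu>) \<le> ennreal (exp Z)"
  proof -
    have i2: "integrable \<nu> (\<lambda>x. exp (t * \<phi> x))"
      by (rule nu.exp_integral_bounds(1)[where B="t * C"]) (use t C(2) in \<open>auto simp: abs_mult\<close>)
    have "(\<integral>\<^sup>+x. ennreal (exp (t * \<phi> x)) \<partial>\<nu>) = ennreal (\<integral>x. exp (t * \<phi> x) \<partial>\<nu>)"
      by (rule nn_integral_eq_integral[OF i2]) simp
    also have "(\<integral>x. exp (t * \<phi> x) \<partial>\<nu>) \<le> (\<integral>x. 1 + t * \<phi> x + t^2 * C^2 \<partial>\<nu>)"
      by (rule integral_mono[OF i2 _ bd]) (use int in simp)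
    also have "(\<integral>x. 1 + t * \<phi> x + t^2 * C^2 \<partial>\<nu>) = 1 + Z" using int nu.prob_space by (simp add: Z_def m_def)
    also have "1 + Z \<le> exp Z" by (rule exp_ge_add_one_self)
    finally show ?thesis by (simp add: ennreal_leI)
  qed
  define c where "c = t * (m + e) - Z"
  have c: "c > 0"
  proof -
    have "t * (t * C^2) \<le> t * (e / 2)" using t by (intro mult_left_mono) auto
    then have "c \<ge> t * e / 2" by (simp add: c_def Z_def power2_eq_square algebra_simps)
    moreover have "0 < t * e / 2" using t(1) e by simp
    ultimately show ?thesis by linarith
  qed
  have le: "measure (sample \<nu> n) {x \<in> space (sample \<nu> n). m + e \<le> (\<Sum>i\<in>{1..n}. \<phi> (x i)) / real n} \<le> exp (- c) ^ n" if n: "n \<ge> 1" for n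
  proof -
    interpret S: prob_space "sample \<nu> n" by (rule prob_space_sample[OF nu])
    have "measure (sample \<nu> n) {x \<in> space (sample \<nu> n). m + e \<le> (\<Sum>i\<in>{1..n}. \<phi> (x i)) / real n}
      \<le> measure (sample \<nu> n) {x \<in> space (sample \<nu> n). t * (m + e) \<le> (\<Sum>i\<in>{1..n}. t * \<phi> (x i)) / real n}"
    proof (rule S.finite_measure_mono)
      show "{x \<in> space (sample \<nu> n). m + e \<le> (\<Sum>i\<in>{1..n}. \<phi> (x i)) / real n}
        \<subseteq> {x \<in> space (sample \<nu> n). t * (m + e) \<le> (\<Sum>i\<in>{1..n}. t * \<phi> (x i)) / real n}"
        using t(1) by (auto simp: sum_distrib_left[symmetric] times_divide_eq_right[symmetric] simp del: times_divide_eq_right)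
    qed (rule sample_sets_ge[OF nu], simp)
    also have "\<dots> \<le> exp (- (real n * (t * (m + e) - Z)))" by (rule chernoff[OF nu _ Z n]) simp
    also have "\<dots> = exp (- c) ^ n" unfolding c_def[symmetric] exp_of_nat_mult[symmetric] by simp
    finally show ?thesis .
  qed
  have lim: "(\<lambda>n. exp (- c) ^ n) \<longlonglongrightarrow> 0" by (rule LIMSEQ_realpow_zero) (use c in auto)
  show ?thesis
    unfolding m_def[symmetric]
    by (rule tendsto_sandwich[OF _ eventually_mono[OF eventually_ge_at_top[of 1] le] tendsto_const lim]) simp_all
qed

text \<open>The exceptional sets are part of the definition because \<open>E n\<close> itself need not be measurable.\<close>
definition whp :: "real measure \<Rightarrow> (nat \<Rightarrow> (nat \<Rightarrow> real) \<Rightarrow> bool) \<Rightarrow> bool" where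
  "whp \<nu> E \<longleftrightarrow> (\<exists>A. (\<forall>n. A n \<in> sets (sample \<nu> n)) \<and> (\<lambda>n. measure (sample \<nu> n) (A n)) \<longlonglongrightarrow> 0 \<and>
     (\<forall>n\<ge>1. \<forall>x\<in>space (sample \<nu> n) - A n. E n x))"

lemma whpI:
  assumes "\<And>n. A n \<in> sets (sample \<nu> n)" "(\<lambda>n. measure (sample \<nu> n) (A n)) \<longlonglongrightarrow> 0"
    "\<And>n x. n \<ge> 1 \<Longrightarrow> x \<in> space (sample \<nu> n) \<Longrightarrow> x \<notin> A n \<Longrightarrow> E n x"
  shows "whp \<nu> E"
  unfolding whp_def by (rule exI[of _ A]) (use assms in blast)

lemma whpE:
  assumes "whp \<nu> E"
  obtains A where "\<And>n. A n \<in> sets (sample \<nu> n)" "(\<lambda>n. measure (sample \<nu> n) (A n)) \<longlonglongrightarrow> 0"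
    "\<And>n x. n \<ge> 1 \<Longrightarrow> x \<in> space (sample \<nu> n) \<Longrightarrow> x \<notin> A n \<Longrightarrow> E n x"
  using assms unfolding whp_def by blast

lemma whp_mono: "whp \<nu> E \<Longrightarrow> (\<And>n x. n \<ge> 1 \<Longrightarrow> E n x \<Longrightarrow> E' n x) \<Longrightarrow> whp \<nu> E'"
  unfolding whp_def by blast

lemma whp_True: "(\<And>n x. n \<ge> 1 \<Longrightarrow> E n x) \<Longrightarrow> whp \<nu> E"
  by (rule whpI[of "\<lambda>_. {}"]) auto

lemma whp_conj:
  assumes nu: "real_distribution \<nu>" and "whp \<nu> E" "whp \<nu> E'" shows "whp \<nu> (\<lambda>n x. E n x \<and> E' n x)"
proof -
  obtain A where A: "\<And>n. A n \<in> sets (sample \<nu> n)" "(\<lambda>n. measure (sample \<nu> n) (A n)) \<longlonglongrightarrow> 0"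
    "\<And>n x. n \<ge> 1 \<Longrightarrow> x \<in> space (sample \<nu> n) \<Longrightarrow> x \<notin> A n \<Longrightarrow> E n x" by (rule whpE[OF assms(2)]) (rule that)
  obtain A' where A': "\<And>n. A' n \<in> sets (sample \<nu> n)" "(\<lambda>n. measure (sample \<nu> n) (A' n)) \<longlonglongrightarrow> 0"
    "\<And>n x. n \<ge> 1 \<Longrightarrow> x \<in> space (sample \<nu> n) \<Longrightarrow> x \<notin> A' n \<Longrightarrow> E' n x" by (rule whpE[OF assms(3)]) (rule that)
  show ?thesis
  proof (rule whpI[of "\<lambda>n. A n \<union> A' n"])
    show "A n \<union> A' n \<in> sets (sample \<nu> n)" for n using A(1) A'(1) by blast
    have lim: "(\<lambda>n. measure (sample \<nu> n) (A n) + measure (sample \<nu> n) (A' n)) \<longlonglongrightarrow> 0"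
      using tendsto_add[OF A(2) A'(2)] by simp
    show "(\<lambda>n. measure (sample \<nu> n) (A n \<union> A' n)) \<longlonglongrightarrow> 0"
      by (rule tendsto_sandwich[OF _ _ tendsto_const lim]) (simp_all only: measure_nonneg eventually_True measure_Un_le[OF A(1) A'(1)])
  qed (use A(3) A'(3) in blast)
qed

lemma whp_ball:
  assumes nu: "real_distribution \<nu>" and "finite D" "\<And>d. d \<in> D \<Longrightarrow> whp \<nu> (E d)"
  shows "whp \<nu> (\<lambda>n x. \<forall>d\<in>D. E d n x)"
  using assms(2,3)
proof (induction D)
  case empty
  show ?case by (rule whp_True) simp
next
  case (insert d D)
  have "whp \<nu> (\<lambda>n x. E d n x \<and> (\<forall>d\<in>D. E d n x))" by (rule whp_conj[OF nu]) (use insert in auto)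
  then show ?case by simp
qed

lemma whp_less:
  fixes \<phi> :: "real \<Rightarrow> real"
  assumes nu: "real_distribution \<nu>" and \<phi>: "\<phi> \<in> borel_measurable borel" and B: "\<And>x. \<bar>\<phi> x\<bar> \<le> B" and c: "(\<integral>x. \<phi> x \<partial>\<nu>) < c"
  shows "whp \<nu> (\<lambda>n x. (\<Sum>i\<in>{1..n}. \<phi> (x i)) / real n < c)"
  by (rule whpI[OF sample_sets_ge[OF nu \<phi>, where a=c]])
     (use deviation_bounded[OF nu \<phi> B, of "c - (\<integral>x. \<phi> x \<partial>\<nu>)"] c in auto)

lemma whp_greater:
  fixes \<phi> :: "real \<Rightarrow> real"
  assumes nu: "real_distribution \<nu>" and \<phi>[measurable]: "\<phi> \<in> borel_measurable borel" and B: "\<And>x. \<bar>\<phi> x\<bar> \<le> B" and c: "c < (\<integral>x. \<phi> x \<partial>\<nu>)"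
  shows "whp \<nu> (\<lambda>n x. c < (\<Sum>i\<in>{1..n}. \<phi> (x i)) / real n)"
  using whp_less[OF nu, of "\<lambda>x. - \<phi> x" B "- c"] B c by (simp add: sum_negf)

lemma whp_interval:
  assumes nu: "real_distribution \<nu>" and c: "c < measure \<nu> {-K<..K}"
  shows "whp \<nu> (\<lambda>n x. c < measure (emp x n) {-K<..K})"
proof -
  interpret nu: real_distribution \<nu> by fact
  have i: "(\<integral>y. indicator {-K<..K} y \<partial>\<kappa>) = measure \<kappa> {-K<..K}" if "real_distribution \<kappa>" for \<kappa>
  proof -
    interpret real_distribution \<kappa> by fact
    show ?thesis by simp
  qed
  have "whp \<nu> (\<lambda>n x. c < (\<Sum>i\<in>{1..n}. indicator {-K<..K} (x i)) / real n)"
    by (rule whp_greater[OF nu, where B=1]) (use c i[OF nu] in \<open>auto simp: indicator_def\<close>)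
  then show ?thesis
  proof (rule whp_mono)
    fix n :: nat and x assume n: "n \<ge> 1" and a: "c < (\<Sum>i\<in>{1..n}. indicator {-K<..K} (x i)) / real n"
    show "c < measure (emp x n) {-K<..K}"
      using a unfolding i[OF real_distribution_emp, symmetric] by (subst integral_emp[OF n]) auto
  qed
qed

text \<open>Monotone convergence in the truncation level, which covers infinite values of
  \<open>mgf \<nu> q\<close> as well.\<close>

lemma truncated_exp_integral:
  assumes nu: "real_distribution \<nu>" and c: "ereal c < mgf \<nu> q"
  shows "\<exists>L::nat. c < (\<integral>x. min (exp (q * x)) (real L) \<partial>\<nu>)"
proof (rule ccontr)
  interpret nu: real_distribution \<nu> by fact
  assume "\<not> ?thesis"
  then have le: "(\<integral>x. min (exp (q * x)) (real L) \<partial>\<nu>) \<le> c" for L :: nat by (simp add: not_less)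
  have "0 \<le> (\<integral>x. min (exp (q * x)) (real 0) \<partial>\<nu>)" by (intro integral_nonneg_AE) simp
  then have c0: "0 \<le> c" using le[of 0] by linarith
  have int: "integrable \<nu> (\<lambda>x. min (exp (q * x)) (real L))" for L :: nat by (rule nu.integrable_bdd[where B="real L"]) auto
  have "ennreal (exp (q * x)) = (SUP L::nat. ennreal (min (exp (q * x)) (real L)))" for x
  proof (rule antisym)
    obtain L :: nat where "exp (q * x) \<le> real L" using real_arch_simple by blast
    then have "ennreal (exp (q * x)) = ennreal (min (exp (q * x)) (real L))" by (simp add: min_def)
    also have "\<dots> \<le> (SUP L::nat. ennreal (min (exp (q * x)) (real L)))" by (rule SUP_upper) simp
    finally show "ennreal (exp (q * x)) \<le> (SUP L::nat. ennreal (min (exp (q * x)) (real L)))" .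
  qed (auto intro!: SUP_least ennreal_leI)
  then have "(\<integral>\<^sup>+x. ennreal (exp (q * x)) \<partial>\<nu>) = (\<integral>\<^sup>+x. (SUP L::nat. ennreal (min (exp (q * x)) (real L))) \<partial>\<nu>)" by simp
  also have "\<dots> = (SUP L::nat. \<integral>\<^sup>+x. ennreal (min (exp (q * x)) (real L)) \<partial>\<nu>)"
    by (rule nn_integral_monotone_convergence_SUP) (auto simp: incseq_def le_fun_def intro!: ennreal_leI)
  also have "\<dots> \<le> ennreal c"
  proof (rule SUP_least)
    fix L :: nat
    have "(\<integral>\<^sup>+x. ennreal (min (exp (q * x)) (real L)) \<partial>\<nu>) = ennreal (\<integral>x. min (exp (q * x)) (real L) \<partial>\<nu>)"
      by (rule nn_integral_eq_integral[OF int]) simp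
    also have "\<dots> \<le> ennreal c" by (rule ennreal_leI[OF le])
    finally show "(\<integral>\<^sup>+x. ennreal (min (exp (q * x)) (real L)) \<partial>\<nu>) \<le> ennreal c" .
  qed
  finally have "mgf \<nu> q \<le> ereal c" using mgf_le_iff[OF c0] by blast
  then show False using c by simp
qed

lemma whp_mgf_greater:
  assumes nu: "real_distribution \<nu>" and c: "ereal c < mgf \<nu> q"
  shows "whp \<nu> (\<lambda>n x. ereal c < emgf n x q)"
proof -
  obtain L :: nat where L: "c < (\<integral>x. min (exp (q * x)) (real L) \<partial>\<nu>)" using truncated_exp_integral[OF assms] by blast
  have "whp \<nu> (\<lambda>n x. c < (\<Sum>i\<in>{1..n}. min (exp (q * x i)) (real L)) / real n)"
    by (rule whp_greater[OF nu _ _ L, where B="real L"]) auto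
  then show ?thesis
  proof (rule whp_mono)
    fix n :: nat and x assume n: "n \<ge> 1" and a: "c < (\<Sum>i\<in>{1..n}. min (exp (q * x i)) (real L)) / real n"
    have "(\<Sum>i\<in>{1..n}. min (exp (q * x i)) (real L)) / real n \<le> (\<Sum>i\<in>{1..n}. exp (q * x i)) / real n"
      by (intro divide_right_mono sum_mono) auto
    then show "ereal c < emgf n x q" using a by (simp add: Mn_def)
  qed
qed

lemma markov_sample:
  fixes h :: "real \<Rightarrow> real"
  assumes nu: "real_distribution \<nu>" and h[measurable]: "h \<in> borel_measurable borel" and h0: "\<And>x. 0 \<le> h x"
    and int: "integrable \<nu> h" and e: "e > 0" and n: "n \<ge> 1"
  shows "measure (sample \<nu> n) {x \<in> space (sample \<nu> n). e \<le> (\<Sum>i\<in>{1..n}. h (x i)) / real n} \<le> (\<integral>x. h x \<partial>\<nu>) / e"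
proof -
  interpret nu: real_distribution \<nu> by fact
  interpret S: prob_space "sample \<nu> n" by (rule prob_space_sample[OF nu])
  have d: "distr (sample \<nu> n) \<nu> (\<lambda>x. x i) = \<nu>" if "i \<in> {1..n}" for i
    by (rule distr_PiM_component) (use that nu.prob_space_axioms in auto)
  have mi: "(\<lambda>x. x i) \<in> measurable (sample \<nu> n) \<nu>" if "i \<in> {1..n}" for i
    by (rule measurable_component_singleton[OF that])
  have hm: "h \<in> borel_measurable \<nu>" by simp
  have ii: "integrable (sample \<nu> n) (\<lambda>x. h (x i))" if "i \<in> {1..n}" for i
    using integrable_distr_eq[OF mi[OF that] hm] int unfolding d[OF that] by blast
  have iv: "(\<integral>x. h (x i) \<partial>sample \<nu> n) = (\<integral>x. h x \<partial>\<nu>)" if "i \<in> {1..n}" for i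
    using integral_distr[OF mi[OF that] hm] unfolding d[OF that] by simp
  have int': "integrable (sample \<nu> n) (\<lambda>x. (\<Sum>i\<in>{1..n}. h (x i)) / real n)"
    using ii by (intro integrable_divide Bochner_Integration.integrable_sum) auto
  have val: "(\<integral>x. (\<Sum>i\<in>{1..n}. h (x i)) / real n \<partial>sample \<nu> n) = (\<integral>x. h x \<partial>\<nu>)"
  proof -
    have "(\<integral>x. (\<Sum>i\<in>{1..n}. h (x i)) / real n \<partial>sample \<nu> n) = (\<Sum>i\<in>{1..n}. \<integral>x. h (x i) \<partial>sample \<nu> n) / real n"
      using ii by (subst integral_divide_zero, subst Bochner_Integration.integral_sum) auto
    also have "\<dots> = (\<Sum>i\<in>{1..n}. \<integral>x. h x \<partial>\<nu>) / real n" using iv by (intro arg_cong2[where f="(/)"] sum.cong) auto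
    finally show ?thesis using n by simp
  qed
  show ?thesis
    using integral_Markov_inequality_measure[OF int' _ _ e, of "{}"] h0 unfolding val
    by (auto simp: sum_nonneg divide_nonneg_nonneg)
qed

text \<open>A finite mean is all that is known. The exponential is split at a level \<open>L\<close>
  into a bounded part, which concentrates, and a remainder of small mean, for which Markov's
  inequality suffices; \<open>L\<close> depends on the target probability \<epsilon> and not on
  \<open>n\<close>.\<close>

lemma whp_mgf_less:
  assumes nu: "real_distribution \<nu>" and c: "mgf \<nu> q < ereal c"
  shows "whp \<nu> (\<lambda>n x. emgf n x q < ereal c)"
proof -
  interpret nu: real_distribution \<nu> by fact
  have fin: "mgf \<nu> q < \<infinity>" using c by (rule less_trans) simp
  define m where "m = (\<integral>x. exp (q * x) \<partial>\<nu>)"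
  have m: "mgf \<nu> q = ereal m" "integrable \<nu> (\<lambda>x. exp (q * x))" using nu.mgf_eq_integral[OF fin] by (simp_all add: m_def)
  define e where "e = (c - m) / 2"
  have e: "e > 0" using c by (simp add: e_def m)
  let ?bad = "\<lambda>n. {x \<in> space (sample \<nu> n). c \<le> (\<Sum>i\<in>{1..n}. exp (q * x i)) / real n}"
  show ?thesis
  proof (rule whpI[of ?bad])
    show "?bad n \<in> sets (sample \<nu> n)" for n using sample_sets_ge[OF nu, of "\<lambda>y. exp (q * y)"] by simp
    show "(\<lambda>n. measure (sample \<nu> n) (?bad n)) \<longlonglongrightarrow> 0"
    proof (rule LIMSEQ_I)
      fix \<epsilon> :: real assume \<epsilon>: "0 < \<epsilon>"
      \<comment> \<open>Chosen so that Markov's bound \<open>\<eta> / e\<close> for the remainder is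
        \<open>\<epsilon> / 2\<close>.\<close>
      define \<eta> where "\<eta> = e * \<epsilon> / 2"
      have "\<eta> > 0" using e \<epsilon> by (simp add: \<eta>_def)
      then have "ereal (m - \<eta>) < mgf \<nu> q" by (simp add: m)
      then obtain L :: nat where L: "m - \<eta> < (\<integral>x. min (exp (q * x)) (real L) \<partial>\<nu>)" using truncated_exp_integral[OF nu] by blast
      let ?g = "\<lambda>y. min (exp (q * y)) (real L)"
      let ?h = "\<lambda>y. exp (q * y) - ?g y"
      have ig: "integrable \<nu> ?g" by (rule nu.integrable_bdd[where B="real L"]) auto
      have ih: "integrable \<nu> ?h" "(\<integral>x. ?h x \<partial>\<nu>) = m - (\<integral>x. ?g x \<partial>\<nu>)" using m(2) ig by (simp_all add: m_def)
      have gm: "(\<integral>x. ?g x \<partial>\<nu>) \<le> m" unfolding m_def by (rule integral_mono[OF ig m(2)]) simp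
      let ?G = "\<lambda>n. {x \<in> space (sample \<nu> n). (\<integral>x. ?g x \<partial>\<nu>) + e \<le> (\<Sum>i\<in>{1..n}. ?g (x i)) / real n}"
      let ?H = "\<lambda>n. {x \<in> space (sample \<nu> n). e \<le> (\<Sum>i\<in>{1..n}. ?h (x i)) / real n}"
      have "(\<lambda>n. measure (sample \<nu> n) (?G n)) \<longlonglongrightarrow> 0"
        by (rule deviation_bounded[OF nu _ _ e, where B="real L"]) auto
      then have "\<forall>\<^sub>F n in sequentially. measure (sample \<nu> n) (?G n) < \<epsilon> / 2" by (rule order_tendstoD(2)) (use \<epsilon> in simp)
      then have "\<forall>\<^sub>F n in sequentially. norm (measure (sample \<nu> n) (?bad n) - 0) < \<epsilon>"
        using eventually_ge_at_top[of 1]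
      proof eventually_elim
        case (elim n)
        interpret S: prob_space "sample \<nu> n" by (rule prob_space_sample[OF nu])
        have G: "?G n \<in> sets (sample \<nu> n)" by (rule sample_sets_ge[OF nu]) simp
        have H: "?H n \<in> sets (sample \<nu> n)" by (rule sample_sets_ge[OF nu]) simp
        have "?bad n \<subseteq> ?G n \<union> ?H n"
        proof
          fix x assume x: "x \<in> ?bad n"
          have "(\<Sum>i\<in>{1..n}. exp (q * x i)) / real n = (\<Sum>i\<in>{1..n}. ?g (x i)) / real n + (\<Sum>i\<in>{1..n}. ?h (x i)) / real n"
            by (simp add: add_divide_distrib[symmetric] sum.distrib[symmetric])
          then show "x \<in> ?G n \<union> ?H n" using x gm by (auto simp: e_def field_simps)
        qed
        then have "measure (sample \<nu> n) (?bad n) \<le> measure (sample \<nu> n) (?G n \<union> ?H n)" using G H by (intro S.finite_measure_mono) auto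
        also have "\<dots> \<le> measure (sample \<nu> n) (?G n) + measure (sample \<nu> n) (?H n)" by (rule measure_Un_le[OF G H])
        also have "measure (sample \<nu> n) (?H n) \<le> (\<integral>x. ?h x \<partial>\<nu>) / e"
          by (rule markov_sample[OF nu _ _ ih(1) e elim(2)]) auto
        also have "\<dots> \<le> \<eta> / e" using e L by (intro divide_right_mono) (auto simp: ih(2))
        also have "\<eta> / e = \<epsilon> / 2" using e by (simp add: \<eta>_def)
        finally show ?case using elim(1) by simp
      qed
      then show "\<exists>no. \<forall>n\<ge>no. norm (measure (sample \<nu> n) (?bad n) - 0) < \<epsilon>" unfolding eventually_sequentially .
    qed
    show "emgf n x q < ereal c" if "x \<in> space (sample \<nu> n)" "x \<notin> ?bad n" for n x
      using that by (simp add: Mn_def)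
  qed
qed

lemma whp_mgf_open:
  assumes nu: "real_distribution \<nu>" and V: "open V" "mgf \<nu> q \<in> V"
  shows "whp \<nu> (\<lambda>n x. mgf (emp x n) q \<in> V)"
proof (cases "mgf \<nu> q = \<infinity>")
  case True
  then obtain c where c: "{ereal c<..} \<subseteq> V" using open_PInfty2 V by metis
  have "whp \<nu> (\<lambda>n x. ereal c < emgf n x q)" by (rule whp_mgf_greater[OF nu]) (simp add: True)
  then show ?thesis by (rule whp_mono) (use c in \<open>auto simp: mgf_emp\<close>)
next
  case False
  interpret nu: real_distribution \<nu> by fact
  obtain r where r: "mgf \<nu> q = ereal r" using nu.mgf_eq_integral(2)[of q] False by auto
  then have "\<bar>mgf \<nu> q\<bar> \<noteq> \<infinity>" by simp
  then obtain e where e: "e > 0" "{mgf \<nu> q - e<..<mgf \<nu> q + e} \<subseteq> V" 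
    by (rule ereal_open_cont_interval[OF V])
  obtain d where d: "0 < d" "ereal d \<le> e" using e(1) by (cases e) (auto intro: that[of 1])
  have "whp \<nu> (\<lambda>n x. ereal (r - d) < emgf n x q)" by (rule whp_mgf_greater[OF nu]) (simp add: r d)
  moreover have "whp \<nu> (\<lambda>n x. emgf n x q < ereal (r + d))" by (rule whp_mgf_less[OF nu]) (simp add: r d)
  ultimately have "whp \<nu> (\<lambda>n x. ereal (r - d) < emgf n x q \<and> emgf n x q < ereal (r + d))" by (rule whp_conj[OF nu])
  then show ?thesis
  proof (rule whp_mono)
    fix n :: nat and x assume n: "n \<ge> 1" and a: "ereal (r - d) < emgf n x q \<and> emgf n x q < ereal (r + d)"
    have "mgf \<nu> q - e \<le> ereal (r - d)" "ereal (r + d) \<le> mgf \<nu> q + e"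
      using d r by (cases e; simp)+
    then have "emgf n x q \<in> {mgf \<nu> q - e<..<mgf \<nu> q + e}" using a by (auto intro: le_less_trans less_le_trans)
    then show "mgf (emp x n) q \<in> V" using e(2) mgf_emp[OF n] by auto
  qed
qed

text \<open>The neighbourhood is guaranteed by finitely many conditions, each of which holds with
  probability tending to 1.\<close>

lemma whp_emgf_open:
  assumes nu: "real_distribution \<nu>" and G: "openin (AW_top XM) G" "mgf \<nu> \<in> G"
  shows "whp \<nu> (\<lambda>n x. emgf n x \<in> G)"
proof -
  obtain D E where DE: "finite D" "finite E" "\<forall>(q, V)\<in>D. open V \<and> mgf \<nu> q \<in> V" "\<forall>(K, c)\<in>E. c < measure \<nu> {-K<..K}"
    "\<And>\<kappa>. real_distribution \<kappa> \<Longrightarrow> (\<forall>(q, V)\<in>D. mgf \<kappa> q \<in> V) \<Longrightarrow> (\<forall>(K, c)\<in>E. c < measure \<kappa> {-K<..K}) \<Longrightarrow> mgf \<kappa> \<in> G"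
    using mgf_nbhd_test_functions[OF nu G] by blast
  have "whp \<nu> (\<lambda>n x. \<forall>d\<in>D. case d of (q, V) \<Rightarrow> mgf (emp x n) q \<in> V)"
    by (rule whp_ball[OF nu DE(1)]) (use DE(3) whp_mgf_open[OF nu] in auto)
  moreover have "whp \<nu> (\<lambda>n x. \<forall>d\<in>E. case d of (K, c) \<Rightarrow> c < measure (emp x n) {-K<..K})"
    by (rule whp_ball[OF nu DE(2)]) (use DE(4) whp_interval[OF nu] in auto)
  ultimately have "whp \<nu> (\<lambda>n x. (\<forall>d\<in>D. case d of (q, V) \<Rightarrow> mgf (emp x n) q \<in> V) \<and> (\<forall>d\<in>E. case d of (K, c) \<Rightarrow> c < measure (emp x n) {-K<..K}))"
    by (rule whp_conj[OF nu])
  then show ?thesis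
    by (rule whp_mono) (use DE(5)[OF real_distribution_emp] mgf_emp in metis)
qed

section \<open>Large deviation bounds\<close>

lemma ereal_le_uminus_iff: "a \<le> - b \<longleftrightarrow> b \<le> - a" for a b :: ereal
  by (cases a; cases b) auto

lemma elog_prob_pos: "0 < p \<Longrightarrow> ereal (1 / real n) * elog_prob p = ereal (ln p / real n)"
  by (simp add: elog_prob_def)

text \<open>Under a nearly optimal law \<kappa> the event has probability tending to 1. In the
  change of measure the denominator \<open>r n\<close> and the constant \<open>ln 2\<close> then
  leave no trace on the exponential scale.\<close>

lemma sample_liminf:
  assumes mu: "real_distribution \<mu>" and G: "openin (AW_top XM) G" "f \<in> G"
  shows "- mgf_rate \<mu> f \<le> liminf (\<lambda>n. ereal (1 / real n) * elog_prob (measure (sample \<mu> n) {x \<in> space (sample \<mu> n). emgf n x \<in> G}))"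
    (is "_ \<le> ?l")
proof (cases "mgf_rate \<mu> f = \<infinity>")
  case True
  then show ?thesis by simp
next
  case False
  have f: "f \<in> XM" using openin_subset[OF G(1)] G(2) AW_top_topspace[OF epi_sep_XM] by blast
  obtain s where s: "mgf_rate \<mu> f = ereal s" using False mgf_rate_nonneg[OF mu, of f] by (cases "mgf_rate \<mu> f") auto
  let ?p = "\<lambda>n. measure (sample \<mu> n) {x \<in> space (sample \<mu> n). emgf n x \<in> G}"
  have le: "ereal (- (s + e)) \<le> ?l" if e: "e > 0" for e
  proof -
    obtain \<kappa> where k: "real_distribution \<kappa>" "ent_le \<kappa> \<mu> (s + e)" "mgf \<kappa> \<in> G"
      using mgf_rate_approx[OF mu f s e G] by blast
    obtain A where A: "\<And>n. A n \<in> sets (sample \<kappa> n)" "(\<lambda>n. measure (sample \<kappa> n) (A n)) \<longlonglongrightarrow> 0"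
      "\<And>n x. n \<ge> 1 \<Longrightarrow> x \<in> space (sample \<kappa> n) \<Longrightarrow> x \<notin> A n \<Longrightarrow> emgf n x \<in> G"
      by (rule whpE[OF whp_emgf_open[OF k(1) G(1) k(3)]]) (rule that)
    define r where "r n = 1 - measure (sample \<kappa> n) (A n)" for n
    have r: "r \<longlonglongrightarrow> 1" unfolding r_def using tendsto_diff[OF tendsto_const A(2), of 1] by simp
    define h where "h n = - ((s + e) + ln 2 * (1 / real n)) / r n" for n
    have "h \<longlonglongrightarrow> - ((s + e) + ln 2 * 0) / 1"
      unfolding h_def by (intro tendsto_intros r lim_1_over_n) simp
    then have h: "(\<lambda>n. ereal (h n)) \<longlonglongrightarrow> ereal (- (s + e))" by simp
    have "\<forall>\<^sub>F n in sequentially. 0 < r n" by (rule order_tendstoD(1)[OF r]) simp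
    then have "\<forall>\<^sub>F n in sequentially. ereal (h n) \<le> ereal (1 / real n) * elog_prob (?p n)"
      using eventually_ge_at_top[of 1]
    proof eventually_elim
      case (elim n)
      interpret K: prob_space "sample \<kappa> n" by (rule prob_space_sample[OF k(1)])
      have sp: "space (sample \<mu> n) = space (sample \<kappa> n)"
        using sets_eq_imp_space_eq[of "sample \<mu> n" "sample \<kappa> n"] sets_sample[OF mu, of n] sets_sample[OF k(1), of n] by simp
      let ?E = "{x \<in> space (sample \<mu> n). emgf n x \<in> G}"
      have E: "?E \<in> sets (sample \<mu> n)" by (rule emgf_open_sets[OF mu elim(2) G(1)])
      then have E': "?E \<in> sets (sample \<kappa> n)" "?E \<in> sets (Pi\<^sub>M {1..n} (\<lambda>_. borel))"
        using sets_sample[OF mu, of n] sets_sample[OF k(1), of n] by auto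
      have "r n = measure (sample \<kappa> n) (space (sample \<kappa> n) - A n)" using K.prob_compl[OF A(1)] by (simp add: r_def)
      also have "\<dots> \<le> measure (sample \<kappa> n) ?E"
        by (rule K.finite_measure_mono[OF _ E'(1)]) (use A(3)[OF elim(2)] sp in auto)
      finally have rE: "r n \<le> measure (sample \<kappa> n) ?E" .
      then have q: "0 < measure (sample \<kappa> n) ?E" using elim(1) by linarith
      note P = ent_le_PiM_measure[OF k(1) mu k(2) finite_atLeastAtMost E'(2) q]
      have s0: "0 \<le> s + e" by (rule ent_le_nonneg[OF mu k(2)])
      have "(real n * (s + e) + ln 2) / measure (sample \<kappa> n) ?E \<le> (real n * (s + e) + ln 2) / r n"
        by (rule divide_left_mono[OF rE]) (use s0 elim(1) q in auto)
      moreover have "- ((real n * (s + e) + ln 2) / measure (sample \<kappa> n) ?E) \<le> ln (?p n)"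
        using P(2) by (simp only: card_atLeastAtMost diff_Suc_1 minus_divide_left)
      ultimately have "- ((real n * (s + e) + ln 2) / r n) \<le> ln (?p n)" by linarith
      then have "- ((real n * (s + e) + ln 2) / r n) / real n \<le> ln (?p n) / real n" by (rule divide_right_mono) simp
      moreover have "- ((real n * (s + e) + ln 2) / r n) / real n = h n"
        using elim by (simp add: h_def field_simps)
      ultimately show ?case using P(1) by (simp add: elog_prob_pos)
    qed
    then have "liminf (\<lambda>n. ereal (h n)) \<le> ?l" by (rule Liminf_mono)
    then show ?thesis using lim_imp_Liminf[OF sequentially_bot h] by simp
  qed
  have "- ?l \<le> ereal s + ereal e" if "e > 0" for e
    using le[OF that] by (subst ereal_uminus_le_reorder) simp
  then have "- ?l \<le> ereal s" by (rule ereal_le_epsilon2[rule_format])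
  then show ?thesis by (simp add: s ereal_uminus_le_reorder)
qed

lemma sample_lower_bound:
  assumes mu: "real_distribution \<mu>" and G: "openin (AW_top XM) G"
  shows "- (INF f\<in>G. mgf_rate \<mu> f) \<le> liminf (\<lambda>n. ereal (1 / real n) * elog_prob (measure (sample \<mu> n) {x \<in> space (sample \<mu> n). emgf n x \<in> G}))"
    (is "_ \<le> ?l")
proof -
  have "- ?l \<le> (INF f\<in>G. mgf_rate \<mu> f)"
    by (rule INF_greatest) (use sample_liminf[OF mu G] in \<open>simp add: ereal_uminus_le_reorder\<close>)
  then show ?thesis by (simp add: ereal_uminus_le_reorder)
qed

text \<open>One exceptional set serves all stages of the ramp: the stages increase with
  \<open>J\<close>, and Chernoff's bound does not depend on \<open>J\<close>.\<close>

lemma sample_tight: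
  assumes mu: "real_distribution \<mu>" and n: "n \<ge> 1"
    and k: "\<And>J. (\<integral>\<^sup>+x. ennreal (exp (ramp k J x)) \<partial>\<mu>) \<le> ennreal 2"
  shows "\<exists>B\<in>sets (sample \<mu> n). measure (sample \<mu> n) B \<le> exp (- (real n * A)) \<and>
    (\<forall>x\<in>space (sample \<mu> n) - B. tight_class k (A + ln 2) (emp x n))"
proof -
  interpret S: prob_space "sample \<mu> n" by (rule prob_space_sample[OF mu])
  let ?a = "\<lambda>J x. (\<Sum>i\<in>{1..n}. ramp k J (x i)) / real n"
  define B where "B J = {x \<in> space (sample \<mu> n). A + ln 2 < ?a J x}" for J
  have B: "B J \<in> sets (sample \<mu> n)" for J
    unfolding B_def by (rule borel_measurable_less[OF borel_measurable_const measurable_sample_sum[OF mu ramp_measurable]])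
  have "?a J x \<le> ?a J' x" if "J \<le> J'" for J J' x using ramp_mono[OF that] by (intro divide_right_mono sum_mono) auto
  then have inc: "incseq B" by (intro incseq_SucI) (auto simp: B_def intro: less_le_trans)
  have le: "measure (sample \<mu> n) (B J) \<le> exp (- (real n * A))" for J
  proof -
    have "measure (sample \<mu> n) (B J) \<le> measure (sample \<mu> n) {x \<in> space (sample \<mu> n). A + ln 2 \<le> ?a J x}"
      by (rule S.finite_measure_mono[OF _ sample_sets_ge[OF mu ramp_measurable]]) (auto simp: B_def)
    also have "\<dots> \<le> exp (- (real n * ((A + ln 2) - ln 2)))"
      by (rule chernoff[OF mu ramp_measurable _ n]) (use k in simp)
    finally show ?thesis by simp
  qed
  have "(\<lambda>J. measure (sample \<mu> n) (B J)) \<longlonglongrightarrow> measure (sample \<mu> n) (\<Union>J. B J)"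
    by (rule S.finite_Lim_measure_incseq[OF _ inc]) (use B in auto)
  then have m: "measure (sample \<mu> n) (\<Union>J. B J) \<le> exp (- (real n * A))" by (rule LIMSEQ_le_const2) (use le in auto)
  have t: "tight_class k (A + ln 2) (emp x n)" if "x \<in> space (sample \<mu> n)" "x \<notin> (\<Union>J. B J)" for x
    unfolding tight_class_def integral_emp[OF n ramp_measurable]
    using that real_distribution_emp by (auto simp: B_def not_less)
  show ?thesis by (rule bexI[of _ "\<Union>J. B J"]) (use m t B in blast)+
qed

text \<open>The tightness level and every set of the finite cover use the same exponent
  \<open>A\<close>. Each covering set contributes one term, and the samples outside the tight class
  contribute one more.\<close>

lemma sample_closed_bound:
  assumes mu: "real_distribution \<mu>" and F: "closedin (AW_top XM) F" and A: "0 \<le> A" "\<And>f. f \<in> F \<Longrightarrow> ereal A < mgf_rate \<mu> f"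
  shows "\<exists>N::nat. \<forall>n\<ge>1. measure (sample \<mu> n) {x \<in> space (sample \<mu> n). emgf n x \<in> F} \<le> (real N + 1) * exp (- (real n * A))"
proof -
  obtain k where k: "\<And>J. (\<integral>\<^sup>+x. ennreal (exp (ramp k J x)) \<partial>\<mu>) \<le> ennreal 2" using exists_ramp[OF mu] by blast
  define c where "c = A + ln 2"
  \<comment> \<open>The open sets on which the wanted bound holds for all \<open>n\<close> at once,
    apart from samples outside the tight class; compactness is applied to this family, which does
    not depend on \<open>n\<close>.\<close>
  define \<U> where "\<U> = {U. openin (AW_top XM) U \<and> (\<forall>n\<ge>1. \<exists>B\<in>sets (sample \<mu> n). measure (sample \<mu> n) B \<le> exp (- (real n * A)) \<and>
    (\<forall>x\<in>space (sample \<mu> n). emgf n x \<in> U \<longrightarrow> tight_class k c (emp x n) \<longrightarrow> x \<in> B))}"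
  let ?C = "{f \<in> XM. \<exists>\<nu>. tight_class k c \<nu> \<and> matches f \<nu>}"
  have "F \<inter> ?C \<subseteq> \<Union>\<U>"
  proof
    fix f assume f: "f \<in> F \<inter> ?C"
    then have "f \<in> XM" "ereal A < mgf_rate \<mu> f" using A(2) by auto
    then obtain U \<phi> a Z where U: "openin (AW_top XM) U" "f \<in> U" "\<phi> \<in> borel_measurable borel"
      "(\<integral>\<^sup>+x. ennreal (exp (\<phi> x)) \<partial>\<mu>) \<le> ennreal (exp Z)" "A \<le> a - Z"
      "\<And>n x. n \<ge> 1 \<Longrightarrow> emgf n x \<in> U \<Longrightarrow> tight_class k c (emp x n) \<Longrightarrow> a \<le> (\<Sum>i\<in>{1..n}. \<phi> (x i)) / real n"
      using mgf_rate_local_separation[OF mu _ A(1), of f k c] by blast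
    have "\<exists>B\<in>sets (sample \<mu> n). measure (sample \<mu> n) B \<le> exp (- (real n * A)) \<and>
      (\<forall>x\<in>space (sample \<mu> n). emgf n x \<in> U \<longrightarrow> tight_class k c (emp x n) \<longrightarrow> x \<in> B)" if n: "n \<ge> 1" for n
    proof (rule bexI[OF _ sample_sets_ge[OF mu U(3)]], intro conjI ballI impI)
      have "measure (sample \<mu> n) {x \<in> space (sample \<mu> n). a \<le> (\<Sum>i\<in>{1..n}. \<phi> (x i)) / real n} \<le> exp (- (real n * (a - Z)))"
        by (rule chernoff[OF mu U(3,4) n])
      also have "\<dots> \<le> exp (- (real n * A))" using U(5) by (simp add: mult_left_mono)
      finally show "measure (sample \<mu> n) {x \<in> space (sample \<mu> n). a \<le> (\<Sum>i\<in>{1..n}. \<phi> (x i)) / real n} \<le> exp (- (real n * A))" .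
    qed (use U(6)[OF n] in blast)
    then have "U \<in> \<U>" using U(1) by (simp add: \<U>_def)
    then show "f \<in> \<Union>\<U>" using U(2) by blast
  qed
  moreover have "compactin (AW_top XM) (F \<inter> ?C)" by (rule closed_Int_compactin[OF F tight_class_compact])
  ultimately obtain \<F> where fin: "finite \<F>" "\<F> \<subseteq> \<U>" "F \<inter> ?C \<subseteq> \<Union>\<F>"
    using compactinD[of "AW_top XM" "F \<inter> ?C" \<U>] by (auto simp: \<U>_def)
  have "measure (sample \<mu> n) {x \<in> space (sample \<mu> n). emgf n x \<in> F} \<le> (real (card \<F>) + 1) * exp (- (real n * A))" if n: "n \<ge> 1" for n
  proof -
    interpret S: prob_space "sample \<mu> n" by (rule prob_space_sample[OF mu])
    obtain T where T: "T \<in> sets (sample \<mu> n)" "measure (sample \<mu> n) T \<le> exp (- (real n * A))"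
      "\<And>x. x \<in> space (sample \<mu> n) \<Longrightarrow> x \<notin> T \<Longrightarrow> tight_class k c (emp x n)"
      using sample_tight[OF mu n k, of A] unfolding c_def by blast
    have "\<forall>U\<in>\<F>. \<exists>B. B \<in> sets (sample \<mu> n) \<and> measure (sample \<mu> n) B \<le> exp (- (real n * A)) \<and>
      (\<forall>x\<in>space (sample \<mu> n). emgf n x \<in> U \<longrightarrow> tight_class k c (emp x n) \<longrightarrow> x \<in> B)"
      using fin(2) n unfolding \<U>_def by blast
    from bchoice[OF this] obtain B where B: "\<forall>U\<in>\<F>. B U \<in> sets (sample \<mu> n) \<and> measure (sample \<mu> n) (B U) \<le> exp (- (real n * A)) \<and>
      (\<forall>x\<in>space (sample \<mu> n). emgf n x \<in> U \<longrightarrow> tight_class k c (emp x n) \<longrightarrow> x \<in> B U)" ..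
    have UB: "(\<Union>U\<in>\<F>. B U) \<in> sets (sample \<mu> n)" using fin(1) B by (intro sets.finite_UN) auto
    have "{x \<in> space (sample \<mu> n). emgf n x \<in> F} \<subseteq> (\<Union>U\<in>\<F>. B U) \<union> T"
    proof
      fix x assume x: "x \<in> {x \<in> space (sample \<mu> n). emgf n x \<in> F}"
      show "x \<in> (\<Union>U\<in>\<F>. B U) \<union> T"
      proof (cases "x \<in> T")
        case False
        then have t: "tight_class k c (emp x n)" using T(3) x by blast
        moreover have "matches (emgf n x) (emp x n)" using real_distribution_emp mgf_emp[OF n, of x] by (simp add: matches_def)
        ultimately have "emgf n x \<in> F \<inter> ?C" using x emgf_in_XM[OF n] by blast
        then obtain U where "U \<in> \<F>" "emgf n x \<in> U" using fin(3) by blast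
        then show ?thesis using B x t by blast
      qed simp
    qed
    then have "measure (sample \<mu> n) {x \<in> space (sample \<mu> n). emgf n x \<in> F} \<le> measure (sample \<mu> n) ((\<Union>U\<in>\<F>. B U) \<union> T)"
      by (rule S.finite_measure_mono) (use UB T(1) in blast)
    also have "\<dots> \<le> measure (sample \<mu> n) (\<Union>U\<in>\<F>. B U) + measure (sample \<mu> n) T" by (rule measure_Un_le[OF UB T(1)])
    also have "measure (sample \<mu> n) (\<Union>U\<in>\<F>. B U) \<le> (\<Sum>U\<in>\<F>. measure (sample \<mu> n) (B U))"
      by (rule measure_UNION_le[OF fin(1)]) (use B in blast)
    also have "\<dots> \<le> (\<Sum>U\<in>\<F>. exp (- (real n * A)))" by (rule sum_mono) (use B in blast)
    finally show ?thesis using T(2) by (simp add: algebra_simps)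
  qed
  then show ?thesis by blast
qed

lemma limsup_elog_prob_le:
  assumes p: "\<And>n::nat. n \<ge> 1 \<Longrightarrow> p n \<le> (real N + 1) * exp (- (real n * A))"
  shows "limsup (\<lambda>n. ereal (1 / real n) * elog_prob (p n)) \<le> ereal (- A)"
proof -
  define h where "h n = ln (real N + 1) * (1 / real n) - A" for n :: nat
  have "h \<longlonglongrightarrow> ln (real N + 1) * 0 - A" unfolding h_def by (intro tendsto_intros lim_1_over_n)
  then have h: "(\<lambda>n. ereal (h n)) \<longlonglongrightarrow> ereal (- A)" by simp
  have "\<forall>\<^sub>F n in sequentially. ereal (1 / real n) * elog_prob (p n) \<le> ereal (h n)"
    using eventually_ge_at_top[of 1]
  proof eventually_elim
    case (elim n)
    show ?case
    proof (cases "0 < p n")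
      case True
      then have "ln (p n) \<le> ln ((real N + 1) * exp (- (real n * A)))" using p[OF elim] by (subst ln_le_cancel_iff) auto
      also have "\<dots> = ln (real N + 1) - real n * A" by (subst ln_mult) auto
      finally have "ln (p n) / real n \<le> (ln (real N + 1) - real n * A) / real n" by (rule divide_right_mono) simp
      also have "\<dots> = h n" using elim by (simp add: h_def diff_divide_distrib)
      finally show ?thesis using True by (simp add: elog_prob_pos)
    next
      case False
      then show ?thesis using elim by (simp add: elog_prob_def)
    qed
  qed
  then have "limsup (\<lambda>n. ereal (1 / real n) * elog_prob (p n)) \<le> limsup (\<lambda>n. ereal (h n))" by (rule Limsup_mono)
  then show ?thesis using lim_imp_Limsup[OF sequentially_bot h] by simp
qed

lemma sample_upper_bound:
  assumes mu: "real_distribution \<mu>" and F: "closedin (AW_top XM) F"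
  shows "limsup (\<lambda>n. ereal (1 / real n) * elog_prob (measure (sample \<mu> n) {x \<in> space (sample \<mu> n). emgf n x \<in> F})) \<le> - (INF f\<in>F. mgf_rate \<mu> f)"
    (is "?l \<le> - ?I")
proof -
  let ?p = "\<lambda>n. measure (sample \<mu> n) {x \<in> space (sample \<mu> n). emgf n x \<in> F}"
  have *: "ereal A \<le> - ?l" if A: "ereal A < ?I" for A
  proof -
    have "\<exists>N::nat. \<forall>n\<ge>1. ?p n \<le> (real N + 1) * exp (- (real n * A))"
    proof (cases "0 \<le> A")
      case True
      show ?thesis by (rule sample_closed_bound[OF mu F True]) (use A in \<open>auto simp: less_INF_D\<close>)
    next
      \<comment> \<open>For negative \<open>A\<close> the right-hand side is at least 1 and bounds
        any probability.\<close>
      case False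
      have "?p n \<le> (real 0 + 1) * exp (- (real n * A))" for n
      proof -
        interpret S: prob_space "sample \<mu> n" by (rule prob_space_sample[OF mu])
        have "0 \<le> - (real n * A)" using False by (simp add: mult_nonneg_nonpos)
        then have "1 \<le> exp (- (real n * A))" by simp
        then show ?thesis using S.prob_le_1 by (intro order_trans[OF S.prob_le_1]) simp
      qed
      then show ?thesis by blast
    qed
    then obtain N :: nat where "\<And>n. n \<ge> 1 \<Longrightarrow> ?p n \<le> (real N + 1) * exp (- (real n * A))" by blast
    from limsup_elog_prob_le[OF this] have "?l \<le> - ereal A" by simp
    then show ?thesis by (rule ereal_le_uminus_iff[THEN iffD2])
  qed
  have "?I \<le> - ?l"
  proof (rule ccontr)
    assume "\<not> ?I \<le> - ?l"
    then have "- ?l < ?I" by simp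
    then obtain A where "- ?l < ereal A" "ereal A < ?I" by (rule ereal_dense_real)
    then show False using * by (simp add: leD)
  qed
  then show ?thesis by (rule ereal_le_uminus_iff[THEN iffD2])
qed

text \<open>\<open>Mn\<close> reads only the coordinates \<open>1\<close> to \<open>n\<close>, so
  restricting the sample to them changes nothing, and independence makes their joint law the
  product.\<close>

lemma sample_transfer:
  assumes P: "prob_space P" and ind: "prob_space.indep_vars P (\<lambda>_. borel) X UNIV" and X: "\<And>i. distr P borel (X i) = \<mu>"
    and n: "n \<ge> 1" and U: "{x \<in> space (sample \<mu> n). emgf n x \<in> U} \<in> sets (sample \<mu> n)"
  shows "measure P (Mn X n -` U \<inter> space P) = measure (sample \<mu> n) {x \<in> space (sample \<mu> n). emgf n x \<in> U}"
proof -
  interpret P: prob_space P by fact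
  have rv: "X i \<in> borel_measurable P" for i using ind by (simp add: P.indep_vars_def)
  have mu: "real_distribution \<mu>" using P.real_distribution_distr[OF rv[of 0]] X by simp
  have "P.indep_vars (\<lambda>_. borel) X {1..n}" by (rule P.indep_vars_subset[OF ind]) simp
  then have "distr P (\<Pi>\<^sub>M i\<in>{1..n}. borel) (\<lambda>x. \<lambda>i\<in>{1..n}. X i x) = (\<Pi>\<^sub>M i\<in>{1..n}. distr P borel (X i))"
    using n by (subst (asm) P.indep_vars_iff_distr_eq_PiM[OF _ rv]) auto
  then have d: "distr P (\<Pi>\<^sub>M i\<in>{1..n}. borel) (\<lambda>x. \<lambda>i\<in>{1..n}. X i x) = sample \<mu> n" by (simp add: X)
  have m: "(\<lambda>x. \<lambda>i\<in>{1..n}. X i x) \<in> measurable P (\<Pi>\<^sub>M i\<in>{1..n}. borel)" by (rule measurable_restrict[OF rv])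
  have e: "emgf n (\<lambda>i\<in>{1..n}. X i \<omega>) = Mn X n \<omega>" for \<omega> by (simp add: Mn_def)
  have "measure (sample \<mu> n) {x \<in> space (sample \<mu> n). emgf n x \<in> U} =
      measure P ((\<lambda>x. \<lambda>i\<in>{1..n}. X i x) -` {x \<in> space (sample \<mu> n). emgf n x \<in> U} \<inter> space P)"
    using U sets_sample[OF mu, of n] unfolding d[symmetric] by (subst measure_distr[OF m]) (simp_all add: d)
  also have "(\<lambda>x. \<lambda>i\<in>{1..n}. X i x) -` {x \<in> space (sample \<mu> n). emgf n x \<in> U} \<inter> space P = Mn X n -` U \<inter> space P"
  proof -
    have "(\<lambda>i\<in>{1..n}. X i \<omega>) \<in> space (sample \<mu> n)" if "\<omega> \<in> space P" for \<omega>
      using measurable_space[OF m that] sets_eq_imp_space_eq[OF sets_sample[OF mu, of n]] by simp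
    then show ?thesis by (auto simp: e simp del: One_nat_def)
  qed
  finally show ?thesis ..
qed

section \<open>The large deviation principles\<close>

lemma LDP_mgf:
  assumes P: "prob_space P" and ind: "prob_space.indep_vars P (\<lambda>_. borel) X UNIV" and X: "\<And>i. distr P borel (X i) = \<mu>"
  shows "LDP P (AW_top XM) (Mn X) (mgf_rate \<mu>)"
proof -
  interpret P: prob_space P by fact
  have rv: "X i \<in> borel_measurable P" for i using ind by (simp add: P.indep_vars_def)
  have mu: "real_distribution \<mu>" using P.real_distribution_distr[OF rv[of 0]] X by simp
  let ?e = "\<lambda>U n. ereal (1 / real n) * elog_prob (measure P (Mn X n -` U \<inter> space P))"
  let ?s = "\<lambda>U n. ereal (1 / real n) * elog_prob (measure (sample \<mu> n) {x \<in> space (sample \<mu> n). emgf n x \<in> U})"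
  have ev: "\<forall>\<^sub>F n in sequentially. ?e U n = ?s U n" if "openin (AW_top XM) U \<or> closedin (AW_top XM) U" for U
    using eventually_ge_at_top[of 1]
  proof eventually_elim
    case (elim n)
    have "{x \<in> space (sample \<mu> n). emgf n x \<in> U} \<in> sets (sample \<mu> n)"
      using that emgf_open_sets[OF mu elim] emgf_closed_sets[OF mu elim] by blast
    then show ?case using sample_transfer[OF P ind X elim] by simp
  qed
  show ?thesis
    unfolding LDP_def
  proof (intro conjI allI impI)
    show "Mn X n \<in> measurable P (borel_of_top (AW_top XM))" if "n \<ge> 1" for n by (rule Mn_measurable[OF that rv])
    show "rate_function (AW_top XM) (mgf_rate \<mu>)" using mgf_rate_good[OF mu] by (simp add: good_rate_function_def)
    show "- (INF f\<in>G. mgf_rate \<mu> f) \<le> liminf (?e G)" if G: "openin (AW_top XM) G" for G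
      using sample_lower_bound[OF mu G] Liminf_eq[OF ev[of G]] G by simp
    show "limsup (?e F) \<le> - (INF f\<in>F. mgf_rate \<mu> f)" if F: "closedin (AW_top XM) F" for F
      using sample_upper_bound[OF mu F] Limsup_eq[OF ev[of F]] F by simp
  qed
qed

text \<open>Multiplication by the argument undoes the division, at infinite values and for either
  sign too. At 0 the slope does not determine the function, but its value there is always 1.\<close>

lemma eexp_jfun_elog:
  assumes "f \<in> XM"
  shows "(\<lambda>\<theta>. if \<theta> = 0 then 1 else eexp (ereal \<theta> * jfun (elog \<circ> f) \<theta>)) = f"
proof
  fix \<theta>
  show "(if \<theta> = 0 then 1 else eexp (ereal \<theta> * jfun (elog \<circ> f) \<theta>)) = f \<theta>"
  proof (cases "\<theta> = 0")
    case False
    have p: "0 < f \<theta>" using assms by (simp add: XM_iff)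
    have "ereal \<theta> * (elog (f \<theta>) / ereal \<theta>) = elog (f \<theta>)"
      using False by (cases "elog (f \<theta>)"; cases "0 < \<theta>") (auto simp: divide_ereal_def)
    then show ?thesis using False eexp_elog[OF p] by (simp add: jfun_def)
  qed (use XM_0[OF assms] in simp)
qed

lemma eexp_legendre_elog:
  assumes "f \<in> XM"
  shows "(\<lambda>\<theta>. eexp (SUP x. ereal (x * \<theta>) - legendre (elog \<circ> f) x)) = f"
proof -
  have "legendre (legendre (elog \<circ> f)) = elog \<circ> f"
    by (rule legendre_legendre[OF elog_convex[OF assms] elog_lsc[OF assms] elog_XM_0[OF assms]])
  then have "eexp (SUP x. ereal (x * \<theta>) - legendre (elog \<circ> f) x) = eexp (elog (f \<theta>))" for \<theta>
    unfolding legendre_def[of "legendre (elog \<circ> f)", symmetric] by simp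
  then show ?thesis using assms by (simp add: eexp_elog XM_iff)
qed

theorem theorem3p1:
  fixes P :: "'a measure" and X :: "nat \<Rightarrow> 'a \<Rightarrow> real" and \<mu> :: "real measure"
  assumes "prob_space P"
    and "prob_space.indep_vars P (\<lambda>_. borel) X UNIV"
    and "\<And>i. distr P borel (X i) = \<mu>"
  shows "\<exists>IM :: (real \<Rightarrow> ereal) \<Rightarrow> ereal.
    LDP P (AW_top XM) (Mn X) IM \<and>
    good_rate_function (AW_top XM) IM \<and>
    (\<forall>f\<in>XM. \<forall>g\<in>XM. \<forall>t::real. 0 < t \<and> t < 1 \<longrightarrow>
        IM (\<lambda>\<theta>. ereal t * f \<theta> + ereal (1 - t) * g \<theta>) \<le> ereal t * IM f + ereal (1 - t) * IM g) \<and>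
    (\<forall>\<nu>. prob_measure_real \<nu> \<and> (\<exists>a b. a < b \<and> (\<forall>\<theta>\<in>{a<..<b}. mgf \<nu> \<theta> < \<infinity>)) \<longrightarrow>
        IM (mgf \<nu>) = rel_entropy \<nu> \<mu>) \<and>
    IM (\<lambda>\<theta>. if \<theta> = 0 then 1 else \<infinity>) =
      (INF \<nu>\<in>{\<nu>. prob_measure_real \<nu> \<and> mgf \<nu> = (\<lambda>\<theta>. if \<theta> = 0 then 1 else \<infinity>)}. rel_entropy \<nu> \<mu>) \<and>
    (\<forall>\<alpha> \<beta> f \<nu>. \<alpha> \<le> 0 \<and> 0 \<le> \<beta> \<and> f \<in> Dint \<alpha> \<beta> \<and> mimics f \<nu> \<longrightarrow>
        IM f = (if \<exists>g. is_MGF g \<and> g \<in> Dint \<alpha> \<beta> \<and> IM g < \<infinity> then IM (mgf \<nu>) else \<infinity>)) \<and>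
    LDP P (AW_top XLam) (Lamn X) (\<lambda>f. IM (\<lambda>\<theta>. eexp (f \<theta>))) \<and>
    LDP P (AW_top XJ) (Jn X) (\<lambda>f. IM (\<lambda>\<theta>. if \<theta> = 0 then 1 else eexp (ereal \<theta> * f \<theta>))) \<and>
    LDP P (AW_top XI) (In X) (\<lambda>f. IM (\<lambda>\<theta>. eexp (SUP x. ereal (x * \<theta>) - f x)))"
proof -
  interpret P: prob_space P by fact
  have rv: "X i \<in> borel_measurable P" for i using assms(2) by (simp add: P.indep_vars_def)
  have mu: "real_distribution \<mu>" using P.real_distribution_distr[OF rv[of 0]] assms(3) by simp
  note ldp = LDP_mgf[OF assms] and good = mgf_rate_good[OF mu]
  have a: "mgf_rate \<mu> (mgf \<nu>) = rel_entropy \<nu> \<mu>"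
    if "prob_measure_real \<nu>" "a < b" "\<forall>\<theta>\<in>{a<..<b}. mgf \<nu> \<theta> < \<infinity>" for \<nu> a b
  proof -
    \<comment> \<open>The interval may be centred at 0, while identifying the law takes a nonzero
      argument.\<close>
    have "\<exists>p. a < p \<and> p < b \<and> p \<noteq> 0"
    proof (cases "(a + b) / 2 = 0")
      case True then show ?thesis using that(2) by (intro exI[of _ "(a + 3 * b) / 4"]) auto
    next
      case False then show ?thesis using that(2) by (intro exI[of _ "(a + b) / 2"]) auto
    qed
    then obtain p where "a < p" "p < b" "p \<noteq> 0" by blast
    then show ?thesis using that mgf_rate_mgf[OF mu, of \<nu> p] by (simp add: prob_measure_real_iff)
  qed
  have L: "LDP P (AW_top XLam) (Lamn X) (\<lambda>f. mgf_rate \<mu> (\<lambda>\<theta>. eexp (f \<theta>)))"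
  proof (rule LDP_contraction[OF epi_sep_XM epi_sep_XLam XLam_def _ ldp good])
    show "epi_conv (\<lambda>n. elog \<circ> g n) (elog \<circ> f)" if "\<And>n. g n \<in> XM" "f \<in> XM" "epi_conv g f" for g f
      using epi_conv_elog that by blast
    show "mgf_rate \<mu> (\<lambda>\<theta>. eexp ((elog \<circ> f) \<theta>)) = mgf_rate \<mu> f" if "f \<in> XM" for f
      using that by (simp add: eexp_elog XM_iff)
  qed (simp add: Lamn_def)
  have J: "LDP P (AW_top XJ) (Jn X) (\<lambda>f. mgf_rate \<mu> (\<lambda>\<theta>. if \<theta> = 0 then 1 else eexp (ereal \<theta> * f \<theta>)))"
  proof (rule LDP_contraction[OF epi_sep_XM epi_sep_XJ _ _ ldp good])
    show "XJ = (\<lambda>f. jfun (elog \<circ> f)) ` XM" by (simp add: XJ_def XLam_def image_image)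
    show "epi_conv (\<lambda>n. jfun (elog \<circ> g n)) (jfun (elog \<circ> f))" if "\<And>n. g n \<in> XM" "f \<in> XM" "epi_conv g f" for g f
      using epi_conv_XJ that by blast
  qed (simp_all add: Jn_def Lamn_def eexp_jfun_elog)
  have I: "LDP P (AW_top XI) (In X) (\<lambda>f. mgf_rate \<mu> (\<lambda>\<theta>. eexp (SUP x. ereal (x * \<theta>) - f x)))"
  proof (rule LDP_contraction[OF epi_sep_XM epi_sep_XI _ _ ldp good])
    show "XI = (\<lambda>f. legendre (elog \<circ> f)) ` XM" by (simp add: XI_def XLam_def image_image)
    show "epi_conv (\<lambda>n. legendre (elog \<circ> g n)) (legendre (elog \<circ> f))" if "\<And>n. g n \<in> XM" "f \<in> XM" "epi_conv g f" for g f
      using epi_conv_XI that by blast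
  qed (simp_all add: In_def Lamn_def eexp_legendre_elog)
  show ?thesis
  proof (intro exI[of _ "mgf_rate \<mu>"] conjI ldp good L J I)
    show "\<forall>f\<in>XM. \<forall>g\<in>XM. \<forall>t::real. 0 < t \<and> t < 1 \<longrightarrow>
        mgf_rate \<mu> (\<lambda>\<theta>. ereal t * f \<theta> + ereal (1 - t) * g \<theta>) \<le> ereal t * mgf_rate \<mu> f + ereal (1 - t) * mgf_rate \<mu> g"
      using mgf_rate_convex[OF mu] by blast
    show "\<forall>\<nu>. prob_measure_real \<nu> \<and> (\<exists>a b. a < b \<and> (\<forall>\<theta>\<in>{a<..<b}. mgf \<nu> \<theta> < \<infinity>)) \<longrightarrow>
        mgf_rate \<mu> (mgf \<nu>) = rel_entropy \<nu> \<mu>"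
      using a by blast
    show "mgf_rate \<mu> (\<lambda>\<theta>. if \<theta> = 0 then 1 else \<infinity>) =
      (INF \<nu>\<in>{\<nu>. prob_measure_real \<nu> \<and> mgf \<nu> = (\<lambda>\<theta>. if \<theta> = 0 then 1 else \<infinity>)}. rel_entropy \<nu> \<mu>)"
      using mgf_rate_point_fun[OF mu] by (simp only: point_fun_def prob_measure_real_iff)
    show "\<forall>\<alpha> \<beta> f \<nu>. \<alpha> \<le> 0 \<and> 0 \<le> \<beta> \<and> f \<in> Dint \<alpha> \<beta> \<and> mimics f \<nu> \<longrightarrow>
        mgf_rate \<mu> f = (if \<exists>g. is_MGF g \<and> g \<in> Dint \<alpha> \<beta> \<and> mgf_rate \<mu> g < \<infinity> then mgf_rate \<mu> (mgf \<nu>) else \<infinity>)"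
      using mgf_rate_mimics[OF mu] by blast
  qed
qed

end
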